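(* Let $p$ be a prime and let $(\alpha_n)_{n\ge 1}$ be a sequence of positive real numbers satisfying $$\liminf_{n\to\infty}\frac{n\alpha_n}{\log n}>1.$$ For each $n$, let $A_n\in \mathrm{Mat}_n(\mathbb{F}_p)$ be an $\alpha_n$-balanced random matrix. Let $F_1,\ldots,F_r\in\mathbb{F}_p[t]$ be distinct monic irreducible nonconstant polynomials, and let $e_{F_j}(A_n)$ denote the multiplicity of $F_j$ as a factor of $\det(tI_n-A_n)$. Then the distribution of $(e_{F_1}(A_n),\ldots,e_{F_r}(A_n))$ converges pointwise, as $n\to\infty$, to the product measure $\prod_{j=1}^r\nu_{F_j}$ on $\mathbb{Z}_{\ge0}^r$; that is, for all $m_1,\ldots,m_r\in\mathbb{Z}_{\ge 0}$, $$\lim_{n\to\infty}\mathbf{P}\left(e_{F_j}(A_n)=m_j\ \text{for all }1\le j\le r\right)=\prod_{j=1}^r\nu_{F_j}(m_j),$$ where, for a monic irreducible nonconstant polynomial $F\in\mathbb{F}_p[t]$, $$\nu_F(m)=p^{-m\deg F}\prod_{\ell\ge m+1}\left(1-p^{-\ell\deg F}\right),\qquad m\in\mathbb{Z}_{\ge0}.$$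
   Context: $\mathbb{F}_p$ is the field with $p$ elements and $\mathrm{Mat}_n(\mathbb{F}_p)$ the set of $n\times n$ matrices over it. For $\alpha>0$, a random variable $\xi\in\mathbb{F}_p$ is $\alpha$-balanced if $\mathbf{P}(\xi=a)\le 1-\alpha$ for every $a\in\mathbb{F}_p$. A random matrix over $\mathbb{F}_p$ is $\alpha$-balanced if its entries are independent and each is $\alpha$-balanced (the entries need not be identically distributed). The multiplicity $e_F(A)$ is $0$ if $F\nmid\det(tI_n-A)$. *)

theory Defs
  imports
    "HOL-Probability.Probability"
    "Jordan_Normal_Form.Char_Poly"
    "Berlekamp_Zassenhaus.Finite_Field"
begin

text \<open>
  The field with \<open>p\<close> elements is \<^typ>\<open>'p mod_ring\<close> for \<open>'p :: prime_card\<close>, with \<open>p = CARD('p)\<close>.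
\<close>

definition (in prob_space) alpha_balanced ::
    "real \<Rightarrow> ('a \<Rightarrow> 'p::prime_card mod_ring) \<Rightarrow> bool" where
  "alpha_balanced \<alpha> \<xi> \<longleftrightarrow>
     random_variable (count_space UNIV) \<xi> \<and>
     (\<forall>a. prob {\<omega> \<in> space M. \<xi> \<omega> = a} \<le> 1 - \<alpha>)"

definition (in prob_space) alpha_balanced_mat ::
    "real \<Rightarrow> nat \<Rightarrow> ('a \<Rightarrow> 'p::prime_card mod_ring mat) \<Rightarrow> bool" where
  "alpha_balanced_mat \<alpha> n A \<longleftrightarrow>
     (\<forall>\<omega> \<in> space M. A \<omega> \<in> carrier_mat n n) \<and>
     indep_vars (\<lambda>_. count_space UNIV) (\<lambda>(i, j) \<omega>. A \<omega> $$ (i, j)) ({..<n} \<times> {..<n}) \<and>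
     (\<forall>i<n. \<forall>j<n. alpha_balanced \<alpha> (\<lambda>\<omega>. A \<omega> $$ (i, j)))"

text \<open>
  \<^const>\<open>multiplicity\<close> would return \<open>0\<close> also when arbitrarily high powers of \<open>F\<close> divide; this does
  not happen for nonconstant \<open>F\<close>, since \<^term>\<open>char_poly A\<close> is monic for square \<open>A\<close>.
\<close>

definition factor_mult :: "'p::prime_card mod_ring poly \<Rightarrow> 'p mod_ring mat \<Rightarrow> nat" where
  "factor_mult F A = multiplicity F (char_poly A)"

text \<open>The factor with index \<open>i\<close> of the infinite product is the one for \<open>l = m + 1 + i\<close>.\<close>

definition nu :: "'p::prime_card mod_ring poly \<Rightarrow> nat \<Rightarrow> real" where
  "nu F m = 1 / real CARD('p) ^ (m * degree F) *
     (\<Prod>i. 1 - 1 / real CARD('p) ^ ((m + 1 + i) * degree F))"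

text \<open>
  \<^const>\<open>prodinf\<close> is only meaningful for convergent products, which holds here as \<open>F\<close> is nonconstant.
\<close>

lemma convergent_prod_nu:
  fixes F :: "'p::prime_card mod_ring poly"
  assumes "degree F > 0"
  shows "convergent_prod (\<lambda>i. 1 - 1 / real CARD('p) ^ ((m + 1 + i) * degree F))"
proof -
  define q where "q = 1 / real CARD('p) ^ degree F"
  have "CARD('p) > 1"
    using prime_card[where 'a = 'p] prime_gt_1_nat by blast
  then have q: "0 < q" "q < 1"
    using assms by (auto simp: q_def one_less_power)
  have eq: "1 - 1 / real CARD('p) ^ ((m + 1 + i) * degree F) = 1 - q ^ (m + 1) * q ^ i" for i
    by (simp add: q_def power_divide power_mult[symmetric] power_add[symmetric] algebra_simps)
  have "summable (\<lambda>i. norm (- (q ^ (m + 1) * q ^ i)))"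
    using q by (auto simp: abs_mult intro!: summable_mult summable_geometric)
  then have "abs_convergent_prod (\<lambda>i. 1 + - (q ^ (m + 1) * q ^ i))"
    by (intro summable_imp_abs_convergent_prod) simp
  then show ?thesis
    unfolding eq by (auto dest: abs_convergent_prod_imp_convergent_prod)
qed

end

theory Submission
  imports Defs "HOL-Real_Asymp.Real_Asymp"
begin

text \<open>
  An $F$-part of $A$ is seen through injective solutions $X$ of $A X = X T$, that is, embeddings of
  the module $(\mathbb{F}_p^d, T)$ into $(\mathbb{F}_p^n, A)$. For fixed $T$ the expected number of
  embeddings tends to 1: by row independence it is a sum over $X$ of products of $n$ point
  probabilities of random linear combinations of the rows of $X$. Apart from few outlying rows,
  these rows equidistribute in a subspace, Fourier inversion gives nearly uniform point
  probabilities, and the outlying rows contribute $o(1)$ exactly because $n \alpha_n / \log n$ stays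
  above 1.

  Next, let $X$ be an embedding of $T$ and let $q^s$ be the index of the image of $X$ in the
  preimage of that image under $F(A)$, where $q = p^{\deg F}$. Then $s = 0$ iff $A$ and $T$ have the
  same $F$-multiplicity, and embeddings of the $i$-fold extensions of $T$ by companion blocks of $F$
  count $\prod_{l<i} (q^s - q^l)$. Newton interpolation writes the indicator of $s = 0$ as an
  alternating series in these products whose partial sums are Bonferroni bounds, so the expected
  number of embeddings restricted to equal multiplicities tends to
  $\prod_F \sum_i (-1)^i / \prod_{l \le i} (q^l - 1)$.

  Finally, with $g = \prod_F F^{m_F}$ of degree $D$, a matrix with multiplicities $m_F$ has exactly
  $|GL_D|$ embeddings from matrices $T$ of characteristic polynomial $g$, by uniqueness of the
  $g$-primary part. This converts the restricted counts into probabilities. The number of matrices $T$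
  with characteristic polynomial $g$ is found from the same Newton identity, and Euler's $q$-series
  identities turn the answer into $\nu_F(m_F)$.
\<close>

section \<open>Characters and balanced distributions\<close>

text \<open>Bonferroni bounds hold for each matrix separately, so the truncation of the alternating
  series stays fixed while n grows; no moment has to be controlled uniformly in the size of
  \<open>T\<close>. The threshold 1 already shows in a single outlying row: it has n positions and
  at most p^d values, and each of the n rows of the random matrix costs a factor at most 1 -
  \<alpha>, in total n p^d (1 - \<alpha>)^n. This vanishes for n \<alpha> \<ge> c log n with c > 1.
  The main term is subtler. The relative error must be o(1/n) in each of n factors, so the defects
  summed over the rows must exceed 2 g log n with some g > 1, while their mean for random rows is
  only bounded below by about 2 c log n. A lossy constant would spoil this, hence the exact
  averaging over frequencies. The tuples of rows that violate the bound are exponentially rare, but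
  the trivial estimate (1 + p^d)^n on them is exponentially large. The subspace is therefore chosen
  so that every functional not trivial on it is nonzero on a positive proportion of the rows, which
  lowers that estimate to exp (\<eta> n) with \<eta> as small as desired.\<close>

definition chi :: "'p::prime_card mod_ring \<Rightarrow> complex" where
  "chi a = cis (2 * pi * of_int (to_int_mod_ring a) / real CARD('p))"

lemma card_prime_card_gt_1: "CARD('p::prime_card) > 1"
  using prime_card[where 'a = 'p] prime_gt_1_nat by blast

lemma to_int_mod_ring_add:
  "to_int_mod_ring (a + b :: 'p::prime_card mod_ring) =
     (to_int_mod_ring a + to_int_mod_ring b) mod int CARD('p)"
  by transfer simp

lemma cis_mod_period:
  assumes "m > 0"
  shows "cis (2 * pi * of_int (k mod int m) / real m) = cis (2 * pi * of_int k / real m)"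
proof -
  have "of_int k = real m * of_int (k div int m) + (of_int (k mod int m) :: real)"
    by (metis mult_div_mod_eq of_int_add of_int_mult of_int_of_nat_eq)
  then have "2 * pi * of_int k / real m
      = 2 * pi * of_int (k div int m) + 2 * pi * of_int (k mod int m) / real m"
    using assms by (simp add: field_simps)
  then have "cis (2 * pi * of_int k / real m)
      = cis (2 * pi * of_int (k div int m)) * cis (2 * pi * of_int (k mod int m) / real m)"
    by (simp only: cis_mult)
  moreover have "cis (2 * pi * of_int (k div int m)) = 1"
    by (rule cis_multiple_2pi) simp
  ultimately show ?thesis
    by (simp only: mult_1_left)
qed

lemma chi_add: "chi (a + b :: 'p::prime_card mod_ring) = chi a * chi b"
  unfolding chi_def to_int_mod_ring_add
  by (subst cis_mod_period) (simp_all add: cis_mult distrib_left add_divide_distrib)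

lemma norm_chi [simp]: "norm (chi a) = 1"
  by (simp add: chi_def)

lemma chi_0 [simp]: "chi 0 = 1"
  by (simp add: chi_def)

lemma chi_minus: "chi (- a :: 'p::prime_card mod_ring) = cnj (chi a)"
proof -
  have "chi (- a) * chi a = 1"
    by (simp flip: chi_add)
  moreover have "cnj (chi a) * chi a = 1"
    by (metis complex_norm_square mult.commute norm_chi of_real_1 power_one)
  ultimately show ?thesis
    by (metis mult_cancel_right norm_chi norm_zero zero_neq_one)
qed

lemma Re_chi_less_1:
  assumes "a \<noteq> (0 :: 'p::prime_card mod_ring)"
  shows "Re (chi a) < 1"
proof -
  let ?k = "to_int_mod_ring a" and ?p = "real CARD('p)"
  have p: "?p > 0" by simp
  have k: "0 < ?k" "?k < int CARD('p)"
  proof -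
    have "?k \<in> {0..<int CARD('p)}" using range_to_int_mod_ring[where 'a='p] by blast
    moreover have "?k \<noteq> 0" using assms to_int_mod_ring_hom.hom_0_iff by blast
    ultimately show "0 < ?k" "?k < int CARD('p)" by (simp_all add: order.strict_iff_order)
  qed
  have "cos (2 * pi * of_int ?k / ?p) \<noteq> 1"
  proof
    assume "cos (2 * pi * of_int ?k / ?p) = 1"
    then obtain n :: int where "2 * pi * of_int ?k / ?p = of_int n * 2 * pi"
      by (auto simp: cos_one_2pi_int)
    then have "of_int ?k = of_int n * ?p"
      using p by (simp add: field_simps)
    then have "?k = n * int CARD('p)"
      by (metis of_int_eq_iff of_int_mult of_int_of_nat_eq)
    then have "int CARD('p) dvd ?k" by simp
    then show False using k zdvd_not_zless by blast
  qed
  then show ?thesis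
    using cos_le_one[of "2 * pi * of_int ?k / ?p"] by (simp add: chi_def less_le)
qed

lemma Re_chi_ge: "Re (chi a) \<ge> -1"
  by (simp add: chi_def)

lemma sum_chi_mult:
  assumes "s \<noteq> (0 :: 'p::prime_card mod_ring)"
  shows "(\<Sum>a\<in>UNIV. chi (s * a)) = 0"
proof -
  let ?S = "\<Sum>a\<in>UNIV. chi (s * a)"
  have "?S = (\<Sum>a\<in>UNIV. chi (s * (a + 1)))"
    by (rule sum.reindex_bij_witness[of _ "\<lambda>a. a + 1" "\<lambda>a. a - 1"]) auto
  also have "\<dots> = chi s * ?S"
    by (simp add: distrib_left chi_add mult.commute sum_distrib_left)
  finally have "(1 - chi s) * ?S = 0"
    by (simp add: algebra_simps)
  moreover have "chi s \<noteq> 1"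
    using Re_chi_less_1[OF assms] by auto
  ultimately show ?thesis by auto
qed

text \<open>A constant of \<open>p\<close> alone. It serves where only the order of magnitude of a
  defect counts; the sharp constant comes from averaging over all frequencies.\<close>

definition chi_gap :: "'p::prime_card itself \<Rightarrow> real" where
  "chi_gap _ = Min ((\<lambda>a :: 'p mod_ring. 1 - Re (chi a)) ` (UNIV - {0}))"

lemma chi_gap_pos: "chi_gap TYPE('p::prime_card) > 0"
proof -
  have "(1 :: 'p mod_ring) \<in> UNIV - {0}" by simp
  then have "UNIV - {0 :: 'p mod_ring} \<noteq> {}" by blast
  then show ?thesis
    unfolding chi_gap_def by (subst Min_gr_iff) (auto simp: Re_chi_less_1)
qed

lemma chi_gap_le: "a \<noteq> 0 \<Longrightarrow> chi_gap TYPE('p::prime_card) \<le> 1 - Re (chi (a :: 'p mod_ring))"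
  unfolding chi_gap_def by (rule Min_le) auto

definition pdist :: "('a::finite \<Rightarrow> real) \<Rightarrow> bool" where
  "pdist q \<longleftrightarrow> (\<forall>a. 0 \<le> q a) \<and> (\<Sum>a\<in>UNIV. q a) = 1"

lemma pdist_nonneg: "pdist q \<Longrightarrow> 0 \<le> q a"
  and pdist_sum: "pdist q \<Longrightarrow> (\<Sum>a\<in>UNIV. q a) = 1"
  by (auto simp: pdist_def)

definition phi :: "('p::prime_card mod_ring \<Rightarrow> real) \<Rightarrow> 'p mod_ring \<Rightarrow> complex" where
  "phi q s = (\<Sum>a\<in>UNIV. of_real (q a) * chi (s * a))"

text \<open>\<open>phi\<close> is the characteristic function of \<open>q\<close>, and its squared
  modulus is that of the difference of two independent samples. Passing to the difference makes the
  loss a nonnegative average of 1 - Re chi over pairs of values.\<close>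

definition defect :: "('p::prime_card mod_ring \<Rightarrow> real) \<Rightarrow> 'p mod_ring \<Rightarrow> real" where
  "defect q s = 1 - (norm (phi q s))\<^sup>2"

text \<open>The probability that two independent samples differ, the complement of the collision
  probability.\<close>

definition coll :: "('p::prime_card mod_ring \<Rightarrow> real) \<Rightarrow> real" where
  "coll q = 1 - (\<Sum>a\<in>UNIV. (q a)\<^sup>2)"

lemma pdist_double_sum:
  assumes "pdist q" shows "(\<Sum>a\<in>UNIV. \<Sum>b\<in>UNIV. q a * q b) = 1"
  using assms by (simp add: sum_distrib_left[symmetric] pdist_sum)

lemma norm_phi_square:
  "(norm (phi q s))\<^sup>2 = (\<Sum>a\<in>UNIV. \<Sum>b\<in>UNIV. q a * q b * Re (chi (s * (a - b))))"
proof -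
  have "complex_of_real ((norm (phi q s))\<^sup>2) = phi q s * cnj (phi q s)"
    by (rule complex_norm_square)
  also have "\<dots> = (\<Sum>a\<in>UNIV. \<Sum>b\<in>UNIV. (of_real (q a) * chi (s * a)) * (of_real (q b) * chi (- (s * b))))"
    by (simp add: phi_def sum_product chi_minus)
  also have "\<dots> = (\<Sum>a\<in>UNIV. \<Sum>b\<in>UNIV. of_real (q a * q b) * chi (s * (a - b)))"
    by (simp add: right_diff_distrib algebra_simps flip: chi_add)
  finally have "Re (complex_of_real ((norm (phi q s))\<^sup>2)) = Re (\<Sum>a\<in>UNIV. \<Sum>b\<in>UNIV. of_real (q a * q b) * chi (s * (a - b)))"
    by simp
  then show ?thesis by simp
qed

lemma defect_eq:
  assumes "pdist q"
  shows "defect q s = (\<Sum>a\<in>UNIV. \<Sum>b\<in>UNIV. q a * q b * (1 - Re (chi (s * (a - b)))))"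
  using pdist_double_sum[OF assms]
  by (simp add: defect_def norm_phi_square right_diff_distrib sum_subtractf)

lemma coll_eq:
  assumes "pdist q"
  shows "coll q = (\<Sum>a\<in>UNIV. \<Sum>b\<in>UNIV. if a = b then 0 else q a * q b)"
proof -
  have "(\<Sum>a\<in>UNIV. \<Sum>b\<in>UNIV. if a = b then 0 else q a * q b)
      = (\<Sum>a\<in>UNIV. \<Sum>b\<in>UNIV. q a * q b - (if a = b then q a * q b else 0))"
    by (intro sum.cong) auto
  also have "\<dots> = coll q"
    using pdist_double_sum[OF assms] by (simp add: sum_subtractf coll_def power2_eq_square)
  finally show ?thesis by simp
qed

lemma defect_nonneg: "pdist q \<Longrightarrow> 0 \<le> defect q s"
  unfolding defect_eq
  by (intro sum_nonneg mult_nonneg_nonneg) (auto simp: pdist_nonneg chi_def)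

lemma defect_0 [simp]: "pdist q \<Longrightarrow> defect q 0 = 0"
  by (simp add: defect_eq)

lemma defect_le: "pdist q \<Longrightarrow> defect q s \<le> 2 * coll q"
  unfolding defect_eq coll_eq sum_distrib_left
proof (intro sum_mono)
  fix a b :: "'a mod_ring" assume q: "pdist q"
  have "q a * q b * (1 - Re (chi (s * (a - b)))) \<le> q a * q b * 2"
    using Re_chi_ge[of "s * (a - b)"] q by (intro mult_left_mono) (auto simp: pdist_nonneg)
  then show "q a * q b * (1 - Re (chi (s * (a - b)))) \<le> 2 * (if a = b then 0 else q a * q b)"
    by auto
qed

lemma defect_ge:
  assumes q: "pdist q" and s: "s \<noteq> 0"
  shows "chi_gap TYPE('p::prime_card) * coll q \<le> defect (q :: 'p mod_ring \<Rightarrow> real) s"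
  unfolding defect_eq[OF q] coll_eq[OF q] sum_distrib_left
proof (intro sum_mono)
  fix a b :: "'p mod_ring"
  show "chi_gap TYPE('p) * (if a = b then 0 else q a * q b)
      \<le> q a * q b * (1 - Re (chi (s * (a - b))))"
  proof (cases "a = b")
    case False
    then have "chi_gap TYPE('p) \<le> 1 - Re (chi (s * (a - b)))"
      using s by (intro chi_gap_le) auto
    then show ?thesis
      using False q mult_left_mono[of "chi_gap TYPE('p)" "1 - Re (chi (s * (a - b)))" "q a * q b"]
      by (simp add: pdist_nonneg mult.commute)
  qed simp
qed

text \<open>Orthogonality: for a \<noteq> b the characters at s (a - b) cancel over s, so each pair
  of distinct values contributes p times its weight. The mean defect over all frequencies is thus
  exactly \<open>coll q\<close>, with no loss from the gap.\<close>

lemma sum_defect: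
  fixes q :: "'p::prime_card mod_ring \<Rightarrow> real"
  assumes q: "pdist q"
  shows "(\<Sum>s\<in>UNIV. defect q s) = real CARD('p) * coll q"
proof -
  have *: "(\<Sum>s\<in>UNIV. 1 - Re (chi (s * (a - b)))) = (if a = b then 0 else real CARD('p))"
    for a b :: "'p mod_ring"
  proof (cases "a = b")
    case False
    then have "(\<Sum>s\<in>UNIV. chi ((a - b) * s)) = 0"
      by (intro sum_chi_mult) simp
    then have "(\<Sum>s\<in>UNIV. Re (chi (s * (a - b)))) = 0"
      by (simp add: mult.commute flip: Re_sum)
    with False show ?thesis by (simp add: sum_subtractf)
  qed simp
  have "(\<Sum>s\<in>UNIV. defect q s)
      = (\<Sum>a\<in>UNIV. \<Sum>b\<in>UNIV. \<Sum>s\<in>UNIV. q a * q b * (1 - Re (chi (s * (a - b)))))"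
    unfolding defect_eq[OF q] by (subst sum.swap, intro sum.cong refl sum.swap)
  also have "\<dots> = (\<Sum>a\<in>UNIV. \<Sum>b\<in>UNIV. q a * q b * (if a = b then 0 else real CARD('p)))"
    by (simp only: * flip: sum_distrib_left)
  also have "\<dots> = real CARD('p) * coll q"
    unfolding coll_eq[OF q] sum_distrib_left by (intro sum.cong) auto
  finally show ?thesis .
qed

text \<open>The extremal case has two atoms of masses 1 - \<alpha> and \<alpha>. If one atom exceeds
  1/2, merging all the others into one only increases the sum of squares; without such an atom that
  sum is at most 1/2, and 2 \<alpha> (1 - \<alpha>) \<le> 1/2 suffices.\<close>

lemma coll_ge:
  fixes q :: "'p::prime_card mod_ring \<Rightarrow> real"
  assumes q: "pdist q" and bal: "\<And>a. q a \<le> 1 - \<alpha>" and \<alpha>: "0 \<le> \<alpha>" "\<alpha> \<le> 1 / 2"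
  shows "2 * \<alpha> * (1 - \<alpha>) \<le> coll q"
proof -
  have "\<exists>a. \<forall>b. q b \<le> q a"
  proof -
    have "Max (range q) \<in> range q" by (intro Max_in) auto
    then obtain a where "Max (range q) = q a" by (rule rangeE)
    then show ?thesis by (metis Max_ge finite finite_imageI rangeI)
  qed
  then obtain a where a: "\<And>b. q b \<le> q a" by auto
  have rest: "(\<Sum>b\<in>UNIV - {a}. q b) = 1 - q a"
    using pdist_sum[OF q] by (simp add: sum_diff1)
  have "\<alpha> * \<alpha> \<le> (1 / 2) * \<alpha>" using \<alpha> by (intro mult_right_mono) auto
  then have half: "2 * \<alpha> * (1 - \<alpha>) \<le> 1 / 2"
    using zero_le_power2[of "1 - 2 * \<alpha>"] by (simp add: power2_eq_square algebra_simps)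
  show ?thesis
  proof (cases "q a \<le> 1 / 2")
    case True
    have "(\<Sum>b\<in>UNIV. (q b)\<^sup>2) \<le> (\<Sum>b\<in>UNIV. q b * (1 / 2))"
      unfolding power2_eq_square using order_trans[OF a True] pdist_nonneg[OF q]
      by (intro sum_mono mult_left_mono) auto
    also have "\<dots> = 1 / 2" using pdist_sum[OF q] by (simp flip: sum_divide_distrib)
    finally show ?thesis using half by (simp add: coll_def)
  next
    case False
    have le: "q b \<le> 1 - q a" if "b \<noteq> a" for b
      using member_le_sum[of b "UNIV - {a}" q] that rest pdist_nonneg[OF q] by simp
    have "(\<Sum>b\<in>UNIV. (q b)\<^sup>2) = (q a)\<^sup>2 + (\<Sum>b\<in>UNIV - {a}. (q b)\<^sup>2)"
      by (simp add: sum.remove)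
    also have "(\<Sum>b\<in>UNIV - {a}. (q b)\<^sup>2) \<le> (\<Sum>b\<in>UNIV - {a}. q b * (1 - q a))"
      unfolding power2_eq_square using le pdist_nonneg[OF q]
      by (intro sum_mono mult_left_mono) auto
    also have "\<dots> = (1 - q a)\<^sup>2"
      by (simp add: rest power2_eq_square flip: sum_distrib_right)
    finally have "coll q \<ge> 1 - ((q a)\<^sup>2 + (1 - q a)\<^sup>2)" by (simp add: coll_def)
    moreover have "0 \<le> ((1 - \<alpha>) - q a) * (q a - \<alpha>)"
      using bal[of a] False \<alpha> by (intro mult_nonneg_nonneg) auto
    ultimately show ?thesis by (simp add: power2_eq_square algebra_simps)
  qed
qed

lemma norm_phi_le_exp: "norm (phi q s) \<le> exp (- defect q s / 2)"
proof (rule power2_le_imp_le)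
  have "(norm (phi q s))\<^sup>2 = 1 + (- defect q s)" by (simp add: defect_def)
  also have "\<dots> \<le> exp (- defect q s)" by (rule exp_ge_add_one_self)
  also have "\<dots> = (exp (- defect q s / 2))\<^sup>2" by (simp add: power2_eq_square flip: exp_add)
  finally show "(norm (phi q s))\<^sup>2 \<le> (exp (- defect q s / 2))\<^sup>2" .
qed simp

lemma exp_minus_le_quadratic:
  assumes "0 \<le> (t::real)" shows "exp (- t) \<le> 1 - t + t\<^sup>2 / 2"
proof -
  have "((\<lambda>t. 1 - t + t\<^sup>2 / 2 - exp (- t)) has_real_derivative (- 1 + x + exp (- x))) (at x)" for x :: real
    by (auto intro!: derivative_eq_intros)
  moreover have "- 1 + x + exp (- x) \<ge> 0" for x :: real
    using exp_ge_add_one_self[of "- x"] by simp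
  ultimately have "1 - 0 + 0\<^sup>2 / 2 - exp (- 0) \<le> 1 - t + t\<^sup>2 / 2 - exp (- t)"
    by (intro DERIV_nonneg_imp_nondecreasing[OF assms]) blast
  then show ?thesis by simp
qed

text \<open>
  The defect is rescaled to have mean exactly \<open>2 \<alpha> (1 - \<alpha>)\<close>; then \<open>\<mu>\<close> times the rescaled defect
  is at most \<open>2 \<lambda>\<close> and the exponential can be linearised with the sharp constant.
\<close>
lemma mean_exp_defect_le:
  fixes q :: "'p::prime_card mod_ring \<Rightarrow> real"
  assumes q: "pdist q" and bal: "\<And>a. q a \<le> 1 - \<alpha>" and \<alpha>: "0 < \<alpha>" "\<alpha> \<le> 1 / 2"
    and lam: "0 < lam" "lam \<le> 1"
  shows "(\<Sum>s\<in>UNIV. exp (- (lam / (2 * \<alpha>)) * defect q s))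
           \<le> real CARD('p) * exp (- lam * (1 - lam) * (1 - \<alpha>))"
proof -
  have cq: "2 * \<alpha> * (1 - \<alpha>) \<le> coll q" using coll_ge[OF q bal] \<alpha> by simp
  have pos: "2 * \<alpha> * (1 - \<alpha>) > 0" using \<alpha> by simp
  then have cpos: "coll q > 0" using cq by linarith
  define t where "t = (\<lambda>s. lam * (1 - \<alpha>) * defect q s / coll q)"
  have t0: "0 \<le> t s" for s using \<alpha> lam cpos defect_nonneg[OF q] by (simp add: t_def)
  have t2: "t s \<le> 2 * lam" for s
  proof -
    have "t s \<le> lam * (1 - \<alpha>) * (2 * coll q) / coll q"
      unfolding t_def using \<alpha> lam cpos defect_le[OF q]
      by (intro divide_right_mono mult_left_mono) auto
    also have "\<dots> = 2 * lam * (1 - \<alpha>)" using cpos by simp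
    also have "\<dots> \<le> 2 * lam * 1" using \<alpha> lam by (intro mult_left_mono) auto
    finally show ?thesis by simp
  qed
  have tle: "t s \<le> lam / (2 * \<alpha>) * defect q s" for s
  proof -
    have "(1 - \<alpha>) / coll q \<le> 1 / (2 * \<alpha>)"
      using cq cpos \<alpha> by (simp add: field_simps)
    then have "(1 - \<alpha>) / coll q * (lam * defect q s) \<le> 1 / (2 * \<alpha>) * (lam * defect q s)"
      using lam defect_nonneg[OF q] by (intro mult_right_mono) auto
    then show ?thesis by (simp add: t_def mult.commute mult.left_commute)
  qed
  have "(\<Sum>s\<in>UNIV. exp (- (lam / (2 * \<alpha>)) * defect q s)) \<le> (\<Sum>s\<in>UNIV. 1 - (1 - lam) * t s)"
  proof (intro sum_mono)
    fix s
    have "exp (- (lam / (2 * \<alpha>)) * defect q s) \<le> exp (- t s)" using tle by simp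
    also have "\<dots> \<le> 1 - t s + (t s)\<^sup>2 / 2" by (rule exp_minus_le_quadratic[OF t0])
    also have "(t s)\<^sup>2 \<le> 2 * lam * t s"
      unfolding power2_eq_square using t0 t2 by (intro mult_right_mono) auto
    finally show "exp (- (lam / (2 * \<alpha>)) * defect q s) \<le> 1 - (1 - lam) * t s"
      by (simp add: algebra_simps)
  qed
  also have "\<dots> = real CARD('p) - (1 - lam) * (\<Sum>s\<in>UNIV. t s)"
    by (simp add: sum_subtractf sum_distrib_left)
  also have "(\<Sum>s\<in>UNIV. t s) = lam * (1 - \<alpha>) * (\<Sum>s\<in>UNIV. defect q s) / coll q"
    by (simp only: t_def sum_distrib_left sum_divide_distrib)
  also have "\<dots> = real CARD('p) * (lam * (1 - \<alpha>))"
    using cpos by (simp add: sum_defect[OF q])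
  also have "real CARD('p) - (1 - lam) * \<dots> = real CARD('p) * (1 - (1 - lam) * (lam * (1 - \<alpha>)))"
    by (simp add: algebra_simps)
  also have "\<dots> \<le> real CARD('p) * exp (- lam * (1 - lam) * (1 - \<alpha>))"
    using exp_ge_add_one_self[of "- lam * (1 - lam) * (1 - \<alpha>)"]
    by (intro mult_left_mono) (auto simp: algebra_simps)
  finally show ?thesis .
qed

section \<open>Random linear combinations of vectors\<close>

no_notation Finite_Cartesian_Product.vec.vec_nth (infixl "$" 90)
no_notation Inner_Product.real_inner_class.inner (infix "\<bullet>" 70)

lemma chi_sum: "chi (\<Sum>i\<in>I. f i) = (\<Prod>i\<in>I. chi (f i))"
  by (induction I rule: infinite_finite_induct) (auto simp: chi_add)

lemma bij_betw_vec: "bij_betw (vec n) (PiE {..<n} (\<lambda>_. UNIV :: 'a set)) (carrier_vec n)"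
proof (rule bij_betw_byWitness[where f' = "\<lambda>v. \<lambda>i\<in>{..<n}. v $ i"])
  show "\<forall>a\<in>{..<n} \<rightarrow>\<^sub>E (UNIV :: 'a set). (\<lambda>i\<in>{..<n}. vec n a $ i) = a"
  proof (intro ballI ext)
    fix a :: "nat \<Rightarrow> 'a" and i assume "a \<in> {..<n} \<rightarrow>\<^sub>E UNIV"
    then show "(\<lambda>i\<in>{..<n}. vec n a $ i) i = a i"
      by (cases "i < n") (simp_all add: PiE_arb[of a "{..<n}"])
  qed
  show "\<forall>v\<in>carrier_vec n :: 'a vec set. vec n (\<lambda>i\<in>{..<n}. v $ i) = v"
    by (intro ballI eq_vecI) simp_all
  show "vec n ` ({..<n} \<rightarrow>\<^sub>E (UNIV :: 'a set)) \<subseteq> carrier_vec n"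
    by (intro image_subsetI vec_carrier)
  show "(\<lambda>v. \<lambda>i\<in>{..<n}. v $ i) ` carrier_vec n \<subseteq> {..<n} \<rightarrow>\<^sub>E (UNIV :: 'a set)"
    by (intro image_subsetI restrict_PiE_iff[THEN iffD2]) simp
qed

lemma finite_carrier_vec [simp]: "finite (carrier_vec n :: 'a::finite vec set)"
proof -
  have "finite (PiE {..<n} (\<lambda>_. UNIV :: 'a set))" by (intro finite_PiE) auto
  then show ?thesis using bij_betw_finite[OF bij_betw_vec[where 'a='a and n=n]] by (rule iffD1[rotated])
qed

lemma card_carrier_vec: "card (carrier_vec n :: 'a::finite vec set) = CARD('a) ^ n"
  using bij_betw_same_card[OF bij_betw_vec[where 'a='a and n=n]] by (simp add: card_PiE)

text \<open>
  For independent coordinates $b_j \sim q_j$: \<open>pe\<close> is expectation, \<open>rp\<close> the point probability of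
  $\sum_j b_j x_j = c$, and \<open>cp\<close> the probability that this equation holds after applying
  all functionals in \<open>E\<close>.
\<close>
definition pe :: "('i \<Rightarrow> 'a::finite \<Rightarrow> real) \<Rightarrow> 'i set \<Rightarrow> (('i \<Rightarrow> 'a) \<Rightarrow> real) \<Rightarrow> real" where
  "pe q I f = (\<Sum>b\<in>PiE I (\<lambda>_. UNIV). (\<Prod>j\<in>I. q j (b j)) * f b)"

lemma pe_empty [simp]: "pe q {} f = f (\<lambda>_. undefined)"
  by (simp add: pe_def)

lemma pe_insert:
  fixes q :: "'i \<Rightarrow> 'a::finite \<Rightarrow> real"
  assumes "finite I" "j \<notin> I"
  shows "pe q (insert j I) f = (\<Sum>a\<in>UNIV. q j a * pe q I (\<lambda>b. f (b(j := a))))"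
proof -
  have inj: "inj_on (\<lambda>(y, g). g(j := y)) (UNIV \<times> PiE I (\<lambda>_. UNIV :: 'a set))"
    using inj_combinator[OF assms(2), of "\<lambda>_. UNIV :: 'a set"] by simp
  have "pe q (insert j I) f
      = (\<Sum>(a, b)\<in>UNIV \<times> PiE I (\<lambda>_. UNIV). (\<Prod>i\<in>insert j I. q i ((b(j := a)) i)) * f (b(j := a)))"
    unfolding pe_def PiE_insert_eq
    by (subst sum.reindex[OF inj]) (simp only: case_prod_unfold comp_def)
  also have "\<dots> = (\<Sum>(a, b)\<in>UNIV \<times> PiE I (\<lambda>_. UNIV). q j a * ((\<Prod>i\<in>I. q i (b i)) * f (b(j := a))))"
  proof (intro sum.cong refl, clarify)
    fix a b
    have "(\<Prod>i\<in>I. q i ((b(j := a)) i)) = (\<Prod>i\<in>I. q i (b i))"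
      using assms by (intro prod.cong) auto
    then show "(\<Prod>i\<in>insert j I. q i ((b(j := a)) i)) * f (b(j := a))
        = q j a * ((\<Prod>i\<in>I. q i (b i)) * f (b(j := a)))"
      using assms by simp
  qed
  also have "\<dots> = (\<Sum>a\<in>UNIV. q j a * pe q I (\<lambda>b. f (b(j := a))))"
    by (simp add: pe_def sum_distrib_left sum.cartesian_product)
  finally show ?thesis .
qed

lemma pe_mono:
  assumes "\<And>j. j \<in> I \<Longrightarrow> pdist (q j)" "\<And>b. f b \<le> g b"
  shows "pe q I f \<le> pe q I g"
  unfolding pe_def using assms
  by (intro sum_mono mult_left_mono prod_nonneg) (auto simp: pdist_nonneg)

lemma pe_const:
  assumes "finite I" "\<And>j. j \<in> I \<Longrightarrow> pdist (q j)"
  shows "pe q I (\<lambda>_. c) = c"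
  using assms
proof (induction I rule: finite_induct)
  case (insert j I)
  then show ?case
    by (simp add: pe_insert pdist_sum flip: sum_distrib_right)
qed simp

lemma pe_sum: "pe q I (\<lambda>b. \<Sum>k\<in>A. f k b) = (\<Sum>k\<in>A. pe q I (f k))"
  unfolding pe_def sum_distrib_left by (rule sum.swap)

lemma pe_cong: "(\<And>b. b \<in> PiE I (\<lambda>_. UNIV) \<Longrightarrow> f b = g b) \<Longrightarrow> pe q I f = pe q I g"
  unfolding pe_def by (intro sum.cong) auto

definition rp :: "nat \<Rightarrow> ('i \<Rightarrow> 'p::prime_card mod_ring \<Rightarrow> real) \<Rightarrow> ('i \<Rightarrow> 'p mod_ring vec) \<Rightarrow> 'i set
    \<Rightarrow> 'p mod_ring vec \<Rightarrow> real" where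
  "rp d q x I c = pe q I (\<lambda>b. of_bool (\<forall>k<d. (\<Sum>j\<in>I. b j * x j $ k) = c $ k))"

definition cp :: "'p::prime_card mod_ring vec set \<Rightarrow> ('i \<Rightarrow> 'p mod_ring \<Rightarrow> real) \<Rightarrow> ('i \<Rightarrow> 'p mod_ring vec)
    \<Rightarrow> 'i set \<Rightarrow> 'p mod_ring vec \<Rightarrow> real" where
  "cp E q x I c = pe q I (\<lambda>b. of_bool (\<forall>u\<in>E. (\<Sum>j\<in>I. b j * (u \<bullet> x j)) = u \<bullet> c))"

lemma sum_fun_upd_other:
  "j \<notin> I \<Longrightarrow> (\<Sum>i\<in>I. (b(j := a)) i * f i) = (\<Sum>i\<in>I. b i * (f i :: 'a::comm_ring_1))"
  by (intro sum.cong) auto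

text \<open>Conditioning on one coefficient moves its multiple of the row into the target. This
  recursion and its analogue \<open>cp_insert\<close> let the inductions below peel off rows one at
  a time, with an arbitrary target.\<close>

lemma rp_insert:
  fixes x :: "'i \<Rightarrow> 'p::prime_card mod_ring vec"
  assumes "finite I" "j \<notin> I" "x j \<in> carrier_vec d" "c \<in> carrier_vec d"
  shows "rp d q x (insert j I) c = (\<Sum>a\<in>UNIV. q j a * rp d q x I (c - a \<cdot>\<^sub>v x j))"
  unfolding rp_def pe_insert[OF assms(1,2)]
proof (intro sum.cong refl arg_cong2[of _ _ _ _ "(*)"] pe_cong)
  fix a b
  have "(\<Sum>i\<in>insert j I. (b(j := a)) i * x i $ k) = c $ k \<longleftrightarrow>
      (\<Sum>i\<in>I. b i * x i $ k) = (c - a \<cdot>\<^sub>v x j) $ k" if "k < d" for k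
    unfolding sum.insert[OF assms(1,2)] sum_fun_upd_other[OF assms(2)]
    using assms(3,4) that by (simp add: eq_diff_eq add.commute)
  then show "of_bool (\<forall>k<d. (\<Sum>i\<in>insert j I. (b(j := a)) i * x i $ k) = c $ k) =
      (of_bool (\<forall>k<d. (\<Sum>i\<in>I. b i * x i $ k) = (c - a \<cdot>\<^sub>v x j) $ k) :: real)"
    by auto
qed

lemma cp_insert:
  fixes x :: "'i \<Rightarrow> 'p::prime_card mod_ring vec"
  assumes "finite I" "j \<notin> I" "x j \<in> carrier_vec d" "c \<in> carrier_vec d" "E \<subseteq> carrier_vec d"
  shows "cp E q x (insert j I) c = (\<Sum>a\<in>UNIV. q j a * cp E q x I (c - a \<cdot>\<^sub>v x j))"
  unfolding cp_def pe_insert[OF assms(1,2)]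
proof (intro sum.cong refl arg_cong2[of _ _ _ _ "(*)"] pe_cong)
  fix a b
  have "(\<Sum>i\<in>insert j I. (b(j := a)) i * (u \<bullet> x i)) = u \<bullet> c \<longleftrightarrow>
      (\<Sum>i\<in>I. b i * (u \<bullet> x i)) = u \<bullet> (c - a \<cdot>\<^sub>v x j)" if "u \<in> E" for u
  proof -
    have "u \<bullet> (c - a \<cdot>\<^sub>v x j) = u \<bullet> c - a * (u \<bullet> x j)"
      using assms that by (subst scalar_prod_minus_distrib[of _ d]) auto
    then have *: "u \<bullet> (c - a \<cdot>\<^sub>v x j) = u \<bullet> c - a * (u \<bullet> x j)" by simp
    show ?thesis
      unfolding sum.insert[OF assms(1,2)] sum_fun_upd_other[OF assms(2)] fun_upd_same *
      by (simp only: eq_diff_eq add.commute)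
  qed
  then show "of_bool (\<forall>u\<in>E. (\<Sum>i\<in>insert j I. (b(j := a)) i * (u \<bullet> x i)) = u \<bullet> c) =
      (of_bool (\<forall>u\<in>E. (\<Sum>i\<in>I. b i * (u \<bullet> x i)) = u \<bullet> (c - a \<cdot>\<^sub>v x j)) :: real)"
    by auto
qed

lemma rp_nonneg: "(\<And>j. j \<in> I \<Longrightarrow> pdist (q j)) \<Longrightarrow> 0 \<le> rp d q x I c"
  unfolding rp_def pe_def by (intro sum_nonneg mult_nonneg_nonneg prod_nonneg) (auto simp: pdist_nonneg)

lemma cp_nonneg: "(\<And>j. j \<in> I \<Longrightarrow> pdist (q j)) \<Longrightarrow> 0 \<le> cp E q x I c"
  unfolding cp_def pe_def by (intro sum_nonneg mult_nonneg_nonneg prod_nonneg) (auto simp: pdist_nonneg)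

section \<open>The cost of outlying rows\<close>

text \<open>The worst case puts weight 1 - \<alpha> on the value m and weight \<alpha> on the value
  1 - m. Only the largest value of \<open>v\<close> matters: as the values sum to at most 1, every
  other one is at most its complement.\<close>

lemma balanced_rearrangement:
  fixes q v :: "'a::finite \<Rightarrow> real"
  assumes q: "pdist q" "\<And>a. q a \<le> 1 - \<alpha>" and \<alpha>: "0 \<le> \<alpha>" "\<alpha> \<le> 1 / 2"
    and v: "\<And>a. 0 \<le> v a" "\<And>a. v a \<le> m" "(\<Sum>a\<in>UNIV. v a) \<le> 1" and m: "1 / 2 \<le> m"
  shows "(\<Sum>a\<in>UNIV. q a * v a) \<le> (1 - \<alpha>) * m + \<alpha> * (1 - m)"
proof -
  have "Max (range v) \<in> range v" by (intro Max_in) auto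
  then obtain a where "Max (range v) = v a" by (rule rangeE)
  then have a: "v b \<le> v a" for b by (metis Max_ge finite finite_imageI rangeI)
  have m': "(1 - 2 * \<alpha>) * (1 / 2) \<le> (1 - 2 * \<alpha>) * m" using \<alpha> m by (intro mult_left_mono) auto
  show ?thesis
  proof (cases "v a \<le> 1 / 2")
    case True
    have "(\<Sum>b\<in>UNIV. q b * v b) \<le> (\<Sum>b\<in>UNIV. q b * (1 / 2))"
      using order_trans[OF a True] pdist_nonneg[OF q(1)] by (intro sum_mono mult_left_mono) auto
    also have "\<dots> = 1 / 2" using pdist_sum[OF q(1)] by (simp flip: sum_divide_distrib)
    also have "\<dots> \<le> (1 - \<alpha>) * m + \<alpha> * (1 - m)" using m' by (simp add: algebra_simps)
    finally show ?thesis .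
  next
    case False
    have le: "v b \<le> 1 - v a" if "b \<noteq> a" for b
    proof -
      have "v b \<le> (\<Sum>b\<in>UNIV - {a}. v b)" using that v by (intro member_le_sum) auto
      also have "\<dots> = (\<Sum>b\<in>UNIV. v b) - v a" by (simp add: sum_diff1)
      finally show ?thesis using v(3) by simp
    qed
    have "(\<Sum>b\<in>UNIV. q b * v b) = q a * v a + (\<Sum>b\<in>UNIV - {a}. q b * v b)"
      by (simp add: sum.remove)
    also have "(\<Sum>b\<in>UNIV - {a}. q b * v b) \<le> (\<Sum>b\<in>UNIV - {a}. q b * (1 - v a))"
      using le pdist_nonneg[OF q(1)] by (intro sum_mono mult_left_mono) auto
    also have "\<dots> = (1 - q a) * (1 - v a)"
      using pdist_sum[OF q(1)] by (simp add: sum_diff1 flip: sum_distrib_right)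
    also have "q a * v a + (1 - q a) * (1 - v a) = q a * (2 * v a - 1) + (1 - v a)"
      by (simp add: algebra_simps)
    also have "\<dots> \<le> (1 - \<alpha>) * (2 * v a - 1) + (1 - v a)"
      using q(2)[of a] False by (intro add_right_mono mult_right_mono) auto
    also have "\<dots> = (1 - 2 * \<alpha>) * v a + \<alpha>" by (simp add: algebra_simps)
    also have "\<dots> \<le> (1 - 2 * \<alpha>) * m + \<alpha>"
      using v(2)[of a] \<alpha> by (intro add_right_mono mult_left_mono) auto
    finally show ?thesis by (simp add: algebra_simps)
  qed
qed

text \<open>For different values of one coefficient the shifted targets are incompatible, because
  some functional in \<open>E\<close> is nonzero on that row; the conditional probabilities thus sum
  to at most 1 and the rearrangement bound applies. The recursion m -> (1 - \<alpha>) m + \<alpha>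
  (1 - m) is that of a two-state walk which flips with probability \<alpha>; its return probability
  is the bound.\<close>

lemma cp_le:
  fixes x :: "'i \<Rightarrow> 'p::prime_card mod_ring vec"
  assumes "finite S" "E \<subseteq> carrier_vec d"
    and "\<And>j. j \<in> S \<Longrightarrow> pdist (q j)" "\<And>j a. j \<in> S \<Longrightarrow> q j a \<le> 1 - \<alpha>" and \<alpha>: "0 \<le> \<alpha>" "\<alpha> \<le> 1 / 2"
    and "\<And>j. j \<in> S \<Longrightarrow> x j \<in> carrier_vec d" "\<And>j. j \<in> S \<Longrightarrow> \<exists>u\<in>E. u \<bullet> x j \<noteq> 0"
    and "c \<in> carrier_vec d"
  shows "cp E q x S c \<le> (1 + (1 - 2 * \<alpha>) ^ card S) / 2"
  using assms(1,3,4,7-)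
proof (induction S arbitrary: c rule: finite_induct)
  case empty
  then show ?case by (simp add: cp_def)
next
  case (insert j I)
  define m where "m = (1 + (1 - 2 * \<alpha>) ^ card I) / 2"
  have IH: "cp E q x I (c - a \<cdot>\<^sub>v x j) \<le> m" for a
    unfolding m_def using insert by auto
  obtain u where u: "u \<in> E" "u \<bullet> x j \<noteq> 0" using insert.prems by blast
  have uc: "u \<in> carrier_vec d" using u assms(2) by auto
  have "(\<Sum>a\<in>UNIV. cp E q x I (c - a \<cdot>\<^sub>v x j)) \<le> pe q I (\<lambda>_. 1)"
    unfolding cp_def pe_sum[symmetric]
  proof (rule pe_mono)
    fix b
    let ?P = "\<lambda>a. \<forall>u\<in>E. (\<Sum>i\<in>I. b i * (u \<bullet> x i)) = u \<bullet> (c - a \<cdot>\<^sub>v x j)"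
    have "a = a'" if "?P a" "?P a'" for a a'
    proof -
      have "u \<bullet> (c - a \<cdot>\<^sub>v x j) = u \<bullet> (c - a' \<cdot>\<^sub>v x j)" using that u by metis
      moreover have "u \<bullet> (c - a \<cdot>\<^sub>v x j) = u \<bullet> c - a * (u \<bullet> x j)" for a
        using insert.prems uc by (subst scalar_prod_minus_distrib[of _ d]) auto
      ultimately show ?thesis using u by simp
    qed
    then have "card {a. ?P a} \<le> Suc 0" by (subst card_le_Suc0_iff_eq) auto
    then show "(\<Sum>a\<in>UNIV. of_bool (?P a)) \<le> (1 :: real)" by (simp add: sum_of_bool_eq)
  qed (use insert in auto)
  also have "\<dots> = 1" using insert by (intro pe_const) auto
  finally have sum: "(\<Sum>a\<in>UNIV. cp E q x I (c - a \<cdot>\<^sub>v x j)) \<le> 1" .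
  have "cp E q x (insert j I) c = (\<Sum>a\<in>UNIV. q j a * cp E q x I (c - a \<cdot>\<^sub>v x j))"
    using insert assms(2) by (intro cp_insert) auto
  also have "\<dots> \<le> (1 - \<alpha>) * m + \<alpha> * (1 - m)"
  proof (rule balanced_rearrangement)
    show "1 / 2 \<le> m" using \<alpha> by (simp add: m_def)
  qed (use insert IH sum \<alpha> in \<open>auto intro: cp_nonneg\<close>)
  also have "\<dots> = (1 + (1 - 2 * \<alpha>) ^ card (insert j I)) / 2"
    using insert by (simp add: m_def field_simps)
  finally show ?case .
qed

text \<open>Rows in \<open>R\<close> are invisible to \<open>E\<close>, so the functionals in
  \<open>E\<close> must hit their targets on the rows in \<open>S\<close> alone. Given the
  coefficients on \<open>S\<close>, the remaining probability is at most \<sigma>, or 0 if one of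
  these targets is missed; this dichotomy is the base case, where the rows of \<open>S\<close> have
  been moved into the target.\<close>

lemma rp_Un_le:
  fixes x :: "'i \<Rightarrow> 'p::prime_card mod_ring vec"
  assumes "finite S" "finite R" "S \<inter> R = {}" "E \<subseteq> carrier_vec d"
    and "\<And>j. j \<in> S \<union> R \<Longrightarrow> pdist (q j)"
    and "\<And>j. j \<in> S \<union> R \<Longrightarrow> x j \<in> carrier_vec d" "\<And>j u. j \<in> R \<Longrightarrow> u \<in> E \<Longrightarrow> u \<bullet> x j = 0"
    and \<sigma>: "\<And>c. c \<in> carrier_vec d \<Longrightarrow> rp d q x R c \<le> \<sigma>"
    and "c \<in> carrier_vec d"
  shows "rp d q x (S \<union> R) c \<le> \<sigma> * cp E q x S c"
  using assms(1,3,5,6,9)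
proof (induction S arbitrary: c rule: finite_induct)
  case empty
  show ?case
  proof (cases "\<forall>u\<in>E. u \<bullet> c = 0")
    case True
    then show ?thesis using \<sigma>[of c] empty by (simp add: cp_def)
  next
    case False
    then obtain u where u: "u \<in> E" "u \<bullet> c \<noteq> 0" by blast
    have uc: "u \<in> carrier_vec d" using u assms(4) by auto
    have "\<not> (\<forall>k<d. (\<Sum>j\<in>R. b j * x j $ k) = c $ k)" for b
    proof
      assume b: "\<forall>k<d. (\<Sum>j\<in>R. b j * x j $ k) = c $ k"
      have "u \<bullet> c = (\<Sum>k<d. u $ k * c $ k)"
        using empty by (simp add: scalar_prod_def lessThan_atLeast0)
      also have "\<dots> = (\<Sum>k<d. \<Sum>j\<in>R. b j * (u $ k * x j $ k))"
      proof (intro sum.cong refl)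
        fix k assume "k \<in> {..<d}"
        then have "c $ k = (\<Sum>j\<in>R. b j * x j $ k)" using b by simp
        then show "u $ k * c $ k = (\<Sum>j\<in>R. b j * (u $ k * x j $ k))"
          by (simp only: sum_distrib_left mult.left_commute)
      qed
      also have "\<dots> = (\<Sum>j\<in>R. b j * (u \<bullet> x j))"
        using empty
        by (subst sum.swap, intro sum.cong refl)
           (simp add: scalar_prod_def lessThan_atLeast0 sum_distrib_left carrier_vecD[of _ d])
      also have "\<dots> = 0" using assms(7) u by simp
      finally show False using u by simp
    qed
    then have "rp d q x R c = 0"
      unfolding rp_def pe_def by (intro sum.neutral ballI) (simp only: of_bool_eq mult_zero_right if_False)
    moreover have "cp E q x {} c = 0" using u unfolding cp_def by auto
    ultimately show ?thesis by simp
  qed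
next
  case (insert j I)
  have "rp d q x (insert j I \<union> R) c = (\<Sum>a\<in>UNIV. q j a * rp d q x (I \<union> R) (c - a \<cdot>\<^sub>v x j))"
    using insert assms(2) by (simp, intro rp_insert) auto
  also have "\<dots> \<le> (\<Sum>a\<in>UNIV. q j a * (\<sigma> * cp E q x I (c - a \<cdot>\<^sub>v x j)))"
    using insert by (intro sum_mono mult_left_mono insert.IH) (auto simp: pdist_nonneg)
  also have "\<dots> = \<sigma> * (\<Sum>a\<in>UNIV. q j a * cp E q x I (c - a \<cdot>\<^sub>v x j))"
    by (simp add: sum_distrib_left mult.left_commute)
  also have "(\<Sum>a\<in>UNIV. q j a * cp E q x I (c - a \<cdot>\<^sub>v x j)) = cp E q x (insert j I) c"
    using insert assms(4) by (intro cp_insert[symmetric]) auto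
  finally show ?case .
qed

section \<open>Subspaces given by functionals, and Fourier inversion on them\<close>

definition ann :: "nat \<Rightarrow> 'a::comm_ring_1 vec set \<Rightarrow> 'a vec set" where
  "ann d E = {x \<in> carrier_vec d. \<forall>u\<in>E. u \<bullet> x = 0}"

lemma ann_subset: "ann d E \<subseteq> carrier_vec d" by (auto simp: ann_def)
lemma ann_carrier: "x \<in> ann d E \<Longrightarrow> x \<in> carrier_vec d" by (simp add: ann_def)
lemma zero_in_ann: "E \<subseteq> carrier_vec d \<Longrightarrow> 0\<^sub>v d \<in> ann d E" by (auto simp: ann_def)
lemma finite_ann [simp]: "finite (ann d E :: 'a::{finite,comm_ring_1} vec set)"
  by (rule finite_subset[OF ann_subset]) simp

lemma add_in_ann:
  assumes "E \<subseteq> carrier_vec d" "x \<in> ann d E" "y \<in> ann d E"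
  shows "x + y \<in> ann d E"
proof -
  have "u \<bullet> (x + y) = 0" if "u \<in> E" for u
    using assms that scalar_prod_add_distrib[of u d x y] by (simp add: ann_def subsetD)
  then show ?thesis using assms by (simp add: ann_def)
qed

lemma diff_in_ann:
  assumes "E \<subseteq> carrier_vec d" "x \<in> ann d E" "y \<in> ann d E"
  shows "x - y \<in> ann d E"
proof -
  have "u \<bullet> (x - y) = 0" if "u \<in> E" for u
    using assms that scalar_prod_minus_distrib[of u d x y] by (simp add: ann_def subsetD)
  then show ?thesis using assms by (simp add: ann_def)
qed

lemma ann_empty [simp]: "ann d {} = carrier_vec d" by (simp add: ann_def)

lemma sum_shift_ann:
  fixes f :: "'a::comm_ring_1 vec \<Rightarrow> 'b::comm_monoid_add"
  assumes "E \<subseteq> carrier_vec d" "y \<in> ann d E"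
  shows "(\<Sum>x\<in>ann d E. f (x + y)) = (\<Sum>x\<in>ann d E. f x)"
proof (rule sum.reindex_bij_witness[of _ "\<lambda>x. x - y" "\<lambda>x. x + y"])
  fix x assume "x \<in> ann d E"
  then have "x \<in> carrier_vec d" "y \<in> carrier_vec d" using assms ann_carrier by auto
  then show "x + y - y = x" "x - y + y = x" by auto
qed (use assms add_in_ann diff_in_ann in auto)

lemma sum_chi_ann:
  fixes E :: "'p::prime_card mod_ring vec set"
  assumes E: "E \<subseteq> carrier_vec d" and u: "u \<in> carrier_vec d"
  shows "(\<Sum>x\<in>ann d E. chi (u \<bullet> x)) = of_nat (card (ann d E)) * of_bool (\<forall>x\<in>ann d E. u \<bullet> x = 0)"
proof (cases "\<forall>x\<in>ann d E. u \<bullet> x = 0")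
  case False
  then obtain y where y: "y \<in> ann d E" "u \<bullet> y \<noteq> 0" by blast
  have "(\<Sum>x\<in>ann d E. chi (u \<bullet> x)) = (\<Sum>x\<in>ann d E. chi (u \<bullet> (x + y)))"
    using sum_shift_ann[OF E y(1), of "\<lambda>x. chi (u \<bullet> x)"] by simp
  also have "\<dots> = (\<Sum>x\<in>ann d E. chi (u \<bullet> x)) * chi (u \<bullet> y)"
    unfolding sum_distrib_right
  proof (intro sum.cong refl)
    fix x assume "x \<in> ann d E"
    then show "chi (u \<bullet> (x + y)) = chi (u \<bullet> x) * chi (u \<bullet> y)"
      using u y(1) ann_carrier by (subst scalar_prod_add_distrib[of _ d]) (auto simp: chi_add)
  qed
  finally have "(\<Sum>x\<in>ann d E. chi (u \<bullet> x)) * (1 - chi (u \<bullet> y)) = 0"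
    by (simp add: algebra_simps)
  moreover have "chi (u \<bullet> y) \<noteq> 1" using Re_chi_less_1[OF y(2)] by auto
  ultimately show ?thesis using False by simp
qed simp

lemma scalar_prod_eq_0_imp:
  assumes "y \<in> carrier_vec d" "\<And>u. u \<in> carrier_vec d \<Longrightarrow> u \<bullet> (y :: 'a::comm_ring_1 vec) = 0"
  shows "y = 0\<^sub>v d"
proof (rule eq_vecI)
  fix i assume i: "i < dim_vec (0\<^sub>v d :: 'a vec)"
  then have "y $ i = unit_vec d i \<bullet> y" using assms(1) by simp
  then show "y $ i = 0\<^sub>v d $ i" using i assms(2)[of "unit_vec d i"] by simp
qed (use assms in auto)

lemma sum_chi_carrier:
  fixes y :: "'p::prime_card mod_ring vec"
  assumes y: "y \<in> carrier_vec d"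
  shows "(\<Sum>u\<in>carrier_vec d. chi (u \<bullet> y)) = of_nat (CARD('p) ^ d) * of_bool (y = 0\<^sub>v d)"
proof -
  have "(\<Sum>u\<in>carrier_vec d. chi (u \<bullet> y)) = (\<Sum>u\<in>ann d {}. chi (y \<bullet> u))"
    using y by (intro sum.cong) (auto simp: comm_scalar_prod[of _ d])
  also have "\<dots> = of_nat (CARD('p) ^ d) * of_bool (\<forall>u\<in>carrier_vec d. y \<bullet> u = 0)"
    using sum_chi_ann[OF _ y, of "{}"] by (simp add: card_carrier_vec)
  also have "(\<forall>u\<in>carrier_vec d. y \<bullet> u = 0) \<longleftrightarrow> y = 0\<^sub>v d"
    using scalar_prod_eq_0_imp[OF y] y by (auto simp: comm_scalar_prod[of _ d])
  finally show ?thesis .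
qed

text \<open>For H = \<open>ann d E\<close> this is the span of \<open>E\<close>: the frequencies at
  which rows in H produce no cancellation.\<close>

definition perp :: "nat \<Rightarrow> 'a::comm_ring_1 vec set \<Rightarrow> 'a vec set" where
  "perp d H = {u \<in> carrier_vec d. \<forall>x\<in>H. u \<bullet> x = 0}"

text \<open>The character sum over pairs (u, x) is evaluated in both orders by orthogonality, which
  replaces the dimension formula.\<close>

lemma card_ann_perp:
  fixes E :: "'p::prime_card mod_ring vec set"
  assumes E: "E \<subseteq> carrier_vec d"
  shows "card (ann d E) * card (perp d (ann d E)) = CARD('p) ^ d"
proof -
  have "complex_of_nat (CARD('p) ^ d) = (\<Sum>x\<in>ann d E. of_nat (CARD('p) ^ d) * of_bool (x = 0\<^sub>v d))"
    using zero_in_ann[OF E] by (simp add: of_bool_def if_distrib cong: if_cong)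
  also have "\<dots> = (\<Sum>x\<in>ann d E. \<Sum>u\<in>carrier_vec d. chi (u \<bullet> x))"
    by (intro sum.cong refl) (simp add: sum_chi_carrier ann_carrier)
  also have "\<dots> = (\<Sum>u\<in>carrier_vec d. of_nat (card (ann d E)) * of_bool (\<forall>x\<in>ann d E. u \<bullet> x = 0))"
    by (subst sum.swap, intro sum.cong refl sum_chi_ann[OF E])
  also have "\<dots> = of_nat (card (ann d E) * card (perp d (ann d E)))"
    by (simp add: sum_distrib_left[symmetric] sum_of_bool_eq perp_def Int_def)
  finally show ?thesis unfolding of_nat_eq_iff by (rule sym)
qed

text \<open>The indicator of y = 0 is expanded in characters; independence of the coefficients then
  factors the mean of each character into values of \<open>phi\<close>.\<close>

lemma rp_fourier:
  fixes x :: "'i \<Rightarrow> 'p::prime_card mod_ring vec"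
  assumes I: "finite I" and x: "\<And>j. j \<in> I \<Longrightarrow> x j \<in> carrier_vec d" and c: "c \<in> carrier_vec d"
  shows "of_real (real CARD('p) ^ d * rp d q x I c)
    = (\<Sum>u\<in>carrier_vec d. chi (- (u \<bullet> c)) * (\<Prod>j\<in>I. phi (q j) (u \<bullet> x j)))"
proof -
  define y where "y = (\<lambda>b. vec d (\<lambda>k. (\<Sum>j\<in>I. b j * x j $ k) - c $ k))"
  have y0: "y b = 0\<^sub>v d \<longleftrightarrow> (\<forall>k<d. (\<Sum>j\<in>I. b j * x j $ k) = c $ k)" for b
    by (auto simp: y_def vec_eq_iff)
  have uy: "u \<bullet> y b = (\<Sum>j\<in>I. (u \<bullet> x j) * b j) - u \<bullet> c" if "u \<in> carrier_vec d" for u b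
  proof -
    have "u \<bullet> y b = (\<Sum>k<d. (\<Sum>j\<in>I. u $ k * x j $ k * b j) - u $ k * c $ k)"
      by (simp add: scalar_prod_def y_def lessThan_atLeast0 right_diff_distrib sum_distrib_left mult_ac)
    also have "\<dots> = (\<Sum>j\<in>I. \<Sum>k<d. u $ k * x j $ k * b j) - (\<Sum>k<d. u $ k * c $ k)"
      by (simp add: sum_subtractf sum.swap[of _ I])
    also have "\<dots> = (\<Sum>j\<in>I. (u \<bullet> x j) * b j) - u \<bullet> c"
      using x c by (simp add: scalar_prod_def lessThan_atLeast0 sum_distrib_right carrier_vecD[of _ d])
    finally show ?thesis .
  qed
  have "of_real (real CARD('p) ^ d * rp d q x I c)
      = (\<Sum>b\<in>PiE I (\<lambda>_. UNIV). (\<Prod>j\<in>I. complex_of_real (q j (b j))) * (of_nat (CARD('p) ^ d) * of_bool (y b = 0\<^sub>v d)))"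
    by (simp add: rp_def pe_def y0 sum_distrib_left mult_ac of_bool_def if_distrib cong: if_cong)
  also have "\<dots> = (\<Sum>b\<in>PiE I (\<lambda>_. UNIV). \<Sum>u\<in>carrier_vec d. chi (- (u \<bullet> c)) * (\<Prod>j\<in>I. of_real (q j (b j)) * chi ((u \<bullet> x j) * b j)))"
  proof (intro sum.cong refl)
    fix b
    have "y b \<in> carrier_vec d" by (simp add: y_def)
    then have "of_nat (CARD('p) ^ d) * of_bool (y b = 0\<^sub>v d) = (\<Sum>u\<in>carrier_vec d. chi (u \<bullet> y b))"
      by (simp add: sum_chi_carrier)
    also have "\<dots> = (\<Sum>u\<in>carrier_vec d. chi (- (u \<bullet> c)) * (\<Prod>j\<in>I. chi ((u \<bullet> x j) * b j)))"
    proof (intro sum.cong refl)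
      fix u :: "'p mod_ring vec" assume u: "u \<in> carrier_vec d"
      have "u \<bullet> y b = - (u \<bullet> c) + (\<Sum>j\<in>I. (u \<bullet> x j) * b j)" using uy[OF u] by simp
      then show "chi (u \<bullet> y b) = chi (- (u \<bullet> c)) * (\<Prod>j\<in>I. chi ((u \<bullet> x j) * b j))"
        by (simp only: chi_add chi_sum)
    qed
    finally show "(\<Prod>j\<in>I. complex_of_real (q j (b j))) * (of_nat (CARD('p) ^ d) * of_bool (y b = 0\<^sub>v d))
      = (\<Sum>u\<in>carrier_vec d. chi (- (u \<bullet> c)) * (\<Prod>j\<in>I. of_real (q j (b j)) * chi ((u \<bullet> x j) * b j)))"
      by (simp add: sum_distrib_left prod.distrib mult_ac)
  qed
  also have "\<dots> = (\<Sum>u\<in>carrier_vec d. chi (- (u \<bullet> c)) * (\<Sum>b\<in>PiE I (\<lambda>_. UNIV). \<Prod>j\<in>I. of_real (q j (b j)) * chi ((u \<bullet> x j) * b j)))"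
    by (subst sum.swap) (simp add: sum_distrib_left)
  also have "\<dots> = (\<Sum>u\<in>carrier_vec d. chi (- (u \<bullet> c)) * (\<Prod>j\<in>I. phi (q j) (u \<bullet> x j)))"
    using I by (simp add: phi_def prod_sum_PiE)
  finally show ?thesis .
qed

text \<open>Bounds the modulus of the Fourier coefficient at \<open>u\<close>; in this exponential
  form the defects of the single rows add up.\<close>

definition err :: "('i \<Rightarrow> 'p::prime_card mod_ring \<Rightarrow> real) \<Rightarrow> ('i \<Rightarrow> 'p mod_ring vec) \<Rightarrow> 'i set
    \<Rightarrow> 'p mod_ring vec \<Rightarrow> real" where
  "err q x I u = exp (- (\<Sum>j\<in>I. defect (q j) (u \<bullet> x j)) / 2)"

lemma norm_prod_phi_le: "finite I \<Longrightarrow> norm (\<Prod>j\<in>I. phi (q j) (u \<bullet> x j)) \<le> err q x I u"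
proof -
  assume "finite I"
  have "norm (\<Prod>j\<in>I. phi (q j) (u \<bullet> x j)) \<le> (\<Prod>j\<in>I. exp (- defect (q j) (u \<bullet> x j) / 2))"
    unfolding prod_norm[symmetric] by (intro prod_mono conjI norm_phi_le_exp) auto
  also have "\<dots> = err q x I u"
    unfolding err_def sum_divide_distrib sum_negf[symmetric] using \<open>finite I\<close>
    by (simp add: exp_sum)
  finally show ?thesis .
qed

lemma phi_0: "pdist q \<Longrightarrow> phi q 0 = 1"
  using pdist_sum[of q] by (simp add: phi_def flip: of_real_sum)

text \<open>Frequencies trivial on the subspace contribute 1 each, and their number divided by p^d
  is exactly the uniform probability on it. All other frequencies form the relative error; taking
  the number of trivial ones out of that term as well is allowed because it is at least 1.\<close>

lemma rp_le:
  fixes x :: "'i \<Rightarrow> 'p::prime_card mod_ring vec"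
  assumes I: "finite I" and E: "E \<subseteq> carrier_vec d" and x: "\<And>j. j \<in> I \<Longrightarrow> x j \<in> ann d E"
    and q: "\<And>j. j \<in> I \<Longrightarrow> pdist (q j)" and c: "c \<in> carrier_vec d"
  shows "rp d q x I c \<le> (1 + (\<Sum>u\<in>carrier_vec d - perp d (ann d E). err q x I u)) / card (ann d E)"
proof -
  let ?H = "ann d E" and ?N = "real CARD('p) ^ d"
  let ?e = "\<Sum>u\<in>carrier_vec d - perp d ?H. err q x I u"
  have sub: "perp d ?H \<subseteq> carrier_vec d" by (auto simp: perp_def)
  have e0: "0 \<le> ?e" by (intro sum_nonneg) (simp add: err_def)
  have card: "real (card ?H) * real (card (perp d ?H)) = ?N"
    using card_ann_perp[OF E] by (metis of_nat_mult of_nat_power)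
  have Npos: "?N > 0" by simp
  have "card ?H \<noteq> 0"
    using zero_in_ann[OF E] by auto
  moreover have "card (perp d ?H) \<noteq> 0"
    using card Npos by (metis mult_zero_right of_nat_0 less_irrefl)
  ultimately have pos: "real (card ?H) > 0" "real (card (perp d ?H)) > 0"
    by (simp_all only: of_nat_0_less_iff neq0_conv)
  have pge: "real (card (perp d ?H)) \<ge> 1"
    using pos(2) by (metis One_nat_def Suc_leI of_nat_0_less_iff of_nat_1 of_nat_le_iff)
  have "?N * rp d q x I c = norm (complex_of_real (?N * rp d q x I c))"
    using rp_nonneg[of I q d x c] q by (simp only: norm_of_real abs_mult) simp
  also have "\<dots> \<le> (\<Sum>u\<in>carrier_vec d. norm (chi (- (u \<bullet> c)) * (\<Prod>j\<in>I. phi (q j) (u \<bullet> x j))))"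
    by (subst rp_fourier[OF I ann_carrier[OF x] c]) (assumption, rule norm_sum)
  also have "\<dots> = (\<Sum>u\<in>carrier_vec d - perp d ?H. norm (\<Prod>j\<in>I. phi (q j) (u \<bullet> x j)))
      + (\<Sum>u\<in>perp d ?H. norm (\<Prod>j\<in>I. phi (q j) (u \<bullet> x j)))"
    by (simp add: norm_mult sum.subset_diff[OF sub])
  also have "\<dots> \<le> ?e + (\<Sum>u\<in>perp d ?H. 1)"
    using I x q by (intro add_mono sum_mono norm_prod_phi_le) (auto simp: perp_def phi_0)
  also have "\<dots> \<le> real (card (perp d ?H)) * (1 + ?e)"
    using mult_right_mono[OF pge e0] by (simp add: algebra_simps)
  finally have "real (card (perp d ?H)) * (real (card ?H) * rp d q x I c) \<le> real (card (perp d ?H)) * (1 + ?e)"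
    unfolding card[symmetric] by (simp only: mult_ac)
  then have "real (card ?H) * rp d q x I c \<le> 1 + ?e"
    using pos(2) by (rule mult_left_le_imp_le)
  then show ?thesis using pos(1) by (simp add: field_simps)
qed

lemma rp_ge:
  fixes x :: "'i \<Rightarrow> 'p::prime_card mod_ring vec"
  assumes I: "finite I" and x: "\<And>j. j \<in> I \<Longrightarrow> x j \<in> carrier_vec d"
    and q: "\<And>j. j \<in> I \<Longrightarrow> pdist (q j)" and c: "c \<in> carrier_vec d"
  shows "rp d q x I c \<ge> (1 - (\<Sum>u\<in>carrier_vec d - {0\<^sub>v d}. err q x I u)) / real CARD('p) ^ d"
proof -
  let ?N = "real CARD('p) ^ d"
  let ?f = "\<lambda>u. chi (- (u \<bullet> c)) * (\<Prod>j\<in>I. phi (q j) (u \<bullet> x j))"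
  let ?e = "\<Sum>u\<in>carrier_vec d - {0\<^sub>v d}. err q x I u"
  have "?f (0\<^sub>v d) = 1" using x c q by (simp add: phi_0)
  moreover have "(\<Sum>u\<in>carrier_vec d. ?f u) = ?f (0\<^sub>v d) + (\<Sum>u\<in>carrier_vec d - {0\<^sub>v d}. ?f u)"
    by (rule sum.remove) auto
  ultimately have "complex_of_real (?N * rp d q x I c) = 1 + (\<Sum>u\<in>carrier_vec d - {0\<^sub>v d}. ?f u)"
    using rp_fourier[OF I x c] by (simp only:)
  then have "complex_of_real (?N * rp d q x I c - 1) = (\<Sum>u\<in>carrier_vec d - {0\<^sub>v d}. ?f u)"
    by simp
  then have "\<bar>?N * rp d q x I c - 1\<bar> = norm (\<Sum>u\<in>carrier_vec d - {0\<^sub>v d}. ?f u)"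
    by (metis norm_of_real)
  also have "\<dots> \<le> (\<Sum>u\<in>carrier_vec d - {0\<^sub>v d}. norm (?f u))" by (rule norm_sum)
  also have "\<dots> \<le> ?e" using I by (intro sum_mono) (simp add: norm_mult norm_prod_phi_le)
  finally have "?N * rp d q x I c \<ge> 1 - ?e" by linarith
  then show ?thesis by (simp add: field_simps)
qed

section \<open>Chernoff bounds for rows in a subspace\<close>

text \<open>A functional not trivial on the subspace takes every value equally often there:
  translation by a multiple of a vector on which it is nonzero shifts its value by any prescribed
  amount.\<close>

lemma sum_ann_uniform:
  fixes g :: "'p::prime_card mod_ring \<Rightarrow> real"
  assumes E: "E \<subseteq> carrier_vec d" and u: "u \<in> carrier_vec d" "u \<notin> perp d (ann d E)"
  shows "real CARD('p) * (\<Sum>x\<in>ann d E. g (u \<bullet> x)) = real (card (ann d E)) * (\<Sum>s\<in>UNIV. g s)"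
proof -
  obtain y where y: "y \<in> ann d E" "u \<bullet> y \<noteq> 0" using u by (auto simp: perp_def)
  have shift: "(\<Sum>x\<in>ann d E. g (u \<bullet> x)) = (\<Sum>x\<in>ann d E. g (u \<bullet> x + s))" for s
  proof -
    define z where "z = (s / (u \<bullet> y)) \<cdot>\<^sub>v y"
    have z: "z \<in> ann d E" unfolding z_def
      using y E by (auto simp: ann_def)
    have uz: "u \<bullet> z = s" using u y ann_carrier[OF y(1)] by (simp add: z_def)
    have "(\<Sum>x\<in>ann d E. g (u \<bullet> x)) = (\<Sum>x\<in>ann d E. g (u \<bullet> (x + z)))"
      using sum_shift_ann[OF E z, of "\<lambda>x. g (u \<bullet> x)"] by simp
    also have "\<dots> = (\<Sum>x\<in>ann d E. g (u \<bullet> x + s))"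
    proof (intro sum.cong refl)
      fix x assume "x \<in> ann d E"
      then show "g (u \<bullet> (x + z)) = g (u \<bullet> x + s)"
        using u(1) z scalar_prod_add_distrib[of u d x z] uz by (simp add: ann_carrier)
    qed
    finally show ?thesis .
  qed
  have "real CARD('p) * (\<Sum>x\<in>ann d E. g (u \<bullet> x)) = (\<Sum>s\<in>(UNIV :: 'p mod_ring set). \<Sum>x\<in>ann d E. g (u \<bullet> x))"
    by simp
  also have "\<dots> = (\<Sum>s\<in>UNIV. \<Sum>x\<in>ann d E. g (u \<bullet> x + s))"
    by (intro sum.cong refl shift)
  also have "\<dots> = (\<Sum>x\<in>ann d E. \<Sum>s\<in>UNIV. g (u \<bullet> x + s))" by (rule sum.swap)
  also have "\<dots> = (\<Sum>x\<in>ann d E. \<Sum>s\<in>UNIV. g s)"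
  proof (rule sum.cong[OF refl])
    fix x
    show "(\<Sum>s\<in>UNIV. g (u \<bullet> x + s)) = (\<Sum>s\<in>UNIV. g s)"
      by (rule sum.reindex_bij_witness[of _ "\<lambda>s. s - u \<bullet> x" "\<lambda>s. u \<bullet> x + s"]) auto
  qed
  finally show ?thesis by simp
qed

text \<open>Markov's inequality for the exponential moment, with rows drawn independently and
  uniformly from the subspace. Each row then contributes the mean over all frequencies bounded in
  \<open>mean_exp_defect_le\<close>. The exponent lam / (2 \<alpha>) is scaled to the size \<alpha>
  of a mean defect, so the decay is exponential in the number of rows even when \<alpha> tends to
  0.\<close>

lemma card_small_defect_le:
  fixes q :: "'i \<Rightarrow> 'p::prime_card mod_ring \<Rightarrow> real"
  assumes R: "finite R" and E: "E \<subseteq> carrier_vec d" and u: "u \<in> carrier_vec d" "u \<notin> perp d (ann d E)"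
    and q: "\<And>j. j \<in> R \<Longrightarrow> pdist (q j)" "\<And>j a. j \<in> R \<Longrightarrow> q j a \<le> 1 - \<alpha>"
    and \<alpha>: "0 < \<alpha>" "\<alpha> \<le> 1 / 2" and lam: "0 < lam" "lam \<le> 1"
  shows "real (card {x \<in> PiE R (\<lambda>_. ann d E). (\<Sum>j\<in>R. defect (q j) (u \<bullet> x j)) \<le> t})
    \<le> real (card (ann d E)) ^ card R * exp (lam / (2 * \<alpha>) * t - lam * (1 - lam) * (1 - \<alpha>) * real (card R))"
proof -
  let ?H = "ann d E" and ?mu = "lam / (2 * \<alpha>)"
  let ?D = "\<lambda>x. \<Sum>j\<in>R. defect (q j) (u \<bullet> x j)"
  have fin: "finite (PiE R (\<lambda>_. ?H))" using R by (intro finite_PiE) auto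
  have mu: "?mu > 0" using \<alpha> lam by simp
  have "real (card {x \<in> PiE R (\<lambda>_. ?H). ?D x \<le> t}) = (\<Sum>x\<in>PiE R (\<lambda>_. ?H). of_bool (?D x \<le> t))"
    using fin by (simp add: sum_of_bool_eq Int_def)
  also have "\<dots> \<le> (\<Sum>x\<in>PiE R (\<lambda>_. ?H). exp (?mu * t) * (\<Prod>j\<in>R. exp (- ?mu * defect (q j) (u \<bullet> x j))))"
  proof (intro sum_mono)
    fix x
    have "(\<Prod>j\<in>R. exp (- ?mu * defect (q j) (u \<bullet> x j))) = exp (- ?mu * ?D x)"
      using R by (simp only: exp_sum sum_distrib_left)
    then have *: "exp (?mu * t) * (\<Prod>j\<in>R. exp (- ?mu * defect (q j) (u \<bullet> x j))) = exp (?mu * (t - ?D x))"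
      by (simp only: exp_add[symmetric]) (simp add: algebra_simps)
    show "of_bool (?D x \<le> t) \<le> exp (?mu * t) * (\<Prod>j\<in>R. exp (- ?mu * defect (q j) (u \<bullet> x j)))"
    proof (cases "?D x \<le> t")
      case True
      then have "0 \<le> ?mu * (t - ?D x)" using mu by (intro mult_nonneg_nonneg) auto
      then show ?thesis unfolding * using True by simp
    next
      case False
      then show ?thesis unfolding * by simp
    qed
  qed
  also have "\<dots> = exp (?mu * t) * (\<Prod>j\<in>R. \<Sum>x\<in>?H. exp (- ?mu * defect (q j) (u \<bullet> x)))"
    unfolding sum_distrib_left[symmetric]
    using prod_sum_PiE[of R "\<lambda>_. ?H" "\<lambda>j x. exp (- ?mu * defect (q j) (u \<bullet> x))"] R by simp
  also have "\<dots> \<le> exp (?mu * t) * (\<Prod>j\<in>R. real (card ?H) * exp (- lam * (1 - lam) * (1 - \<alpha>)))"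
  proof (intro mult_left_mono prod_mono conjI sum_nonneg)
    fix j assume j: "j \<in> R"
    have "real CARD('p) * (\<Sum>x\<in>?H. exp (- ?mu * defect (q j) (u \<bullet> x)))
        = real (card ?H) * (\<Sum>s\<in>UNIV. exp (- ?mu * defect (q j) s))"
      by (rule sum_ann_uniform[OF E u])
    also have "\<dots> \<le> real (card ?H) * (real CARD('p) * exp (- lam * (1 - lam) * (1 - \<alpha>)))"
      using j q \<alpha> lam by (intro mult_left_mono mean_exp_defect_le) auto
    also have "\<dots> = real CARD('p) * (real (card ?H) * exp (- lam * (1 - lam) * (1 - \<alpha>)))"
      by (simp only: mult_ac)
    finally show "(\<Sum>x\<in>?H. exp (- ?mu * defect (q j) (u \<bullet> x))) \<le> real (card ?H) * exp (- lam * (1 - lam) * (1 - \<alpha>))"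
      by (rule mult_left_le_imp_le) simp
  qed auto
  also have "\<dots> = real (card ?H) ^ card R * (exp (?mu * t) * exp (- lam * (1 - lam) * (1 - \<alpha>)) ^ card R)"
    by (simp add: power_mult_distrib)
  also have "exp (?mu * t) * exp (- lam * (1 - lam) * (1 - \<alpha>)) ^ card R
      = exp (?mu * t - lam * (1 - lam) * (1 - \<alpha>) * real (card R))"
    by (simp add: exp_of_nat_mult[symmetric] exp_add[symmetric] algebra_simps)
  finally show ?thesis .
qed

text \<open>What the greedy choice of the subspace guarantees for every single tuple; it is the only
  control available on the exceptional set of the Chernoff bound.\<close>

definition many_nonzero :: "nat \<Rightarrow> 'p::prime_card mod_ring vec set \<Rightarrow> real \<Rightarrow> 'i set \<Rightarrow> ('i \<Rightarrow> 'p mod_ring vec) \<Rightarrow> bool" where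
  "many_nonzero d E w R x \<longleftrightarrow>
     (\<forall>u\<in>carrier_vec d - perp d (ann d E). real (card {j \<in> R. u \<bullet> x j \<noteq> 0}) > w)"

lemma err_le_many_nonzero:
  fixes q :: "'i \<Rightarrow> 'p::prime_card mod_ring \<Rightarrow> real"
  assumes R: "finite R" and u: "real (card {j \<in> R. u \<bullet> x j \<noteq> 0}) \<ge> w"
    and q: "\<And>j. j \<in> R \<Longrightarrow> pdist (q j)" "\<And>j a. j \<in> R \<Longrightarrow> q j a \<le> 1 - \<alpha>"
    and \<alpha>: "0 \<le> \<alpha>" "\<alpha> \<le> 1 / 2"
  shows "err q x R u \<le> exp (- chi_gap TYPE('p) * \<alpha> * (1 - \<alpha>) * w)"
proof -
  let ?k = "chi_gap TYPE('p)"
  have k: "?k > 0" by (rule chi_gap_pos)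
  have c0: "0 \<le> ?k * (2 * \<alpha> * (1 - \<alpha>))" using k \<alpha> by simp
  have "?k * (2 * \<alpha> * (1 - \<alpha>)) * w \<le> ?k * (2 * \<alpha> * (1 - \<alpha>)) * real (card {j \<in> R. u \<bullet> x j \<noteq> 0})"
    using u c0 by (rule mult_left_mono)
  also have "\<dots> = (\<Sum>j\<in>{j \<in> R. u \<bullet> x j \<noteq> 0}. ?k * (2 * \<alpha> * (1 - \<alpha>)))" by simp
  also have "\<dots> \<le> (\<Sum>j\<in>{j \<in> R. u \<bullet> x j \<noteq> 0}. defect (q j) (u \<bullet> x j))"
  proof (intro sum_mono)
    fix j assume j: "j \<in> {j \<in> R. u \<bullet> x j \<noteq> 0}"
    have "?k * (2 * \<alpha> * (1 - \<alpha>)) \<le> ?k * coll (q j)"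
      using k q j \<alpha> by (intro mult_left_mono coll_ge) auto
    also have "\<dots> \<le> defect (q j) (u \<bullet> x j)" using q j by (intro defect_ge) auto
    finally show "?k * (2 * \<alpha> * (1 - \<alpha>)) \<le> defect (q j) (u \<bullet> x j)" .
  qed
  also have "\<dots> \<le> (\<Sum>j\<in>R. defect (q j) (u \<bullet> x j))"
    using R q by (intro sum_mono2) (auto intro: defect_nonneg)
  finally show ?thesis unfolding err_def by (simp add: algebra_simps)
qed

text \<open>
  In the sum over all \<open>x\<close>, the first summand comes from those \<open>x\<close> for which every defect sum exceeds
  \<open>t\<close>; the last factor is the Chernoff bound for the others, multiplied by the crude bound
  that \<open>many_nonzero\<close> gives for each.
\<close>
definition fbound :: "real \<Rightarrow> nat \<Rightarrow> real \<Rightarrow> real \<Rightarrow> real \<Rightarrow> real \<Rightarrow> real \<Rightarrow> real \<Rightarrow> real" where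
  "fbound N n \<kappa> \<alpha> lam t w r = (1 + N * exp (- t / 2)) ^ n
     + (1 + N * exp (- \<kappa> * \<alpha> * (1 - \<alpha>) * w)) ^ n
       * (real n * N * exp (lam / (2 * \<alpha>) * t - lam * (1 - lam) * (1 - \<alpha>) * r))"

lemma sum_prod_err_le:
  fixes Q :: "nat \<Rightarrow> 'i \<Rightarrow> 'p::prime_card mod_ring \<Rightarrow> real"
  assumes R: "finite R" and E: "E \<subseteq> carrier_vec d"
    and Q: "\<And>i j. i < n \<Longrightarrow> j \<in> R \<Longrightarrow> pdist (Q i j)" "\<And>i j a. i < n \<Longrightarrow> j \<in> R \<Longrightarrow> Q i j a \<le> 1 - \<alpha>"
    and \<alpha>: "0 < \<alpha>" "\<alpha> \<le> 1 / 2" and lam: "0 < lam" "lam \<le> 1" and r: "r \<le> real (card R)"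
  shows "(\<Sum>x\<in>{x \<in> PiE R (\<lambda>_. ann d E). many_nonzero d E w R x}.
      \<Prod>i<n. 1 + (\<Sum>u\<in>carrier_vec d - perp d (ann d E). err (Q i) x R u))
    \<le> real (card (ann d E)) ^ card R * fbound (real CARD('p) ^ d) n (chi_gap TYPE('p)) \<alpha> lam t w r"
proof -
  let ?H = "ann d E" and ?N = "real CARD('p) ^ d"
  let ?U = "carrier_vec d - perp d ?H"
  let ?X = "{x \<in> PiE R (\<lambda>_. ?H). many_nonzero d E w R x}"
  let ?D = "\<lambda>i u x. \<Sum>j\<in>R. defect (Q i j) (u \<bullet> x j)"
  let ?f = "\<lambda>x. \<Prod>i<n. 1 + (\<Sum>u\<in>?U. err (Q i) x R u)"
  let ?a = "(1 + ?N * exp (- t / 2)) ^ n"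
  let ?b = "(1 + ?N * exp (- chi_gap TYPE('p) * \<alpha> * (1 - \<alpha>) * w)) ^ n"
  let ?c = "exp (lam / (2 * \<alpha>) * t - lam * (1 - lam) * (1 - \<alpha>) * r)"
  have fin: "finite (PiE R (\<lambda>_. ?H))" using R by (intro finite_PiE) auto
  have finU: "finite ?U" by simp
  have cardU: "real (card ?U) \<le> ?N"
  proof -
    have "card ?U \<le> card (carrier_vec d :: 'p mod_ring vec set)" by (intro card_mono) auto
    then show ?thesis by (simp add: card_carrier_vec flip: of_nat_power)
  qed
  have prod_le: "?f x \<le> (1 + ?N * e) ^ n" if "\<And>i u. i < n \<Longrightarrow> u \<in> ?U \<Longrightarrow> err (Q i) x R u \<le> e" "0 \<le> e" for x e
  proof -
    have "?f x \<le> (\<Prod>i<n. 1 + ?N * e)"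
    proof (intro prod_mono conjI)
      fix i assume "i \<in> {..<n}"
      then have "(\<Sum>u\<in>?U. err (Q i) x R u) \<le> (\<Sum>u\<in>?U. e)" using that by (intro sum_mono) auto
      also have "\<dots> \<le> ?N * e" using cardU that(2) by (simp add: mult_right_mono)
      finally show "1 + (\<Sum>u\<in>?U. err (Q i) x R u) \<le> 1 + ?N * e" by simp
      show "0 \<le> 1 + (\<Sum>u\<in>?U. err (Q i) x R u)"
        by (intro add_nonneg_nonneg sum_nonneg) (auto simp: err_def)
    qed
    then show ?thesis by simp
  qed
  \<comment> \<open>The exceptional tuples for matrix row \<open>i\<close> and frequency
    \<open>u\<close>; the union over all pairs produces the factor n N in
    \<open>fbound\<close>.\<close>
  define B where "B = (\<lambda>i u. {x \<in> PiE R (\<lambda>_. ?H). ?D i u x \<le> t})"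
  let ?Bs = "\<Union>i\<in>{..<n}. \<Union>u\<in>?U. B i u"
  have finB: "finite (B i u)" for i u unfolding B_def using fin by simp
  have cardB: "real (card ?Bs) \<le> real n * ?N * (real (card ?H) ^ card R * ?c)"
  proof -
    have "real (card ?Bs) \<le> (\<Sum>i<n. \<Sum>u\<in>?U. real (card (B i u)))"
    proof -
      have "card ?Bs \<le> (\<Sum>i<n. card (\<Union>u\<in>?U. B i u))" by (rule card_UN_le) simp
      also have "\<dots> \<le> (\<Sum>i<n. \<Sum>u\<in>?U. card (B i u))" by (intro sum_mono card_UN_le finU)
      finally show ?thesis by (simp flip: of_nat_sum)
    qed
    also have "\<dots> \<le> (\<Sum>i<n. \<Sum>u\<in>?U. real (card ?H) ^ card R * ?c)"
    proof (intro sum_mono)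
      fix i u assume i: "i \<in> {..<n}" and u: "u \<in> ?U"
      have "real (card (B i u)) \<le> real (card ?H) ^ card R * exp (lam / (2 * \<alpha>) * t - lam * (1 - lam) * (1 - \<alpha>) * real (card R))"
        unfolding B_def using i u Q by (intro card_small_defect_le[OF R E _ _ _ _ \<alpha> lam]) auto
      also have "\<dots> \<le> real (card ?H) ^ card R * ?c"
        using r \<alpha> lam by (intro mult_left_mono) (auto intro!: mult_left_mono)
      finally show "real (card (B i u)) \<le> real (card ?H) ^ card R * ?c" .
    qed
    also have "\<dots> = real n * (real (card ?U) * (real (card ?H) ^ card R * ?c))" by simp
    also have "\<dots> \<le> real n * (?N * (real (card ?H) ^ card R * ?c))"
      using cardU by (intro mult_left_mono mult_right_mono) auto
    finally show ?thesis by (simp only: mult_ac)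
  qed
  have "(\<Sum>x\<in>?X. ?f x) \<le> (\<Sum>x\<in>?X. ?a + ?b * of_bool (x \<in> ?Bs))"
  proof (intro sum_mono)
    fix x assume x: "x \<in> ?X"
    have a0: "0 \<le> ?a" "0 \<le> ?b" by (intro zero_le_power add_nonneg_nonneg; simp)+
    show "?f x \<le> ?a + ?b * of_bool (x \<in> ?Bs)"
    proof (cases "x \<in> ?Bs")
      case True
      have "?f x \<le> ?b"
      proof (rule prod_le)
        fix i u assume "i < n" "u \<in> ?U"
        then show "err (Q i) x R u \<le> exp (- chi_gap TYPE('p) * \<alpha> * (1 - \<alpha>) * w)"
          using x Q \<alpha> R by (intro err_le_many_nonzero) (auto simp: many_nonzero_def intro: less_imp_le)
      qed simp
      also have "\<dots> \<le> ?a + ?b" using a0 by simp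
      finally show ?thesis using True by simp
    next
      case False
      have "?f x \<le> ?a"
      proof (rule prod_le)
        fix i u assume iu: "i < n" "u \<in> ?U"
        then have "x \<notin> B i u" using False by blast
        then have "t < ?D i u x" using x by (simp add: B_def)
        then show "err (Q i) x R u \<le> exp (- t / 2)" by (simp add: err_def)
      qed simp
      then show ?thesis using False by simp
    qed
  qed
  also have "\<dots> = real (card ?X) * ?a + ?b * real (card (?X \<inter> ?Bs))"
    using fin by (simp add: sum.distrib sum_distrib_left[symmetric] sum_of_bool_eq Int_def)
  also have "\<dots> \<le> (real (card ?H) ^ card R) * ?a + ?b * (real n * ?N * (real (card ?H) ^ card R * ?c))"
  proof (intro add_mono mult_left_mono mult_right_mono order_trans[OF _ cardB])
    have "card ?X \<le> card (PiE R (\<lambda>_. ?H))" using fin by (intro card_mono) auto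
    also have "\<dots> = card ?H ^ card R" using R by (simp add: card_PiE)
    finally show "real (card ?X) \<le> real (card ?H) ^ card R" by (simp flip: of_nat_power)
    show "real (card (?X \<inter> ?Bs)) \<le> real (card ?Bs)"
      using finB by (intro of_nat_mono card_mono) auto
  qed (auto intro!: zero_le_power add_nonneg_nonneg)
  also have "\<dots> = real (card ?H) ^ card R * fbound ?N n (chi_gap TYPE('p)) \<alpha> lam t w r"
    by (simp add: fbound_def algebra_simps)
  finally show ?thesis .
qed

definition outside :: "nat \<Rightarrow> nat \<Rightarrow> 'a::comm_ring_1 vec set \<Rightarrow> (nat \<Rightarrow> 'a vec) \<Rightarrow> nat set" where
  "outside n d E x = {j \<in> {..<n}. x j \<notin> ann d E}"

text \<open>The tuple is cut into its outlying rows, bounded by the number of their choices, and its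
  rows in the subspace H. Each of the n row probabilities carries a factor 1 / |H| by
  equidistribution, and there are |H|^(n - |S|) inner tuples, so these powers cancel up to a factor
  at most 1. What the outliers must gain comes from \<open>cp_le\<close>, once for each of the n
  matrix rows.\<close>

lemma sum_prod_rp_le:
  fixes Q :: "nat \<Rightarrow> nat \<Rightarrow> 'p::prime_card mod_ring \<Rightarrow> real"
  assumes E: "E \<subseteq> carrier_vec d" and S: "S \<subseteq> {..<n}"
    and Q: "\<And>i j. i < n \<Longrightarrow> j < n \<Longrightarrow> pdist (Q i j)" "\<And>i j a. i < n \<Longrightarrow> j < n \<Longrightarrow> Q i j a \<le> 1 - \<alpha>"
    and \<alpha>: "0 < \<alpha>" "\<alpha> \<le> 1 / 2" and lam: "0 < lam" "lam \<le> 1" and r: "r \<le> real n - real (card S)"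
    and c: "\<And>x i. c x i \<in> carrier_vec d"
  shows "(\<Sum>x\<in>{x \<in> PiE {..<n} (\<lambda>_. carrier_vec d). outside n d E x = S \<and> many_nonzero d E w ({..<n} - S) x}.
       \<Prod>i<n. rp d (Q i) x {..<n} (c x i))
    \<le> (real CARD('p) ^ d) ^ card S * ((1 + (1 - 2 * \<alpha>) ^ card S) / 2) ^ n
       * fbound (real CARD('p) ^ d) n (chi_gap TYPE('p)) \<alpha> lam t w r"
proof -
  let ?H = "ann d E" and ?R = "{..<n} - S"
  let ?U = "carrier_vec d - perp d ?H"
  let ?X = "{x \<in> PiE {..<n} (\<lambda>_. carrier_vec d). outside n d E x = S \<and> many_nonzero d E w ?R x}"
  let ?Y = "{y \<in> PiE ?R (\<lambda>_. ?H). many_nonzero d E w ?R y}"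
  let ?rho = "(1 + (1 - 2 * \<alpha>) ^ card S) / 2"
  let ?h = "real (card ?H)"
  define g where "g = (\<lambda>y. \<Prod>i<n. ?rho * ((1 + (\<Sum>u\<in>?U. err (Q i) y ?R u)) / ?h))"
  have finS: "finite S" using S finite_subset by blast
  have cardR: "card ?R = n - card S" using S finS by (simp add: card_Diff_subset)
  have cardS: "card S \<le> n" using S by (metis card_lessThan card_mono finite_lessThan)
  have hpos: "?h > 0"
    using zero_in_ann[OF E] by (metis card_gt_0_iff empty_iff finite_ann of_nat_0_less_iff)
  have rho0: "0 \<le> ?rho" using \<alpha> by simp
  have S_union: "S \<union> ?R = {..<n}" using S by auto
  have le: "(\<Prod>i<n. rp d (Q i) x {..<n} (c x i)) \<le> g (restrict x ?R)" if x: "x \<in> ?X" for x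
    unfolding g_def
  proof (intro prod_mono conjI rp_nonneg)
    fix i assume i: "i \<in> {..<n}"
    let ?s = "(1 + (\<Sum>u\<in>?U. err (Q i) (restrict x ?R) ?R u)) / ?h"
    have err_eq: "err (Q i) x ?R u = err (Q i) (restrict x ?R) ?R u" for u
      by (simp add: err_def)
    have xR: "x j \<in> ?H" if "j \<in> ?R" for j using that x by (auto simp: outside_def)
    have xS: "x j \<in> carrier_vec d" "x j \<notin> ?H" if "j \<in> S" for j
      using that x S by (auto simp: outside_def PiE_iff)
    have "rp d (Q i) x (S \<union> ?R) (c x i) \<le> ?s * cp E (Q i) x S (c x i)"
    proof (rule rp_Un_le[OF finS _ _ E])
      fix c' :: "'p mod_ring vec" assume "c' \<in> carrier_vec d"
      then show "rp d (Q i) x ?R c' \<le> ?s"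
        unfolding err_eq[symmetric] using i xR Q by (intro rp_le[OF _ E]) auto
    next
      fix j assume "j \<in> S \<union> ?R" then show "x j \<in> carrier_vec d"
        using xS xR ann_carrier by blast
    next
      fix j u assume "j \<in> ?R" "u \<in> E" then show "u \<bullet> x j = 0"
        using xR by (auto simp: ann_def)
    qed (use Q i S c in auto)
    also have "\<dots> \<le> ?s * ?rho"
    proof (intro mult_left_mono cp_le[OF finS E])
      fix j assume j: "j \<in> S"
      show "\<exists>u\<in>E. u \<bullet> x j \<noteq> 0" using xS[OF j] by (auto simp: ann_def)
      show "x j \<in> carrier_vec d" using xS[OF j] by auto
    qed (use Q i S c \<alpha> in \<open>auto intro!: divide_nonneg_nonneg add_nonneg_nonneg sum_nonneg simp: err_def\<close>)
    finally show "rp d (Q i) x {..<n} (c x i) \<le> ?rho * ?s"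
      unfolding S_union by (simp only: mult.commute)
  qed (use Q in auto)
  have g0: "0 \<le> g y" for y
    unfolding g_def using \<alpha> hpos
    by (intro prod_nonneg mult_nonneg_nonneg divide_nonneg_nonneg add_nonneg_nonneg sum_nonneg ballI)
       (auto simp: err_def)
  define \<phi> where "\<phi> = (\<lambda>x :: nat \<Rightarrow> 'p mod_ring vec. (restrict x S, restrict x ?R))"
  have inj: "inj_on \<phi> ?X"
  proof (rule inj_onI)
    fix x y assume xy: "x \<in> ?X" "y \<in> ?X" "\<phi> x = \<phi> y"
    then have eq: "restrict x S = restrict y S" "restrict x ?R = restrict y ?R"
      by (auto simp: \<phi>_def)
    have "x j = y j" if "j < n" for j
      using fun_cong[OF eq(1), of j] fun_cong[OF eq(2), of j] that by (cases "j \<in> S") auto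
    then show "x = y" using xy by (intro PiE_ext[of x "{..<n}" "\<lambda>_. carrier_vec d" y]) auto
  qed
  have sub: "\<phi> ` ?X \<subseteq> PiE S (\<lambda>_. carrier_vec d :: 'p mod_ring vec set) \<times> ?Y"
  proof (rule image_subsetI)
    fix x assume x: "x \<in> ?X"
    have "restrict x S \<in> PiE S (\<lambda>_. carrier_vec d)" using x S by (auto simp: PiE_iff)
    moreover have "restrict x ?R \<in> PiE ?R (\<lambda>_. ?H)" using x by (auto simp: outside_def)
    moreover have "many_nonzero d E w ?R (restrict x ?R)"
    proof -
      have "{j \<in> ?R. u \<bullet> restrict x ?R j \<noteq> 0} = {j \<in> ?R. u \<bullet> x j \<noteq> 0}" for u by auto
      moreover have "many_nonzero d E w ?R x" using x by blast
      ultimately show ?thesis unfolding many_nonzero_def by simp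
    qed
    ultimately show "\<phi> x \<in> PiE S (\<lambda>_. carrier_vec d :: 'p mod_ring vec set) \<times> ?Y" by (simp add: \<phi>_def)
  qed
  have finY: "finite (PiE S (\<lambda>_. carrier_vec d :: 'p mod_ring vec set) \<times> ?Y)"
    using finS by (intro finite_cartesian_product finite_PiE finite_subset[OF _ finite_PiE[of ?R "\<lambda>_. ?H"]]) auto
  have "(\<Sum>x\<in>?X. \<Prod>i<n. rp d (Q i) x {..<n} (c x i)) \<le> (\<Sum>x\<in>?X. g (restrict x ?R))"
    by (intro sum_mono le)
  also have "\<dots> = (\<Sum>z\<in>\<phi> ` ?X. g (snd z))"
    by (subst sum.reindex[OF inj]) (simp add: \<phi>_def)
  also have "\<dots> \<le> (\<Sum>z\<in>PiE S (\<lambda>_. carrier_vec d :: 'p mod_ring vec set) \<times> ?Y. g (snd z))"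
    using finY sub g0 by (intro sum_mono2) auto
  also have "\<dots> = (\<Sum>a\<in>PiE S (\<lambda>_. carrier_vec d :: 'p mod_ring vec set). \<Sum>y\<in>?Y. g y)"
    by (simp only: sum.cartesian_product case_prod_unfold)
  also have "\<dots> = (real CARD('p) ^ d) ^ card S * (\<Sum>y\<in>?Y. g y)"
    using finS by (simp add: card_PiE card_carrier_vec)
  also have "(\<Sum>y\<in>?Y. g y) = (?rho / ?h) ^ n * (\<Sum>y\<in>?Y. \<Prod>i<n. 1 + (\<Sum>u\<in>?U. err (Q i) y ?R u))"
  proof -
    have "g y = (?rho / ?h) ^ n * (\<Prod>i<n. 1 + (\<Sum>u\<in>?U. err (Q i) y ?R u))" for y
    proof -
      have "g y = (\<Prod>i<n. (?rho / ?h) * (1 + (\<Sum>u\<in>?U. err (Q i) y ?R u)))"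
        unfolding g_def by (intro prod.cong refl) (simp only: times_divide_eq_left times_divide_eq_right)
      then show ?thesis by (simp only: prod.distrib prod_constant card_lessThan)
    qed
    then show ?thesis by (simp only: sum_distrib_left)
  qed
  also have "(\<Sum>y\<in>?Y. \<Prod>i<n. 1 + (\<Sum>u\<in>?U. err (Q i) y ?R u))
      \<le> ?h ^ card ?R * fbound (real CARD('p) ^ d) n (chi_gap TYPE('p)) \<alpha> lam t w r"
    using Q r cardR cardS by (intro sum_prod_err_le[OF _ E _ _ \<alpha> lam]) (auto simp: of_nat_diff)
  finally have main: "(\<Sum>x\<in>?X. \<Prod>i<n. rp d (Q i) x {..<n} (c x i)) \<le> (real CARD('p) ^ d) ^ card S *
      ((?rho / ?h) ^ n * (?h ^ card ?R * fbound (real CARD('p) ^ d) n (chi_gap TYPE('p)) \<alpha> lam t w r))"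
    using rho0 hpos by (auto simp: mult_left_mono)
  let ?F = "fbound (real CARD('p) ^ d) n (chi_gap TYPE('p)) \<alpha> lam t w r"
  have F0: "0 \<le> ?F" unfolding fbound_def
    by (intro add_nonneg_nonneg mult_nonneg_nonneg zero_le_power) auto
  have "?h ^ card ?R \<le> ?h ^ n"
    using hpos cardR by (intro power_increasing) (auto simp: Suc_le_eq)
  then have "(?rho / ?h) ^ n * (?h ^ card ?R * ?F) \<le> (?rho / ?h) ^ n * (?h ^ n * ?F)"
    using rho0 hpos F0 by (intro mult_left_mono mult_right_mono) auto
  also have "\<dots> = ?rho ^ n * ?F"
  proof -
    have cancel: "a / b * (b * F) = a * F" if "b \<noteq> 0" for a b F :: real using that by simp
    have "?h ^ n \<noteq> 0" using hpos by (metis less_irrefl power_not_zero)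
    then show ?thesis unfolding power_divide by (rule cancel)
  qed
  finally have "(real CARD('p) ^ d) ^ card S * ((?rho / ?h) ^ n * (?h ^ card ?R * ?F))
      \<le> (real CARD('p) ^ d) ^ card S * (?rho ^ n * ?F)" by (intro mult_left_mono) auto
  then show ?thesis using main by (simp only: mult.assoc)
qed

section \<open>Greedy splitting, and summation over all tuples\<close>

text \<open>A vector of the larger subspace outside the smaller one yields a disjoint translate of
  the smaller one.\<close>

lemma card_ann_insert_le:
  fixes E :: "'a::{finite,comm_ring_1} vec set"
  assumes E: "E \<subseteq> carrier_vec d" and u: "u \<in> carrier_vec d" "u \<notin> perp d (ann d E)"
  shows "2 * card (ann d (insert u E)) \<le> card (ann d E)"
proof -
  let ?H = "ann d E" and ?H' = "ann d (insert u E)"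
  obtain y where y: "y \<in> ?H" "u \<bullet> y \<noteq> 0" using u by (auto simp: perp_def)
  have yc: "y \<in> carrier_vec d" using y ann_carrier by blast
  have sub: "?H' \<subseteq> ?H" by (auto simp: ann_def)
  have inj: "inj_on (\<lambda>x. x + y) ?H'"
  proof (rule inj_on_inverseI[where g = "\<lambda>x. x - y"])
    fix x assume "x \<in> ?H'"
    then have "x \<in> carrier_vec d" by (rule ann_carrier)
    then show "x + y - y = x" using yc by auto
  qed
  have "(\<lambda>x. x + y) ` ?H' \<subseteq> ?H - ?H'"
  proof (rule image_subsetI)
    fix x assume x: "x \<in> ?H'"
    have "u \<bullet> (x + y) = u \<bullet> x + u \<bullet> y"
      using x yc u(1) ann_carrier[OF x] by (intro scalar_prod_add_distrib) auto
    then have "u \<bullet> (x + y) \<noteq> 0" using x y by (simp add: ann_def)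
    moreover have "x + y \<in> ?H" using add_in_ann[OF E] x sub y by blast
    ultimately show "x + y \<in> ?H - ?H'" by (simp add: ann_def)
  qed
  then have "card ((\<lambda>x. x + y) ` ?H') \<le> card (?H - ?H')" by (intro card_mono) auto
  then have "card ?H' \<le> card ?H - card ?H'"
    using card_image[OF inj] sub by (simp add: card_Diff_subset)
  moreover have "card ?H' \<le> card ?H" using sub by (intro card_mono) auto
  ultimately show ?thesis by simp
qed

text \<open>
  The subspace is shrunk greedily: as long as some functional is nontrivial on it but vanishes on all
  but \<open>w\<close> rows, it is intersected with the kernel of that functional.
\<close>
lemma exists_ann_split:
  fixes x :: "nat \<Rightarrow> 'p::prime_card mod_ring vec"
  assumes x: "\<And>j. j < n \<Longrightarrow> x j \<in> carrier_vec d" and w: "0 \<le> w"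
  shows "\<exists>E\<subseteq>carrier_vec d. real (card (outside n d E x)) \<le> real (d * CARD('p)) * w
     \<and> many_nonzero d E w ({..<n} - outside n d E x) x"
proof -
  \<comment> \<open>Here t stands for the number of functionals inserted: each at least halves the
    subspace and puts at most \<open>w\<close> further rows outside it. Taking the subspace of least
    cardinality makes the process stop.\<close>
  define P where "P = (\<lambda>E. E \<subseteq> carrier_vec d \<and> (\<exists>t. card (ann d E) * 2 ^ t \<le> CARD('p) ^ d
     \<and> real (card (outside n d E x)) \<le> real t * w))"
  have "P {}"
    unfolding P_def using x by (intro conjI exI[of _ 0]) (auto simp: outside_def card_carrier_vec)
  then obtain E where E: "P E" "\<And>E'. P E' \<Longrightarrow> card (ann d E) \<le> card (ann d E')"
    using exists_least_iff[of "\<lambda>k. \<exists>E. P E \<and> card (ann d E) = k"] by (metis linorder_not_le)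
  then obtain t where Ec: "E \<subseteq> carrier_vec d" and t: "card (ann d E) * 2 ^ t \<le> CARD('p) ^ d"
      "real (card (outside n d E x)) \<le> real t * w" by (auto simp: P_def)
  have pos: "card (ann d E) > 0" using zero_in_ann[OF Ec] by (auto simp: card_gt_0_iff)
  have "2 ^ t \<le> card (ann d E) * 2 ^ t" using pos by simp
  also have "\<dots> \<le> CARD('p) ^ d" by (rule t)
  \<comment> \<open>The crude p \<le> 2^p avoids logarithms; what matters is that the bound on t is
    independent of n.\<close>
  also have "\<dots> \<le> (2 ^ CARD('p)) ^ d" by (intro power_mono) (auto intro: less_imp_le less_exp)
  finally have "(2::nat) ^ t \<le> 2 ^ (d * CARD('p))" by (simp add: power_mult[symmetric] mult.commute)
  then have "t \<le> d * CARD('p)" by (rule power_le_imp_le_exp[rotated]) simp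
  then have "real (card (outside n d E x)) \<le> real (d * CARD('p)) * w"
    using t(2) w by (meson mult_right_mono of_nat_mono order_trans)
  moreover have "many_nonzero d E w ({..<n} - outside n d E x) x"
  proof (rule ccontr)
    let ?R = "{..<n} - outside n d E x"
    assume "\<not> many_nonzero d E w ?R x"
    then obtain u where u: "u \<in> carrier_vec d" "u \<notin> perp d (ann d E)"
        "real (card {j \<in> ?R. u \<bullet> x j \<noteq> 0}) \<le> w" by (auto simp: many_nonzero_def not_less)
    let ?E = "insert u E"
    have half: "2 * card (ann d ?E) \<le> card (ann d E)" by (rule card_ann_insert_le[OF Ec u(1,2)])
    have "outside n d ?E x \<subseteq> outside n d E x \<union> {j \<in> ?R. u \<bullet> x j \<noteq> 0}"
      using x by (auto simp: outside_def ann_def)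
    then have "card (outside n d ?E x) \<le> card (outside n d E x \<union> {j \<in> ?R. u \<bullet> x j \<noteq> 0})"
      by (intro card_mono) (auto simp: outside_def)
    also have "\<dots> \<le> card (outside n d E x) + card {j \<in> ?R. u \<bullet> x j \<noteq> 0}" by (rule card_Un_le)
    finally have "real (card (outside n d ?E x)) \<le> real (card (outside n d E x)) + real (card {j \<in> ?R. u \<bullet> x j \<noteq> 0})"
      by (simp flip: of_nat_add)
    also have "\<dots> \<le> real (Suc t) * w" using t(2) u(3) by (simp add: algebra_simps)
    finally have "real (card (outside n d ?E x)) \<le> real (Suc t) * w" .
    moreover have "card (ann d ?E) * 2 ^ Suc t \<le> CARD('p) ^ d"
    proof -
      have "card (ann d ?E) * 2 ^ Suc t = (2 * card (ann d ?E)) * 2 ^ t" by simp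
      also have "\<dots> \<le> card (ann d E) * 2 ^ t" using half by (rule mult_le_mono1)
      also have "\<dots> \<le> CARD('p) ^ d" by (rule t(1))
      finally show ?thesis .
    qed
    ultimately have "P ?E" unfolding P_def using u(1) Ec by blast
    then have "card (ann d E) \<le> card (ann d ?E)" by (rule E(2))
    then show False using half pos by simp
  qed
  ultimately show ?thesis using Ec by blast
qed

lemma sum_subsets_card:
  fixes h :: "nat \<Rightarrow> real"
  assumes "finite A"
  shows "(\<Sum>S\<in>{S. S \<subseteq> A \<and> card S \<in> {a..b}}. h (card S)) = (\<Sum>s\<in>{a..b}. real (card A choose s) * h s)"
proof -
  let ?P = "{S. S \<subseteq> A \<and> card S \<in> {a..b}}"
  have fin: "finite ?P" by (rule finite_subset[of _ "Pow A"]) (use assms in auto)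
  have "(\<Sum>S\<in>?P. h (card S)) = (\<Sum>s\<in>{a..b}. \<Sum>S\<in>{S \<in> ?P. card S = s}. h (card S))"
    by (rule sum.group[symmetric]) (use fin in auto)
  also have "\<dots> = (\<Sum>s\<in>{a..b}. real (card A choose s) * h s)"
  proof (rule sum.cong[OF refl])
    fix s assume s: "s \<in> {a..b}"
    then have "{S \<in> ?P. card S = s} = {S. S \<subseteq> A \<and> card S = s}" by auto
    moreover have "(\<Sum>S\<in>{S. S \<subseteq> A \<and> card S = s}. h (card S)) = (\<Sum>S\<in>{S. S \<subseteq> A \<and> card S = s}. h s)"
      by (rule sum.cong) auto
    ultimately show "(\<Sum>S\<in>{S \<in> ?P. card S = s}. h (card S)) = real (card A choose s) * h s"
      using n_subsets[OF assms, of s] by simp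
  qed
  finally show ?thesis .
qed

lemma sum_UN_le:
  fixes f :: "'a \<Rightarrow> real"
  assumes "finite I" "\<And>i. i \<in> I \<Longrightarrow> finite (A i)" "\<And>x. 0 \<le> f x"
  shows "sum f (\<Union>i\<in>I. A i) \<le> (\<Sum>i\<in>I. sum f (A i))"
  using assms(1,2)
proof (induction I rule: finite_induct)
  case (insert i I)
  have "sum f (A i \<union> (\<Union>i\<in>I. A i)) \<le> sum f (A i) + sum f (\<Union>i\<in>I. A i)"
    using insert sum_Un[of "A i" "\<Union>i\<in>I. A i" f] assms(3) by (simp add: sum_nonneg)
  then show ?case using insert by simp
qed simp

text \<open>Equivalent to injectivity of the matrix with rows \<open>x j\<close>, which is how it
  enters the count of embeddings.\<close>

definition full :: "nat \<Rightarrow> nat \<Rightarrow> (nat \<Rightarrow> 'a::comm_ring_1 vec) \<Rightarrow> bool" where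
  "full n d x \<longleftrightarrow> (\<forall>u\<in>carrier_vec d. (\<forall>j<n. u \<bullet> x j = 0) \<longrightarrow> u = 0\<^sub>v d)"

text \<open>
  Total contribution of the \<open>x\<close> with between 1 and \<open>\<tau>\<close> rows outside the subspace; the base
  $(1 + (1 - 2\alpha)^s)/2$ bounds the probability that the outlying rows combine into the subspace.
\<close>
definition sbound :: "real \<Rightarrow> nat \<Rightarrow> real \<Rightarrow> nat \<Rightarrow> real" where
  "sbound N n \<alpha> \<tau> = (\<Sum>s\<in>{1..\<tau>}. real (n choose s) * (N ^ s * ((1 + (1 - 2 * \<alpha>) ^ s) / 2) ^ n))"

lemma fbound_nonneg: "0 \<le> N \<Longrightarrow> 0 \<le> fbound N n \<kappa> \<alpha> lam t w r"
  unfolding fbound_def by (intro add_nonneg_nonneg mult_nonneg_nonneg zero_le_power) auto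

text \<open>Each tuple is assigned a subspace by the greedy splitting, with its set of outlying
  rows. If the subspace is proper, \<open>full\<close> keeps that set from being empty, which is why
  the sum in \<open>sbound\<close> starts at 1; otherwise the pair is replaced by \<open>{}\<close>
  and \<open>{}\<close>, the source of the leading 1. The factor 2^(p^d) counts the sets of
  functionals, a constant for fixed \<open>d\<close>.\<close>

lemma sum_full_le:
  fixes Q :: "nat \<Rightarrow> nat \<Rightarrow> 'p::prime_card mod_ring \<Rightarrow> real"
  assumes Q: "\<And>i j. i < n \<Longrightarrow> j < n \<Longrightarrow> pdist (Q i j)" "\<And>i j a. i < n \<Longrightarrow> j < n \<Longrightarrow> Q i j a \<le> 1 - \<alpha>"
    and \<alpha>: "0 < \<alpha>" "\<alpha> \<le> 1 / 2" and lam: "0 < lam" "lam \<le> 1" and w: "0 \<le> w"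
    and c: "\<And>x i. c x i \<in> carrier_vec d"
  shows "(\<Sum>x\<in>{x \<in> PiE {..<n} (\<lambda>_. carrier_vec d). full n d x}. \<Prod>i<n. rp d (Q i) x {..<n} (c x i))
    \<le> fbound (real CARD('p) ^ d) n (chi_gap TYPE('p)) \<alpha> lam t w (real n - real (d * CARD('p)) * w)
      * (1 + 2 ^ (CARD('p) ^ d) * sbound (real CARD('p) ^ d) n \<alpha> (nat \<lfloor>real (d * CARD('p)) * w\<rfloor>))"
proof -
  let ?V = "carrier_vec d :: 'p mod_ring vec set"
  let ?N = "real CARD('p) ^ d" and ?Dw = "real (d * CARD('p)) * w"
  let ?\<tau> = "nat \<lfloor>?Dw\<rfloor>"
  let ?F = "fbound ?N n (chi_gap TYPE('p)) \<alpha> lam t w (real n - ?Dw)"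
  let ?f = "\<lambda>x. \<Prod>i<n. rp d (Q i) x {..<n} (c x i)"
  let ?X = "{x \<in> PiE {..<n} (\<lambda>_. ?V). full n d x}"
  define Z where "Z = (\<lambda>E S. {x \<in> PiE {..<n} (\<lambda>_. ?V). outside n d E x = S \<and> many_nonzero d E w ({..<n} - S) x})"
  define \<E> where "\<E> = {E. E \<subseteq> ?V \<and> ann d E \<noteq> ?V}"
  define \<S> where "\<S> = {S. S \<subseteq> {..<n} \<and> card S \<in> {1..?\<tau>}}"
  let ?h = "\<lambda>s. ?N ^ s * ((1 + (1 - 2 * \<alpha>) ^ s) / 2) ^ n"
  have F0: "0 \<le> ?F" by (intro fbound_nonneg) simp
  have f0: "0 \<le> ?f x" for x using Q by (intro prod_nonneg ballI rp_nonneg) auto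
  have finX: "finite (PiE {..<n} (\<lambda>_. ?V))" by (intro finite_PiE) auto
  have finZ: "finite (Z E S)" for E S unfolding Z_def using finX by simp
  have finE: "finite \<E>" unfolding \<E>_def by (rule finite_subset[of _ "Pow ?V"]) auto
  have finS: "finite \<S>" unfolding \<S>_def by (rule finite_subset[of _ "Pow {..<n}"]) auto
  have cardE: "real (card \<E>) \<le> 2 ^ (CARD('p) ^ d)"
  proof -
    have "card \<E> \<le> card (Pow ?V)" unfolding \<E>_def by (intro card_mono) auto
    then have "card \<E> \<le> 2 ^ (CARD('p) ^ d)" by (simp add: card_Pow card_carrier_vec)
    then have "real (card \<E>) \<le> real (2 ^ (CARD('p) ^ d))" by (rule of_nat_mono)
    then show ?thesis by simp
  qed
  have part: "(\<Sum>x\<in>Z E S. ?f x) \<le> ?h (card S) * ?F"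
    if "E \<subseteq> ?V" "S \<subseteq> {..<n}" "real (card S) \<le> ?Dw" for E S
  proof -
    have "(\<Sum>x\<in>Z E S. ?f x) \<le> ?N ^ card S * ((1 + (1 - 2 * \<alpha>) ^ card S) / 2) ^ n * ?F"
      unfolding Z_def using that by (intro sum_prod_rp_le[OF that(1,2) Q \<alpha> lam _ c]) auto
    then show ?thesis by simp
  qed
  have cover: "?X \<subseteq> Z {} {} \<union> (\<Union>E\<in>\<E>. \<Union>S\<in>\<S>. Z E S)"
  proof
    fix x assume x: "x \<in> ?X"
    then have xc: "x j \<in> ?V" if "j < n" for j using that by (auto simp: PiE_iff)
    obtain E where E: "E \<subseteq> ?V" "real (card (outside n d E x)) \<le> ?Dw"
        "many_nonzero d E w ({..<n} - outside n d E x) x"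
      using exists_ann_split[of n x d w, OF xc w] by blast
    show "x \<in> Z {} {} \<union> (\<Union>E\<in>\<E>. \<Union>S\<in>\<S>. Z E S)"
    proof (cases "ann d E = ?V")
      case True
      then have out: "outside n d E x = {}" using xc by (auto simp: outside_def)
      moreover have "outside n d {} x = {}" using xc by (auto simp: outside_def)
      moreover have "many_nonzero d {} w {..<n} x"
        using E(3) out True by (simp add: many_nonzero_def)
      ultimately show ?thesis using x by (simp add: Z_def)
    next
      case False
      have "outside n d E x \<noteq> {}"
      proof
        assume "outside n d E x = {}"
        then have "\<forall>u\<in>E. \<forall>j<n. u \<bullet> x j = 0" by (auto simp: outside_def ann_def)
        then have "\<forall>u\<in>E. u = 0\<^sub>v d" using x E(1) by (auto simp: full_def)
        then have "ann d E = ?V" by (auto simp: ann_def)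
        then show False using False by simp
      qed
      then have "card (outside n d E x) \<noteq> 0" by (auto simp: outside_def)
      then have "1 \<le> card (outside n d E x)" by linarith
      moreover have "outside n d E x \<subseteq> {..<n}" by (auto simp: outside_def)
      ultimately have "outside n d E x \<in> \<S>"
        unfolding \<S>_def using le_nat_floor[OF E(2)] by simp
      moreover have "x \<in> Z E (outside n d E x)" using x E by (simp add: Z_def)
      ultimately show ?thesis using False E(1) by (auto simp: \<E>_def)
    qed
  qed
  have "(\<Sum>x\<in>?X. ?f x) \<le> (\<Sum>x\<in>Z {} {} \<union> (\<Union>E\<in>\<E>. \<Union>S\<in>\<S>. Z E S). ?f x)"
    using cover finZ finE finS f0 by (intro sum_mono2) auto
  also have "\<dots> \<le> (\<Sum>x\<in>Z {} {}. ?f x) + (\<Sum>x\<in>(\<Union>E\<in>\<E>. \<Union>S\<in>\<S>. Z E S). ?f x)"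
    using finZ finE finS f0 sum_Un[of "Z {} {}" "\<Union>E\<in>\<E>. \<Union>S\<in>\<S>. Z E S" ?f] by (simp add: sum_nonneg)
  also have "(\<Sum>x\<in>(\<Union>E\<in>\<E>. \<Union>S\<in>\<S>. Z E S). ?f x) \<le> (\<Sum>E\<in>\<E>. \<Sum>S\<in>\<S>. \<Sum>x\<in>Z E S. ?f x)"
    using finZ finE finS f0 by (intro order_trans[OF sum_UN_le[OF finE]] sum_mono sum_UN_le) auto
  also have "\<dots> \<le> (\<Sum>E\<in>\<E>. \<Sum>S\<in>\<S>. ?h (card S) * ?F)"
  proof (intro sum_mono part)
    fix S assume "S \<in> \<S>"
    then have "card S \<le> ?\<tau>" by (auto simp: \<S>_def)
    moreover have "real ?\<tau> \<le> ?Dw" using w by (intro of_nat_floor) auto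
    ultimately show "real (card S) \<le> ?Dw" by linarith
  qed (auto simp: \<E>_def \<S>_def)
  also have "\<dots> = real (card \<E>) * ((\<Sum>S\<in>\<S>. ?h (card S)) * ?F)"
    by (simp only: sum_constant sum_distrib_right)
  also have "(\<Sum>S\<in>\<S>. ?h (card S)) = sbound ?N n \<alpha> ?\<tau>"
    unfolding \<S>_def sbound_def by (subst sum_subsets_card) simp_all
  also have "real (card \<E>) * (sbound ?N n \<alpha> ?\<tau> * ?F) \<le> 2 ^ (CARD('p) ^ d) * (sbound ?N n \<alpha> ?\<tau> * ?F)"
    using cardE F0 \<alpha> by (intro mult_right_mono mult_nonneg_nonneg) (auto simp: sbound_def intro!: sum_nonneg)
  also have "(\<Sum>x\<in>Z {} {}. ?f x) \<le> ?h (card ({} :: nat set)) * ?F"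
    using w by (intro part) auto
  finally show ?thesis by (simp add: algebra_simps)
qed

text \<open>A lower bound may discard tuples, and those with all defect sums above t suffice. They
  are automatically full, as a functional vanishing on all rows has defect sum 0, and for them
  Fourier inversion pins every row probability near p^(-d).\<close>

lemma sum_full_ge:
  fixes Q :: "nat \<Rightarrow> nat \<Rightarrow> 'p::prime_card mod_ring \<Rightarrow> real"
  assumes Q: "\<And>i j. i < n \<Longrightarrow> j < n \<Longrightarrow> pdist (Q i j)" "\<And>i j a. i < n \<Longrightarrow> j < n \<Longrightarrow> Q i j a \<le> 1 - \<alpha>"
    and \<alpha>: "0 < \<alpha>" "\<alpha> \<le> 1 / 2" and lam: "0 < lam" "lam \<le> 1"
    and t: "0 \<le> t" "real CARD('p) ^ d * exp (- t / 2) \<le> 1"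
    and n: "0 < n"
    and c: "\<And>x i. c x i \<in> carrier_vec d"
  shows "(1 - real CARD('p) ^ d * exp (- t / 2)) ^ n
      * (1 - real n * real CARD('p) ^ d * exp (lam / (2 * \<alpha>) * t - lam * (1 - lam) * (1 - \<alpha>) * real n))
    \<le> (\<Sum>x\<in>{x \<in> PiE {..<n} (\<lambda>_. carrier_vec d). full n d x}. \<Prod>i<n. rp d (Q i) x {..<n} (c x i))"
proof -
  let ?V = "carrier_vec d :: 'p mod_ring vec set"
  let ?N = "real CARD('p) ^ d"
  let ?c = "exp (lam / (2 * \<alpha>) * t - lam * (1 - lam) * (1 - \<alpha>) * real n)"
  let ?P = "PiE {..<n} (\<lambda>_. ?V)"
  let ?X = "{x \<in> ?P. full n d x}"
  let ?D = "\<lambda>i u x. \<Sum>j<n. defect (Q i j) (u \<bullet> x j)"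
  let ?f = "\<lambda>x. \<Prod>i<n. rp d (Q i) x {..<n} (c x i)"
  let ?U = "?V - {0\<^sub>v d}"
  let ?e = "exp (- t / 2)"
  define B where "B = (\<lambda>i u. {x \<in> ?P. ?D i u x \<le> t})"
  let ?Bs = "\<Union>i\<in>{..<n}. \<Union>u\<in>?U. B i u"
  have finP: "finite ?P" by (intro finite_PiE) auto
  have cardP: "real (card ?P) = ?N ^ n" by (simp add: card_PiE card_carrier_vec)
  have Npos: "?N > 0" by simp
  have cardU: "real (card ?U) \<le> ?N"
  proof -
    have "card ?U \<le> card ?V" by (intro card_mono) auto
    then show ?thesis by (simp add: card_carrier_vec flip: of_nat_power)
  qed
  have perp0: "u \<notin> perp d (ann d {})" if "u \<in> ?U" for u
  proof
    assume "u \<in> perp d (ann d {})"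
    then have "\<And>v. v \<in> ?V \<Longrightarrow> v \<bullet> u = 0"
      using that by (auto simp: perp_def comm_scalar_prod[of _ d u])
    then show False using scalar_prod_eq_0_imp[of u d] that by auto
  qed
  have cardB: "real (card ?Bs) \<le> real n * ?N * (?N ^ n * ?c)"
  proof -
    have "card ?Bs \<le> (\<Sum>i<n. card (\<Union>u\<in>?U. B i u))" by (rule card_UN_le) simp
    also have "\<dots> \<le> (\<Sum>i<n. \<Sum>u\<in>?U. card (B i u))" by (intro sum_mono card_UN_le) simp
    finally have "real (card ?Bs) \<le> (\<Sum>i<n. \<Sum>u\<in>?U. real (card (B i u)))" by (simp flip: of_nat_sum)
    also have "\<dots> \<le> (\<Sum>i<n. \<Sum>u\<in>?U. ?N ^ n * ?c)"
    proof (intro sum_mono)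
      fix i u assume i: "i \<in> {..<n}" and u: "u \<in> ?U"
      have "real (card {x \<in> PiE {..<n} (\<lambda>_. ann d {}). ?D i u x \<le> t})
          \<le> real (card (ann d {} :: 'p mod_ring vec set)) ^ card {..<n}
             * exp (lam / (2 * \<alpha>) * t - lam * (1 - lam) * (1 - \<alpha>) * real (card {..<n}))"
        using i u Q perp0[OF u] by (intro card_small_defect_le[OF _ _ _ _ _ _ \<alpha> lam]) auto
      then show "real (card (B i u)) \<le> ?N ^ n * ?c" by (simp add: B_def card_carrier_vec)
    qed
    also have "\<dots> = real n * (real (card ?U) * (?N ^ n * ?c))" by simp
    also have "\<dots> \<le> real n * (?N * (?N ^ n * ?c))"
      using cardU by (intro mult_left_mono mult_right_mono) auto
    finally show ?thesis by (simp only: mult_ac)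
  qed
  have finB: "finite ?Bs" unfolding B_def using finP by auto
  have sub: "?P - ?Bs \<subseteq> ?X"
  proof
    fix x assume x: "x \<in> ?P - ?Bs"
    have "u = 0\<^sub>v d" if u: "u \<in> ?V" "\<forall>j<n. u \<bullet> x j = 0" for u
    proof (rule ccontr)
      assume "u \<noteq> 0\<^sub>v d"
      \<comment> \<open>Fullness does not depend on the matrix row; n > 0 provides row 0.\<close>
      then have "x \<notin> B 0 u" using x u n by auto
      then have "t < ?D 0 u x" using x by (auto simp: B_def)
      moreover have "?D 0 u x = 0" using u Q n by (intro sum.neutral) auto
      ultimately show False using t by simp
    qed
    then show "x \<in> ?X" using x by (auto simp: full_def)
  qed
  have f0: "0 \<le> ?f x" for x using Q by (intro prod_nonneg ballI rp_nonneg) auto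
  have ge: "((1 - ?N * ?e) / ?N) ^ n \<le> ?f x" if x: "x \<in> ?P - ?Bs" for x
  proof -
    have "(\<Prod>i<n. (1 - ?N * ?e) / ?N) \<le> ?f x"
    proof (intro prod_mono conjI)
      fix i assume i: "i \<in> {..<n}"
      show "0 \<le> (1 - ?N * ?e) / ?N" using t(2) by simp
      have "(\<Sum>u\<in>?U. err (Q i) x {..<n} u) \<le> (\<Sum>u\<in>?U. ?e)"
      proof (intro sum_mono)
        fix u assume "u \<in> ?U"
        then have "x \<notin> B i u" using x i by blast
        then have "t < ?D i u x" using x by (auto simp: B_def)
        then show "err (Q i) x {..<n} u \<le> ?e" by (simp add: err_def)
      qed
      also have "\<dots> \<le> ?N * ?e" using cardU by (simp add: mult_right_mono)
      finally have "(1 - ?N * ?e) / ?N \<le> (1 - (\<Sum>u\<in>?U. err (Q i) x {..<n} u)) / ?N"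
        by (intro divide_right_mono) auto
      also have "\<dots> \<le> rp d (Q i) x {..<n} (c x i)"
        using x i Q c by (intro rp_ge) (auto simp: PiE_iff)
      finally show "(1 - ?N * ?e) / ?N \<le> rp d (Q i) x {..<n} (c x i)" .
    qed
    then show ?thesis by simp
  qed
  have "?N ^ n - real n * ?N * (?N ^ n * ?c) \<le> real (card ?P) - real (card ?Bs)"
    using cardB cardP by simp
  also have "\<dots> \<le> real (card (?P - ?Bs))"
  proof -
    have "card ?P \<le> card (?P - ?Bs) + card ?Bs"
      using diff_card_le_card_Diff[OF finB, of ?P] by linarith
    then show ?thesis by linarith
  qed
  finally have cnt: "?N ^ n * (1 - real n * ?N * ?c) \<le> real (card (?P - ?Bs))" by (simp add: algebra_simps)
  have "(1 - ?N * ?e) ^ n * (1 - real n * ?N * ?c) = ((1 - ?N * ?e) / ?N) ^ n * (?N ^ n * (1 - real n * ?N * ?c))"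
    using Npos by (simp add: power_divide)
  also have "\<dots> \<le> ((1 - ?N * ?e) / ?N) ^ n * real (card (?P - ?Bs))"
    using cnt t(2) by (intro mult_left_mono) auto
  also have "\<dots> = (\<Sum>x\<in>?P - ?Bs. ((1 - ?N * ?e) / ?N) ^ n)" by simp
  also have "\<dots> \<le> (\<Sum>x\<in>?P - ?Bs. ?f x)" by (intro sum_mono ge)
  also have "\<dots> \<le> (\<Sum>x\<in>?X. ?f x)" using sub finP f0 by (intro sum_mono2) auto
  finally show ?thesis .
qed

section \<open>Asymptotics of the bounds\<close>

text \<open>Exponential tilting: z^\<tau> \<le> z^s for s \<le> \<tau>, so after multiplication by
  z^\<tau> the truncated sum is dominated by the binomial expansion of (1 + N z)^n.\<close>

lemma sum_binomial_le_exp: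
  fixes N z T :: real
  assumes N: "0 \<le> N" and z: "0 < z" "z \<le> 1" and \<tau>: "real \<tau> \<le> T"
  shows "(\<Sum>s\<in>{1..\<tau>}. real (n choose s) * N ^ s) \<le> exp (T * ln (1 / z) + real n * (N * z))"
proof -
  have step: "real (n choose s) * N ^ s * z ^ \<tau> \<le> real (n choose s) * (N * z) ^ s" if "s \<le> \<tau>" for s
  proof -
    have "z ^ \<tau> \<le> z ^ s" using z that by (intro power_decreasing) auto
    then have "real (n choose s) * N ^ s * z ^ \<tau> \<le> real (n choose s) * N ^ s * z ^ s"
      using N by (intro mult_left_mono) auto
    then show ?thesis by (simp add: power_mult_distrib mult_ac)
  qed
  have "(\<Sum>s\<in>{1..\<tau>}. real (n choose s) * N ^ s) * z ^ \<tau> \<le> (\<Sum>s\<in>{1..\<tau>}. real (n choose s) * (N * z) ^ s)"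
    unfolding sum_distrib_right by (intro sum_mono step) auto
  also have "\<dots> = (\<Sum>s\<in>{1..\<tau>} \<inter> {..n}. real (n choose s) * (N * z) ^ s)"
    by (intro sum.mono_neutral_right) (auto simp: not_le intro: binomial_eq_0)
  also have "\<dots> \<le> (\<Sum>s\<in>{..n}. real (n choose s) * (N * z) ^ s)"
    using N z by (intro sum_mono2) auto
  also have "\<dots> = (N * z + 1) ^ n"
    by (simp add: binomial_ring)
  also have "\<dots> \<le> exp (N * z) ^ n"
    using N z exp_ge_add_one_self[of "N * z"] by (intro power_mono) (auto simp: add.commute)
  also have "\<dots> = exp (real n * (N * z))" by (simp add: exp_of_nat_mult)
  finally have "(\<Sum>s\<in>{1..\<tau>}. real (n choose s) * N ^ s) \<le> exp (real n * (N * z)) / z ^ \<tau>"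
    using z by (simp add: pos_le_divide_eq)
  also have "1 / z ^ \<tau> = exp (real \<tau> * ln (1 / z))"
    using z by (simp add: exp_of_nat_mult power_one_over)
  then have "exp (real n * (N * z)) / z ^ \<tau> = exp (real \<tau> * ln (1 / z) + real n * (N * z))"
    by (simp add: exp_add divide_inverse mult.commute)
  also have "\<dots> \<le> exp (T * ln (1 / z) + real n * (N * z))"
    using z \<tau> by (auto intro!: mult_right_mono simp: ln_ge_zero_iff)
  finally show ?thesis .
qed

lemma half_power_le:
  assumes "0 \<le> \<alpha>" "\<alpha> \<le> 1 / 2"
  shows "(1 + (1 - 2 * \<alpha>) ^ s) / 2 \<le> (1 + exp (- 2 * (\<alpha> * real s))) / (2 :: real)"
proof -
  have "(1 - 2 * \<alpha>) ^ s \<le> exp (- 2 * \<alpha>) ^ s"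
    using assms exp_ge_add_one_self[of "- 2 * \<alpha>"] by (intro power_mono) auto
  also have "\<dots> = exp (- 2 * (\<alpha> * real s))" by (simp add: exp_of_nat_mult[symmetric] mult_ac)
  finally show ?thesis by simp
qed

text \<open>For \<alpha> s \<le> \<delta> the base is close to exp (- \<alpha> s), so its n-th power
  is at most n^(- (1 + e) s), against a cost (N n)^s for positions and values; here c > 1 enters.
  For larger s the base stays below a constant \<beta> < 1, and T is so small that the number of
  choices grows more slowly than \<beta>^(-n).\<close>

lemma sbound_tendsto_0:
  fixes N c :: real
  assumes N: "1 \<le> N" and c: "1 < c"
  obtains T where "0 < T" "(\<lambda>n. sbound N n (c * ln (real n) / real n) (nat \<lfloor>T * real n\<rfloor>)) \<longlonglongrightarrow> 0"
proof -
  \<comment> \<open>Small enough that c (1 - \<delta>) still exceeds 1, which makes e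
    positive.\<close>
  define \<delta> where "\<delta> = min (1 / 2) ((c - 1) / (2 * c))"
  have \<delta>: "0 < \<delta>" "\<delta> \<le> 1 / 2" using c by (auto simp: \<delta>_def)
  define e where "e = c * (1 - \<delta>) - 1"
  have "c * \<delta> \<le> c * ((c - 1) / (2 * c))" using c by (intro mult_left_mono) (auto simp: \<delta>_def)
  then have "c * \<delta> \<le> (c - 1) / 2" using c by simp
  then have e: "0 < e" using c by (simp add: e_def algebra_simps)
  define \<beta> where "\<beta> = (1 + exp (- 2 * \<delta>)) / 2"
  have \<beta>: "0 < \<beta>" "\<beta> < 1" using \<delta> by (auto simp: \<beta>_def add_pos_pos)
  define L where "L = - ln \<beta>"
  have L: "0 < L" using \<beta> by (simp add: L_def ln_less_zero_iff)
  \<comment> \<open>With this z and the T below, both exponents of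
    \<open>sum_binomial_le_exp\<close> are at most L n / 4, so together they use up half of the
    decay \<beta>^n = exp (- L n).\<close>
  define z where "z = min (1 / 2) (L / (4 * N))"
  have z: "0 < z" "z \<le> 1" "z < 1" using L N by (auto simp: z_def)
  have "N * z \<le> N * (L / (4 * N))" using N by (intro mult_left_mono) (auto simp: z_def)
  then have Nz: "N * z \<le> L / 4" using N by simp
  have lz: "0 < ln (1 / z)" using z by simp
  define T where "T = L / (4 * ln (1 / z))"
  have T: "0 < T" using L lz by (simp add: T_def)
  have Tz: "T * ln (1 / z) = L / 4" using lz by (simp add: T_def)
  define \<alpha> where "\<alpha> = (\<lambda>n. c * ln (real n) / real n)"
  have "(\<lambda>n. \<alpha> n) \<longlonglongrightarrow> 0" unfolding \<alpha>_def using c by real_asymp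
  then have ev\<alpha>: "\<forall>\<^sub>F n in sequentially. \<alpha> n < 1 / 2" by (rule order_tendstoD) simp
  have xlim: "(\<lambda>n. N * real n powr (- e)) \<longlonglongrightarrow> 0" using e N by real_asymp
  then have evx: "\<forall>\<^sub>F n in sequentially. N * real n powr (- e) < 1 / 2" by (rule order_tendstoD) simp
  have "\<forall>\<^sub>F n in sequentially. norm (sbound N n (\<alpha> n) (nat \<lfloor>T * real n\<rfloor>))
      \<le> 2 * (N * real n powr (- e)) + exp (- (L / 2) * real n)"
    using ev\<alpha> evx eventually_gt_at_top[of 1]
  proof eventually_elim
    case (elim n)
    define x where "x = N * real n powr (- e)"
    have n0: "0 < real n" "0 \<le> ln (real n)" using elim by auto
    have a: "0 \<le> \<alpha> n" "\<alpha> n \<le> 1 / 2" using elim n0 c by (auto simp: \<alpha>_def)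
    have x: "0 \<le> x" "x < 1 / 2" using N elim by (auto simp: x_def)
    let ?\<tau> = "nat \<lfloor>T * real n\<rfloor>"
    let ?r = "\<lambda>s. (1 + (1 - 2 * \<alpha> n) ^ s) / 2"
    have r0: "0 \<le> ?r s" for s using a by simp
    have step: "real (n choose s) * (N ^ s * ?r s ^ n) \<le> x ^ s + real (n choose s) * N ^ s * \<beta> ^ n" for s
    proof (cases "\<alpha> n * real s \<le> \<delta>")
      case True
      let ?y = "\<alpha> n * real s"
      have y0: "0 \<le> ?y" using a by simp
      have "?r s \<le> (1 + exp (- (2 * ?y))) / 2" using half_power_le[OF a, of s] by simp
      also have "\<dots> \<le> (1 + (1 - 2 * ?y + (2 * ?y)\<^sup>2 / 2)) / 2"
        using exp_minus_le_quadratic[of "2 * ?y"] y0 by simp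
      also have "\<dots> = 1 + (- (?y * (1 - ?y)))" by (simp add: power2_eq_square field_simps)
      also have "\<dots> \<le> exp (- (?y * (1 - ?y)))" by (rule exp_ge_add_one_self)
      also have "\<dots> \<le> exp (- (?y * (1 - \<delta>)))" using True y0 by (auto intro!: mult_left_mono)
      finally have "?r s ^ n \<le> exp (- (?y * (1 - \<delta>))) ^ n" using r0 by (intro power_mono) auto
      also have "\<dots> = exp (- (real n * \<alpha> n * (1 - \<delta>)) * real s)" by (simp add: exp_of_nat_mult[symmetric] mult_ac)
      also have "real n * \<alpha> n * (1 - \<delta>) = (1 + e) * ln (real n)" using n0 by (simp add: \<alpha>_def e_def)
      also have "exp (- ((1 + e) * ln (real n)) * real s) = (real n powr (- (1 + e))) ^ s"
        using n0 by (simp add: powr_def exp_of_nat_mult[symmetric] algebra_simps)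
      finally have rs: "?r s ^ n \<le> (real n powr (- (1 + e))) ^ s" .
      have "real (n choose s) \<le> real n ^ s"
      proof (cases "s \<le> n")
        case True
        then show ?thesis using of_nat_mono[OF binomial_le_pow[OF True], where 'a=real] by simp
      qed (simp add: binomial_eq_0)
      then have "real (n choose s) * (N ^ s * ?r s ^ n) \<le> real n ^ s * (N ^ s * (real n powr (- (1 + e))) ^ s)"
        using rs r0 N by (intro mult_mono mult_nonneg_nonneg) auto
      also have "\<dots> = (N * (real n * real n powr (- (1 + e)))) ^ s" by (simp add: power_mult_distrib mult_ac)
      also have "real n * real n powr (- (1 + e)) = real n powr (- e)"
        using n0 powr_add[of "real n" 1 "- (1 + e)"] by simp
      finally have "real (n choose s) * (N ^ s * ?r s ^ n) \<le> x ^ s" by (simp add: x_def)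
      moreover have "0 \<le> real (n choose s) * N ^ s * \<beta> ^ n" using N \<beta> by simp
      ultimately show ?thesis by linarith
    next
      case False
      have "?r s \<le> (1 + exp (- 2 * (\<alpha> n * real s))) / 2" by (rule half_power_le[OF a])
      also have "\<dots> \<le> \<beta>" using False by (simp add: \<beta>_def)
      finally have "?r s ^ n \<le> \<beta> ^ n" using r0 by (intro power_mono) auto
      then have "real (n choose s) * (N ^ s * ?r s ^ n) \<le> real (n choose s) * (N ^ s * \<beta> ^ n)"
        using N by (intro mult_left_mono) auto
      moreover have "0 \<le> x ^ s" using x by simp
      ultimately show ?thesis by (simp add: mult.assoc)
    qed
    have "sbound N n (\<alpha> n) ?\<tau> \<le> (\<Sum>s\<in>{1..?\<tau>}. x ^ s + real (n choose s) * N ^ s * \<beta> ^ n)"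
      unfolding sbound_def by (intro sum_mono step)
    also have "\<dots> = (\<Sum>s\<in>{1..?\<tau>}. x ^ s) + (\<Sum>s\<in>{1..?\<tau>}. real (n choose s) * N ^ s) * \<beta> ^ n"
      by (simp add: sum.distrib sum_distrib_right)
    also have "(\<Sum>s\<in>{1..?\<tau>}. x ^ s) \<le> 2 * x"
    proof -
      have "(\<Sum>s\<in>{1..?\<tau>}. x ^ s) = x * (\<Sum>s<?\<tau>. x ^ s)"
        by (simp add: sum_distrib_left sum.atLeast1_atMost_eq)
      also have "\<dots> \<le> x * (1 / (1 - x))"
      proof (rule mult_left_mono)
        have "(\<Sum>s<?\<tau>. x ^ s) * (1 - x) = 1 - x ^ ?\<tau>"
          by (simp add: one_diff_power_eq mult.commute)
        also have "\<dots> \<le> 1" using x by simp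
        finally show "(\<Sum>s<?\<tau>. x ^ s) \<le> 1 / (1 - x)" using x by (simp add: pos_le_divide_eq)
      qed (use x in simp)
      also have "\<dots> \<le> x * 2" using x by (intro mult_left_mono) (auto simp: field_simps)
      finally show ?thesis by simp
    qed
    also have "(\<Sum>s\<in>{1..?\<tau>}. real (n choose s) * N ^ s) \<le> exp (T * real n * ln (1 / z) + real n * (N * z))"
      using N z T by (intro sum_binomial_le_exp) (auto intro: of_nat_floor)
    also have "\<dots> \<le> exp (L / 2 * real n)"
    proof -
      have "real n * (N * z) \<le> real n * (L / 4)" using Nz by (intro mult_left_mono) auto
      moreover have "T * real n * ln (1 / z) = real n * (L / 4)"
        unfolding Tz[symmetric] by (simp only: mult_ac)
      ultimately have "T * real n * ln (1 / z) + real n * (N * z) \<le> real n * (L / 4) + real n * (L / 4)"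
        by (intro add_mono) (simp_all only:)
      also have "\<dots> = L / 2 * real n" by simp
      finally show ?thesis by simp
    qed
    also have "\<beta> ^ n = exp (- L * real n)"
      using \<beta> by (simp add: L_def exp_of_nat_mult mult.commute)
    also have "exp (L / 2 * real n) * exp (- L * real n) = exp (- (L / 2) * real n)"
      by (simp add: exp_add[symmetric] field_simps)
    finally have "sbound N n (\<alpha> n) ?\<tau> \<le> 2 * x + exp (- (L / 2) * real n)"
      using \<beta> by (simp add: mult_right_mono)
    moreover have "0 \<le> sbound N n (\<alpha> n) ?\<tau>"
      unfolding sbound_def using N r0 by (intro sum_nonneg mult_nonneg_nonneg zero_le_power) auto
    ultimately show ?case by (simp add: x_def)
  qed
  moreover have "(\<lambda>n. 2 * (N * real n powr (- e)) + exp (- (L / 2) * real n)) \<longlonglongrightarrow> 0"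
    using e N L by real_asymp
  ultimately have "(\<lambda>n. sbound N n (\<alpha> n) (nat \<lfloor>T * real n\<rfloor>)) \<longlonglongrightarrow> 0"
    by (rule Lim_null_comparison)
  then show ?thesis using that T by (simp add: \<alpha>_def)
qed

lemma one_plus_power_tendsto_1:
  fixes N g :: real
  assumes "0 \<le> N" "1 < g"
  shows "(\<lambda>n. (1 + N * real n powr (- g)) ^ n) \<longlonglongrightarrow> 1"
proof (rule tendsto_sandwich)
  show "\<forall>\<^sub>F n in sequentially. 1 \<le> (1 + N * real n powr (- g)) ^ n"
    using assms by (intro always_eventually allI one_le_power) auto
  show "\<forall>\<^sub>F n in sequentially. (1 + N * real n powr (- g)) ^ n \<le> exp (N * real n powr (1 - g))"
    using eventually_gt_at_top[of 0]
  proof eventually_elim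
    case (elim n)
    have "(1 + N * real n powr (- g)) ^ n \<le> exp (N * real n powr (- g)) ^ n"
      using assms by (intro power_mono exp_ge_add_one_self) auto
    also have "\<dots> = exp (N * (real n * real n powr (- g)))"
      by (simp add: exp_of_nat_mult[symmetric] mult_ac)
    also have "real n * real n powr (- g) = real n powr (1 - g)"
      using elim powr_add[of "real n" 1 "- g"] by simp
    finally show ?case .
  qed
  have "(\<lambda>n. N * real n powr (1 - g)) \<longlonglongrightarrow> N * 0"
    using assms by (intro tendsto_mult tendsto_const) real_asymp
  then show "(\<lambda>n. exp (N * real n powr (1 - g))) \<longlonglongrightarrow> 1"
    using tendsto_exp by fastforce
qed simp

lemma one_minus_power_tendsto_1:
  fixes N g :: real
  assumes "0 \<le> N" "1 < g"
  shows "(\<lambda>n. (1 - N * real n powr (- g)) ^ n) \<longlonglongrightarrow> 1"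
proof (rule tendsto_sandwich)
  have lim: "(\<lambda>n. N * real n powr (- g)) \<longlonglongrightarrow> N * 0"
    using assms by (intro tendsto_mult tendsto_const) real_asymp
  then have ev: "\<forall>\<^sub>F n in sequentially. N * real n powr (- g) < 1" by (rule order_tendstoD) simp
  show "\<forall>\<^sub>F n in sequentially. (1 - N * real n powr (- g)) ^ n \<le> 1"
    using ev
  proof eventually_elim
    case (elim n)
    then show ?case using assms by (intro power_le_one) auto
  qed
  show "\<forall>\<^sub>F n in sequentially. 1 - N * real n powr (1 - g) \<le> (1 - N * real n powr (- g)) ^ n"
    using ev eventually_gt_at_top[of 0]
  proof eventually_elim
    case (elim n)
    have "1 + real n * (- (N * real n powr (- g))) \<le> (1 + (- (N * real n powr (- g)))) ^ n"
      using elim by (intro Bernoulli_inequality) auto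
    moreover have "real n * real n powr (- g) = real n powr (1 - g)"
      using elim powr_add[of "real n" 1 "- g"] by simp
    ultimately show ?case by (simp add: mult.left_commute)
  qed
  have "(\<lambda>n. N * real n powr (1 - g)) \<longlonglongrightarrow> N * 0"
    using assms by (intro tendsto_mult tendsto_const) real_asymp
  then have "(\<lambda>n. 1 - N * real n powr (1 - g)) \<longlonglongrightarrow> 1 - N * 0"
    by (intro tendsto_diff tendsto_const)
  then show "(\<lambda>n. 1 - N * real n powr (1 - g)) \<longlonglongrightarrow> 1" by simp
qed simp

lemma sbound_mono:
  assumes "0 \<le> N" "0 \<le> \<alpha>" "\<alpha> \<le> 1 / 2" "\<tau> \<le> \<tau>'"
  shows "sbound N n \<alpha> \<tau> \<le> sbound N n \<alpha> \<tau>'"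
  unfolding sbound_def using assms by (intro sum_mono2) auto

lemma sbound_nonneg: "0 \<le> N \<Longrightarrow> 0 \<le> \<alpha> \<Longrightarrow> \<alpha> \<le> 1 / 2 \<Longrightarrow> 0 \<le> sbound N n \<alpha> \<tau>"
  unfolding sbound_def by (intro sum_nonneg mult_nonneg_nonneg) auto

lemma three_factor_bound:
  assumes "0 \<le> a" "a \<le> 1" "0 \<le> b" "b \<le> 1" "0 \<le> c" "c \<le> (1::real)"
  shows "1 - a - b - c \<le> (1 - a) * (1 - b) * (1 - c)"
proof -
  have "1 - a - b \<le> (1 - a) * (1 - b)" using assms by (simp add: algebra_simps)
  then have "(1 - a - b) * (1 - c) \<le> (1 - a) * (1 - b) * (1 - c)" using assms by (intro mult_right_mono) auto
  moreover have "0 \<le> (a + b) * c" using assms by simp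
  ultimately show ?thesis by (simp add: algebra_simps)
qed

lemma sum_full_tendsto_1:
  fixes Q :: "nat \<Rightarrow> nat \<Rightarrow> nat \<Rightarrow> 'p::prime_card mod_ring \<Rightarrow> real"
  assumes c: "1 < c"
    and Q: "\<forall>\<^sub>F n in sequentially. \<forall>i<n. \<forall>j<n. pdist (Q n i j) \<and> (\<forall>a. Q n i j a \<le> 1 - c * ln (real n) / real n)"
    and cc: "\<And>n x i. cc n x i \<in> carrier_vec d"
  shows "(\<lambda>n. \<Sum>x\<in>{x \<in> PiE {..<n} (\<lambda>_. carrier_vec d). full n d x}. \<Prod>i<n. rp d (Q n i) x {..<n} (cc n x i)) \<longlonglongrightarrow> 1"
proof -
  let ?N = "real CARD('p) ^ d" and ?\<kappa> = "chi_gap TYPE('p)" and ?D = "real (d * CARD('p))"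
  define \<alpha> where "\<alpha> = (\<lambda>n. c * ln (real n) / real n)"
  have N: "1 \<le> ?N" using card_prime_card_gt_1[where 'p='p] by (intro one_le_power) auto
  obtain T where T: "0 < T" "(\<lambda>n. sbound ?N n (\<alpha> n) (nat \<lfloor>T * real n\<rfloor>)) \<longlonglongrightarrow> 0"
    using sbound_tendsto_0[OF N c] unfolding \<alpha>_def by blast
  \<comment> \<open>Any exponent strictly between 1 and c: with t = 2 g ln n the error exp (- t / 2)
    = n^(-g) is o(1/n), while t stays below the mean defect sum, which is at least about 2 c ln
    n.\<close>
  define g where "g = (1 + c) / 2"
  have g: "1 < g" "g < c" using c by (auto simp: g_def)
  \<comment> \<open>The relative distance of t from that mean. As lam / (2 \<alpha>) t = lam (1 - h)
    n, a margin lam h n remains in the Chernoff exponent for all losses.\<close>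
  define h where "h = 1 - g / c"
  have h: "0 < h" "h < 1" using g c by (auto simp: h_def)
  \<comment> \<open>The relative losses are lam, \<alpha> and D \<theta>; each is eventually at most
    h / 8.\<close>
  define lam where "lam = h / 8"
  have lam: "0 < lam" "lam \<le> 1" using h by (auto simp: lam_def)
  \<comment> \<open>The denominator is increased by 1 because D = d p vanishes for d = 0. The
    minimum with T keeps the number of outlying rows in the range where \<open>sbound\<close> is
    known to vanish.\<close>
  define \<theta> where "\<theta> = min T (h / 8) / (?D + 1)"
  have \<theta>: "0 < \<theta>" using T h by (auto simp: \<theta>_def intro!: divide_pos_pos add_nonneg_pos)
  have D\<theta>: "?D * \<theta> \<le> T" "?D * \<theta> \<le> h / 8" "0 \<le> ?D * \<theta>"
  proof -
    have "?D * \<theta> \<le> (?D + 1) * \<theta>" using \<theta> by (intro mult_right_mono) auto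
    also have "\<dots> = min T (h / 8)" unfolding \<theta>_def
      by (rule nonzero_mult_div_cancel_left[of "?D + 1", unfolded times_divide_eq_right[symmetric]]) (use of_nat_0_le_iff[of "d * CARD('p)", where 'a=real] in linarith)
    finally show "?D * \<theta> \<le> T" "?D * \<theta> \<le> h / 8" by auto
    show "0 \<le> ?D * \<theta>" using \<theta> by simp
  qed
  \<comment> \<open>Exceptional tuples have proportion at most n p^d exp (- 2 \<eta> n), and
    \<open>many_nonzero\<close> bounds the product for each of them by exp (\<eta> n), which leaves
    the error \<open>b\<close> below.\<close>
  define \<eta> where "\<eta> = lam * h / 4"
  have \<eta>: "0 < \<eta>" using lam h by (simp add: \<eta>_def)
  define t where "t = (\<lambda>n. 2 * g * ln (real n))"
  define w where "w = (\<lambda>n. \<theta> * real n)"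
  define F where "F = (\<lambda>n. fbound ?N n ?\<kappa> (\<alpha> n) lam (t n) (w n) (real n - ?D * w n))"
  define G where "G = (\<lambda>n. sbound ?N n (\<alpha> n) (nat \<lfloor>T * real n\<rfloor>))"
  define b where "b = (\<lambda>n. real n * ?N * exp (- \<eta> * real n))"
  define S where "S = (\<lambda>n. \<Sum>x\<in>{x \<in> PiE {..<n} (\<lambda>_. carrier_vec d). full n d x}. \<Prod>i<n. rp d (Q n i) x {..<n} (cc n x i))"
  have "\<alpha> \<longlonglongrightarrow> 0" unfolding \<alpha>_def using c by real_asymp
  then have ev\<alpha>: "\<forall>\<^sub>F n in sequentially. \<alpha> n < min (1 / 2) (h / 8)" using h by (intro order_tendstoD) auto
  have "(\<lambda>n. real n powr (- (?\<kappa> * c * \<theta> / 2))) \<longlonglongrightarrow> 0"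
  proof -
    have "0 < ?\<kappa> * c * \<theta> / 2" using chi_gap_pos[where 'p='p] c \<theta> by simp
    then show ?thesis by real_asymp
  qed
  then have "(\<lambda>n. ?N * real n powr (- (?\<kappa> * c * \<theta> / 2))) \<longlonglongrightarrow> ?N * 0" by (intro tendsto_mult tendsto_const)
  then have ev1: "\<forall>\<^sub>F n in sequentially. ?N * real n powr (- (?\<kappa> * c * \<theta> / 2)) < \<eta>"
    using \<eta> by (intro order_tendstoD) auto
  have "(\<lambda>n. real n powr (- g)) \<longlonglongrightarrow> 0" using g by real_asymp
  then have "(\<lambda>n. ?N * real n powr (- g)) \<longlonglongrightarrow> ?N * 0" by (intro tendsto_mult tendsto_const)
  then have ev2: "\<forall>\<^sub>F n in sequentially. ?N * real n powr (- g) < 1" by (rule order_tendstoD) simp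
  have blim: "b \<longlonglongrightarrow> 0"
  proof -
    have "(\<lambda>n. real n * exp (- \<eta> * real n)) \<longlonglongrightarrow> 0" using \<eta> by real_asymp
    then have "(\<lambda>n. ?N * (real n * exp (- \<eta> * real n))) \<longlonglongrightarrow> ?N * 0" by (intro tendsto_mult tendsto_const)
    then show ?thesis by (simp add: b_def mult_ac)
  qed
  have bounds: "\<forall>\<^sub>F n in sequentially. S n \<le> ((1 + ?N * real n powr (- g)) ^ n + b n) * (1 + 2 ^ (CARD('p) ^ d) * G n)
      \<and> (1 - ?N * real n powr (- g)) ^ n * (1 - b n) \<le> S n"
    using ev\<alpha> ev1 ev2 Q eventually_gt_at_top[of 1]
  proof eventually_elim
    case (elim n)
    have n0: "0 < real n" "0 < ln (real n)" using elim by auto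
    have a: "0 < \<alpha> n" "\<alpha> n \<le> 1 / 2" "\<alpha> n \<le> h / 8" using elim n0 c by (auto simp: \<alpha>_def)
    have Qn: "\<And>i j. i < n \<Longrightarrow> j < n \<Longrightarrow> pdist (Q n i j)" "\<And>i j a. i < n \<Longrightarrow> j < n \<Longrightarrow> Q n i j a \<le> 1 - \<alpha> n"
      using elim by (auto simp: \<alpha>_def)
    have et: "exp (- t n / 2) = real n powr (- g)" using n0 by (simp add: t_def powr_def)
    have expo: "lam / (2 * \<alpha> n) * t n = lam * (1 - h) * real n"
      using n0 c by (simp add: t_def \<alpha>_def h_def)
    have exp_le: "exp (lam / (2 * \<alpha> n) * t n - lam * (1 - lam) * (1 - \<alpha> n) * r) \<le> exp (- 2 * \<eta> * real n)"
      if r: "real n * (1 - ?D * \<theta>) \<le> r" for r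
    proof -
      have "1 - 3 * h / 8 \<le> 1 - lam - \<alpha> n - ?D * \<theta>" using a D\<theta> by (simp add: lam_def)
      also have "\<dots> \<le> (1 - lam) * (1 - \<alpha> n) * (1 - ?D * \<theta>)"
        using lam a D\<theta> h by (intro three_factor_bound) auto
      finally have "lam * real n * (1 - 3 * h / 8) \<le> lam * real n * ((1 - lam) * (1 - \<alpha> n) * (1 - ?D * \<theta>))"
        using lam by (intro mult_left_mono) auto
      also have "\<dots> = lam * (1 - lam) * (1 - \<alpha> n) * (real n * (1 - ?D * \<theta>))" by (simp only: mult_ac)
      also have "\<dots> \<le> lam * (1 - lam) * (1 - \<alpha> n) * r" using r lam a by (intro mult_left_mono) auto
      finally have "lam / (2 * \<alpha> n) * t n - lam * (1 - lam) * (1 - \<alpha> n) * r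
          \<le> lam * (1 - h) * real n - lam * real n * (1 - 3 * h / 8)" using expo by simp
      also have "\<dots> = - (5 / 8) * (lam * h * real n)" by (simp add: algebra_simps)
      also have "\<dots> \<le> - (1 / 2) * (lam * h * real n)" using lam h by simp
      also have "\<dots> = - 2 * \<eta> * real n" by (simp add: \<eta>_def)
      finally show ?thesis by simp
    qed
    have F_le: "F n \<le> (1 + ?N * real n powr (- g)) ^ n + b n"
    proof -
      have "exp (- ?\<kappa> * \<alpha> n * (1 - \<alpha> n) * w n) \<le> real n powr (- (?\<kappa> * c * \<theta> / 2))"
      proof -
        have "\<alpha> n * w n = c * \<theta> * ln (real n)" using n0 by (simp add: \<alpha>_def w_def)
        then have "?\<kappa> * \<alpha> n * (1 - \<alpha> n) * w n = ?\<kappa> * (c * \<theta> * ln (real n)) * (1 - \<alpha> n)"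
          by (metis (no_types, opaque_lifting) mult.commute mult.left_commute)
        also have "\<dots> \<ge> ?\<kappa> * (c * \<theta> * ln (real n)) * (1 / 2)"
          using a c \<theta> n0 chi_gap_pos[where 'p='p] by (intro mult_left_mono mult_nonneg_nonneg) auto
        finally show ?thesis using n0 by (simp add: powr_def mult_ac)
      qed
      then have "?N * exp (- ?\<kappa> * \<alpha> n * (1 - \<alpha> n) * w n) \<le> ?N * real n powr (- (?\<kappa> * c * \<theta> / 2))"
        by (intro mult_left_mono) auto
      then have "1 + ?N * exp (- ?\<kappa> * \<alpha> n * (1 - \<alpha> n) * w n) \<le> 1 + \<eta>" using elim by linarith
      also have "\<dots> \<le> exp \<eta>" by (rule exp_ge_add_one_self)
      finally have "(1 + ?N * exp (- ?\<kappa> * \<alpha> n * (1 - \<alpha> n) * w n)) ^ n \<le> exp \<eta> ^ n"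
        by (intro power_mono) (auto intro: add_nonneg_nonneg)
      then have 1: "(1 + ?N * exp (- ?\<kappa> * \<alpha> n * (1 - \<alpha> n) * w n)) ^ n \<le> exp (\<eta> * real n)"
        by (simp only: exp_of_nat_mult[symmetric] mult.commute[of "real n" \<eta>])
      have 2: "exp (lam / (2 * \<alpha> n) * t n - lam * (1 - lam) * (1 - \<alpha> n) * (real n - ?D * w n)) \<le> exp (- 2 * \<eta> * real n)"
        by (rule exp_le) (simp add: w_def algebra_simps)
      have "F n \<le> (1 + ?N * real n powr (- g)) ^ n + exp (\<eta> * real n) * (real n * ?N * exp (- 2 * \<eta> * real n))"
        unfolding F_def fbound_def et by (intro add_left_mono mult_mono 1 mult_left_mono 2) auto
      also have "exp (\<eta> * real n) * (real n * ?N * exp (- 2 * \<eta> * real n)) = real n * ?N * (exp (\<eta> * real n) * exp (- 2 * \<eta> * real n))"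
        by (simp only: mult_ac)
      also have "\<dots> = b n" by (simp add: b_def exp_add[symmetric])
      finally show ?thesis .
    qed
    have sb: "sbound ?N n (\<alpha> n) (nat \<lfloor>?D * w n\<rfloor>) \<le> G n"
      unfolding G_def
    proof (rule sbound_mono)
      have "?D * w n \<le> T * real n"
        using mult_right_mono[OF D\<theta>(1), of "real n"] by (simp add: w_def mult.assoc)
      then show "nat \<lfloor>?D * w n\<rfloor> \<le> nat \<lfloor>T * real n\<rfloor>" by (intro nat_mono floor_mono)
    qed (use a in auto)
    have G0: "0 \<le> G n" unfolding G_def using a by (intro sbound_nonneg) auto
    have F0: "0 \<le> F n" unfolding F_def by (intro fbound_nonneg) simp
    have "S n \<le> F n * (1 + 2 ^ (CARD('p) ^ d) * sbound ?N n (\<alpha> n) (nat \<lfloor>?D * w n\<rfloor>))"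
      unfolding S_def F_def
      by (rule sum_full_le[OF Qn a(1,2) lam _ cc]) (use \<theta> in \<open>auto simp: w_def\<close>)
    also have "\<dots> \<le> F n * (1 + 2 ^ (CARD('p) ^ d) * G n)"
      using sb F0 by (intro mult_left_mono add_left_mono) auto
    also have "\<dots> \<le> ((1 + ?N * real n powr (- g)) ^ n + b n) * (1 + 2 ^ (CARD('p) ^ d) * G n)"
      using F_le G0 by (intro mult_right_mono) auto
    finally have upper: "S n \<le> ((1 + ?N * real n powr (- g)) ^ n + b n) * (1 + 2 ^ (CARD('p) ^ d) * G n)" .
    have "1 - b n \<le> 1 - real n * ?N * exp (lam / (2 * \<alpha> n) * t n - lam * (1 - lam) * (1 - \<alpha> n) * real n)"
    proof -
      have "real n * (1 - ?D * \<theta>) \<le> real n" using D\<theta>(3) by (simp add: mult_left_le)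
      then have "exp (lam / (2 * \<alpha> n) * t n - lam * (1 - lam) * (1 - \<alpha> n) * real n) \<le> exp (- 2 * \<eta> * real n)"
        by (rule exp_le)
      also have "\<dots> \<le> exp (- \<eta> * real n)" using \<eta> by simp
      finally show ?thesis unfolding b_def by (simp add: mult_left_mono)
    qed
    then have "(1 - ?N * real n powr (- g)) ^ n * (1 - b n)
        \<le> (1 - ?N * real n powr (- g)) ^ n * (1 - real n * ?N * exp (lam / (2 * \<alpha> n) * t n - lam * (1 - lam) * (1 - \<alpha> n) * real n))"
      using elim by (intro mult_left_mono zero_le_power) auto
    also have "\<dots> \<le> S n"
      unfolding S_def et[symmetric]
      by (rule sum_full_ge[OF Qn a(1,2) lam _ _ _ cc]) (use elim n0 g et in \<open>auto simp: t_def\<close>)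
    finally show ?case using upper by simp
  qed
  have "S \<longlonglongrightarrow> 1"
  proof (rule tendsto_sandwich)
    have "(\<lambda>n. (1 - ?N * real n powr (- g)) ^ n * (1 - b n)) \<longlonglongrightarrow> 1 * (1 - 0)"
      by (intro tendsto_mult tendsto_diff tendsto_const blim one_minus_power_tendsto_1 g) simp
    then show "(\<lambda>n. (1 - ?N * real n powr (- g)) ^ n * (1 - b n)) \<longlonglongrightarrow> 1" by simp
    have "G \<longlonglongrightarrow> 0" unfolding G_def by (rule T)
    then have "(\<lambda>n. ((1 + ?N * real n powr (- g)) ^ n + b n) * (1 + 2 ^ (CARD('p) ^ d) * G n)) \<longlonglongrightarrow> (1 + 0) * (1 + 2 ^ (CARD('p) ^ d) * 0)"
      by (intro tendsto_mult tendsto_add tendsto_const blim one_plus_power_tendsto_1 g) simp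
    then show "(\<lambda>n. ((1 + ?N * real n powr (- g)) ^ n + b n) * (1 + 2 ^ (CARD('p) ^ d) * G n)) \<longlonglongrightarrow> 1" by simp
    show "\<forall>\<^sub>F n in sequentially. S n \<le> ((1 + ?N * real n powr (- g)) ^ n + b n) * (1 + 2 ^ (CARD('p) ^ d) * G n)"
      using bounds by eventually_elim auto
    show "\<forall>\<^sub>F n in sequentially. (1 - ?N * real n powr (- g)) ^ n * (1 - b n) \<le> S n"
      using bounds by eventually_elim auto
  qed
  then show ?thesis by (simp add: S_def)
qed

section \<open>Moments\<close>

text \<open>Expectation over a matrix with independent entries, entry (i, j) having point
  probabilities \<open>P i j\<close>. Written as a finite sum, it keeps all sections before the last
  one free of measure theory.\<close>

definition mat_expect :: "nat \<Rightarrow> (nat \<Rightarrow> nat \<Rightarrow> 'a::finite \<Rightarrow> real) \<Rightarrow> ('a mat \<Rightarrow> real) \<Rightarrow> real" where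
  "mat_expect n P f = (\<Sum>B\<in>carrier_mat n n. (\<Prod>i<n. \<Prod>j<n. P i j (B $$ (i, j))) * f B)"

definition emb :: "nat \<Rightarrow> nat \<Rightarrow> 'a::field mat \<Rightarrow> 'a mat \<Rightarrow> 'a mat set" where
  "emb n d T B = {X \<in> carrier_mat n d. B * X = X * T \<and>
     (\<forall>v\<in>carrier_vec d. X *\<^sub>v v = 0\<^sub>v n \<longrightarrow> v = 0\<^sub>v d)}"

lemma finite_carrier_mat [simp]: "finite (carrier_mat n m :: 'a::finite mat set)"
proof -
  have "(carrier_mat n m :: 'a mat set) \<subseteq> (\<lambda>f. mat n m (\<lambda>(i, j). f i j)) ` PiE {..<n} (\<lambda>_. PiE {..<m} (\<lambda>_. UNIV))"
  proof
    fix B :: "'a mat" assume B: "B \<in> carrier_mat n m"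
    then have "B = mat n m (\<lambda>(i, j). (\<lambda>i\<in>{..<n}. \<lambda>j\<in>{..<m}. B $$ (i, j)) i j)"
      by (intro eq_matI) auto
    moreover have "(\<lambda>i\<in>{..<n}. \<lambda>j\<in>{..<m}. B $$ (i, j)) \<in> PiE {..<n} (\<lambda>_. PiE {..<m} (\<lambda>_. UNIV))" by auto
    ultimately show "B \<in> (\<lambda>f. mat n m (\<lambda>(i, j). f i j)) ` PiE {..<n} (\<lambda>_. PiE {..<m} (\<lambda>_. UNIV))" by blast
  qed
  then show ?thesis by (rule finite_subset) (intro finite_imageI finite_PiE; simp)+
qed

lemma finite_emb [simp]: "finite (emb n d T B :: 'a::{field,finite} mat set)"
  unfolding emb_def by simp

lemma vec_index_eq: "v \<in> carrier_vec d \<Longrightarrow> vec d (\<lambda>i. v $ i) = v"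
  by (intro eq_vecI) auto

text \<open>Row i of B X = X T constrains row i of B only. The target is row i of X T, which varies
  with i and X; this is why the bounds above admit arbitrary targets \<open>c x i\<close>.\<close>

lemma mat_expect_emb:
  fixes P :: "nat \<Rightarrow> nat \<Rightarrow> 'p::prime_card mod_ring \<Rightarrow> real"
  assumes T: "T \<in> carrier_mat d d"
  shows "mat_expect n P (\<lambda>B. real (card (emb n d T B)))
    = (\<Sum>x\<in>{x \<in> PiE {..<n} (\<lambda>_. carrier_vec d). full n d x}.
        \<Prod>i<n. rp d (P i) x {..<n} (vec d (\<lambda>k. x i \<bullet> col T k)))"
proof -
  let ?V = "carrier_vec d :: 'p mod_ring vec set"
  define X where "X = (\<lambda>x :: nat \<Rightarrow> 'p mod_ring vec. mat n d (\<lambda>(i, k). x i $ k))"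
  define Y where "Y = {X :: 'p mod_ring mat. X \<in> carrier_mat n d \<and> (\<forall>v\<in>?V. X *\<^sub>v v = 0\<^sub>v n \<longrightarrow> v = 0\<^sub>v d)}"
  define wt where "wt = (\<lambda>B. \<Prod>i<n. \<Prod>j<n. P i j (B $$ (i, j)))"
  have finY: "finite Y" unfolding Y_def by simp
  have full_iff: "full n d x \<longleftrightarrow> X x \<in> Y" if x: "x \<in> PiE {..<n} (\<lambda>_. ?V)" for x
  proof -
    have "X x *\<^sub>v v = 0\<^sub>v n \<longleftrightarrow> (\<forall>j<n. v \<bullet> x j = 0)" if v: "v \<in> ?V" for v
    proof -
      have "(X x *\<^sub>v v) $ j = v \<bullet> x j" if "j < n" for j
      proof -
        have "x j \<in> ?V" using that x by auto
        then have "row (X x) j = x j" using that by (simp add: X_def vec_index_eq)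
        then show ?thesis using that v x by (simp add: X_def comm_scalar_prod[of _ d] PiE_iff)
      qed
      then show ?thesis by (auto simp: vec_eq_iff X_def)
    qed
    then show ?thesis by (auto simp: full_def Y_def X_def)
  qed
  have ev: "B * X x = X x * T \<longleftrightarrow>
      (\<forall>i<n. \<forall>k<d. (\<Sum>j<n. B $$ (i, j) * x j $ k) = vec d (\<lambda>k. x i \<bullet> col T k) $ k)"
    if x: "x \<in> PiE {..<n} (\<lambda>_. ?V)" and B: "B \<in> carrier_mat n n" for x B
  proof -
    have l: "(B * X x) $$ (i, k) = (\<Sum>j<n. B $$ (i, j) * x j $ k)" if "i < n" "k < d" for i k
      using that B by (simp add: X_def scalar_prod_def lessThan_atLeast0)
    have r: "(X x * T) $$ (i, k) = x i \<bullet> col T k" if "i < n" "k < d" for i k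
    proof -
      have "x i \<in> ?V" using that x by auto
      then have "row (X x) i = x i" using that by (simp add: X_def vec_index_eq)
      then show ?thesis using that T by (simp add: X_def)
    qed
    show ?thesis using B T l r by (auto simp: mat_eq_iff X_def)
  qed
  have row: "(\<Sum>B\<in>carrier_mat n n. wt B * of_bool (B * X x = X x * T))
      = (\<Prod>i<n. rp d (P i) x {..<n} (vec d (\<lambda>k. x i \<bullet> col T k)))"
    if x: "x \<in> PiE {..<n} (\<lambda>_. ?V)" for x
  proof -
    let ?b = "\<lambda>i r. (\<Prod>j<n. P i j (r j)) * of_bool (\<forall>k<d. (\<Sum>j<n. r j * x j $ k) = vec d (\<lambda>k. x i \<bullet> col T k) $ k)"
    have "(\<Sum>B\<in>carrier_mat n n. wt B * of_bool (B * X x = X x * T))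
        = (\<Sum>b\<in>PiE {..<n} (\<lambda>_. PiE {..<n} (\<lambda>_. UNIV)). \<Prod>i<n. ?b i (b i))"
    proof (rule sum.reindex_bij_witness[of _ "\<lambda>b. mat n n (\<lambda>(i, j). b i j)" "\<lambda>B. \<lambda>i\<in>{..<n}. \<lambda>j\<in>{..<n}. B $$ (i, j)"])
      fix B :: "'p mod_ring mat" assume B: "B \<in> carrier_mat n n"
      show "mat n n (\<lambda>(i, j). (\<lambda>i\<in>{..<n}. \<lambda>j\<in>{..<n}. B $$ (i, j)) i j) = B"
        using B by (intro eq_matI) auto
      show "(\<lambda>i\<in>{..<n}. \<lambda>j\<in>{..<n}. B $$ (i, j)) \<in> PiE {..<n} (\<lambda>_. PiE {..<n} (\<lambda>_. UNIV))" by auto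
      have "(\<Prod>i<n. ?b i ((\<lambda>i\<in>{..<n}. \<lambda>j\<in>{..<n}. B $$ (i, j)) i))
          = wt B * (\<Prod>i<n. of_bool (\<forall>k<d. (\<Sum>j<n. B $$ (i, j) * x j $ k) = vec d (\<lambda>k. x i \<bullet> col T k) $ k))"
        by (simp add: wt_def prod.distrib)
      also have "(\<Prod>i<n. of_bool (\<forall>k<d. (\<Sum>j<n. B $$ (i, j) * x j $ k) = vec d (\<lambda>k. x i \<bullet> col T k) $ k))
          = (of_bool (\<forall>i<n. \<forall>k<d. (\<Sum>j<n. B $$ (i, j) * x j $ k) = vec d (\<lambda>k. x i \<bullet> col T k) $ k) :: real)"
        by (auto simp: of_bool_def prod_zero_iff)
      finally show "(\<Prod>i<n. ?b i ((\<lambda>i\<in>{..<n}. \<lambda>j\<in>{..<n}. B $$ (i, j)) i)) = wt B * of_bool (B * X x = X x * T)"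
        using ev[OF x B] by simp
    next
      fix b :: "nat \<Rightarrow> nat \<Rightarrow> 'p mod_ring" assume b: "b \<in> PiE {..<n} (\<lambda>_. PiE {..<n} (\<lambda>_. UNIV))"
      show "mat n n (\<lambda>(i, j). b i j) \<in> carrier_mat n n" by simp
      show "(\<lambda>i\<in>{..<n}. \<lambda>j\<in>{..<n}. mat n n (\<lambda>(i, j). b i j) $$ (i, j)) = b"
      proof (intro ext)
        fix i j
        have "b i \<in> PiE {..<n} (\<lambda>_. UNIV)" if "i < n" using b that by auto
        then show "(\<lambda>i\<in>{..<n}. \<lambda>j\<in>{..<n}. mat n n (\<lambda>(i, j). b i j) $$ (i, j)) i j = b i j"
          using PiE_arb[OF b, of i] PiE_arb[of "b i" "{..<n}" "\<lambda>_. UNIV" j] by (cases "i < n"; cases "j < n") auto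
      qed
    qed
    also have "\<dots> = (\<Prod>i<n. \<Sum>r\<in>PiE {..<n} (\<lambda>_. UNIV). ?b i r)"
      by (rule prod_sum_PiE[symmetric]) (auto intro!: finite_PiE)
    finally show ?thesis by (simp only: rp_def pe_def)
  qed
  have "mat_expect n P (\<lambda>B. real (card (emb n d T B))) = (\<Sum>B\<in>carrier_mat n n. \<Sum>Z\<in>Y. wt B * of_bool (B * Z = Z * T))"
    unfolding mat_expect_def
  proof (rule sum.cong[OF refl])
    fix B :: "'p mod_ring mat"
    have "emb n d T B = Y \<inter> {Z. B * Z = Z * T}" by (auto simp: emb_def Y_def)
    then have "wt B * real (card (emb n d T B)) = (\<Sum>Z\<in>Y. wt B * of_bool (B * Z = Z * T))"
      using finY by (simp add: sum_distrib_left[symmetric] sum_of_bool_eq)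
    then show "(\<Prod>i<n. \<Prod>j<n. P i j (B $$ (i, j))) * real (card (emb n d T B))
        = (\<Sum>Z\<in>Y. wt B * of_bool (B * Z = Z * T))" by (simp only: wt_def)
  qed
  also have "\<dots> = (\<Sum>Z\<in>Y. \<Sum>B\<in>carrier_mat n n. wt B * of_bool (B * Z = Z * T))" by (rule sum.swap)
  also have "\<dots> = (\<Sum>x\<in>{x \<in> PiE {..<n} (\<lambda>_. ?V). full n d x}. \<Sum>B\<in>carrier_mat n n. wt B * of_bool (B * X x = X x * T))"
  proof (rule sum.reindex_bij_witness[of _ X "\<lambda>Z. \<lambda>i\<in>{..<n}. row Z i"])
    fix Z :: "'p mod_ring mat" assume Z: "Z \<in> Y"
    show XZ: "X (\<lambda>i\<in>{..<n}. row Z i) = Z"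
      using Z by (intro eq_matI) (auto simp: X_def Y_def)
    have "(\<lambda>i\<in>{..<n}. row Z i) \<in> PiE {..<n} (\<lambda>_. ?V)" using Z by (auto simp: Y_def)
    then show "(\<lambda>i\<in>{..<n}. row Z i) \<in> {x \<in> PiE {..<n} (\<lambda>_. ?V). full n d x}"
      using full_iff XZ Z by simp
    show "(\<Sum>B\<in>carrier_mat n n. wt B * of_bool (B * X (\<lambda>i\<in>{..<n}. row Z i) = X (\<lambda>i\<in>{..<n}. row Z i) * T))
        = (\<Sum>B\<in>carrier_mat n n. wt B * of_bool (B * Z = Z * T))" by (simp only: XZ)
  next
    fix x assume "x \<in> {x \<in> PiE {..<n} (\<lambda>_. ?V). full n d x}"
    then have x: "x \<in> PiE {..<n} (\<lambda>_. ?V)" "full n d x" by auto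
    show "X x \<in> Y" using full_iff x by simp
    show "(\<lambda>i\<in>{..<n}. row (X x) i) = x"
    proof
      fix i
      show "(\<lambda>i\<in>{..<n}. row (X x) i) i = x i"
      proof (cases "i < n")
        case True
        then have "x i \<in> ?V" using x by auto
        then show ?thesis using True by (simp add: X_def vec_index_eq)
      qed (use PiE_arb[OF x(1), of i] in auto)
    qed
  qed
  also have "\<dots> = (\<Sum>x\<in>{x \<in> PiE {..<n} (\<lambda>_. ?V). full n d x}.
        \<Prod>i<n. rp d (P i) x {..<n} (vec d (\<lambda>k. x i \<bullet> col T k)))"
    by (intro sum.cong refl row) auto
  finally show ?thesis .
qed

theorem moments_tendsto_1:
  fixes P :: "nat \<Rightarrow> nat \<Rightarrow> nat \<Rightarrow> 'p::prime_card mod_ring \<Rightarrow> real"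
  assumes c: "1 < c"
    and P: "\<forall>\<^sub>F n in sequentially. \<forall>i<n. \<forall>j<n. pdist (P n i j) \<and> (\<forall>a. P n i j a \<le> 1 - c * ln (real n) / real n)"
    and T: "T \<in> carrier_mat d d"
  shows "(\<lambda>n. mat_expect n (P n) (\<lambda>B. real (card (emb n d T B)))) \<longlonglongrightarrow> 1"
  unfolding mat_expect_emb[OF T] by (rule sum_full_tendsto_1[OF c P]) simp

section \<open>Injective matrices and invariant subspaces\<close>

definition hc :: "'a mat \<Rightarrow> 'a mat \<Rightarrow> 'a mat" where
  "hc X Y = mat (dim_row X) (dim_col X + dim_col Y)
     (\<lambda>(i, j). if j < dim_col X then X $$ (i, j) else Y $$ (i, j - dim_col X))"

lemma hc_carrier [simp, intro]:
  "X \<in> carrier_mat n d \<Longrightarrow> Y \<in> carrier_mat n f \<Longrightarrow> hc X Y \<in> carrier_mat n (d + f)"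
  by (auto simp: hc_def)

lemma dim_hc [simp]: "dim_row (hc X Y) = dim_row X" "dim_col (hc X Y) = dim_col X + dim_col Y"
  by (auto simp: hc_def)

lemma mult_inverse_cancel:
  assumes "P \<in> carrier_mat n n" "P' \<in> carrier_mat n n" "P * P' = 1\<^sub>m n" "Q \<in> carrier_mat n m"
  shows "P * (P' * Q) = (Q :: 'a::comm_ring_1 mat)"
  unfolding assoc_mult_mat[OF assms(1,2,4), symmetric] assms(3) using assms(4) by simp

lemma mult_mat_vec_0 [simp]: "X \<in> carrier_mat n d \<Longrightarrow> X *\<^sub>v 0\<^sub>v d = (0\<^sub>v (dim_row X) :: 'a::comm_ring_1 vec)"
  by (intro eq_vecI) auto

lemma col_hc:
  assumes "X \<in> carrier_mat n d" "Y \<in> carrier_mat n f" "j < d + f"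
  shows "col (hc X Y) j = (if j < d then col X j else col Y (j - d))"
  using assms by (intro eq_vecI) (auto simp: hc_def)

lemma row_hc:
  assumes "X \<in> carrier_mat n d" "Y \<in> carrier_mat n f" "i < n"
  shows "row (hc X Y) i = row X i @\<^sub>v row Y i"
  using assms by (intro eq_vecI) (auto simp: hc_def)

lemma hc_eq_iff:
  assumes "X \<in> carrier_mat n d" "Y \<in> carrier_mat n f" "X' \<in> carrier_mat n d" "Y' \<in> carrier_mat n f"
  shows "hc X Y = hc X' Y' \<longleftrightarrow> X = X' \<and> Y = Y'"
proof
  assume eq: "hc X Y = hc X' Y'"
  have "X $$ (i, j) = X' $$ (i, j)" if "i < n" "j < d" for i j
    using arg_cong[OF eq, of "\<lambda>M. M $$ (i, j)"] assms that by (simp add: hc_def)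
  moreover have "Y $$ (i, j) = Y' $$ (i, j)" if "i < n" "j < f" for i j
    using arg_cong[OF eq, of "\<lambda>M. M $$ (i, d + j)"] assms that by (simp add: hc_def)
  ultimately show "X = X' \<and> Y = Y'" using assms by (auto intro!: eq_matI)
qed simp

lemma hc_mult_vec:
  fixes X Y :: "'a::comm_ring_1 mat"
  assumes "X \<in> carrier_mat n d" "Y \<in> carrier_mat n f" "a \<in> carrier_vec d" "b \<in> carrier_vec f"
  shows "hc X Y *\<^sub>v (a @\<^sub>v b) = X *\<^sub>v a + Y *\<^sub>v b"
proof (rule eq_vecI)
  fix i assume "i < dim_vec (X *\<^sub>v a + Y *\<^sub>v b)"
  then have i: "i < n" using assms by simp
  have "(hc X Y *\<^sub>v (a @\<^sub>v b)) $ i = (row X i @\<^sub>v row Y i) \<bullet> (a @\<^sub>v b)"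
    using i assms row_hc[OF assms(1,2) i] by simp
  also have "\<dots> = row X i \<bullet> a + row Y i \<bullet> b"
    using i assms by (intro scalar_prod_append) auto
  finally show "(hc X Y *\<^sub>v (a @\<^sub>v b)) $ i = (X *\<^sub>v a + Y *\<^sub>v b) $ i" using i assms by simp
qed (use assms hc_carrier[OF assms(1,2)] in auto)

lemma mult_hc:
  fixes A X Y :: "'a::comm_ring_1 mat"
  assumes "A \<in> carrier_mat m n" "X \<in> carrier_mat n d" "Y \<in> carrier_mat n f"
  shows "A * hc X Y = hc (A * X) (A * Y)"
proof (rule eq_matI)
  fix i j assume "i < dim_row (hc (A * X) (A * Y))" "j < dim_col (hc (A * X) (A * Y))"
  then have ij: "i < m" "j < d + f" using assms by (auto simp: hc_def)
  then show "(A * hc X Y) $$ (i, j) = hc (A * X) (A * Y) $$ (i, j)"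
    using assms hc_carrier[OF assms(2,3)]
    by (auto simp: col_hc[OF assms(2,3)] hc_def[of "A * X"])
qed (use assms in \<open>auto simp: hc_def\<close>)

lemma hc_four_block:
  assumes "X \<in> carrier_mat n d" "Y \<in> carrier_mat n f"
  shows "hc X Y = four_block_mat X Y (0\<^sub>m 0 d) (0\<^sub>m 0 f)"
  using assms by (intro eq_matI) (auto simp: hc_def)

lemma hc_mult_four_block:
  fixes X Y :: "'a::comm_ring_1 mat"
  assumes X: "X \<in> carrier_mat n d" and Y: "Y \<in> carrier_mat n f"
    and T: "T \<in> carrier_mat d a" and B: "B \<in> carrier_mat d b" and C: "C \<in> carrier_mat f a" and S: "S \<in> carrier_mat f b"
  shows "hc X Y * four_block_mat T B C S = hc (X * T + Y * C) (X * B + Y * S)"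
proof -
  have "hc X Y * four_block_mat T B C S = four_block_mat (X * T + Y * C) (X * B + Y * S)
     (0\<^sub>m 0 d * T + 0\<^sub>m 0 f * C) (0\<^sub>m 0 d * B + 0\<^sub>m 0 f * S)"
    unfolding hc_four_block[OF X Y] by (rule mult_four_block_mat[OF X Y _ _ T B C S]) auto
  also have "\<dots> = hc (X * T + Y * C) (X * B + Y * S)"
    using assms by (subst hc_four_block[of _ n a _ b]) auto
  finally show ?thesis .
qed

lemma vec_split:
  assumes "v \<in> carrier_vec (d + f)"
  obtains a b where "a \<in> carrier_vec d" "b \<in> carrier_vec f" "v = a @\<^sub>v b"
  using assms vec_first_last_append[OF assms] vec_first_carrier vec_last_carrier by metis

definition injm :: "nat \<Rightarrow> nat \<Rightarrow> 'a::field mat \<Rightarrow> bool" where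
  "injm n d X \<longleftrightarrow> X \<in> carrier_mat n d \<and> (\<forall>v\<in>carrier_vec d. X *\<^sub>v v = 0\<^sub>v n \<longrightarrow> v = 0\<^sub>v d)"

lemma injm_carrier: "injm n d X \<Longrightarrow> X \<in> carrier_mat n d" by (simp add: injm_def)

lemma injmD: "injm n d X \<Longrightarrow> v \<in> carrier_vec d \<Longrightarrow> X *\<^sub>v v = 0\<^sub>v n \<Longrightarrow> v = 0\<^sub>v d" by (simp add: injm_def)

lemma emb_altdef: "emb n d T B = {X. injm n d X \<and> B * X = X * T}"
  by (auto simp: emb_def injm_def)

definition colsp :: "'a::field mat \<Rightarrow> 'a vec set" where
  "colsp X = (\<lambda>v. X *\<^sub>v v) ` carrier_vec (dim_col X)"

lemma colspI: "X \<in> carrier_mat n d \<Longrightarrow> v \<in> carrier_vec d \<Longrightarrow> X *\<^sub>v v \<in> colsp X"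
  by (auto simp: colsp_def)

lemma colspE:
  assumes "y \<in> colsp X" "X \<in> carrier_mat n d"
  obtains v where "v \<in> carrier_vec d" "y = X *\<^sub>v v"
  using assms by (auto simp: colsp_def)

lemma colsp_carrier: "X \<in> carrier_mat n d \<Longrightarrow> y \<in> colsp X \<Longrightarrow> y \<in> carrier_vec n"
  by (auto simp: colsp_def)

lemma colsp_subset: "X \<in> carrier_mat n d \<Longrightarrow> colsp X \<subseteq> carrier_vec n"
  using colsp_carrier by blast

lemma colsp_add: "X \<in> carrier_mat n d \<Longrightarrow> y \<in> colsp X \<Longrightarrow> z \<in> colsp X \<Longrightarrow> y + z \<in> colsp (X :: 'a::field mat)"
  by (elim colspE) (auto simp: mult_add_distrib_mat_vec[symmetric] intro!: colspI)

lemma colsp_smult: "X \<in> carrier_mat n d \<Longrightarrow> y \<in> colsp X \<Longrightarrow> c \<cdot>\<^sub>v y \<in> colsp (X :: 'a::field mat)"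
  by (elim colspE) (auto simp: mult_mat_vec[symmetric] intro!: colspI)

lemma injm_inj:
  assumes "injm n d X" "v \<in> carrier_vec d" "w \<in> carrier_vec d" "X *\<^sub>v v = X *\<^sub>v w"
  shows "v = w"
proof -
  have X: "X \<in> carrier_mat n d" using assms by (simp add: injm_def)
  have "X *\<^sub>v (v - w) = X *\<^sub>v v - X *\<^sub>v w"
    using assms X by (simp add: mult_minus_distrib_mat_vec)
  also have "\<dots> = 0\<^sub>v n" unfolding assms(4) using X assms by simp
  finally have "X *\<^sub>v (v - w) = 0\<^sub>v n" .
  then have "v - w = 0\<^sub>v d" by (rule injmD[OF assms(1) minus_carrier_vec[OF assms(2,3)]])
  then have *: "(v - w) $ i = 0" if "i < d" for i using that by simp
  show ?thesis
  proof (rule eq_vecI)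
    fix i assume "i < dim_vec w"
    then show "v $ i = w $ i" using *[of i] assms(2,3) by simp
  qed (use assms(2,3) in simp)
qed

lemma card_colsp:
  fixes X :: "'a::{field,finite} mat"
  assumes "injm n d X"
  shows "card (colsp X) = CARD('a) ^ d"
proof -
  have X: "X \<in> carrier_mat n d" using assms by (simp add: injm_def)
  have "inj_on (\<lambda>v. X *\<^sub>v v) (carrier_vec d)" using injm_inj[OF assms] by (auto intro: inj_onI)
  then show ?thesis using X by (simp add: colsp_def card_image card_carrier_vec)
qed

lemma CARD_gt_1: "CARD('a::{field,finite}) > 1"
proof -
  have "card {0, 1 :: 'a} \<le> CARD('a)" by (intro card_mono) auto
  then show ?thesis by simp
qed

lemma injm_le:
  fixes X :: "'a::{field,finite} mat"
  assumes "injm n d X" shows "d \<le> n"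
proof -
  have "card (colsp X) \<le> card (carrier_vec n :: 'a vec set)"
    using assms colsp_subset by (intro card_mono) (auto simp: injm_def)
  then have "CARD('a) ^ d \<le> CARD('a) ^ n" by (simp add: card_colsp[OF assms] card_carrier_vec)
  then show ?thesis using CARD_gt_1[where 'a='a] by (rule power_le_imp_le_exp[rotated])
qed

text \<open>Injectivity of new columns can thus be tested modulo the old column space, both when
  embeddings are built up and when they are taken apart.\<close>

lemma injm_hc_iff:
  fixes X Y :: "'a::field mat"
  assumes X: "X \<in> carrier_mat n d" and Y: "Y \<in> carrier_mat n f"
  shows "injm n (d + f) (hc X Y) \<longleftrightarrow> injm n d X \<and> (\<forall>b\<in>carrier_vec f. Y *\<^sub>v b \<in> colsp X \<longrightarrow> b = 0\<^sub>v f)"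
proof (intro iffI conjI ballI impI)
  assume inj: "injm n (d + f) (hc X Y)"
  show "injm n d X"
    unfolding injm_def
  proof (intro conjI ballI impI X)
    fix v :: "'a vec" assume v: "v \<in> carrier_vec d" "X *\<^sub>v v = 0\<^sub>v n"
    have "hc X Y *\<^sub>v (v @\<^sub>v 0\<^sub>v f) = 0\<^sub>v n" using X Y v by (simp add: hc_mult_vec[of _ n d])
    then have "v @\<^sub>v 0\<^sub>v f = 0\<^sub>v (d + f)" using inj v by (intro injmD[OF inj]) auto
    then have "(v @\<^sub>v 0\<^sub>v f) $ i = 0" if "i < d" for i using that by simp
    then have "v $ i = 0" if "i < d" for i using that v by (metis index_append_vec(1) carrier_vecD trans_less_add1)
    then show "v = 0\<^sub>v d" using v by (intro eq_vecI) auto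
  qed
  fix b :: "'a vec" assume b: "b \<in> carrier_vec f" "Y *\<^sub>v b \<in> colsp X"
  then obtain a where a: "a \<in> carrier_vec d" "Y *\<^sub>v b = X *\<^sub>v a" using X by (auto elim: colspE)
  have "hc X Y *\<^sub>v ((- a) @\<^sub>v b) = X *\<^sub>v (- a) + X *\<^sub>v a" using X Y a b by (simp add: hc_mult_vec[of _ n d _ f])
  also have "\<dots> = X *\<^sub>v (- a + a)" using X a by (intro mult_add_distrib_mat_vec[symmetric]) auto
  also have "- a + a = 0\<^sub>v d" using a by simp
  finally have "hc X Y *\<^sub>v ((- a) @\<^sub>v b) = 0\<^sub>v n" using X by simp
  then have eq: "(- a) @\<^sub>v b = 0\<^sub>v (d + f)" using a b by (intro injmD[OF inj]) auto
  show "b = 0\<^sub>v f"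
  proof (rule eq_vecI)
    fix i assume "i < dim_vec (0\<^sub>v f :: 'a vec)"
    then have i: "i < f" by simp
    then have "((- a) @\<^sub>v b) $ (d + i) = 0" by (simp add: eq)
    then show "b $ i = 0\<^sub>v f $ i" using i a b by simp
  qed (use b in auto)
next
  assume r: "injm n d X \<and> (\<forall>b\<in>carrier_vec f. Y *\<^sub>v b \<in> colsp X \<longrightarrow> b = 0\<^sub>v f)"
  show "injm n (d + f) (hc X Y)"
    unfolding injm_def
  proof (intro conjI ballI impI)
    show "hc X Y \<in> carrier_mat n (d + f)" using X Y by simp
    fix v :: "'a vec" assume v: "v \<in> carrier_vec (d + f)" "hc X Y *\<^sub>v v = 0\<^sub>v n"
    obtain a b where ab: "a \<in> carrier_vec d" "b \<in> carrier_vec f" "v = a @\<^sub>v b" using v by (elim vec_split)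
    have 0: "X *\<^sub>v a + Y *\<^sub>v b = 0\<^sub>v n" using v ab X Y by (simp add: hc_mult_vec[of _ n d _ f])
    have "Y *\<^sub>v b = X *\<^sub>v (- a)"
    proof (rule eq_vecI)
      fix i assume "i < dim_vec (X *\<^sub>v (- a))"
      then have i: "i < n" using X by simp
      have "(X *\<^sub>v a + Y *\<^sub>v b) $ i = 0" using 0 i by simp
      then have "(Y *\<^sub>v b) $ i = - (X *\<^sub>v a) $ i" using i X Y by (simp add: eq_neg_iff_add_eq_0 add.commute)
      then show "(Y *\<^sub>v b) $ i = (X *\<^sub>v (- a)) $ i" using i X ab by simp
    qed (use X Y in simp)
    then have "Y *\<^sub>v b \<in> colsp X" using X ab colspI[of X n d "- a"] by simp
    then have b0: "b = 0\<^sub>v f" using r ab by blast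
    then have "X *\<^sub>v a = 0\<^sub>v n" using 0 X Y ab by simp
    then have "a = 0\<^sub>v d" using r ab injmD by blast
    then show "v = 0\<^sub>v (d + f)" using b0 ab by auto
  qed
qed

text \<open>Completion to a basis, one column at a time: fewer than n independent columns span fewer
  vectors than there are in the finite space, so counting supplies a new one.\<close>

lemma injm_extend:
  fixes X :: "'a::{field,finite} mat"
  assumes "injm n d X"
  shows "\<exists>Z\<in>carrier_mat n (n - d). injm n n (hc X Z)"
proof -
  have "\<exists>Z\<in>carrier_mat n k. injm n (d + k) (hc X Z)" if "d + k \<le> n" for k
    using that
  proof (induction k)
    case 0
    have X: "X \<in> carrier_mat n d" using assms by (simp add: injm_def)
    have "injm n (d + 0) (hc X (0\<^sub>m n 0))"
      using X assms by (subst injm_hc_iff) auto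
    then show ?case by (intro bexI[of _ "0\<^sub>m n 0"]) auto
  next
    case (Suc k)
    then obtain Z where Z: "Z \<in> carrier_mat n k" "injm n (d + k) (hc X Z)" by auto
    have X: "X \<in> carrier_mat n d" using assms by (simp add: injm_def)
    let ?W = "hc X Z"
    have W: "?W \<in> carrier_mat n (d + k)" using X Z by simp
    have "card (colsp ?W) < card (carrier_vec n :: 'a vec set)"
      using Suc.prems CARD_gt_1[where 'a='a] by (simp add: card_colsp[OF Z(2)] card_carrier_vec)
    then obtain z where z: "z \<in> carrier_vec n" "z \<notin> colsp ?W"
      using colsp_subset[OF W] by (metis subsetI subset_antisym less_irrefl)
    define z1 where "z1 = mat n 1 (\<lambda>(i, j). z $ i)"
    have z1: "z1 \<in> carrier_mat n 1" by (simp add: z1_def)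
    have z1v: "z1 *\<^sub>v b = b $ 0 \<cdot>\<^sub>v z" if "b \<in> carrier_vec 1" for b
      using that z by (intro eq_vecI) (auto simp: z1_def scalar_prod_def mult.commute)
    have "injm n (d + k + 1) (hc ?W z1)"
      unfolding injm_hc_iff[OF W z1]
    proof (intro conjI ballI impI Z(2))
      fix b :: "'a vec" assume b: "b \<in> carrier_vec 1" "z1 *\<^sub>v b \<in> colsp ?W"
      have "b $ 0 = 0"
      proof (rule ccontr)
        assume nz: "b $ 0 \<noteq> 0"
        have "b $ 0 \<cdot>\<^sub>v z \<in> colsp ?W" using b z1v[OF b(1)] by simp
        then have "inverse (b $ 0) \<cdot>\<^sub>v (b $ 0 \<cdot>\<^sub>v z) \<in> colsp ?W" by (rule colsp_smult[OF W])
        moreover have "inverse (b $ 0) \<cdot>\<^sub>v (b $ 0 \<cdot>\<^sub>v z) = z" using nz by (intro eq_vecI) auto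
        ultimately show False using z by simp
      qed
      then show "b = 0\<^sub>v 1" using b by (intro eq_vecI) auto
    qed
    moreover have "hc ?W z1 = hc X (hc Z z1)"
      using X Z z1 by (intro eq_matI) (auto simp: hc_def)
    ultimately show ?case using Z z1 hc_carrier[OF Z(1) z1] by (intro bexI[of _ "hc Z z1"]) auto
  qed
  from this[of "n - d"] show ?thesis using injm_le[OF assms] by simp
qed

lemma injm_square_inverse:
  fixes P :: "'a::field mat"
  assumes "injm n n P"
  obtains P' where "P' \<in> carrier_mat n n" "P * P' = 1\<^sub>m n" "P' * P = 1\<^sub>m n"
proof -
  have P: "P \<in> carrier_mat n n" using assms by (simp add: injm_def)
  have "det P \<noteq> 0"
    unfolding det_0_iff_vec_prod_zero_field[OF P] using injmD[OF assms] by blast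
  then have "P \<in> Units (ring_mat TYPE('a) n ())" by (rule det_non_zero_imp_unit[OF P])
  then have "\<exists>P'\<in>carrier_mat n n. P' * P = 1\<^sub>m n \<and> P * P' = 1\<^sub>m n"
    unfolding Units_def ring_mat_def by simp
  then show ?thesis using that by blast
qed

section \<open>Invariant subspaces as block triangular forms\<close>

lemma char_poly_four_block_lower_zero:
  fixes T :: "'a::field mat"
  assumes T: "T \<in> carrier_mat d d" and B: "B \<in> carrier_mat d f" and S: "S \<in> carrier_mat f f"
  shows "char_poly (four_block_mat T B (0\<^sub>m f d) S) = char_poly T * char_poly S"
proof -
  let ?M = "four_block_mat T B (0\<^sub>m f d) S"
  have M: "?M \<in> carrier_mat (d + f) (d + f)" using T S by (rule four_block_carrier_mat)
  have idx: "char_poly_matrix A $$ (i, j) = (if i = j then [:0, 1:] else 0) + [:- A $$ (i, j):]"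
    if "A \<in> carrier_mat n n" "i < n" "j < n" for A :: "'a mat" and n i j
    using that by (simp add: char_poly_matrix_def)
  have eq: "char_poly_matrix ?M
      = four_block_mat (char_poly_matrix T) (map_mat (\<lambda>a. [:- a:]) B) (0\<^sub>m f d) (char_poly_matrix S)" (is "?L = ?R")
  proof (rule eq_matI)
    have cT: "char_poly_matrix T \<in> carrier_mat d d" and cS: "char_poly_matrix S \<in> carrier_mat f f"
      using T S by simp_all
    have R: "?R \<in> carrier_mat (d + f) (d + f)" using cT cS by (rule four_block_carrier_mat)
    have L: "?L \<in> carrier_mat (d + f) (d + f)" using M by simp
    show "dim_row ?L = dim_row ?R" "dim_col ?L = dim_col ?R" using L R by (simp_all only: carrier_matD)
    fix i j assume "i < dim_row ?R" "j < dim_col ?R"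
    then have ij: "i < d + f" "j < d + f" using R by (simp_all only: carrier_matD)
    show "?L $$ (i, j) = ?R $$ (i, j)"
      unfolding idx[OF M ij]
    proof (cases "i < d"; cases "j < d")
      assume "i < d" "j < d"
      then show "(if i = j then [:0, 1:] else 0) + [:- ?M $$ (i, j):] = ?R $$ (i, j)"
        using carrier_matD[OF T] carrier_matD[OF S] carrier_matD[OF cT] carrier_matD[OF cS] idx[OF T, of i j] by simp
    next
      assume "i < d" "\<not> j < d"
      then show "(if i = j then [:0, 1:] else 0) + [:- ?M $$ (i, j):] = ?R $$ (i, j)"
        using carrier_matD[OF T] carrier_matD[OF S] carrier_matD[OF cT] carrier_matD[OF cS] carrier_matD[OF B] ij by simp
    next
      assume "\<not> i < d" "j < d"
      then show "(if i = j then [:0, 1:] else 0) + [:- ?M $$ (i, j):] = ?R $$ (i, j)"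
        using carrier_matD[OF T] carrier_matD[OF S] carrier_matD[OF cT] carrier_matD[OF cS] carrier_matD[OF B] ij by simp
    next
      assume "\<not> i < d" "\<not> j < d"
      then show "(if i = j then [:0, 1:] else 0) + [:- ?M $$ (i, j):] = ?R $$ (i, j)"
        using carrier_matD[OF T] carrier_matD[OF S] carrier_matD[OF cT] carrier_matD[OF cS] carrier_matD[OF B] ij
          idx[OF S, of "i - d" "j - d"] by (simp add: eq_diff_iff)
    qed
  qed
  show ?thesis
    unfolding char_poly_def eq using B
    by (intro det_four_block_mat_lower_left_zero[of _ d _ f] char_poly_matrix_closed[OF T] char_poly_matrix_closed[OF S]) auto
qed

text \<open>In a basis that begins with the columns of \<open>X\<close>, the matrix of
  \<open>A\<close> is block triangular with first diagonal block \<open>T\<close>. The equivalence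
  serves two ends: to read off the action \<open>S\<close> on the quotient, and to count all
  \<open>A\<close> with A X = X T through the free blocks \<open>B\<close> and
  \<open>S\<close>.\<close>

lemma invariant_block_form:
  fixes X :: "'a::field mat"
  assumes X: "X \<in> carrier_mat n d" and Z: "Z \<in> carrier_mat n (n - d)" and dn: "d \<le> n"
    and P': "P' \<in> carrier_mat n n" "hc X Z * P' = 1\<^sub>m n" "P' * hc X Z = 1\<^sub>m n"
    and T: "T \<in> carrier_mat d d" and A: "A \<in> carrier_mat n n"
  shows "A * X = X * T \<longleftrightarrow> (\<exists>B\<in>carrier_mat d (n - d). \<exists>S\<in>carrier_mat (n - d) (n - d).
           A = hc X Z * four_block_mat T B (0\<^sub>m (n - d) d) S * P')"
proof
  let ?P = "hc X Z" and ?f = "n - d"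
  have P: "?P \<in> carrier_mat n n" using hc_carrier[OF X Z] dn by simp
  assume AX: "A * X = X * T"
  obtain M1 B M3 S where sp: "split_block (P' * A * ?P) d d = (M1, B, M3, S)" by (cases "split_block (P' * A * ?P) d d")
  have dims: "dim_row (P' * A * ?P) = d + ?f" "dim_col (P' * A * ?P) = d + ?f" using P P' A dn by auto
  note sb = split_block[OF sp dims]
  have M: "P' * A * ?P = four_block_mat M1 B M3 S" by (rule sb(5))
  have "?P * (P' * A * ?P) = A * ?P"
    unfolding assoc_mult_mat[OF P'(1) A P] using A P by (intro mult_inverse_cancel[OF P P'(1,2)]) auto
  also have "\<dots> = hc (X * T) (A * Z)" using mult_hc[OF A X Z] AX by simp
  finally have 1: "?P * four_block_mat M1 B M3 S = hc (X * T) (A * Z)" unfolding M .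
  have "?P * four_block_mat M1 B M3 S = hc (X * M1 + Z * M3) (X * B + Z * S)"
    by (rule hc_mult_four_block[OF X Z sb(1) sb(2) sb(3) sb(4)])
  then have "hc (X * M1 + Z * M3) (X * B + Z * S) = hc (X * T) (A * Z)" using 1 by simp
  then have "X * M1 + Z * M3 = X * T"
    using X Z T A sb by (subst (asm) hc_eq_iff[of _ n d _ ?f]) auto
  then have "?P * four_block_mat M1 (0\<^sub>m d 0) M3 (0\<^sub>m ?f 0) = ?P * four_block_mat T (0\<^sub>m d 0) (0\<^sub>m ?f d) (0\<^sub>m ?f 0)"
    using X Z T sb by (simp add: hc_mult_four_block[of _ n d _ ?f _ d _ 0])
  then have "P' * (?P * four_block_mat M1 (0\<^sub>m d 0) M3 (0\<^sub>m ?f 0)) = P' * (?P * four_block_mat T (0\<^sub>m d 0) (0\<^sub>m ?f d) (0\<^sub>m ?f 0))"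
    by simp
  moreover have "P' * (?P * Q) = Q" if "Q \<in> carrier_mat n d" for Q
    by (rule mult_inverse_cancel[OF P'(1) P P'(3) that])
  moreover have "four_block_mat M1 (0\<^sub>m d 0) M3 (0\<^sub>m ?f 0) \<in> carrier_mat n d"
    "four_block_mat T (0\<^sub>m d 0) (0\<^sub>m ?f d) (0\<^sub>m ?f 0) \<in> carrier_mat n d"
    using sb T dn by auto
  ultimately have eq: "four_block_mat M1 (0\<^sub>m d 0) M3 (0\<^sub>m ?f 0) = four_block_mat T (0\<^sub>m d 0) (0\<^sub>m ?f d) (0\<^sub>m ?f 0)"
    by metis
  have "M1 = T"
  proof (rule eq_matI)
    fix i j assume "i < dim_row T" "j < dim_col T"
    then show "M1 $$ (i, j) = T $$ (i, j)"
      using arg_cong[OF eq, of "\<lambda>M. M $$ (i, j)"] sb T by simp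
  qed (use sb T in auto)
  moreover have "M3 = 0\<^sub>m ?f d"
  proof (rule eq_matI)
    fix i j assume "i < dim_row (0\<^sub>m ?f d :: 'a mat)" "j < dim_col (0\<^sub>m ?f d :: 'a mat)"
    then show "M3 $$ (i, j) = 0\<^sub>m ?f d $$ (i, j)"
      using arg_cong[OF eq, of "\<lambda>M. M $$ (d + i, j)"] sb T by simp
  qed (use sb in auto)
  moreover have "A = ?P * (P' * A * ?P) * P'"
  proof -
    have "?P * (P' * A * ?P) = A * ?P"
      unfolding assoc_mult_mat[OF P'(1) A P] using A P by (intro mult_inverse_cancel[OF P P'(1,2)]) auto
    then show ?thesis using assoc_mult_mat[OF A P P'(1)] P'(2) A by simp
  qed
  ultimately show "\<exists>B\<in>carrier_mat d ?f. \<exists>S\<in>carrier_mat ?f ?f. A = ?P * four_block_mat T B (0\<^sub>m ?f d) S * P'"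
    using sb unfolding M by metis
next
  let ?P = "hc X Z" and ?f = "n - d"
  assume "\<exists>B\<in>carrier_mat d ?f. \<exists>S\<in>carrier_mat ?f ?f. A = ?P * four_block_mat T B (0\<^sub>m ?f d) S * P'"
  then obtain B S where BS: "B \<in> carrier_mat d ?f" "S \<in> carrier_mat ?f ?f"
      "A = ?P * four_block_mat T B (0\<^sub>m ?f d) S * P'" by blast
  have P: "?P \<in> carrier_mat n n" using hc_carrier[OF X Z] dn by simp
  have F: "four_block_mat T B (0\<^sub>m ?f d) S \<in> carrier_mat n n" using T BS dn by auto
  have PF: "?P * four_block_mat T B (0\<^sub>m ?f d) S \<in> carrier_mat n n" using P F by simp
  have "A * ?P = ?P * four_block_mat T B (0\<^sub>m ?f d) S * (P' * ?P)"
    unfolding BS(3) by (rule assoc_mult_mat[OF PF P'(1) P])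
  also have "\<dots> = ?P * four_block_mat T B (0\<^sub>m ?f d) S" unfolding P'(3) by (rule right_mult_one_mat[OF PF])
  also have "\<dots> = hc (X * T + Z * 0\<^sub>m ?f d) (X * B + Z * S)"
    by (rule hc_mult_four_block[OF X Z T BS(1) _ BS(2)]) simp
  finally have "hc (A * X) (A * Z) = hc (X * T + Z * 0\<^sub>m ?f d) (X * B + Z * S)"
    using mult_hc[OF A X Z] by simp
  then have "A * X = X * T + Z * 0\<^sub>m ?f d"
    using X Z T A BS by (subst (asm) hc_eq_iff[of _ n d _ ?f]) auto
  then show "A * X = X * T" using X Z T by simp
qed

text \<open>\<open>S\<close> is the action of \<open>A\<close> on the quotient by the image of
  \<open>X\<close>, and \<open>R\<close> the quotient map: in the adapted basis it drops the first
  \<open>d\<close> coordinates, which is the matrix \<open>J\<close> of the proof.\<close>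

lemma quotient_matrix:
  fixes X :: "'a::{field,finite} mat"
  assumes inj: "injm n d X" and T: "T \<in> carrier_mat d d" and A: "A \<in> carrier_mat n n" and AX: "A * X = X * T"
  obtains S R where "S \<in> carrier_mat (n - d) (n - d)" "R \<in> carrier_mat (n - d) n" "R * A = S * R"
    "\<And>y. y \<in> carrier_vec n \<Longrightarrow> R *\<^sub>v y = 0\<^sub>v (n - d) \<longleftrightarrow> y \<in> colsp X"
    "\<And>w. w \<in> carrier_vec (n - d) \<Longrightarrow> \<exists>y\<in>carrier_vec n. R *\<^sub>v y = w"
    "char_poly A = char_poly T * char_poly S"
proof -
  let ?f = "n - d"
  have X: "X \<in> carrier_mat n d" and dn: "d \<le> n" using inj injm_le by (auto simp: injm_def)
  obtain Z where Z: "Z \<in> carrier_mat n ?f" "injm n n (hc X Z)" using injm_extend[OF inj] by blast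
  let ?P = "hc X Z"
  obtain P' where P': "P' \<in> carrier_mat n n" "?P * P' = 1\<^sub>m n" "P' * ?P = 1\<^sub>m n" using injm_square_inverse[OF Z(2)] by blast
  have P: "?P \<in> carrier_mat n n" using hc_carrier[OF X Z(1)] dn by simp
  obtain B S where BS: "B \<in> carrier_mat d ?f" "S \<in> carrier_mat ?f ?f" "A = ?P * four_block_mat T B (0\<^sub>m ?f d) S * P'"
    using invariant_block_form[OF X Z(1) dn P' T A] AX by blast
  let ?F = "four_block_mat T B (0\<^sub>m ?f d) S"
  have F: "?F \<in> carrier_mat n n" using T BS dn by auto
  define J :: "'a mat" where "J = mat ?f n (\<lambda>(i, j). if j = d + i then 1 else 0)"
  have J: "J \<in> carrier_mat ?f n" by (simp add: J_def)
  have rowJ: "row J i = unit_vec n (d + i)" if "i < ?f" for i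
    using that by (intro eq_vecI) (auto simp: J_def unit_vec_def)
  have colJ: "col J j = (if j < d then 0\<^sub>v ?f else unit_vec ?f (j - d))" if "j < n" for j
    using that by (intro eq_vecI) (auto simp: J_def unit_vec_def)
  have JF: "J * ?F = S * J"
  proof (rule eq_matI)
    fix i j assume "i < dim_row (S * J)" "j < dim_col (S * J)"
    then have ij: "i < ?f" "j < n" using BS(2) J by simp_all
    have colF: "col ?F j \<in> carrier_vec n" using F ij by simp
    have "(J * ?F) $$ (i, j) = unit_vec n (d + i) \<bullet> col ?F j"
      using ij J F rowJ by (metis carrier_matD index_mult_mat(1))
    also have "\<dots> = col ?F j $ (d + i)" using colF ij by (intro scalar_prod_left_unit) auto
    also have "\<dots> = ?F $$ (d + i, j)" using carrier_matD[OF F] ij by (intro index_col) linarith+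
    also have "\<dots> = (if j < d then 0 else S $$ (i, j - d))"
      using ij T BS(2) dn by (subst index_mat_four_block(1)) auto
    also have "\<dots> = row S i \<bullet> col J j"
      using ij BS(2) by (simp add: colJ)
    also have "\<dots> = (S * J) $$ (i, j)" using ij BS(2) J by simp
    finally show "(J * ?F) $$ (i, j) = (S * J) $$ (i, j)" .
  qed (use BS(2) J F in \<open>simp_all only: index_mult_mat carrier_matD\<close>)
  have Jv: "J *\<^sub>v (a @\<^sub>v b) = b" if ab: "a \<in> carrier_vec d" "b \<in> carrier_vec ?f" for a b
  proof (rule eq_vecI)
    fix i assume "i < dim_vec b"
    then have i: "i < ?f" using ab by simp
    have v: "a @\<^sub>v b \<in> carrier_vec n" using append_carrier_vec[OF ab] dn by simp
    have "(J *\<^sub>v (a @\<^sub>v b)) $ i = unit_vec n (d + i) \<bullet> (a @\<^sub>v b)" using i J rowJ by simp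
    also have "\<dots> = (a @\<^sub>v b) $ (d + i)" using v i by (intro scalar_prod_left_unit) auto
    also have "\<dots> = b $ i" using i ab by simp
    finally show "(J *\<^sub>v (a @\<^sub>v b)) $ i = b $ i" .
  qed (use J ab in simp)
  define R where "R = J * P'"
  show ?thesis
  proof (rule that[of S R])
    show "S \<in> carrier_mat ?f ?f" by (rule BS)
    show Pi: "R \<in> carrier_mat ?f n" unfolding R_def using J P' by simp
    have FP: "?F * P' \<in> carrier_mat n n" using F P' by simp
    have "R * A = J * (P' * A)" unfolding R_def by (rule assoc_mult_mat[OF J P'(1) A])
    also have "P' * A = ?F * P'"
      unfolding BS(3) assoc_mult_mat[OF P F P'(1)] by (rule mult_inverse_cancel[OF P'(1) P P'(3) FP])
    also have "J * (?F * P') = (J * ?F) * P'" by (rule assoc_mult_mat[OF J F P'(1), symmetric])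
    also have "\<dots> = S * R" unfolding JF R_def by (rule assoc_mult_mat[OF BS(2) J P'(1)])
    finally show "R * A = S * R" .
    have PiP: "R *\<^sub>v (?P *\<^sub>v (a @\<^sub>v b)) = b" if ab: "a \<in> carrier_vec d" "b \<in> carrier_vec ?f" for a b
    proof -
      have v: "a @\<^sub>v b \<in> carrier_vec n" using ab dn append_carrier_vec[OF ab] by simp
      have Pv: "?P *\<^sub>v (a @\<^sub>v b) \<in> carrier_vec n" using P v by simp
      have "R *\<^sub>v (?P *\<^sub>v (a @\<^sub>v b)) = J *\<^sub>v (P' *\<^sub>v (?P *\<^sub>v (a @\<^sub>v b)))"
        unfolding R_def by (rule assoc_mult_mat_vec[OF J P'(1) Pv])
      also have "P' *\<^sub>v (?P *\<^sub>v (a @\<^sub>v b)) = a @\<^sub>v b"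
        unfolding assoc_mult_mat_vec[OF P'(1) P v, symmetric] P'(3) using v by simp
      finally show ?thesis using Jv[OF ab] by simp
    qed
    have surj: "\<exists>a b. a \<in> carrier_vec d \<and> b \<in> carrier_vec ?f \<and> y = ?P *\<^sub>v (a @\<^sub>v b)" if y: "y \<in> carrier_vec n" for y
    proof -
      have "P' *\<^sub>v y \<in> carrier_vec (d + ?f)" using P' y dn by simp
      then obtain a b where ab: "a \<in> carrier_vec d" "b \<in> carrier_vec ?f" "P' *\<^sub>v y = a @\<^sub>v b" by (elim vec_split)
      have "?P *\<^sub>v (P' *\<^sub>v y) = (?P * P') *\<^sub>v y" by (rule assoc_mult_mat_vec[OF P P'(1) y, symmetric])
      then show ?thesis using ab P' y by (metis one_mult_mat_vec)
    qed
    show "R *\<^sub>v y = 0\<^sub>v ?f \<longleftrightarrow> y \<in> colsp X" if y: "y \<in> carrier_vec n" for y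
    proof -
      obtain a b where ab: "a \<in> carrier_vec d" "b \<in> carrier_vec ?f" "y = ?P *\<^sub>v (a @\<^sub>v b)" using surj[OF y] by blast
      have y_eq: "y = X *\<^sub>v a + Z *\<^sub>v b" unfolding ab(3) by (rule hc_mult_vec[OF X Z(1) ab(1,2)])
      show ?thesis
      proof
        assume "R *\<^sub>v y = 0\<^sub>v ?f"
        then have "b = 0\<^sub>v ?f" using PiP[OF ab(1,2)] ab(3) by simp
        then have "y = X *\<^sub>v a" using y_eq X Z ab by simp
        then show "y \<in> colsp X" using colspI[OF X ab(1)] by simp
      next
        assume "y \<in> colsp X"
        then obtain c where c: "c \<in> carrier_vec d" "y = X *\<^sub>v c" using X by (auto elim: colspE)
        have "?P *\<^sub>v (c @\<^sub>v 0\<^sub>v ?f) = y" using hc_mult_vec[OF X Z(1) c(1), of "0\<^sub>v ?f"] c X Z by simp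
        then show "R *\<^sub>v y = 0\<^sub>v ?f" using PiP[OF c(1), of "0\<^sub>v ?f"] by simp
      qed
    qed
    show "\<exists>y\<in>carrier_vec n. R *\<^sub>v y = w" if w: "w \<in> carrier_vec ?f" for w
    proof
      show "R *\<^sub>v (?P *\<^sub>v (0\<^sub>v d @\<^sub>v w)) = w" by (rule PiP[OF zero_carrier_vec w])
      have "0\<^sub>v d @\<^sub>v w \<in> carrier_vec n" using append_carrier_vec[OF zero_carrier_vec[of d] w] dn by simp
      then show "?P *\<^sub>v (0\<^sub>v d @\<^sub>v w) \<in> carrier_vec n" using P by simp
    qed
    have "similar_mat A ?F"
      unfolding similar_mat_def similar_mat_wit_def
      using P P' A F BS(3) carrier_matD(1)[OF A]
      by (intro exI[of _ ?P] exI[of _ P']) (simp only: Let_def insert_subset empty_subsetI simp_thms)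
    then show "char_poly A = char_poly T * char_poly S"
      using char_poly_similar char_poly_four_block_lower_zero[OF T BS(1,2)] by metis
  qed
qed

section \<open>The module structure of a matrix\<close>

text \<open>p(A) v by Horner's rule on vectors: the action of the polynomial ring on the module of
  \<open>A\<close>, without forming powers of the matrix.\<close>

definition pact :: "'a::field mat \<Rightarrow> 'a poly \<Rightarrow> 'a vec \<Rightarrow> 'a vec" where
  "pact A p v = fold_coeffs (\<lambda>a w. a \<cdot>\<^sub>v v + A *\<^sub>v w) p (0\<^sub>v (dim_row A))"

lemma pact_0 [simp]: "pact A 0 v = 0\<^sub>v (dim_row A)"
  by (simp add: pact_def)

lemma pact_pCons:
  assumes "A \<in> carrier_mat n n" "v \<in> carrier_vec n"
  shows "pact A (pCons a p) v = a \<cdot>\<^sub>v v + A *\<^sub>v pact A p v"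
proof (cases "a = 0 \<and> p = 0")
  case True
  have "0 \<cdot>\<^sub>v v + A *\<^sub>v 0\<^sub>v (dim_row A) = 0\<^sub>v (dim_row A)"
    using assms by (intro eq_vecI) auto
  then show ?thesis using True by simp
next
  case False
  then show ?thesis
    unfolding pact_def by (cases "a = 0") (simp_all add: fold_coeffs_pCons_coeff_not_0_eq fold_coeffs_pCons_not_0_0_eq)
qed

lemma pact_carrier [simp, intro]:
  assumes "A \<in> carrier_mat n n" "v \<in> carrier_vec n"
  shows "pact A p v \<in> carrier_vec n"
proof (induction p)
  case (pCons a p)
  then show ?case using assms by (simp add: pact_pCons[OF assms])
qed (use assms in simp)

lemma pact_add:
  assumes A: "A \<in> carrier_mat n n" and v: "v \<in> carrier_vec n"
  shows "pact A (p + q) v = pact A p v + pact A q v"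
proof (induction p q rule: poly_induct2)
  case 0
  show ?case using A by (intro eq_vecI) auto
next
  case (pCons a p b q)
  have c: "pact A p v \<in> carrier_vec n" "pact A q v \<in> carrier_vec n" using A v by auto
  have "pact A (pCons a p + pCons b q) v = (a + b) \<cdot>\<^sub>v v + A *\<^sub>v (pact A p v + pact A q v)"
    by (simp add: pact_pCons[OF A v] pCons)
  also have "A *\<^sub>v (pact A p v + pact A q v) = A *\<^sub>v pact A p v + A *\<^sub>v pact A q v"
    by (rule mult_add_distrib_mat_vec[OF A c])
  also have "(a + b) \<cdot>\<^sub>v v + (A *\<^sub>v pact A p v + A *\<^sub>v pact A q v) =
      (a \<cdot>\<^sub>v v + A *\<^sub>v pact A p v) + (b \<cdot>\<^sub>v v + A *\<^sub>v pact A q v)" (is "?l = ?r")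
  proof (rule eq_vecI)
    fix i assume "i < dim_vec ?r"
    then have i: "i < n" using A v by simp
    have d: "dim_vec (A *\<^sub>v pact A p v) = n" "dim_vec (A *\<^sub>v pact A q v) = n" "dim_vec v = n" using A v by auto
    show "?l $ i = ?r $ i"
      using i d by (simp add: algebra_simps del: dim_mult_mat_vec index_mult_mat_vec)
  qed (use A v in simp)
  finally show ?case by (simp add: pact_pCons[OF A v])
qed

lemma pact_smult:
  assumes A: "A \<in> carrier_mat n n" and v: "v \<in> carrier_vec n"
  shows "pact A (Polynomial.smult c p) v = c \<cdot>\<^sub>v pact A p v"
proof (induction p)
  case 0
  show ?case using A by (intro eq_vecI) auto
next
  case (pCons a p)
  have w: "pact A p v \<in> carrier_vec n" using A v by auto
  have "pact A (Polynomial.smult c (pCons a p)) v = (c * a) \<cdot>\<^sub>v v + A *\<^sub>v (c \<cdot>\<^sub>v pact A p v)"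
    by (simp add: pact_pCons[OF A v] pCons)
  also have "A *\<^sub>v (c \<cdot>\<^sub>v pact A p v) = c \<cdot>\<^sub>v (A *\<^sub>v pact A p v)" by (rule mult_mat_vec[OF A w])
  also have "(c * a) \<cdot>\<^sub>v v + c \<cdot>\<^sub>v (A *\<^sub>v pact A p v) = c \<cdot>\<^sub>v (a \<cdot>\<^sub>v v + A *\<^sub>v pact A p v)"
    using A v by (intro eq_vecI) (auto simp: distrib_left mult.assoc simp del: index_mult_mat_vec)
  finally show ?case by (simp add: pact_pCons[OF A v])
qed

lemma pact_1 [simp]:
  assumes "A \<in> carrier_mat n n" "v \<in> carrier_vec n"
  shows "pact A 1 v = v"
proof -
  have "pact A [:1:] v = 1 \<cdot>\<^sub>v v + A *\<^sub>v 0\<^sub>v n" using assms by (simp add: pact_pCons[OF assms])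
  also have "\<dots> = v" using assms by (intro eq_vecI) auto
  finally show ?thesis by (simp add: one_pCons)
qed

lemma pact_mult:
  assumes A: "A \<in> carrier_mat n n" and v: "v \<in> carrier_vec n"
  shows "pact A (p * q) v = pact A p (pact A q v)"
proof (induction p)
  case 0
  show ?case by simp
next
  case (pCons a p)
  have w: "pact A q v \<in> carrier_vec n" using A v by auto
  have z: "0 \<cdot>\<^sub>v v + A *\<^sub>v pact A p (pact A q v) = A *\<^sub>v pact A p (pact A q v)"
    using A v by (intro eq_vecI) (auto simp del: index_mult_mat_vec)
  have "pact A (pCons a p * q) v = pact A (Polynomial.smult a q) v + pact A (pCons 0 (p * q)) v"
    by (simp add: pact_add[OF A v] algebra_simps)
  also have "\<dots> = a \<cdot>\<^sub>v pact A q v + A *\<^sub>v pact A p (pact A q v)"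
    unfolding pact_smult[OF A v] pact_pCons[OF A v] pCons z ..
  finally show ?case unfolding pact_pCons[OF A w] .
qed

text \<open>A X = X T makes \<open>X\<close> a module homomorphism. The same fact with other
  intertwiners gives commutation with \<open>A\<close> and compatibility with quotient maps.\<close>

lemma pact_intertwine:
  assumes A: "A \<in> carrier_mat n n" and T: "T \<in> carrier_mat d d" and X: "X \<in> carrier_mat n d"
    and AX: "A * X = X * T" and v: "v \<in> carrier_vec d"
  shows "pact A p (X *\<^sub>v v) = X *\<^sub>v pact T p v"
proof (induction p)
  case 0
  show ?case using A T X by (intro eq_vecI) auto
next
  case (pCons a p)
  have w: "pact T p v \<in> carrier_vec d" "T *\<^sub>v pact T p v \<in> carrier_vec d" using T v by auto
  have Xv: "X *\<^sub>v v \<in> carrier_vec n" using X v by (rule mult_mat_vec_carrier)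
  have "pact A (pCons a p) (X *\<^sub>v v) = a \<cdot>\<^sub>v (X *\<^sub>v v) + A *\<^sub>v (X *\<^sub>v pact T p v)"
    unfolding pact_pCons[OF A Xv] pCons ..
  also have "A *\<^sub>v (X *\<^sub>v pact T p v) = X *\<^sub>v (T *\<^sub>v pact T p v)"
    unfolding assoc_mult_mat_vec[OF A X w(1), symmetric] AX by (rule assoc_mult_mat_vec[OF X T w(1)])
  also have "a \<cdot>\<^sub>v (X *\<^sub>v v) = X *\<^sub>v (a \<cdot>\<^sub>v v)" by (rule mult_mat_vec[OF X v, symmetric])
  also have "X *\<^sub>v (a \<cdot>\<^sub>v v) + X *\<^sub>v (T *\<^sub>v pact T p v) = X *\<^sub>v (a \<cdot>\<^sub>v v + T *\<^sub>v pact T p v)"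
    using v by (intro mult_add_distrib_mat_vec[OF X _ w(2), symmetric]) simp
  finally show ?case unfolding pact_pCons[OF T v] .
qed

lemma pact_commute_mat:
  assumes "A \<in> carrier_mat n n" "v \<in> carrier_vec n"
  shows "pact A p (A *\<^sub>v v) = A *\<^sub>v pact A p v"
  by (rule pact_intertwine[OF assms(1,1,1) refl assms(2)])

lemma pact_vec_add:
  assumes A: "A \<in> carrier_mat n n" and v: "v \<in> carrier_vec n" "w \<in> carrier_vec n"
  shows "pact A p (v + w) = pact A p v + pact A p w"
proof (induction p)
  case 0
  show ?case using A by (intro eq_vecI) auto
next
  case (pCons a p)
  have c: "pact A p v \<in> carrier_vec n" "pact A p w \<in> carrier_vec n" using A v by auto
  have vw: "v + w \<in> carrier_vec n" using v by simp
  have "pact A (pCons a p) (v + w) = a \<cdot>\<^sub>v (v + w) + A *\<^sub>v (pact A p v + pact A p w)"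
    unfolding pact_pCons[OF A vw] pCons ..
  also have "A *\<^sub>v (pact A p v + pact A p w) = A *\<^sub>v pact A p v + A *\<^sub>v pact A p w"
    by (rule mult_add_distrib_mat_vec[OF A c])
  also have "a \<cdot>\<^sub>v (v + w) + (A *\<^sub>v pact A p v + A *\<^sub>v pact A p w) =
      (a \<cdot>\<^sub>v v + A *\<^sub>v pact A p v) + (a \<cdot>\<^sub>v w + A *\<^sub>v pact A p w)" (is "?l = ?r")
  proof (rule eq_vecI)
    fix i assume "i < dim_vec ?r"
    then have i: "i < n" using A v by simp
    have d: "dim_vec (A *\<^sub>v pact A p v) = n" "dim_vec (A *\<^sub>v pact A p w) = n" using A v by auto
    show "?l $ i = ?r $ i"
      using i d v by (simp add: algebra_simps del: dim_mult_mat_vec index_mult_mat_vec)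
  qed (use A v in simp)
  finally show ?case unfolding pact_pCons[OF A v(1)] pact_pCons[OF A v(2)] .
qed

lemma pact_vec_smult:
  assumes A: "A \<in> carrier_mat n n" and v: "v \<in> carrier_vec n"
  shows "pact A p (c \<cdot>\<^sub>v v) = c \<cdot>\<^sub>v pact A p v"
proof (induction p)
  case 0
  show ?case using A by (intro eq_vecI) auto
next
  case (pCons a p)
  have w: "pact A p v \<in> carrier_vec n" using A v by auto
  have cv: "c \<cdot>\<^sub>v v \<in> carrier_vec n" using v by simp
  have "pact A (pCons a p) (c \<cdot>\<^sub>v v) = a \<cdot>\<^sub>v (c \<cdot>\<^sub>v v) + A *\<^sub>v (c \<cdot>\<^sub>v pact A p v)"
    unfolding pact_pCons[OF A cv] pCons ..
  also have "A *\<^sub>v (c \<cdot>\<^sub>v pact A p v) = c \<cdot>\<^sub>v (A *\<^sub>v pact A p v)" by (rule mult_mat_vec[OF A w])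
  also have "a \<cdot>\<^sub>v (c \<cdot>\<^sub>v v) + c \<cdot>\<^sub>v (A *\<^sub>v pact A p v) = c \<cdot>\<^sub>v (a \<cdot>\<^sub>v v + A *\<^sub>v pact A p v)"
    using A v by (intro eq_vecI) (auto simp: algebra_simps simp del: index_mult_mat_vec)
  finally show ?case unfolding pact_pCons[OF A v] .
qed

lemma pact_index_sum:
  assumes A: "A \<in> carrier_mat n n" and v: "v \<in> carrier_vec n" and i: "i < n"
  shows "pact A (\<Sum>l\<in>I. g l) v $ i = (\<Sum>l\<in>I. pact A (g l) v $ i)"
proof (induction I rule: infinite_finite_induct)
  case (insert l I)
  have "pact A (g l + (\<Sum>l\<in>I. g l)) v $ i = (pact A (g l) v + pact A (\<Sum>l\<in>I. g l) v) $ i"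
    by (simp only: pact_add[OF A v])
  also have "\<dots> = pact A (g l) v $ i + pact A (\<Sum>l\<in>I. g l) v $ i"
    using i carrier_vecD[OF pact_carrier[OF A v]] by (intro index_add_vec(1)) simp
  finally show ?case using insert by simp
qed (use A i in auto)

section \<open>The Cayley-Hamilton theorem\<close>

text \<open>Column k of the adjugate of tI - A has polynomial entries \<open>U j\<close>; row i of
  tI - A times this column is the characteristic polynomial for i = k and 0 otherwise. Letting row i
  of the identity act on e_i and summing over i leaves, for each j, A U_j(A) e_j minus U_j(A)
  applied to the sum of the A_ij e_i. That sum is A e_j, so everything cancels.\<close>

lemma cayley_hamilton_unit:
  fixes A :: "'a::field mat"
  assumes A: "A \<in> carrier_mat n n" and k: "k < n"
  shows "pact A (char_poly A) (unit_vec n k) = 0\<^sub>v n"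
proof (rule eq_vecI)
  define M where "M = char_poly_matrix A"
  define N where "N = adj_mat M"
  define e :: "nat \<Rightarrow> 'a vec" where "e = unit_vec n"
  have M: "M \<in> carrier_mat n n" using A by (simp add: M_def)
  have N: "N \<in> carrier_mat n n" and MN: "M * N = det M \<cdot>\<^sub>m 1\<^sub>m n" using adj_mat[OF M] by (auto simp: N_def)
  have e: "e i \<in> carrier_vec n" for i by (simp add: e_def)
  have Mi: "M $$ (i, j) = (if i = j then [:0, 1:] else 0) + [:- A $$ (i, j):]" if "i < n" "j < n" for i j
    using that A by (simp add: M_def char_poly_matrix_def)
  define U where "U = (\<lambda>j. N $$ (j, k))"
  have MU: "(\<Sum>j<n. M $$ (i, j) * U j) = (if i = k then char_poly A else 0)" if i: "i < n" for i
  proof -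
    have "(\<Sum>j<n. M $$ (i, j) * U j) = (M * N) $$ (i, k)"
      using i k M N by (simp add: U_def scalar_prod_def lessThan_atLeast0)
    also have "\<dots> = (if i = k then char_poly A else 0)"
      unfolding MN using i k by (simp add: char_poly_def M_def)
    finally show ?thesis .
  qed
  fix r assume "r < dim_vec (0\<^sub>v n :: 'a vec)"
  then have r: "r < n" by simp
  have dimp: "dim_vec (pact A p (e i)) = n" for p i using carrier_vecD[OF pact_carrier[OF A e]] .
  have Ae: "(\<Sum>i<n. A $$ (i, j) * pact A p (e i) $ r) = (A *\<^sub>v pact A p (e j)) $ r" if j: "j < n" for j p
  proof -
    have "pact A p (A *\<^sub>v e j) = pact A p (vec n (\<lambda>i. A $$ (i, j)))"
    proof (rule arg_cong[where f = "pact A p"], rule eq_vecI)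
      fix i assume "i < dim_vec (vec n (\<lambda>i. A $$ (i, j)))"
      then show "(A *\<^sub>v e j) $ i = vec n (\<lambda>i. A $$ (i, j)) $ i" using A j by (simp add: e_def)
    qed (use A in simp)
    also have "pact A p (vec n (\<lambda>i. A $$ (i, j))) $ r = (\<Sum>i<n. A $$ (i, j) * pact A p (e i) $ r)"
    proof -
      have "pact A p (vec n (\<lambda>i. if i < m then c i else 0)) $ r = (\<Sum>i<m. c i * pact A p (e i) $ r)" if "m \<le> n" for m c
        using that
      proof (induction m)
        case 0
        have "vec n (\<lambda>i. if i < 0 then c i else 0) = 0 \<cdot>\<^sub>v e 0" by (intro eq_vecI) (auto simp: e_def)
        then show ?case using r dimp by (simp add: pact_vec_smult[OF A e])
      next
        case (Suc m)
        have "vec n (\<lambda>i. if i < Suc m then c i else 0) = vec n (\<lambda>i. if i < m then c i else 0) + c m \<cdot>\<^sub>v e m"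
          using Suc.prems by (intro eq_vecI) (auto simp: e_def unit_vec_def less_Suc_eq)
        then have "pact A p (vec n (\<lambda>i. if i < Suc m then c i else 0)) =
            pact A p (vec n (\<lambda>i. if i < m then c i else 0)) + c m \<cdot>\<^sub>v pact A p (e m)"
          using pact_vec_add[OF A vec_carrier, of "c m \<cdot>\<^sub>v e m" p] e by (simp add: pact_vec_smult[OF A e])
        then show ?case using Suc r dimp by simp
      qed
      note * = this[of n "\<lambda>i. A $$ (i, j)", OF order_refl]
      have "vec n (\<lambda>i. if i < n then A $$ (i, j) else 0) = vec n (\<lambda>i. A $$ (i, j))"
        by (intro eq_vecI) auto
      then show ?thesis using * by (simp only:)
    qed
    finally show ?thesis unfolding pact_commute_mat[OF A e] by simp
  qed
  have "pact A (char_poly A) (e k) $ r = (\<Sum>i<n. pact A (\<Sum>j<n. M $$ (i, j) * U j) (e i) $ r)"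
  proof -
    have "(\<Sum>i<n. pact A (\<Sum>j<n. M $$ (i, j) * U j) (e i) $ r) = (\<Sum>i<n. if i = k then pact A (char_poly A) (e k) $ r else 0)"
      using r A by (intro sum.cong refl) (simp add: MU)
    then show ?thesis using k by simp
  qed
  also have "\<dots> = (\<Sum>i<n. \<Sum>j<n. pact A (M $$ (i, j) * U j) (e i) $ r)"
    by (simp only: pact_index_sum[OF A e r])
  also have "\<dots> = (\<Sum>i<n. \<Sum>j<n. (if i = j then (A *\<^sub>v pact A (U j) (e j)) $ r else 0) - A $$ (i, j) * pact A (U j) (e i) $ r)"
  proof (intro sum.cong refl)
    fix i j assume "i \<in> {..<n}" "j \<in> {..<n}"
    then have ij: "i < n" "j < n" by auto
    have "M $$ (i, j) * U j = (if i = j then pCons 0 (U j) else 0) + Polynomial.smult (- A $$ (i, j)) (U j)"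
      by (simp add: Mi[OF ij] algebra_simps)
    then have "pact A (M $$ (i, j) * U j) (e i) = pact A (if i = j then pCons 0 (U j) else 0) (e i) + (- A $$ (i, j)) \<cdot>\<^sub>v pact A (U j) (e i)"
      by (simp only: pact_add[OF A e] pact_smult[OF A e])
    also have "\<dots> $ r = pact A (if i = j then pCons 0 (U j) else 0) (e i) $ r - A $$ (i, j) * pact A (U j) (e i) $ r"
      using r dimp by simp
    also have "pact A (if i = j then pCons 0 (U j) else 0) (e i) $ r = (if i = j then (A *\<^sub>v pact A (U j) (e j)) $ r else 0)"
    proof (cases "i = j")
      case True
      have "pact A (pCons 0 (U j)) (e j) $ r = (0 \<cdot>\<^sub>v e j + A *\<^sub>v pact A (U j) (e j)) $ r"
        by (simp only: pact_pCons[OF A e])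
      also have "\<dots> = (A *\<^sub>v pact A (U j) (e j)) $ r" using r A e by (simp add: e_def)
      finally show ?thesis using True by simp
    qed (use A r in simp)
    finally show "pact A (M $$ (i, j) * U j) (e i) $ r = (if i = j then (A *\<^sub>v pact A (U j) (e j)) $ r else 0) - A $$ (i, j) * pact A (U j) (e i) $ r" .
  qed
  also have "\<dots> = (\<Sum>i<n. \<Sum>j<n. if i = j then (A *\<^sub>v pact A (U j) (e j)) $ r else 0)
      - (\<Sum>i<n. \<Sum>j<n. A $$ (i, j) * pact A (U j) (e i) $ r)"
    by (simp only: sum_subtractf)
  also have "(\<Sum>i<n. \<Sum>j<n. if i = j then (A *\<^sub>v pact A (U j) (e j)) $ r else 0) = (\<Sum>i<n. (A *\<^sub>v pact A (U i) (e i)) $ r)"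
    by (simp del: index_mult_mat_vec)
  also have "(\<Sum>i<n. \<Sum>j<n. A $$ (i, j) * pact A (U j) (e i) $ r) = (\<Sum>j<n. \<Sum>i<n. A $$ (i, j) * pact A (U j) (e i) $ r)"
    by (rule sum.swap)
  also have "(\<Sum>j<n. \<Sum>i<n. A $$ (i, j) * pact A (U j) (e i) $ r) = (\<Sum>j<n. (A *\<^sub>v pact A (U j) (e j)) $ r)"
    by (intro sum.cong refl Ae) simp
  finally show "pact A (char_poly A) (unit_vec n k) $ r = 0\<^sub>v n $ r" using r by (simp add: e_def)
qed (use carrier_vecD[OF pact_carrier[OF A]] in simp)

theorem cayley_hamilton:
  fixes A :: "'a::field mat"
  assumes A: "A \<in> carrier_mat n n" and v: "v \<in> carrier_vec n"
  shows "pact A (char_poly A) v = 0\<^sub>v n"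
proof -
  let ?c = "char_poly A"
  have "pact A ?c (vec n (\<lambda>i. if i < m then v $ i else 0)) = 0\<^sub>v n" if "m \<le> n" for m
    using that
  proof (induction m)
    case 0
    have "vec n (\<lambda>i. if i < 0 then v $ i else 0) = 0 \<cdot>\<^sub>v v" using v by (intro eq_vecI) auto
    then have "pact A ?c (vec n (\<lambda>i. if i < 0 then v $ i else 0)) = 0 \<cdot>\<^sub>v pact A ?c v"
      by (simp only: pact_vec_smult[OF A v])
    also have "\<dots> = 0\<^sub>v n" using carrier_vecD[OF pact_carrier[OF A v]] by (intro eq_vecI) auto
    finally show ?case .
  next
    case (Suc m)
    have e: "unit_vec n m \<in> carrier_vec n" "v $ m \<cdot>\<^sub>v unit_vec n m \<in> carrier_vec n" by auto
    have split: "vec n (\<lambda>i. if i < Suc m then v $ i else 0) = vec n (\<lambda>i. if i < m then v $ i else 0) + v $ m \<cdot>\<^sub>v unit_vec n m"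
      using Suc.prems by (intro eq_vecI) (auto simp: unit_vec_def less_Suc_eq)
    have "pact A ?c (vec n (\<lambda>i. if i < Suc m then v $ i else 0)) = 0\<^sub>v n + v $ m \<cdot>\<^sub>v 0\<^sub>v n"
      unfolding split pact_vec_add[OF A vec_carrier e(2)] pact_vec_smult[OF A e(1)]
      using Suc cayley_hamilton_unit[OF A, of m] by simp
    also have "0\<^sub>v n + v $ m \<cdot>\<^sub>v 0\<^sub>v n = 0\<^sub>v n" by (intro eq_vecI) auto
    finally show ?case .
  qed
  from this[of n] have "pact A ?c (vec n (\<lambda>i. if i < n then v $ i else 0)) = 0\<^sub>v n" by simp
  also have "vec n (\<lambda>i. if i < n then v $ i else 0) = v" using v by (intro eq_vecI) auto
  finally show ?thesis .
qed

section \<open>Krylov matrices\<close>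

lemma pact_in_colsp:
  fixes A X :: "'a::field mat"
  assumes A: "A \<in> carrier_mat n n" and T: "T \<in> carrier_mat d d" and X: "X \<in> carrier_mat n d"
    and AX: "A * X = X * T" and y: "y \<in> colsp X"
  shows "pact A p y \<in> colsp X"
proof -
  obtain v where v: "v \<in> carrier_vec d" "y = X *\<^sub>v v" using y X by (rule colspE)
  show ?thesis
    unfolding v(2) pact_intertwine[OF A T X AX v(1)] by (rule colspI[OF X pact_carrier[OF T v(1)]])
qed

text \<open>Columns y, A y, ..., A^(f-1) y; multiplying by a coefficient vector evaluates a
  polynomial in \<open>A\<close> at \<open>y\<close>.\<close>

definition krylov :: "'a::field mat \<Rightarrow> 'a vec \<Rightarrow> nat \<Rightarrow> 'a mat" where
  "krylov A y f = mat (dim_row A) f (\<lambda>(i, l). pact A (Polynomial.monom 1 l) y $ i)"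

lemma krylov_carrier [simp]: "A \<in> carrier_mat n n \<Longrightarrow> krylov A y f \<in> carrier_mat n f"
  by (simp add: krylov_def)

lemma col_krylov:
  assumes "A \<in> carrier_mat n n" "y \<in> carrier_vec n" "l < f"
  shows "col (krylov A y f) l = pact A (Polynomial.monom 1 l) y"
proof -
  have d: "dim_vec (pact A (Polynomial.monom 1 l) y) = n"
    using carrier_vecD[OF pact_carrier[OF assms(1,2)]] .
  show ?thesis using assms by (intro eq_vecI) (auto simp: krylov_def d)
qed

lemma krylov_mult_vec:
  fixes A :: "'a::field mat"
  assumes A: "A \<in> carrier_mat n n" and y: "y \<in> carrier_vec n" and p: "\<And>l. f \<le> l \<Longrightarrow> Polynomial.coeff p l = 0"
  shows "krylov A y f *\<^sub>v vec f (Polynomial.coeff p) = pact A p y"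
proof (rule eq_vecI)
  have dimp: "dim_vec (pact A p y) = n" using carrier_vecD[OF pact_carrier[OF A y]] .
  fix i assume "i < dim_vec (pact A p y)"
  then have i: "i < n" using dimp by simp
  have "p = (\<Sum>l<f. Polynomial.smult (Polynomial.coeff p l) (Polynomial.monom 1 l))"
    using p by (intro poly_eqI) (auto simp: coeff_sum smult_monom if_distrib sum.delta not_less cong: if_cong)
  then have "pact A p y $ i = pact A (\<Sum>l<f. Polynomial.smult (Polynomial.coeff p l) (Polynomial.monom 1 l)) y $ i" by simp
  also have "\<dots> = (\<Sum>l<f. Polynomial.coeff p l * pact A (Polynomial.monom 1 l) y $ i)"
    unfolding pact_index_sum[OF A y i] pact_smult[OF A y]
    using i carrier_vecD[OF pact_carrier[OF A y]] by simp
  also have "\<dots> = (krylov A y f *\<^sub>v vec f (Polynomial.coeff p)) $ i"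
    using i A by (simp add: krylov_def scalar_prod_def lessThan_atLeast0 mult.commute)
  finally show "(krylov A y f *\<^sub>v vec f (Polynomial.coeff p)) $ i = pact A p y $ i" by simp
qed (use A carrier_vecD[OF pact_carrier[OF A y]] in \<open>simp add: krylov_def\<close>)

lemma pact_monom_Suc:
  assumes "A \<in> carrier_mat n n" "y \<in> carrier_vec n"
  shows "pact A (Polynomial.monom 1 (Suc l)) y = A *\<^sub>v pact A (Polynomial.monom 1 l) y"
proof -
  have "pact A (Polynomial.monom 1 (Suc l)) y = 0 \<cdot>\<^sub>v y + A *\<^sub>v pact A (Polynomial.monom 1 l) y"
    by (simp only: monom_Suc pact_pCons[OF assms])
  also have "\<dots> = A *\<^sub>v pact A (Polynomial.monom 1 l) y"
    using assms by (intro eq_vecI) (auto simp del: index_mult_mat_vec)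
  finally show ?thesis .
qed

lemma bezout_irreducible:
  fixes F :: "'a::field_gcd poly"
  assumes "irreducible F" "\<not> F dvd h"
  obtains a b where "a * F + b * h = 1"
proof -
  have "coprime F h" using assms by (intro prime_elem_imp_coprime irreducible_imp_prime_elem) auto
  then have "fst (bezout_coefficients F h) * F + snd (bezout_coefficients F h) * h = 1"
    by (simp add: bezout_coefficients_fst_snd)
  then show ?thesis by (rule that)
qed

text \<open>Modulo the column space of \<open>Z\<close>, the vector \<open>y\<close> is nonzero and
  killed by the irreducible \<open>F\<close>, so it generates a copy of K[t]/(F). Concretely, a
  relation h(A) y in the column space with h \<noteq> 0 and deg h < deg F would put \<open>y\<close>
  itself there by a Bezout identity.\<close>

lemma injm_hc_krylov:
  fixes A :: "'a::{field_gcd,finite} mat"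
  assumes A: "A \<in> carrier_mat n n" and T: "T \<in> carrier_mat d d" and Z: "injm n d Z" and AZ: "A * Z = Z * T"
    and F: "irreducible F" and y: "y \<in> carrier_vec n" "y \<notin> colsp Z" "pact A F y \<in> colsp Z"
  shows "injm n (d + degree F) (hc Z (krylov A y (degree F)))"
proof -
  have Zc: "Z \<in> carrier_mat n d" using Z by (simp add: injm_def)
  note inv = pact_in_colsp[OF A T Zc AZ]
  show ?thesis
    unfolding injm_hc_iff[OF Zc krylov_carrier[OF A]]
  proof (intro conjI ballI impI Z)
    fix b :: "'a vec" assume b: "b \<in> carrier_vec (degree F)" "krylov A y (degree F) *\<^sub>v b \<in> colsp Z"
    define h where "h = Poly (list_of_vec b)"
    have ch: "Polynomial.coeff h l = (if l < degree F then b $ l else 0)" for l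
      using b(1) by (simp add: h_def nth_default_def list_of_vec_index)
    have bh: "b = vec (degree F) (Polynomial.coeff h)" using b(1) by (intro eq_vecI) (auto simp: ch)
    have hy: "pact A h y \<in> colsp Z"
      using b(2) krylov_mult_vec[OF A y(1), of "degree F" h] bh ch by simp
    have "h = 0"
    proof (rule ccontr)
      assume "h \<noteq> 0"
      then have "degree h < degree F" using ch by (metis leading_coeff_0_iff)
      then have "\<not> F dvd h" using \<open>h \<noteq> 0\<close> by (meson dvd_imp_degree_le leD)
      then obtain a c where ac: "a * F + c * h = 1" using bezout_irreducible[OF F] by blast
      have "y = pact A (a * F + c * h) y" using ac A y by simp
      also have "\<dots> = pact A a (pact A F y) + pact A c (pact A h y)"
        by (simp only: pact_add[OF A y(1)] pact_mult[OF A y(1)])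
      also have "\<dots> \<in> colsp Z" using inv y(3) hy by (intro colsp_add[OF Zc]) auto
      finally show False using y(2) by simp
    qed
    then show "b = 0\<^sub>v (degree F)" using bh by (auto intro!: eq_vecI)
  qed
qed

hide_const (open) up_ring.monom up_ring.coeff Module.smult

section \<open>Extensions by companion blocks\<close>

text \<open>The convention matching \<open>krylov\<close>: for monic F with F(A) y = 0, the Krylov
  matrix K of \<open>y\<close> satisfies A K = K C.\<close>

definition companion :: "'a::field poly \<Rightarrow> 'a mat" where
  "companion F = mat (degree F) (degree F)
     (\<lambda>(i, l). if Suc l = degree F then - coeff F i else if i = Suc l then 1 else 0)"

text \<open>Only the last column is free, since in a Krylov basis the gluing of the new block to the
  old module is given by the single vector F(A) y. A shorter \<open>b\<close> is padded by
  zeros.\<close>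

definition last_col :: "nat \<Rightarrow> nat \<Rightarrow> 'a::field vec \<Rightarrow> 'a mat" where
  "last_col D f b = mat D f (\<lambda>(i, l). if Suc l = f \<and> i < dim_vec b then b $ i else 0)"

definition pad :: "nat \<Rightarrow> 'a::field vec \<Rightarrow> 'a vec" where
  "pad D b = vec D (\<lambda>i. if i < dim_vec b then b $ i else 0)"

definition ext :: "'a::field poly \<Rightarrow> 'a mat \<Rightarrow> 'a vec \<Rightarrow> 'a mat" where
  "ext F T b = four_block_mat T (last_col (dim_row T) (degree F) b) (0\<^sub>m (degree F) (dim_row T)) (companion F)"

definition fc :: "nat \<Rightarrow> 'a mat \<Rightarrow> 'a mat" where
  "fc d Z = mat (dim_row Z) d (\<lambda>(i, j). Z $$ (i, j))"

lemma companion_carrier [simp]: "companion F \<in> carrier_mat (degree F) (degree F)"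
  and last_col_carrier [simp]: "last_col D f b \<in> carrier_mat D f"
  and pad_carrier [simp]: "pad D b \<in> carrier_vec D"
  by (simp_all add: companion_def last_col_def pad_def)

lemma fc_carrier [simp]: "Z \<in> carrier_mat n D \<Longrightarrow> fc d Z \<in> carrier_mat n d"
  by (simp add: fc_def)

lemma ext_carrier: "T \<in> carrier_mat D D \<Longrightarrow> ext F T b \<in> carrier_mat (D + degree F) (D + degree F)"
  by (auto simp: ext_def)

lemma fc_hc: "Z \<in> carrier_mat n D \<Longrightarrow> Y \<in> carrier_mat n f \<Longrightarrow> fc D (hc Z Y) = Z"
  by (intro eq_matI) (auto simp: fc_def hc_def)

lemma fc_fc: "d \<le> D \<Longrightarrow> fc d (fc D Z) = fc d Z"
  by (intro eq_matI) (auto simp: fc_def)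

lemma fc_id: "Z \<in> carrier_mat n d \<Longrightarrow> fc d Z = Z"
  by (intro eq_matI) (auto simp: fc_def)

lemma mult_pad:
  assumes Z: "Z \<in> carrier_mat n D" and d: "d \<le> D" and b: "b \<in> carrier_vec d"
  shows "Z *\<^sub>v pad D b = fc d Z *\<^sub>v b"
proof (rule eq_vecI)
  fix i assume "i < dim_vec (fc d Z *\<^sub>v b)"
  then have i: "i < n" using Z by (simp add: fc_def)
  have "(Z *\<^sub>v pad D b) $ i = (\<Sum>j\<in>{0..<D}. Z $$ (i, j) * (if j < d then b $ j else 0))"
    using i Z b by (simp add: scalar_prod_def pad_def)
  also have "\<dots> = (\<Sum>j\<in>{0..<d}. Z $$ (i, j) * b $ j)"
    using d by (intro sum.mono_neutral_cong_right) auto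
  also have "\<dots> = (fc d Z *\<^sub>v b) $ i"
    using i Z b d by (simp add: scalar_prod_def fc_def)
  finally show "(Z *\<^sub>v pad D b) $ i = (fc d Z *\<^sub>v b) $ i" .
qed (use Z in \<open>simp add: fc_def\<close>)

lemma injm_fc:
  assumes Z: "injm n D Z" and d: "d \<le> D"
  shows "injm n d (fc d Z)"
  unfolding injm_def
proof (intro conjI ballI impI)
  have Zc: "Z \<in> carrier_mat n D" using Z by (rule injm_carrier)
  show "fc d Z \<in> carrier_mat n d" using Zc by simp
  fix b :: "'a vec" assume b: "b \<in> carrier_vec d" "fc d Z *\<^sub>v b = 0\<^sub>v n"
  then have "Z *\<^sub>v pad D b = 0\<^sub>v n" using mult_pad[OF Zc d b(1)] by simp
  then have 0: "pad D b = 0\<^sub>v D" by (rule injmD[OF Z pad_carrier])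
  show "b = 0\<^sub>v d"
  proof (rule eq_vecI)
    fix i assume "i < dim_vec (0\<^sub>v d :: 'a vec)"
    then have i: "i < d" by simp
    have "pad D b $ i = 0" unfolding 0 using i d by simp
    then show "b $ i = 0\<^sub>v d $ i" using i d b(1) by (simp add: pad_def)
  qed (use b in simp)
qed

text \<open>For monic F and l < deg F this is the remainder of t^(l+1) modulo F.\<close>

definition comp_poly :: "'a::field poly \<Rightarrow> nat \<Rightarrow> 'a poly" where
  "comp_poly F l = (if Suc l = degree F then monom 1 (degree F) - F else monom 1 (Suc l))"

lemma col_companion:
  assumes "l < degree F"
  shows "col (companion F) l = vec (degree F) (coeff (comp_poly F l))"
  using assms by (intro eq_vecI) (auto simp: companion_def comp_poly_def)

lemma coeff_comp_poly:
  assumes "monic F" "l < degree F" "degree F \<le> k"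
  shows "coeff (comp_poly F l) k = 0"
  using assms by (cases "k = degree F") (auto simp: comp_poly_def coeff_eq_0)

lemma col_last_col:
  assumes "l < f"
  shows "col (last_col D f b) l = (if Suc l = f then pad D b else 0\<^sub>v D)"
  using assms by (intro eq_vecI) (auto simp: last_col_def pad_def)

lemma pact_monom_degree:
  assumes A: "A \<in> carrier_mat n n" and y: "y \<in> carrier_vec n"
  shows "pact A (monom 1 (degree F)) y = pact A F y + pact A (monom 1 (degree F) - F) y"
  unfolding pact_add[OF A y, symmetric] by simp

text \<open>Multiplication by \<open>A\<close> shifts the Krylov columns. Only the last one leaves
  the range, and t^f = F + (t^f - F) splits A^f y into the gluing vector and a combination of Krylov
  columns.\<close>

lemma krylov_block_eq:
  fixes A :: "'a::field mat"
  assumes A: "A \<in> carrier_mat n n" and Z: "Z \<in> carrier_mat n D" and y: "y \<in> carrier_vec n"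
    and F: "monic F" and Fy: "pact A F y = Z *\<^sub>v pad D b"
  shows "A * krylov A y (degree F) = Z * last_col D (degree F) b + krylov A y (degree F) * companion F"
proof (rule mat_col_eqI)
  let ?f = "degree F" let ?K = "krylov A y ?f"
  have K: "?K \<in> carrier_mat n ?f" using A by simp
  fix l assume "l < dim_col (Z * last_col D ?f b + ?K * companion F)"
  then have l: "l < ?f" by (simp add: companion_def)
  have "col (A * ?K) l = A *\<^sub>v col ?K l" by (rule col_mult2[OF A K l])
  also have "\<dots> = pact A (monom 1 (Suc l)) y"
    unfolding col_krylov[OF A y l] pact_monom_Suc[OF A y] ..
  also have "\<dots> = Z *\<^sub>v col (last_col D ?f b) l + ?K *\<^sub>v col (companion F) l"
  proof -
    have k: "?K *\<^sub>v col (companion F) l = pact A (comp_poly F l) y"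
      unfolding col_companion[OF l] by (rule krylov_mult_vec[OF A y]) (rule coeff_comp_poly[OF F l])
    show ?thesis
    proof (cases "Suc l = ?f")
      case True
      then show ?thesis
        unfolding k col_last_col[OF l] using pact_monom_degree[OF A y, of F] Fy by (simp add: comp_poly_def)
    next
      case False
      then have "Z *\<^sub>v col (last_col D ?f b) l = 0\<^sub>v n" unfolding col_last_col[OF l] using Z by simp
      then show ?thesis unfolding k using False pact_carrier[OF A y] by (simp add: comp_poly_def)
    qed
  qed
  also have "\<dots> = col (Z * last_col D ?f b) l + col (?K * companion F) l"
    unfolding col_mult2[OF Z last_col_carrier l] col_mult2[OF K companion_carrier l] ..
  also have "\<dots> = col (Z * last_col D ?f b + ?K * companion F) l"
    using l by (intro col_add[symmetric, of _ n ?f]) (use Z K in auto)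
  finally show "col (A * ?K) l = col (Z * last_col D ?f b + ?K * companion F) l" .
qed (use A Z in \<open>auto simp: krylov_def companion_def\<close>)

lemma vec_add_right_cancel:
  assumes "u \<in> carrier_vec n" "v \<in> carrier_vec n" "w \<in> carrier_vec n" "u + w = v + (w :: 'a::ab_group_add vec)"
  shows "u = v"
proof (rule eq_vecI)
  fix i assume "i < dim_vec v"
  then have i: "i < n" using assms(2) by simp
  have "(u + w) $ i = (v + w) $ i" by (simp only: assms(4))
  then show "u $ i = v $ i" using i assms(1-3) by simp
qed (use assms(1,2) in simp)

text \<open>Conversely, all but the last column of the equation force the Krylov recursion from
  column 0, and the last column is then the condition on F(A) y.\<close>

lemma block_eq_krylov:
  fixes A :: "'a::field mat"
  assumes A: "A \<in> carrier_mat n n" and Z: "Z \<in> carrier_mat n D" and Y: "Y \<in> carrier_mat n (degree F)"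
    and F: "monic F" "0 < degree F"
    and eq: "A * Y = Z * last_col D (degree F) b + Y * companion F"
  shows "Y = krylov A (col Y 0) (degree F)" "pact A F (col Y 0) = Z *\<^sub>v pad D b"
proof -
  let ?f = "degree F" and ?y = "col Y 0"
  have y: "?y \<in> carrier_vec n" using Y F by simp
  have step: "A *\<^sub>v col Y l = Z *\<^sub>v col (last_col D ?f b) l + Y *\<^sub>v col (companion F) l" if l: "l < ?f" for l
  proof -
    have "A *\<^sub>v col Y l = col (A * Y) l" by (rule col_mult2[OF A Y l, symmetric])
    also have "\<dots> = col (Z * last_col D ?f b) l + col (Y * companion F) l"
      unfolding eq using l by (intro col_add[of _ n ?f]) (use Z Y in auto)
    also have "\<dots> = Z *\<^sub>v col (last_col D ?f b) l + Y *\<^sub>v col (companion F) l"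
      unfolding col_mult2[OF Z last_col_carrier l] col_mult2[OF Y companion_carrier l] ..
    finally show ?thesis .
  qed
  have cols: "col Y l = pact A (monom 1 l) ?y" if "l < ?f" for l
    using that
  proof (induction l)
    case 0
    then show ?case using A y by simp
  next
    case (Suc l)
    have l: "l < ?f" "Suc l \<noteq> ?f" using Suc.prems by auto
    have "pact A (monom 1 (Suc l)) ?y = A *\<^sub>v col Y l"
      unfolding pact_monom_Suc[OF A y] Suc.IH[OF l(1)] ..
    also have "\<dots> = 0\<^sub>v n + Y *\<^sub>v col (companion F) l"
      unfolding step[OF l(1)] col_last_col[OF l(1)] using l Z by simp
    also have "col (companion F) l = unit_vec ?f (Suc l)"
      using l by (intro eq_vecI) (auto simp: companion_def unit_vec_def)
    also have "0\<^sub>v n + Y *\<^sub>v unit_vec ?f (Suc l) = col Y (Suc l)"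
      using Y Suc.prems by (intro eq_vecI) auto
    finally show ?case by simp
  qed
  show YK: "Y = krylov A ?y ?f"
  proof (rule mat_col_eqI)
    fix l assume "l < dim_col (krylov A ?y ?f)"
    then have l: "l < ?f" by (simp add: krylov_def)
    show "col Y l = col (krylov A ?y ?f) l" unfolding cols[OF l] col_krylov[OF A y l] ..
  qed (use A Y in \<open>auto simp: krylov_def\<close>)
  let ?l = "?f - 1"
  have l: "?l < ?f" "Suc ?l = ?f" using F by auto
  have "Y *\<^sub>v col (companion F) ?l = pact A (comp_poly F ?l) ?y"
    using krylov_mult_vec[OF A y, of ?f "comp_poly F ?l"] coeff_comp_poly[OF F(1) l(1)] YK
    unfolding col_companion[OF l(1)] by metis
  then have "Y *\<^sub>v col (companion F) ?l = pact A (monom 1 ?f - F) ?y" using l by (simp add: comp_poly_def)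
  moreover have "A *\<^sub>v col Y ?l = pact A (monom 1 ?f) ?y"
    unfolding cols[OF l(1)] pact_monom_Suc[OF A y, symmetric] l(2) ..
  ultimately have "pact A F ?y + pact A (monom 1 ?f - F) ?y = Z *\<^sub>v pad D b + pact A (monom 1 ?f - F) ?y"
    using step[OF l(1)] pact_monom_degree[OF A y, of F] l(2) unfolding col_last_col[OF l(1)] by simp
  then show "pact A F ?y = Z *\<^sub>v pad D b"
    by (rule vec_add_right_cancel[rotated 3]) (use A Z y in auto)
qed

text \<open>
  The new columns of an embedding of \<open>ext F T b\<close> form the Krylov sequence of a vector \<open>y\<close> with
  $F(A) y = Z b$, so a choice of \<open>b\<close> and an embedding amounts to a choice of \<open>Z\<close> and \<open>y\<close>.
\<close>
lemma ext_block_iff: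
  fixes A :: "'a::field mat"
  assumes A: "A \<in> carrier_mat n n" and T: "T \<in> carrier_mat D D" and Z: "Z \<in> carrier_mat n D"
    and Y: "Y \<in> carrier_mat n (degree F)"
  shows "A * hc Z Y = hc Z Y * ext F T b \<longleftrightarrow>
    A * Z = Z * T \<and> A * Y = Z * last_col D (degree F) b + Y * companion F"
proof -
  let ?f = "degree F"
  have dT: "dim_row T = D" using T by simp
  have "hc Z Y * ext F T b = hc (Z * T + Y * 0\<^sub>m ?f D) (Z * last_col D ?f b + Y * companion F)"
    unfolding ext_def dT by (rule hc_mult_four_block[OF Z Y T last_col_carrier zero_carrier_mat companion_carrier])
  also have "Z * T + Y * 0\<^sub>m ?f D = Z * T" using Z Y T by simp
  finally have e: "hc Z Y * ext F T b = hc (Z * T) (Z * last_col D ?f b + Y * companion F)" .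
  have c: "Z * last_col D ?f b + Y * companion F \<in> carrier_mat n ?f"
    by (rule add_carrier_mat[OF mult_carrier_mat[OF Y companion_carrier]])
  show ?thesis
    unfolding mult_hc[OF A Z Y] e
    by (rule hc_eq_iff[OF mult_carrier_mat[OF A Z] mult_carrier_mat[OF A Y] mult_carrier_mat[OF Z T] c])
qed

text \<open>
  The preimage of the image of \<open>X\<close> under $F(A)$.
\<close>
definition KX :: "'a::field mat \<Rightarrow> 'a poly \<Rightarrow> 'a mat \<Rightarrow> 'a vec set" where
  "KX A F X = {y \<in> carrier_vec (dim_row A). pact A F y \<in> colsp X}"

lemma emb_carrier: "X \<in> emb n d T A \<Longrightarrow> X \<in> carrier_mat n d"
  and emb_injm: "X \<in> emb n d T A \<Longrightarrow> injm n d X"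
  and emb_eq: "X \<in> emb n d T A \<Longrightarrow> A * X = X * T"
  by (auto simp: emb_altdef injm_def)

lemma hc_krylov_in_emb:
  fixes A :: "'a::{field_gcd,finite} mat"
  assumes A: "A \<in> carrier_mat n n" and T: "T \<in> carrier_mat D D" and d: "d \<le> D"
    and F: "monic F" "irreducible F" and b: "b \<in> carrier_vec d"
    and Z: "Z \<in> emb n D T A" and y: "y \<in> carrier_vec n" "y \<notin> colsp Z" "pact A F y = fc d Z *\<^sub>v b"
  shows "hc Z (krylov A y (degree F)) \<in> emb n (D + degree F) (ext F T b) A"
proof -
  have Zc: "Z \<in> carrier_mat n D" using Z by (rule emb_carrier)
  have Fy: "pact A F y = Z *\<^sub>v pad D b" unfolding y(3) by (rule mult_pad[OF Zc d b, symmetric])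
  then have in_c: "pact A F y \<in> colsp Z" using colspI[OF Zc pad_carrier] by simp
  show ?thesis
    unfolding emb_altdef mem_Collect_eq ext_block_iff[OF A T Zc krylov_carrier[OF A]]
    using injm_hc_krylov[OF A T emb_injm[OF Z] emb_eq[OF Z] F(2) y(1,2) in_c]
      emb_eq[OF Z] krylov_block_eq[OF A Zc y(1) F(1) Fy] by blast
qed

lemma emb_ext_decompose:
  fixes A :: "'a::{field_gcd,finite} mat"
  assumes A: "A \<in> carrier_mat n n" and T: "T \<in> carrier_mat D D" and d: "d \<le> D"
    and F: "monic F" "0 < degree F" and b: "b \<in> carrier_vec d"
    and Z': "Z' \<in> emb n (D + degree F) (ext F T b) A"
  defines "Z \<equiv> fc D Z'" and "y \<equiv> col Z' D"
  shows "Z' = hc Z (krylov A y (degree F))" "Z \<in> emb n D T A" "y \<in> carrier_vec n" "y \<notin> colsp Z"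
    "pact A F y = fc d Z *\<^sub>v b"
proof -
  let ?f = "degree F"
  have Z'c: "Z' \<in> carrier_mat n (D + ?f)" using Z' by (rule emb_carrier)
  define Y where "Y = mat n ?f (\<lambda>(i, l). Z' $$ (i, D + l))"
  have Y: "Y \<in> carrier_mat n ?f" by (simp add: Y_def)
  have Z: "Z \<in> carrier_mat n D" using Z'c by (simp add: Z_def)
  have dec: "Z' = hc Z Y" using Z'c by (intro eq_matI) (auto simp: hc_def Z_def Y_def fc_def)
  have y: "y = col Y 0" using Z'c F by (intro eq_vecI) (auto simp: y_def Y_def)
  have eqs: "A * Z = Z * T" "A * Y = Z * last_col D ?f b + Y * companion F"
    using emb_eq[OF Z'] unfolding dec ext_block_iff[OF A T Z Y] by auto
  have "injm n (D + ?f) (hc Z Y)" using emb_injm[OF Z'] dec by simp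
  then have inj: "injm n D Z" "\<And>b. b \<in> carrier_vec ?f \<Longrightarrow> Y *\<^sub>v b \<in> colsp Z \<Longrightarrow> b = 0\<^sub>v ?f"
    unfolding injm_hc_iff[OF Z Y] by auto
  show "Z \<in> emb n D T A" using inj(1) eqs(1) by (simp add: emb_altdef)
  show yc: "y \<in> carrier_vec n" using Y F unfolding y by simp
  have "Y = krylov A y ?f" unfolding y by (rule block_eq_krylov(1)[OF A Z Y F eqs(2)])
  then show "Z' = hc Z (krylov A y ?f)" using dec by simp
  have "pact A F y = Z *\<^sub>v pad D b" unfolding y by (rule block_eq_krylov(2)[OF A Z Y F eqs(2)])
  then show "pact A F y = fc d Z *\<^sub>v b" using mult_pad[OF Z d b] by simp
  show "y \<notin> colsp Z"
  proof
    assume "y \<in> colsp Z"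
    moreover have "Y *\<^sub>v unit_vec ?f 0 = y" unfolding y using Y F by (intro eq_vecI) auto
    ultimately have "unit_vec ?f 0 = (0\<^sub>v ?f :: 'a vec)" using inj(2)[of "unit_vec ?f 0"] by simp
    then have "unit_vec ?f 0 $ 0 = (0\<^sub>v ?f :: 'a vec) $ 0" by simp
    then show False using F by simp
  qed
qed

text \<open>The weight \<open>g\<close> sees the old columns only, which is what allows the formula
  to be iterated along a chain.\<close>

lemma sum_emb_ext:
  fixes A :: "'a::{field_gcd,finite} mat" and g :: "'a mat \<Rightarrow> real"
  assumes A: "A \<in> carrier_mat n n" and T: "T \<in> carrier_mat D D" and d: "d \<le> D"
    and F: "monic F" "irreducible F" "0 < degree F"
  shows "(\<Sum>b\<in>carrier_vec d. \<Sum>Z'\<in>emb n (D + degree F) (ext F T b) A. g (fc D Z'))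
    = (\<Sum>Z\<in>emb n D T A. g Z * real (card (KX A F (fc d Z) - colsp Z)))"
proof -
  let ?f = "degree F"
  have dA: "dim_row A = n" using A by simp
  have finK: "finite (KX A F X)" for X unfolding KX_def by simp
  have yD: "y \<in> carrier_vec n" "y \<notin> colsp Z" "\<exists>b. b \<in> carrier_vec d \<and> pact A F y = fc d Z *\<^sub>v b"
    if Z: "Z \<in> emb n D T A" and y: "y \<in> KX A F (fc d Z) - colsp Z" for Z y
  proof -
    have "fc d Z \<in> carrier_mat n d" using emb_carrier[OF Z] by simp
    then show "y \<in> carrier_vec n" "y \<notin> colsp Z" "\<exists>b. b \<in> carrier_vec d \<and> pact A F y = fc d Z *\<^sub>v b"
      using y dA by (auto simp: KX_def elim: colspE)
  qed
  \<comment> \<open>Such a vector is unique because the first \<open>d\<close> columns are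
    injective, so this choice inverts the decomposition of an extended embedding.\<close>
  define bb where "bb = (\<lambda>(Z, y). SOME b. b \<in> carrier_vec d \<and> pact A F y = fc d Z *\<^sub>v b)"
  have bb: "bb (Z, y) \<in> carrier_vec d" "pact A F y = fc d Z *\<^sub>v bb (Z, y)"
    if "Z \<in> emb n D T A" "y \<in> KX A F (fc d Z) - colsp Z" for Z y
    using someI_ex[OF yD(3)[OF that]] by (simp_all add: bb_def)
  have "(\<Sum>b\<in>carrier_vec d. \<Sum>Z'\<in>emb n (D + ?f) (ext F T b) A. g (fc D Z'))
      = (\<Sum>(b, Z')\<in>(SIGMA b:carrier_vec d. emb n (D + ?f) (ext F T b) A). g (fc D Z'))"
    by (intro sum.Sigma) auto
  also have "\<dots> = (\<Sum>(Z, y)\<in>(SIGMA Z:emb n D T A. KX A F (fc d Z) - colsp Z). g Z)"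
  proof (rule sum.reindex_bij_witness[of _ "\<lambda>(Z, y). (bb (Z, y), hc Z (krylov A y ?f))" "\<lambda>(b, Z'). (fc D Z', col Z' D)"], goal_cases)
    case (1 x)
    obtain b Z' where x: "x = (b, Z')" by (cases x)
    then have b: "b \<in> carrier_vec d" and Z': "Z' \<in> emb n (D + ?f) (ext F T b) A" using 1 by auto
    note dec = emb_ext_decompose[OF A T d F(1,3) b Z']
    have mem: "col Z' D \<in> KX A F (fc d (fc D Z')) - colsp (fc D Z')"
      using dec dA colspI[OF fc_carrier[OF emb_carrier[OF dec(2)]] b] by (simp add: KX_def)
    have "bb (fc D Z', col Z' D) = b"
    proof (rule injm_inj)
      show "injm n d (fc d (fc D Z'))" by (rule injm_fc[OF emb_injm[OF dec(2)] d])
      show "fc d (fc D Z') *\<^sub>v bb (fc D Z', col Z' D) = fc d (fc D Z') *\<^sub>v b"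
        using bb(2)[OF dec(2) mem] dec(5) by simp
    qed (use bb(1)[OF dec(2) mem] b in auto)
    then show ?case unfolding x using dec(1) by simp
  next
    case (2 x)
    obtain b Z' where x: "x = (b, Z')" by (cases x)
    then have b: "b \<in> carrier_vec d" and Z': "Z' \<in> emb n (D + ?f) (ext F T b) A" using 2 by auto
    note dec = emb_ext_decompose[OF A T d F(1,3) b Z']
    have "col Z' D \<in> KX A F (fc d (fc D Z')) - colsp (fc D Z')"
      using dec dA colspI[OF fc_carrier[OF emb_carrier[OF dec(2)]] b] by (simp add: KX_def)
    then show ?case unfolding x using dec(2) by simp
  next
    case (3 x)
    obtain Z y where x: "x = (Z, y)" by (cases x)
    then have Z: "Z \<in> emb n D T A" and y: "y \<in> KX A F (fc d Z) - colsp Z" using 3 by auto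
    have Zc: "Z \<in> carrier_mat n D" using Z by (rule emb_carrier)
    have "col (hc Z (krylov A y ?f)) D = y"
      using col_hc[OF Zc krylov_carrier[OF A], of D ?f y] col_krylov[OF A yD(1)[OF Z y] F(3)] A yD(1)[OF Z y] F(3) by simp
    then show ?case unfolding x using fc_hc[OF Zc krylov_carrier[OF A]] by simp
  next
    case (4 x)
    obtain Z y where x: "x = (Z, y)" by (cases x)
    then have Z: "Z \<in> emb n D T A" and y: "y \<in> KX A F (fc d Z) - colsp Z" using 4 by auto
    show ?case unfolding x
      using hc_krylov_in_emb[OF A T d F(1,2) bb(1)[OF Z y] Z yD(1,2)[OF Z y] bb(2)[OF Z y]] bb(1)[OF Z y] by simp
  next
    case (5 x)
    then show ?case by auto
  qed
  also have "\<dots> = (\<Sum>Z\<in>emb n D T A. \<Sum>y\<in>KX A F (fc d Z) - colsp Z. g Z)"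
    using finK by (intro sum.Sigma[symmetric]) auto
  finally show ?thesis by (simp add: mult.commute)
qed

text \<open>
  Each \<open>b\<close> has length \<open>d\<close> only and is padded by zeros: the new vector must satisfy
  $F(A) y \in \mathrm{im}\, X$ for the original \<open>X\<close>, not just modulo the columns added before.
\<close>
primrec chainT :: "'a::field poly \<Rightarrow> 'a mat \<Rightarrow> 'a vec list \<Rightarrow> 'a mat" where
  "chainT F T [] = T"
| "chainT F T (b # bs) = ext F (chainT F T bs) b"

lemma chainT_carrier: "T \<in> carrier_mat d d \<Longrightarrow> chainT F T bs \<in> carrier_mat (d + length bs * degree F) (d + length bs * degree F)"
proof (induction bs)
  case (Cons b bs)
  then show ?case using ext_carrier[of "chainT F T bs" "d + length bs * degree F" F b]
    by (simp add: algebra_simps)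
qed simp

text \<open>F(A) commutes with polynomials in \<open>A\<close>, and the image of the original
  \<open>X\<close> is invariant, so all columns added along a chain stay in the same preimage. The
  new vectors admissible at a step thus form a difference of nested subspaces, with an exact
  cardinality.\<close>

lemma chain_closed:
  fixes A :: "'a::{field_gcd,finite} mat"
  assumes A: "A \<in> carrier_mat n n" and T: "T \<in> carrier_mat d d" and F: "monic F" "0 < degree F"
  shows "set bs \<subseteq> carrier_vec d \<Longrightarrow> Z \<in> emb n (d + length bs * degree F) (chainT F T bs) A \<Longrightarrow>
    fc d Z \<in> emb n d T A \<and> colsp Z \<subseteq> KX A F (fc d Z)"
proof (induction bs arbitrary: Z)
  case Nil
  then have Z: "Z \<in> emb n d T A" by simp
  have Zc: "Z \<in> carrier_mat n d" using Z by (rule emb_carrier)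
  have "pact A F y \<in> colsp Z" if "y \<in> colsp Z" for y
    by (rule pact_in_colsp[OF A T Zc emb_eq[OF Z] that])
  then show ?case using Z A colsp_carrier[OF Zc] by (auto simp: fc_id[OF Zc] KX_def)
next
  case (Cons b bs)
  let ?D = "d + length bs * degree F"
  have T': "chainT F T bs \<in> carrier_mat ?D ?D" by (rule chainT_carrier[OF T])
  have b: "b \<in> carrier_vec d" using Cons.prems by simp
  have Z': "Z \<in> emb n (?D + degree F) (ext F (chainT F T bs) b) A"
    using Cons.prems(2) by (simp add: algebra_simps)
  have dD: "d \<le> ?D" by simp
  define W where "W = fc ?D Z"
  define y where "y = col Z ?D"
  note dec = emb_ext_decompose[OF A T' dD F b Z', folded W_def y_def]
  have IH: "fc d W \<in> emb n d T A" "colsp W \<subseteq> KX A F (fc d W)"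
    using Cons.IH[OF _ dec(2)] Cons.prems by auto
  have X: "fc d Z = fc d W" unfolding W_def using fc_fc[OF dD] by metis
  have Xc: "fc d W \<in> carrier_mat n d" using IH(1) by (rule emb_carrier)
  have Wc: "W \<in> carrier_mat n ?D" using dec(2) by (rule emb_carrier)
  have Kc: "krylov A y (degree F) \<in> carrier_mat n (degree F)" using A by simp
  have "colsp Z \<subseteq> KX A F (fc d W)"
  proof
    fix z assume "z \<in> colsp Z"
    then obtain v where v: "v \<in> carrier_vec (?D + degree F)" "z = Z *\<^sub>v v"
      by (rule colspE[OF _ emb_carrier[OF Z']])
    obtain p q where pq: "p \<in> carrier_vec ?D" "q \<in> carrier_vec (degree F)" "v = p @\<^sub>v q" using v(1) by (rule vec_split)
    define h where "h = Poly (list_of_vec q)"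
    have ch: "coeff h l = (if l < degree F then q $ l else 0)" for l
      using pq(2) by (simp add: h_def nth_default_def list_of_vec_index)
    have qh: "q = vec (degree F) (coeff h)" using pq(2) by (intro eq_vecI) (auto simp: ch)
    have "krylov A y (degree F) *\<^sub>v q = pact A h y"
      unfolding qh by (rule krylov_mult_vec[OF A dec(3)]) (simp add: ch)
    then have z: "z = W *\<^sub>v p + pact A h y"
      unfolding v(2) pq(3) using hc_mult_vec[OF Wc Kc pq(1,2)] dec(1) by simp
    have Wp: "W *\<^sub>v p \<in> carrier_vec n" "pact A h y \<in> carrier_vec n" using Wc pq A dec(3) by auto
    have "pact A F z = pact A F (W *\<^sub>v p) + pact A F (pact A h y)"
      unfolding z by (rule pact_vec_add[OF A Wp])
    also have "pact A F (pact A h y) = pact A h (pact A F y)"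
      unfolding pact_mult[OF A dec(3), symmetric] by (simp add: mult.commute)
    finally have Fz: "pact A F z = pact A F (W *\<^sub>v p) + pact A h (pact A F y)" .
    have "pact A F (W *\<^sub>v p) \<in> colsp (fc d W)"
      using IH(2) colspI[OF Wc pq(1)] by (auto simp: KX_def)
    moreover have "pact A h (pact A F y) \<in> colsp (fc d W)"
      unfolding dec(5) by (rule pact_in_colsp[OF A T Xc emb_eq[OF IH(1)] colspI[OF Xc b]])
    ultimately have "pact A F z \<in> colsp (fc d W)" unfolding Fz by (rule colsp_add[OF Xc])
    moreover have "z \<in> carrier_vec n" unfolding z using Wp by simp
    ultimately show "z \<in> KX A F (fc d W)" using A by (simp add: KX_def)
  qed
  then show ?case using IH(1) X by simp
qed

text \<open>Step l of a chain picks a vector of the fixed set \<open>KX A F X\<close> outside a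
  column space of dimension d + l deg F, whence the factors. The induction runs over all weights
  \<open>g\<close>: the factor of the last step is absorbed into the weight.\<close>

theorem chain_sum:
  fixes A :: "'a::{field_gcd,finite} mat" and g :: "'a mat \<Rightarrow> real"
  assumes A: "A \<in> carrier_mat n n" and T: "T \<in> carrier_mat d d" and F: "monic F" "irreducible F" "0 < degree F"
  shows "(\<Sum>bs\<in>{bs. set bs \<subseteq> carrier_vec d \<and> length bs = i}.
       \<Sum>Z\<in>emb n (d + i * degree F) (chainT F T bs) A. g (fc d Z))
    = (\<Sum>X\<in>emb n d T A. g X * (\<Prod>l<i. real (card (KX A F X)) - real CARD('a) ^ (d + l * degree F)))"
proof (induction i arbitrary: g)
  case 0
  have "{bs. set bs \<subseteq> carrier_vec d \<and> length bs = 0} = {[] :: 'a vec list}" by auto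
  then show ?case by (simp add: fc_id[OF emb_carrier] cong: sum.cong)
next
  case (Suc i)
  let ?f = "degree F" and ?L = "\<lambda>i. {bs. set bs \<subseteq> (carrier_vec d :: 'a vec set) \<and> length bs = i}"
  let ?D = "d + i * ?f"
  let ?h = "\<lambda>X. real (card (KX A F X)) - real CARD('a) ^ ?D"
  have finL: "finite (?L i)" for i by (rule finite_lists_length_eq) simp
  have "(\<Sum>bs\<in>?L (Suc i). \<Sum>Z\<in>emb n (d + Suc i * ?f) (chainT F T bs) A. g (fc d Z))
      = (\<Sum>(bs, b)\<in>?L i \<times> carrier_vec d. \<Sum>Z\<in>emb n (d + Suc i * ?f) (chainT F T (b # bs)) A. g (fc d Z))"
    by (rule sum.reindex_bij_witness[of _ "\<lambda>(bs, b). b # bs" "\<lambda>bs. (tl bs, hd bs)"])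
       (auto simp: length_Suc_conv)
  also have "\<dots> = (\<Sum>bs\<in>?L i. \<Sum>b\<in>carrier_vec d. \<Sum>Z\<in>emb n (?D + ?f) (ext F (chainT F T bs) b) A. g (fc d (fc ?D Z)))"
    using finL by (subst sum.cartesian_product[symmetric]) (simp add: fc_fc algebra_simps)
  also have "\<dots> = (\<Sum>bs\<in>?L i. \<Sum>Z\<in>emb n ?D (chainT F T bs) A. g (fc d Z) * ?h (fc d Z))"
  proof (rule sum.cong[OF refl])
    fix bs assume bs: "bs \<in> ?L i"
    have T': "chainT F T bs \<in> carrier_mat ?D ?D" using chainT_carrier[OF T, of F bs] bs by simp
    have "(\<Sum>b\<in>carrier_vec d. \<Sum>Z\<in>emb n (?D + ?f) (ext F (chainT F T bs) b) A. g (fc d (fc ?D Z)))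
        = (\<Sum>Z\<in>emb n ?D (chainT F T bs) A. g (fc d Z) * real (card (KX A F (fc d Z) - colsp Z)))"
      by (rule sum_emb_ext[OF A T' _ F]) simp
    also have "\<dots> = (\<Sum>Z\<in>emb n ?D (chainT F T bs) A. g (fc d Z) * ?h (fc d Z))"
    proof (rule sum.cong[OF refl])
      fix Z assume Z: "Z \<in> emb n ?D (chainT F T bs) A"
      have sub: "colsp Z \<subseteq> KX A F (fc d Z)"
        using chain_closed[OF A T F(1,3), of bs Z] bs Z by auto
      have fin: "finite (KX A F (fc d Z))" by (simp add: KX_def)
      have "card (KX A F (fc d Z) - colsp Z) = card (KX A F (fc d Z)) - card (colsp Z)"
        using sub fin by (intro card_Diff_subset) (auto intro: finite_subset)
      moreover have "card (colsp Z) \<le> card (KX A F (fc d Z))" using sub fin by (rule card_mono[rotated])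
      ultimately show "g (fc d Z) * real (card (KX A F (fc d Z) - colsp Z)) = g (fc d Z) * ?h (fc d Z)"
        by (simp add: of_nat_diff card_colsp[OF emb_injm[OF Z]])
    qed
    finally show "(\<Sum>b\<in>carrier_vec d. \<Sum>Z\<in>emb n (?D + ?f) (ext F (chainT F T bs) b) A. g (fc d (fc ?D Z)))
      = (\<Sum>Z\<in>emb n ?D (chainT F T bs) A. g (fc d Z) * ?h (fc d Z))" .
  qed
  also have "\<dots> = (\<Sum>X\<in>emb n d T A. (g X * ?h X) * (\<Prod>l<i. real (card (KX A F X)) - real CARD('a) ^ (d + l * ?f)))"
    by (rule Suc.IH[of "\<lambda>X. g X * ?h X"])
  finally show ?case by (simp add: mult_ac)
qed

section \<open>Multiplicities and quotients\<close>

definition quotient_of :: "nat \<Rightarrow> nat \<Rightarrow> 'a::field mat \<Rightarrow> 'a mat \<Rightarrow> 'a mat \<Rightarrow> 'a mat \<Rightarrow> 'a mat \<Rightarrow> bool" where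
  "quotient_of n d X T A S R \<longleftrightarrow> S \<in> carrier_mat (n - d) (n - d) \<and> R \<in> carrier_mat (n - d) n \<and> R * A = S * R \<and>
    (\<forall>y\<in>carrier_vec n. R *\<^sub>v y = 0\<^sub>v (n - d) \<longleftrightarrow> y \<in> colsp X) \<and>
    (\<forall>w\<in>carrier_vec (n - d). \<exists>y\<in>carrier_vec n. R *\<^sub>v y = w) \<and>
    char_poly A = char_poly T * char_poly S"

lemma quotient_of_ex:
  fixes X :: "'a::{field,finite} mat"
  assumes "injm n d X" "T \<in> carrier_mat d d" "A \<in> carrier_mat n n" "A * X = X * T"
  shows "\<exists>S R. quotient_of n d X T A S R"
proof (rule quotient_matrix[OF assms])
  fix S R
  assume "S \<in> carrier_mat (n - d) (n - d)" "R \<in> carrier_mat (n - d) n" "R * A = S * R"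
    "\<And>y. y \<in> carrier_vec n \<Longrightarrow> (R *\<^sub>v y = 0\<^sub>v (n - d)) = (y \<in> colsp X)"
    "\<And>w. w \<in> carrier_vec (n - d) \<Longrightarrow> \<exists>y\<in>carrier_vec n. R *\<^sub>v y = w"
    "char_poly A = char_poly T * char_poly S"
  then have "quotient_of n d X T A S R" unfolding quotient_of_def by (intro conjI ballI) assumption+
  then show ?thesis by blast
qed

lemma quotient_ofD:
  assumes "quotient_of n d X T A S R"
  shows "S \<in> carrier_mat (n - d) (n - d)" "R \<in> carrier_mat (n - d) n" "R * A = S * R"
    "y \<in> carrier_vec n \<Longrightarrow> R *\<^sub>v y = 0\<^sub>v (n - d) \<longleftrightarrow> y \<in> colsp X"
    "w \<in> carrier_vec (n - d) \<Longrightarrow> \<exists>y\<in>carrier_vec n. R *\<^sub>v y = w"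
    "char_poly A = char_poly T * char_poly S"
  using assms unfolding quotient_of_def by (elim conjE; blast)+

lemma pact_zero_vec:
  assumes A: "A \<in> carrier_mat n n"
  shows "pact A p (0\<^sub>v n) = (0\<^sub>v n :: 'a::field vec)"
proof -
  have "pact A p (0 \<cdot>\<^sub>v 0\<^sub>v n) = 0 \<cdot>\<^sub>v pact A p (0\<^sub>v n)" by (rule pact_vec_smult[OF A zero_carrier_vec])
  also have "\<dots> = 0\<^sub>v n" using carrier_vecD[OF pact_carrier[OF A zero_carrier_vec], of p] by (intro eq_vecI) auto
  also have "0 \<cdot>\<^sub>v 0\<^sub>v n = (0\<^sub>v n :: 'a vec)" by (intro eq_vecI) auto
  finally show ?thesis .
qed

lemma char_poly_0: "A \<in> carrier_mat 0 0 \<Longrightarrow> char_poly A = 1"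
  by (simp add: char_poly_def)

lemma char_poly_monic:
  assumes "A \<in> carrier_mat n n"
  shows "degree (char_poly A) = n" "coeff (char_poly A) n = 1" "char_poly A \<noteq> (0 :: 'a::field poly)"
  using degree_monic_char_poly[OF assms] by auto

text \<open>Both polynomials are monic of degree f and kill the first unit vector: \<open>F\<close>
  by construction, the other by Cayley-Hamilton. Their difference has degree below f, and as the
  Krylov matrix of that vector is the identity, its coefficients vanish.\<close>

lemma char_poly_companion:
  fixes F :: "'a::field poly"
  assumes F: "monic F" "0 < degree F"
  shows "char_poly (companion F) = F"
proof -
  let ?f = "degree F" and ?C = "companion F" and ?c = "char_poly (companion F)"
  let ?b = "0\<^sub>v 0 :: 'a vec" and ?Z = "0\<^sub>m (degree F) 0 :: 'a mat"
  have C: "?C \<in> carrier_mat ?f ?f" by simp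
  \<comment> \<open>The companion matrix is viewed as an extension of the empty matrix; the block
    equation then exhibits the identity as a Krylov matrix.\<close>
  have "?Z * last_col 0 ?f ?b = 0\<^sub>m ?f ?f" by (intro eq_matI) (auto simp: scalar_prod_def last_col_def)
  then have "?C * 1\<^sub>m ?f = ?Z * last_col 0 ?f ?b + 1\<^sub>m ?f * ?C"
    by (simp only: right_mult_one_mat[OF C] left_mult_one_mat[OF C] left_add_zero_mat[OF C])
  note k = block_eq_krylov[OF C zero_carrier_mat one_carrier_mat F this]
  define e where "e = col (1\<^sub>m ?f :: 'a mat) 0"
  have e: "e \<in> carrier_vec ?f" using F by (simp add: e_def)
  have Fe: "pact ?C F e = 0\<^sub>v ?f" using k(2) unfolding e_def by (auto intro!: eq_vecI simp: scalar_prod_def pad_def)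
  have ce: "pact ?C ?c e = 0\<^sub>v ?f" by (rule cayley_hamilton[OF C e])
  have deg: "coeff (?c - F) l = 0" if "?f \<le> l" for l
    using that char_poly_monic[OF C] F(1) by (cases "l = ?f") (auto simp: coeff_eq_0)
  have "?c = F + (?c - F)" by simp
  then have "pact ?C ?c e = pact ?C F e + pact ?C (?c - F) e" using pact_add[OF C e] by metis
  then have "0\<^sub>v ?f = 0\<^sub>v ?f + pact ?C (?c - F) e" unfolding Fe ce .
  then have 0: "pact ?C (?c - F) e = 0\<^sub>v ?f" using pact_carrier[OF C e, of "?c - F"] by simp
  have "krylov ?C e ?f *\<^sub>v vec ?f (coeff (?c - F)) = pact ?C (?c - F) e"
    by (rule krylov_mult_vec[OF C e deg])
  moreover have "krylov ?C e ?f = 1\<^sub>m ?f" using k(1) unfolding e_def by simp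
  ultimately have v: "vec ?f (coeff (?c - F)) = 0\<^sub>v ?f" using 0 by simp
  have "coeff (?c - F) l = 0" for l
  proof (cases "l < ?f")
    case True
    then have "coeff (?c - F) l = vec ?f (coeff (?c - F)) $ l" by simp
    also have "\<dots> = 0" unfolding v using True by simp
    finally show ?thesis .
  qed (use deg in simp)
  then have "?c - F = 0" by (intro poly_eqI) simp
  then show ?thesis by simp
qed

lemma char_poly_ext:
  fixes F :: "'a::field poly"
  assumes T: "T \<in> carrier_mat D D" and F: "monic F" "0 < degree F"
  shows "char_poly (ext F T b) = char_poly T * F"
proof -
  have dT: "dim_row T = D" using T by simp
  show ?thesis
    unfolding ext_def dT char_poly_four_block_lower_zero[OF T last_col_carrier companion_carrier]
      char_poly_companion[OF F] ..
qed

lemma char_poly_chainT: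
  fixes F :: "'a::field poly"
  assumes T: "T \<in> carrier_mat d d" and F: "monic F" "0 < degree F"
  shows "char_poly (chainT F T bs) = char_poly T * F ^ length bs"
proof (induction bs)
  case (Cons b bs)
  have "char_poly (chainT F T (b # bs)) = char_poly (chainT F T bs) * F"
    using char_poly_ext[OF chainT_carrier[OF T] F] by simp
  then show ?case using Cons by (simp add: mult_ac)
qed simp

section \<open>Multiplicity and the kernel of F on the quotient\<close>

text \<open>A Bezout identity between \<open>F\<close> and the characteristic polynomial; the latter
  acts as 0 by Cayley-Hamilton.\<close>

lemma pact_inj_if_not_dvd:
  fixes S :: "'a::field_gcd mat"
  assumes S: "S \<in> carrier_mat m m" and F: "irreducible F" "\<not> F dvd char_poly S"
    and w: "w \<in> carrier_vec m" "pact S F w = 0\<^sub>v m"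
  shows "w = 0\<^sub>v m"
proof -
  obtain a c where ac: "a * F + c * char_poly S = 1" using bezout_irreducible[OF F] by blast
  have "w = pact S (a * F + c * char_poly S) w" using ac S w by simp
  also have "\<dots> = pact S a (pact S F w) + pact S c (pact S (char_poly S) w)"
    by (simp only: pact_add[OF S w(1)] pact_mult[OF S w(1)])
  also have "\<dots> = 0\<^sub>v m"
    unfolding w(2) cayley_hamilton[OF S w(1)] pact_zero_vec[OF S] by simp
  finally show ?thesis .
qed

lemma quotient_pact:
  assumes S: "S \<in> carrier_mat m m" and R: "R \<in> carrier_mat m n" and A: "A \<in> carrier_mat n n"
    and RA: "R * A = S * R" and y: "y \<in> carrier_vec n"
  shows "R *\<^sub>v pact A p y = pact S p (R *\<^sub>v (y :: 'a::field vec))"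
  using pact_intertwine[OF S A R RA[symmetric] y] by simp

lemma empty_in_emb: "0\<^sub>m n 0 \<in> emb n 0 (0\<^sub>m 0 0) (A :: 'a::field mat)" if "A \<in> carrier_mat n n"
  using that by (auto simp: emb_def intro!: eq_vecI)

lemma colsp_empty: "colsp (0\<^sub>m n 0 :: 'a::field mat) = {0\<^sub>v n}"
proof -
  have "0\<^sub>m n 0 *\<^sub>v v = (0\<^sub>v n :: 'a vec)" if "v \<in> carrier_vec 0" for v :: "'a vec"
    using that by (intro eq_vecI) (auto simp: scalar_prod_def row_def)
  moreover have "carrier_vec 0 \<noteq> ({} :: 'a vec set)" using zero_carrier_vec by blast
  ultimately show ?thesis by (auto simp: colsp_def)
qed

text \<open>Induction on the size, without canonical forms. A polynomial \<open>h\<close> of least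
  degree killing some nonzero vector \<open>w\<close> is irreducible, and the Krylov space of
  \<open>w\<close> splits \<open>h\<close> off the characteristic polynomial. Injectivity of F(S)
  excludes F dvd h. On the finite Krylov space \<open>F\<close> is then bijective, so a preimage of
  zero in the quotient can be corrected by a vector of that space: injectivity passes to the
  quotient.\<close>

lemma not_dvd_if_pact_inj:
  fixes S :: "'a::{field_gcd,finite} mat"
  assumes "S \<in> carrier_mat m m" and F: "irreducible F"
    and "\<And>w. w \<in> carrier_vec m \<Longrightarrow> pact S F w = 0\<^sub>v m \<Longrightarrow> w = 0\<^sub>v m"
  shows "\<not> F dvd char_poly S"
  using assms(1,3)
proof (induction m arbitrary: S rule: less_induct)
  case (less m S)
  note S = less.prems(1) and inj = less.prems(2)
  have prime: "prime_elem F" using F by (rule irreducible_imp_prime_elem)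
  show ?case
  proof (cases "m = 0")
    case True
    then have "char_poly S = 1" using S by (simp add: char_poly_0)
    then show ?thesis using irreducible_not_unit[OF F] by (simp only: not_False_eq_True)
  next
    case False
    define Q where "Q = (\<lambda>h. h \<noteq> 0 \<and> (\<exists>w\<in>carrier_vec m. w \<noteq> 0\<^sub>v m \<and> pact S h w = 0\<^sub>v m))"
    have "Q (char_poly S)"
    proof -
      have "unit_vec m 0 \<noteq> (0\<^sub>v m :: 'a vec)" using False by (intro unit_vec_nonzero) simp
      then show ?thesis
        unfolding Q_def using char_poly_monic(3)[OF S] cayley_hamilton[OF S, of "unit_vec m 0"] by auto
    qed
    then have "\<exists>h. Q h \<and> (\<forall>g. Q g \<longrightarrow> degree h \<le> degree g)"
      using ex_has_least_nat[of Q _ degree] by blast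
    then obtain h0 where h0: "Q h0" "\<And>g. Q g \<Longrightarrow> degree h0 \<le> degree g" by blast
    define h where "h = Polynomial.smult (inverse (lead_coeff h0)) h0"
    have h0n: "h0 \<noteq> 0" using h0 by (simp add: Q_def)
    obtain w where w: "w \<in> carrier_vec m" "w \<noteq> 0\<^sub>v m" "pact S h0 w = 0\<^sub>v m" using h0 by (auto simp: Q_def)
    have hw: "pact S h w = 0\<^sub>v m" unfolding h_def pact_smult[OF S w(1)] w(3) by (intro eq_vecI) auto
    have h: "monic h" "h \<noteq> 0" "degree h = degree h0" using h0n by (auto simp: h_def)
    have min: "degree h \<le> degree g" if "g \<noteq> 0" "x \<in> carrier_vec m" "x \<noteq> 0\<^sub>v m" "pact S g x = 0\<^sub>v m" for g x
      using that h0(2)[of g] h(3) by (auto simp: Q_def)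
    have hpos: "0 < degree h"
    proof (rule ccontr)
      assume "\<not> 0 < degree h"
      then have "h = 1" using h(1) by (simp add: monic_degree_0)
      then show False using hw w S by simp
    qed
    have irr: "irreducible h"
    proof (rule irreducibleI)
      show "h \<noteq> 0" by (rule h)
      show "\<not> h dvd 1" using hpos by (auto simp: is_unit_iff_degree[OF h(2)])
      fix a b assume ab: "h = a * b"
      have nz: "a \<noteq> 0" "b \<noteq> 0" using ab h(2) by auto
      have deg: "degree h = degree a + degree b" using ab nz by (simp add: degree_mult_eq)
      have b: "pact S b w \<in> carrier_vec m" by (rule pact_carrier[OF S w(1)])
      show "a dvd 1 \<or> b dvd 1"
      proof (cases "pact S b w = 0\<^sub>v m")
        case True
        then have "degree h \<le> degree b" using min[OF nz(2) w(1,2)] by simp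
        then have "degree a = 0" using deg by simp
        then show ?thesis using nz by (simp add: is_unit_iff_degree)
      next
        case False
        have "pact S a (pact S b w) = 0\<^sub>v m" using hw unfolding ab pact_mult[OF S w(1)] .
        then have "degree h \<le> degree a" using min[OF nz(1) b False] by simp
        then have "degree b = 0" using deg by simp
        then show ?thesis using nz by (simp add: is_unit_iff_degree)
      qed
    qed
    have nF: "\<not> F dvd h"
    proof
      assume "F dvd h"
      then obtain u where u: "h = F * u" by (elim dvdE)
      have uc: "pact S u w \<in> carrier_vec m" by (rule pact_carrier[OF S w(1)])
      have "pact S F (pact S u w) = 0\<^sub>v m" using hw unfolding u pact_mult[OF S w(1)] .
      then have "pact S u w = 0\<^sub>v m" by (rule inj[OF uc])
      moreover have "u \<noteq> 0" using u h(2) by auto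
      ultimately have "degree h \<le> degree u" using min w by blast
      moreover have "degree h = degree F + degree u" using u h(2) by (auto simp: degree_mult_eq)
      moreover have "0 < degree F" using F by (metis irreducible_def gr0I is_unit_iff_degree)
      ultimately show False by simp
    qed
    let ?E = "0\<^sub>m m 0 :: 'a mat" and ?T = "0\<^sub>m 0 0 :: 'a mat" and ?b = "0\<^sub>v 0 :: 'a vec"
    let ?f = "degree h"
    define T1 where "T1 = ext h ?T ?b"
    have T1: "T1 \<in> carrier_mat ?f ?f" using ext_carrier[of ?T 0 h ?b] by (simp add: T1_def)
    have chT1: "char_poly T1 = h"
      unfolding T1_def using char_poly_ext[OF zero_carrier_mat h(1) hpos, of 0] by (simp add: char_poly_0)
    define X where "X = hc ?E (krylov S w ?f)"
    have X: "X \<in> emb m ?f T1 S"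
    proof -
      have "pact S h w = fc 0 ?E *\<^sub>v ?b" unfolding hw by (intro eq_vecI) (auto simp: fc_def scalar_prod_def)
      then have "X \<in> emb m (0 + ?f) (ext h ?T ?b) S"
        unfolding X_def using w colsp_empty[where 'a='a and n=m]
        by (intro hc_krylov_in_emb[OF S zero_carrier_mat _ h(1) irr _ empty_in_emb[OF S], of 0]) auto
      then show ?thesis by (simp add: T1_def)
    qed
    have Xc: "X \<in> carrier_mat m ?f" using X by (rule emb_carrier)
    obtain S2 R where "quotient_of m ?f X T1 S S2 R"
      using quotient_of_ex[OF emb_injm[OF X] T1 S emb_eq[OF X]] by blast
    note q = quotient_ofD[OF this]
    have "\<not> F dvd char_poly S2"
    proof (rule less.IH[OF _ q(1)])
      show "m - ?f < m" using False hpos by simp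
      fix z :: "'a vec" assume z: "z \<in> carrier_vec (m - ?f)" "pact S2 F z = 0\<^sub>v (m - ?f)"
      obtain y where y: "y \<in> carrier_vec m" "R *\<^sub>v y = z" using q(5)[OF z(1)] by blast
      have Fy: "pact S F y \<in> carrier_vec m" by (rule pact_carrier[OF S y(1)])
      have "R *\<^sub>v pact S F y = 0\<^sub>v (m - ?f)" unfolding quotient_pact[OF q(1,2) S q(3) y(1)] y(2) by (rule z(2))
      then have "pact S F y \<in> colsp X" using q(4)[OF Fy] by blast
      then obtain v where v: "v \<in> carrier_vec ?f" "pact S F y = X *\<^sub>v v" using Xc by (rule colspE)
      have "inj_on (pact T1 F) (carrier_vec ?f)"
      proof (rule inj_onI)
        fix a b assume ab: "a \<in> carrier_vec ?f" "b \<in> carrier_vec ?f" "pact T1 F a = pact T1 F b"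
        have mb: "(-1) \<cdot>\<^sub>v b \<in> carrier_vec ?f" using ab by simp
        have "pact T1 F (a + (-1) \<cdot>\<^sub>v b) = pact T1 F b + (-1) \<cdot>\<^sub>v pact T1 F b"
          unfolding pact_vec_add[OF T1 ab(1) mb] pact_vec_smult[OF T1 ab(2)] ab(3) ..
        also have "\<dots> = 0\<^sub>v ?f" using carrier_vecD[OF pact_carrier[OF T1 ab(2)], of F] by (intro eq_vecI) auto
        finally have "pact T1 F (a + (-1) \<cdot>\<^sub>v b) = 0\<^sub>v ?f" .
        moreover have "\<not> F dvd char_poly T1" using nF by (simp only: chT1 not_False_eq_True)
        ultimately have "a + (-1) \<cdot>\<^sub>v b = 0\<^sub>v ?f"
          using pact_inj_if_not_dvd[OF T1 F _ add_carrier_vec[OF ab(1) mb]] by blast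
        then have *: "(a + (-1) \<cdot>\<^sub>v b) $ i = 0" if "i < ?f" for i using that by simp
        show "a = b"
        proof (rule eq_vecI)
          fix i assume "i < dim_vec b"
          then show "a $ i = b $ i" using *[of i] ab by simp
        qed (use ab in simp)
      qed
      then have "pact T1 F ` carrier_vec ?f = carrier_vec ?f"
        using T1 by (intro endo_inj_surj) auto
      then obtain v' where v': "v' \<in> carrier_vec ?f" "pact T1 F v' = v" using v(1) by (metis imageE)
      have Xv': "X *\<^sub>v v' \<in> carrier_vec m" using Xc v' by simp
      have mX: "(-1) \<cdot>\<^sub>v (X *\<^sub>v v') \<in> carrier_vec m" using Xv' by simp
      have "pact S F (X *\<^sub>v v') = pact S F y"
        unfolding pact_intertwine[OF S T1 Xc emb_eq[OF X] v'(1)] v'(2) v(2) ..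
      then have "pact S F (y + (-1) \<cdot>\<^sub>v (X *\<^sub>v v')) = pact S F y + (-1) \<cdot>\<^sub>v pact S F y"
        unfolding pact_vec_add[OF S y(1) mX] pact_vec_smult[OF S Xv'] by simp
      also have "\<dots> = 0\<^sub>v m" using carrier_vecD[OF Fy] by (intro eq_vecI) auto
      finally have "pact S F (y + (-1) \<cdot>\<^sub>v (X *\<^sub>v v')) = 0\<^sub>v m" .
      then have "y + (-1) \<cdot>\<^sub>v (X *\<^sub>v v') = 0\<^sub>v m" by (rule inj[OF add_carrier_vec[OF y(1) mX]])
      then have *: "(y + (-1) \<cdot>\<^sub>v (X *\<^sub>v v')) $ i = 0" if "i < m" for i using that by simp
      have "y = X *\<^sub>v v'"
      proof (rule eq_vecI)
        fix i assume "i < dim_vec (X *\<^sub>v v')"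
        then have "i < m" using Xc by simp
        then show "y $ i = (X *\<^sub>v v') $ i" using *[of i] y carrier_vecD[OF Xv'] by (simp del: index_mult_mat_vec)
      qed (use y carrier_vecD[OF Xv'] in simp)
      then have "y \<in> colsp X" using colspI[OF Xc v'(1)] by simp
      then show "z = 0\<^sub>v (m - ?f)" using q(4)[OF y(1)] y(2) by simp
    qed
    then show ?thesis unfolding q(6) chT1 using nF prime by (simp add: prime_elem_dvd_mult_iff)
  qed
qed

lemma colsp_subset_KX:
  assumes "A \<in> carrier_mat n n" "T \<in> carrier_mat d d" "X \<in> emb n d T A"
  shows "colsp X \<subseteq> KX A F X"
  using pact_in_colsp[OF assms(1,2) emb_carrier[OF assms(3)] emb_eq[OF assms(3)]]
    colsp_carrier[OF emb_carrier[OF assms(3)]] assms(1)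
  by (auto simp: KX_def)

text \<open>\<open>KX\<close> consists of the vectors whose class in the quotient is killed by
  \<open>F\<close>. Equality thus means that \<open>F\<close> is injective on the quotient, whose
  characteristic polynomial is the cofactor of that of \<open>T\<close>.\<close>

lemma KX_eq_colsp_iff:
  fixes A :: "'a::{field_gcd,finite} mat"
  assumes A: "A \<in> carrier_mat n n" and T: "T \<in> carrier_mat d d" and F: "irreducible F" and X: "X \<in> emb n d T A"
  shows "KX A F X = colsp X \<longleftrightarrow> multiplicity F (char_poly A) = multiplicity F (char_poly T)"
proof -
  let ?m = "n - d"
  obtain S R where "quotient_of n d X T A S R"
    using quotient_of_ex[OF emb_injm[OF X] T A emb_eq[OF X]] by blast
  note q = quotient_ofD[OF this]
  have prime: "prime_elem F" using F by (rule irreducible_imp_prime_elem)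
  have KX_iff: "y \<in> KX A F X \<longleftrightarrow> pact S F (R *\<^sub>v y) = 0\<^sub>v ?m" if y: "y \<in> carrier_vec n" for y
    using q(4)[of "pact A F y"] y A quotient_pact[OF q(1,2) A q(3) y, of F] by (simp add: KX_def)
  have "KX A F X = colsp X \<longleftrightarrow> (\<forall>w\<in>carrier_vec ?m. pact S F w = 0\<^sub>v ?m \<longrightarrow> w = 0\<^sub>v ?m)"
  proof
    assume eq: "KX A F X = colsp X"
    show "\<forall>w\<in>carrier_vec ?m. pact S F w = 0\<^sub>v ?m \<longrightarrow> w = 0\<^sub>v ?m"
    proof (intro ballI impI)
      fix w :: "'a vec" assume w: "w \<in> carrier_vec ?m" "pact S F w = 0\<^sub>v ?m"
      obtain y where y: "y \<in> carrier_vec n" "R *\<^sub>v y = w" using q(5)[OF w(1)] by blast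
      then have "y \<in> colsp X" using KX_iff[OF y(1)] w(2) eq by simp
      then show "w = 0\<^sub>v ?m" using q(4)[OF y(1)] y(2) by simp
    qed
  next
    assume inj: "\<forall>w\<in>carrier_vec ?m. pact S F w = 0\<^sub>v ?m \<longrightarrow> w = 0\<^sub>v ?m"
    show "KX A F X = colsp X"
    proof
      show "KX A F X \<subseteq> colsp X"
      proof
        fix y assume y: "y \<in> KX A F X"
        then have yc: "y \<in> carrier_vec n" using A by (simp add: KX_def)
        have "R *\<^sub>v y \<in> carrier_vec ?m" using q(2) yc by simp
        then have "R *\<^sub>v y = 0\<^sub>v ?m" using KX_iff[OF yc] y inj by blast
        then show "y \<in> colsp X" using q(4)[OF yc] by blast
      qed
    qed (rule colsp_subset_KX[OF A T X])
  qed
  also have "\<dots> \<longleftrightarrow> \<not> F dvd char_poly S"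
    using pact_inj_if_not_dvd[OF q(1) F] not_dvd_if_pact_inj[OF q(1) F] by blast
  also have "\<dots> \<longleftrightarrow> multiplicity F (char_poly S) = 0"
    using char_poly_monic(3)[OF q(1)] irreducible_not_unit[OF F]
    by (subst multiplicity_eq_zero_iff) auto
  also have "\<dots> \<longleftrightarrow> multiplicity F (char_poly A) = multiplicity F (char_poly T)"
    unfolding q(6) using char_poly_monic(3)[OF q(1)] char_poly_monic(3)[OF T]
    by (subst prime_elem_multiplicity_mult_distrib[OF prime]) auto
  finally show ?thesis .
qed

text \<open>A chain that cannot be prolonged exhausts \<open>KX\<close>, since any vector left over
  would extend it; s is its length. This avoids treating the quotient as a vector space over
  K[t]/(F), and the chain itself is reused to enlarge embeddings.\<close>

lemma card_KX:
  fixes A :: "'a::{field_gcd,finite} mat"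
  assumes A: "A \<in> carrier_mat n n" and T: "T \<in> carrier_mat d d" and F: "monic F" "irreducible F" "0 < degree F"
    and X: "X \<in> emb n d T A"
  obtains s where "card (KX A F X) = CARD('a) ^ (d + s * degree F)" "s = 0 \<longleftrightarrow> KX A F X = colsp X"
    "\<exists>bs Z. length bs = s \<and> set bs \<subseteq> carrier_vec d \<and> Z \<in> emb n (d + s * degree F) (chainT F T bs) A"
proof -
  let ?f = "degree F"
  \<comment> \<open>The lengths of chains over \<open>X\<close>. They are bounded by
    \<open>n\<close>, because each step adds deg F \<ge> 1 independent columns, so a greatest one
    exists.\<close>
  define Q where "Q = (\<lambda>l. \<exists>bs Z. length bs = l \<and> set bs \<subseteq> carrier_vec d \<and> Z \<in> emb n (d + l * ?f) (chainT F T bs) A \<and> fc d Z = X)"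
  have Xc: "X \<in> carrier_mat n d" using X by (rule emb_carrier)
  have "Q 0" unfolding Q_def using X fc_id[OF Xc] by (intro exI[of _ "[]"] exI[of _ X]) auto
  moreover have bound: "l \<le> n" if "Q l" for l
  proof -
    have "d + l * ?f \<le> n" using that injm_le emb_injm unfolding Q_def by blast
    moreover have "l \<le> l * ?f" using F(3) by (cases ?f) simp_all
    ultimately show ?thesis by linarith
  qed
  ultimately have s: "Q (Greatest Q)" "\<And>l. Q l \<Longrightarrow> l \<le> Greatest Q"
    by (metis GreatestI_nat, metis Greatest_le_nat)
  define s where "s = Greatest Q"
  note s = s[folded s_def]
  then obtain bs Z where Z: "length bs = s" "set bs \<subseteq> carrier_vec d" "Z \<in> emb n (d + s * ?f) (chainT F T bs) A" "fc d Z = X"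
    unfolding Q_def by blast
  have sub: "colsp Z \<subseteq> KX A F X" using chain_closed[OF A T F(1,3) Z(2)] Z by auto
  have Zc: "Z \<in> carrier_mat n (d + s * ?f)" using Z(3) by (rule emb_carrier)
  have "KX A F X \<subseteq> colsp Z"
  proof
    fix y assume y: "y \<in> KX A F X"
    show "y \<in> colsp Z"
    proof (rule ccontr)
      assume ny: "y \<notin> colsp Z"
      have yc: "y \<in> carrier_vec n" using y A by (simp add: KX_def)
      have "pact A F y \<in> colsp X" using y by (simp add: KX_def)
      then obtain b where b: "b \<in> carrier_vec d" "pact A F y = fc d Z *\<^sub>v b" using Xc unfolding Z(4) by (rule colspE)
      have T': "chainT F T bs \<in> carrier_mat (d + s * ?f) (d + s * ?f)" using chainT_carrier[OF T, of F bs] Z(1) by simp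
      have new: "hc Z (krylov A y ?f) \<in> emb n (d + s * ?f + ?f) (ext F (chainT F T bs) b) A"
        by (rule hc_krylov_in_emb[OF A T' _ F(1,2) b(1) Z(3) yc ny b(2)]) simp
      have "fc d (hc Z (krylov A y ?f)) = X"
        using fc_fc[of d "d + s * ?f" "hc Z (krylov A y ?f)"] fc_hc[OF Zc krylov_carrier[OF A]] Z(4) by simp
      then have "Q (Suc s)"
        unfolding Q_def using new Z(1,2) b(1)
        by (intro exI[of _ "b # bs"] exI[of _ "hc Z (krylov A y ?f)"]) (simp add: algebra_simps)
      then show False using s(2)[of "Suc s"] by simp
    qed
  qed
  then have eq: "KX A F X = colsp Z" using sub by blast
  have card: "card (KX A F X) = CARD('a) ^ (d + s * ?f)" unfolding eq by (rule card_colsp[OF emb_injm[OF Z(3)]])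
  have cX: "card (colsp X) = CARD('a) ^ d" by (rule card_colsp[OF emb_injm[OF X]])
  have "s = 0 \<longleftrightarrow> KX A F X = colsp X"
  proof
    assume "s = 0"
    then have "card (KX A F X) = card (colsp X)" using card cX by simp
    moreover have "finite (KX A F X)" by (simp add: KX_def)
    ultimately show "KX A F X = colsp X" using colsp_subset_KX[OF A T X] by (metis card_subset_eq)
  next
    assume "KX A F X = colsp X"
    then have "CARD('a) ^ (d + s * ?f) = CARD('a) ^ d" using card cX by simp
    then have "d + s * ?f = d" using CARD_gt_1[where 'a='a] by (metis power_inject_exp)
    then show "s = 0" using F(3) by simp
  qed
  then show ?thesis using that card Z by blast
qed

section \<open>Newton interpolation with Bonferroni signs\<close>

text \<open>
  Newton interpolation at the nodes $1, q, q^2, \ldots$ of the function that is 1 at $x = 1$ and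
  vanishes at all $q^s$ with $s > 0$.
\<close>
definition qfact :: "real \<Rightarrow> nat \<Rightarrow> real" where
  "qfact q i = (\<Prod>l\<in>{1..i}. q ^ l - 1)"

text \<open>The interpolant of degree I takes the value 1 at x = 1 and has the zeros q, ..., q^I, so
  it is a multiple of the product of the x - q^l.\<close>

lemma newton_partial_sum:
  assumes "\<And>l. 0 < l \<Longrightarrow> q ^ l \<noteq> (1 :: real)"
  shows "(\<Sum>i\<le>I. (-1) ^ i / qfact q i * (\<Prod>l<i. x - q ^ l)) = (-1) ^ I / qfact q I * (\<Prod>l\<in>{1..I}. x - q ^ l)"
proof (induction I)
  case (Suc I)
  have nz: "qfact q I \<noteq> 0" "q ^ Suc I - 1 \<noteq> 0" using assms[of "Suc I"] assms by (auto simp: qfact_def)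
  have q: "qfact q (Suc I) = qfact q I * (q ^ Suc I - 1)" by (simp add: qfact_def prod.nat_ivl_Suc')
  have p: "(\<Prod>l<Suc I. x - q ^ l) = (x - 1) * (\<Prod>l\<in>{1..I}. x - q ^ l)"
    by (simp add: prod.lessThan_Suc_shift prod.atLeast1_atMost_eq del: prod.lessThan_Suc)
  have "(\<Sum>i\<le>Suc I. (-1) ^ i / qfact q i * (\<Prod>l<i. x - q ^ l)) =
      (-1) ^ I / qfact q I * (\<Prod>l\<in>{1..I}. x - q ^ l) + (-1) ^ Suc I / qfact q (Suc I) * ((x - 1) * (\<Prod>l\<in>{1..I}. x - q ^ l))"
    unfolding sum.atMost_Suc Suc p ..
  also have "\<dots> = (-1) ^ I * (\<Prod>l\<in>{1..I}. x - q ^ l) * (1 / qfact q I - (x - 1) / qfact q (Suc I))"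
    by (simp add: algebra_simps add_divide_distrib diff_divide_distrib)
  also have "1 / qfact q I - (x - 1) / qfact q (Suc I) = - (x - q ^ Suc I) / qfact q (Suc I)"
    unfolding q using nz by (simp add: field_simps)
  also have "(-1) ^ I * (\<Prod>l\<in>{1..I}. x - q ^ l) * (- (x - q ^ Suc I) / qfact q (Suc I)) =
      (-1) ^ Suc I / qfact q (Suc I) * (\<Prod>l\<in>{1..Suc I}. x - q ^ l)"
  proof -
    have gen: "a * P * (- D / Q) = (- 1 * a) / Q * (D * P)" for a P D Q :: real by simp
    have P: "(\<Prod>l\<in>{1..Suc I}. x - q ^ l) = (x - q ^ Suc I) * (\<Prod>l\<in>{1..I}. x - q ^ l)"
      by (rule prod.nat_ivl_Suc') simp
    show ?thesis unfolding P power_Suc[of "-1"] by (rule gen)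
  qed
  finally show ?case .
qed (simp add: qfact_def)

lemma qfact_pos: "1 < q \<Longrightarrow> 0 < qfact q i"
  unfolding qfact_def by (intro prod_pos) (auto intro: one_less_power)

text \<open>At x = q^s the product with zeros q, ..., q^I vanishes for 0 < s \<le> I and is positive
  beyond, so the error has the sign (-1)^I.\<close>

lemma newton_bonferroni:
  fixes q :: real
  assumes q: "1 < q"
  defines "R \<equiv> \<lambda>I s. \<Sum>i\<le>I. (-1) ^ i / qfact q i * (\<Prod>l<i. q ^ s - q ^ l)"
  shows "even I \<Longrightarrow> of_bool (s = 0) \<le> R I s" "odd I \<Longrightarrow> R I s \<le> of_bool (s = 0)"
proof -
  have qn: "q ^ l \<noteq> 1" if "0 < l" for l using one_less_power[OF q that] by simp
  have R: "R I s = (-1) ^ I / qfact q I * (\<Prod>l\<in>{1..I}. q ^ s - q ^ l)"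
    unfolding R_def by (rule newton_partial_sum[OF qn])
  have pos: "qfact q I > 0" by (rule qfact_pos[OF q])
  have "R I s = 1" if "s = 0"
  proof -
    have "(\<Prod>l\<in>{1..I}. q ^ s - q ^ l) = (\<Prod>l\<in>{1..I}. (-1) * (q ^ l - 1))"
      using that by (intro prod.cong) auto
    also have "\<dots> = (-1) ^ I * qfact q I" by (simp only: prod.distrib prod_constant qfact_def) simp
    finally show ?thesis unfolding R using pos by (simp flip: power_mult_distrib)
  qed
  moreover have "0 \<le> (\<Prod>l\<in>{1..I}. q ^ s - q ^ l)" if "s \<noteq> 0"
  proof (cases "s \<le> I")
    case True
    then have "(\<Prod>l\<in>{1..I}. q ^ s - q ^ l) = 0" using that by (intro prod_zero bexI[of _ s]) auto
    then show ?thesis by (simp only: order_refl)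
  next
    case False
    then show ?thesis using q by (intro prod_nonneg) (auto intro!: power_increasing)
  qed
  ultimately have main: "R I s = 1 \<and> s = 0 \<or> s \<noteq> 0 \<and> (\<exists>y\<ge>0. R I s = (-1) ^ I * y)"
  proof (cases "s = 0")
    case False
    then have "0 \<le> (\<Prod>l\<in>{1..I}. q ^ s - q ^ l) / qfact q I"
      using \<open>s \<noteq> 0 \<Longrightarrow> 0 \<le> (\<Prod>l\<in>{1..I}. q ^ s - q ^ l)\<close> pos by (intro divide_nonneg_pos) auto
    moreover have "R I s = (-1) ^ I * ((\<Prod>l\<in>{1..I}. q ^ s - q ^ l) / qfact q I)" unfolding R by (simp only: times_divide_eq_left times_divide_eq_right)
    ultimately show ?thesis using False by blast
  qed blast
  show "even I \<Longrightarrow> of_bool (s = 0) \<le> R I s" "odd I \<Longrightarrow> R I s \<le> of_bool (s = 0)"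
    using main by auto
qed

section \<open>The sieve\<close>

text \<open>Every gluing vector has |K|^d choices. Dividing by |K|^(d i) removes this factor from
  each difference |K|^(d + s deg F) - |K|^(d + l deg F) and leaves q^s - q^l. The bound on
  \<open>s X\<close> is recorded because it makes a truncation at \<open>n\<close> exact in
  \<open>sieve_exact\<close>.\<close>

lemma sieve_expansion:
  fixes A :: "'a::{field_gcd,finite} mat"
  assumes A: "A \<in> carrier_mat n n" and T: "T \<in> carrier_mat d d" and F: "monic F" "irreducible F" "0 < degree F"
  defines "q \<equiv> real CARD('a) ^ degree F"
  defines "N \<equiv> \<lambda>i. \<Sum>bs\<in>{bs. set bs \<subseteq> carrier_vec d \<and> length bs = i}. real (card (emb n (d + i * degree F) (chainT F T bs) A))"
  shows "\<exists>s. (\<forall>X\<in>emb n d T A. s X = 0 \<longleftrightarrow> multiplicity F (char_poly A) = multiplicity F (char_poly T)) \<and>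
    (\<forall>X\<in>emb n d T A. d + s X * degree F \<le> n) \<and>
    (\<forall>I. (\<Sum>i\<le>I. (-1) ^ i / qfact q i * (N i / real CARD('a) ^ (d * i)))
      = (\<Sum>X\<in>emb n d T A. \<Sum>i\<le>I. (-1) ^ i / qfact q i * (\<Prod>l<i. q ^ s X - q ^ l)))"
proof -
  let ?f = "degree F" and ?p = "real CARD('a)"
  have p0: "?p > 0" using CARD_gt_1[where 'a='a] by simp
  have "\<forall>X\<in>emb n d T A. \<exists>s. card (KX A F X) = CARD('a) ^ (d + s * ?f) \<and> (s = 0 \<longleftrightarrow> KX A F X = colsp X) \<and> d + s * ?f \<le> n"
  proof
    fix X assume X: "X \<in> emb n d T A"
    obtain s where s: "card (KX A F X) = CARD('a) ^ (d + s * ?f)" "s = 0 \<longleftrightarrow> KX A F X = colsp X"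
      "\<exists>bs Z. length bs = s \<and> set bs \<subseteq> carrier_vec d \<and> Z \<in> emb n (d + s * ?f) (chainT F T bs) A"
      by (rule card_KX[OF A T F X])
    then have "d + s * ?f \<le> n" using injm_le emb_injm by blast
    then show "\<exists>s. card (KX A F X) = CARD('a) ^ (d + s * ?f) \<and> (s = 0 \<longleftrightarrow> KX A F X = colsp X) \<and> d + s * ?f \<le> n"
      using s by blast
  qed
  then obtain s where s: "\<forall>X\<in>emb n d T A. card (KX A F X) = CARD('a) ^ (d + s X * ?f) \<and> (s X = 0 \<longleftrightarrow> KX A F X = colsp X) \<and> d + s X * ?f \<le> n"
    by (rule bchoice[THEN exE])
  have prod_eq: "(\<Prod>l<i. real (card (KX A F X)) - ?p ^ (d + l * ?f)) = ?p ^ (d * i) * (\<Prod>l<i. q ^ s X - q ^ l)"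
    if X: "X \<in> emb n d T A" for X i
  proof -
    have "real (card (KX A F X)) - ?p ^ (d + l * ?f) = ?p ^ d * (q ^ s X - q ^ l)" for l
    proof -
      have "real (card (KX A F X)) = ?p ^ (d + s X * ?f)" using s X by (simp flip: of_nat_power)
      then show ?thesis by (simp add: q_def power_add right_diff_distrib mult.commute flip: power_mult)
    qed
    then show ?thesis by (simp add: prod.distrib power_mult)
  qed
  have N_eq: "N i / ?p ^ (d * i) = (\<Sum>X\<in>emb n d T A. \<Prod>l<i. q ^ s X - q ^ l)" for i
  proof -
    have "N i = (\<Sum>X\<in>emb n d T A. 1 * (\<Prod>l<i. real (card (KX A F X)) - ?p ^ (d + l * ?f)))"
      unfolding N_def using chain_sum[OF A T F, where i = i and g = "\<lambda>_. 1"] by simp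
    also have "\<dots> = (\<Sum>X\<in>emb n d T A. ?p ^ (d * i) * (\<Prod>l<i. q ^ s X - q ^ l))"
      by (rule sum.cong[OF refl]) (simp add: prod_eq)
    finally show ?thesis using p0 by (simp add: sum_distrib_left[symmetric])
  qed
  have "(\<Sum>i\<le>I. (-1) ^ i / qfact q i * (N i / ?p ^ (d * i)))
      = (\<Sum>X\<in>emb n d T A. \<Sum>i\<le>I. (-1) ^ i / qfact q i * (\<Prod>l<i. q ^ s X - q ^ l))" for I
    unfolding N_eq sum_distrib_left by (rule sum.swap)
  moreover have "s X = 0 \<longleftrightarrow> multiplicity F (char_poly A) = multiplicity F (char_poly T)" if X: "X \<in> emb n d T A" for X
    using s X KX_eq_colsp_iff[OF A T F(2) X] by blast
  ultimately show ?thesis using s by (intro exI[of _ s]) blast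
qed

lemma q_gt_1:
  assumes "0 < k" shows "1 < real CARD('a::{field,finite}) ^ k"
  using CARD_gt_1[where 'a='a] assms by (intro one_less_power) auto

lemma sieve_bounds:
  fixes A :: "'a::{field_gcd,finite} mat"
  assumes A: "A \<in> carrier_mat n n" and T: "T \<in> carrier_mat d d" and F: "monic F" "irreducible F" "0 < degree F"
  defines "q \<equiv> real CARD('a) ^ degree F"
  defines "N \<equiv> \<lambda>i. \<Sum>bs\<in>{bs. set bs \<subseteq> carrier_vec d \<and> length bs = i}. real (card (emb n (d + i * degree F) (chainT F T bs) A))"
  defines "R \<equiv> \<lambda>I. \<Sum>i\<le>I. (-1) ^ i / qfact q i * (N i / real CARD('a) ^ (d * i))"
  defines "m \<equiv> real (card (emb n d T A)) * of_bool (multiplicity F (char_poly A) = multiplicity F (char_poly T))"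
  shows "even I \<Longrightarrow> m \<le> R I" "odd I \<Longrightarrow> R I \<le> m"
proof -
  obtain s where s: "\<forall>X\<in>emb n d T A. s X = 0 \<longleftrightarrow> multiplicity F (char_poly A) = multiplicity F (char_poly T)"
    and RI: "\<forall>I. R I = (\<Sum>X\<in>emb n d T A. \<Sum>i\<le>I. (-1) ^ i / qfact q i * (\<Prod>l<i. q ^ s X - q ^ l))"
    using sieve_expansion[OF A T F] unfolding R_def N_def q_def by blast
  have q: "1 < q" unfolding q_def by (rule q_gt_1[OF F(3)])
  have m: "m = (\<Sum>X\<in>emb n d T A. of_bool (s X = 0))" using s by (simp add: m_def)
  show "m \<le> R I" if "even I"
    unfolding m RI[rule_format] by (intro sum_mono newton_bonferroni(1)[OF q that])
  show "R I \<le> m" if "odd I"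
    unfolding m RI[rule_format] by (intro sum_mono newton_bonferroni(2)[OF q that])
qed

lemma mat_expect_mono:
  assumes "\<And>i j a. i < n \<Longrightarrow> j < n \<Longrightarrow> 0 \<le> P i j a" "\<And>A. A \<in> carrier_mat n n \<Longrightarrow> f A \<le> g A"
  shows "mat_expect n P f \<le> mat_expect n P g"
  unfolding mat_expect_def using assms by (intro sum_mono mult_left_mono prod_nonneg) auto

lemma mat_expect_sum: "mat_expect n P (\<lambda>A. \<Sum>k\<in>K. c k * f k A) = (\<Sum>k\<in>K. c k * mat_expect n P (f k))"
  unfolding mat_expect_def sum_distrib_left by (subst sum.swap) (simp add: mult_ac)

lemma mat_expect_cong: "(\<And>A. A \<in> carrier_mat n n \<Longrightarrow> f A = g A) \<Longrightarrow> mat_expect n P f = mat_expect n P g"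
  unfolding mat_expect_def by (intro sum.cong) auto

section \<open>Limits of the sieved counts\<close>

text \<open>Here n tends to infinity for each fixed k, and only then k; this order demands no
  uniformity in k.\<close>

lemma tendsto_squeeze_family:
  fixes a :: "nat \<Rightarrow> real"
  assumes L: "\<And>k. \<forall>\<^sub>F n in sequentially. L k n \<le> a n" "\<And>k. L k \<longlonglongrightarrow> l k" "l \<longlonglongrightarrow> c"
    and U: "\<And>k. \<forall>\<^sub>F n in sequentially. a n \<le> U k n" "\<And>k. U k \<longlonglongrightarrow> u k" "u \<longlonglongrightarrow> c"
  shows "a \<longlonglongrightarrow> c"
proof (rule order_tendstoI)
  fix y assume "y < c"
  then have "\<forall>\<^sub>F k in sequentially. y < l k" using L(3) by (rule order_tendstoD(1)[rotated])
  then obtain k where "y < l k" by (auto simp: eventually_sequentially)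
  then have "\<forall>\<^sub>F n in sequentially. y < L k n" using L(2) by (rule order_tendstoD(1)[rotated])
  then show "\<forall>\<^sub>F n in sequentially. y < a n" using L(1)[of k] by eventually_elim simp
next
  fix y assume "c < y"
  then have "\<forall>\<^sub>F k in sequentially. u k < y" using U(3) by (rule order_tendstoD(2)[rotated])
  then obtain k where "u k < y" by (auto simp: eventually_sequentially)
  then have "\<forall>\<^sub>F n in sequentially. U k n < y" using U(2) by (rule order_tendstoD(2)[rotated])
  then show "\<forall>\<^sub>F n in sequentially. a n < y" using U(1)[of k] by eventually_elim simp
qed

text \<open>Equal, for q \<ge> 2, to the product of 1 - q^(-l) over l \<ge> 1, the limiting
  probability of multiplicity 0 when q = p^(deg F).\<close>

definition euler :: "real \<Rightarrow> real" where
  "euler q = (\<Sum>i. (-1) ^ i / qfact q i)"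

lemma summable_norm_euler:
  assumes q: "2 \<le> q"
  shows "summable (\<lambda>i. norm ((-1) ^ i / qfact q i))"
proof (rule summable_ratio_test[of "1 / 2" 1])
  fix i :: nat assume i: "1 \<le> i"
  have "qfact q (Suc i) = (q ^ Suc i - 1) * qfact q i" unfolding qfact_def by (rule prod.nat_ivl_Suc') simp
  moreover have pos: "qfact q i > 0" using q by (intro qfact_pos) simp
  moreover have "2 \<le> q ^ Suc i - 1"
  proof -
    have "2 ^ 2 \<le> q ^ 2" using q by (intro power_mono) auto
    also have "\<dots> \<le> q ^ Suc i" using q i by (intro power_increasing) auto
    finally show ?thesis by simp
  qed
  ultimately have le: "2 * qfact q i \<le> qfact q (Suc i)" by (simp add: mult_right_mono)
  then have "1 / qfact q (Suc i) \<le> 1 / (2 * qfact q i)" using pos by (intro divide_left_mono) auto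
  moreover have "0 < qfact q (Suc i)" using le pos by linarith
  ultimately show "norm (norm ((-1) ^ Suc i / qfact q (Suc i))) \<le> 1 / 2 * norm (norm ((-1) ^ i / qfact q i))"
    using pos by (simp add: abs_mult power_abs)
qed simp

lemma euler_partial_sums:
  assumes "2 \<le> q"
  shows "(\<lambda>I. \<Sum>i\<le>I. (-1) ^ i / qfact q i) \<longlonglongrightarrow> euler q"
  unfolding euler_def using summable_norm_cancel[OF summable_norm_euler[OF assms]] by (rule summable_LIMSEQ')

lemma q_ge_2:
  assumes "0 < k" shows "2 \<le> real CARD('a::{field,finite}) ^ k"
proof -
  have "2 \<le> CARD('a)" using CARD_gt_1[where 'a='a] by simp
  also have "\<dots> \<le> CARD('a) ^ k" using assms by (intro self_le_power) auto
  finally have "real 2 \<le> real (CARD('a) ^ k)" by (rule of_nat_mono)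
  then show ?thesis by simp
qed

lemma monic_irreducible_not_dvd:
  fixes F G :: "'a::field_gcd poly"
  assumes F: "monic F" "irreducible F" and G: "monic G" "irreducible G" and ne: "G \<noteq> F"
  shows "\<not> G dvd F"
proof
  assume "G dvd F"
  then obtain u where u: "F = G * u" by (elim dvdE)
  then have "u dvd 1" using F(2) irreducible_not_unit[OF G(2)] by (metis irreducibleD)
  then have "degree u = 0" using u F(1) by (metis is_unit_iff_degree leading_coeff_0_iff mult_zero_right zero_neq_one)
  then have "u = [:coeff u 0:]" by (rule degree_0_id[symmetric])
  moreover have "lead_coeff F = lead_coeff G * lead_coeff u" unfolding u by (rule lead_coeff_mult)
  ultimately have "u = 1" using F(1) G(1) \<open>degree u = 0\<close> by (metis mult_1 one_pCons)
  then show False using u ne by simp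
qed

text \<open>A chain for \<open>F\<close> multiplies the characteristic polynomial by a power of
  \<open>F\<close> only, so the polynomials can be sieved one after another.\<close>

lemma multiplicity_chainT_other:
  fixes F G :: "'a::field_gcd poly"
  assumes T: "T \<in> carrier_mat d d" and F: "monic F" "irreducible F" "0 < degree F"
    and G: "monic G" "irreducible G" and ne: "G \<noteq> F"
  shows "multiplicity G (char_poly (chainT F T bs)) = multiplicity G (char_poly T)"
proof -
  have prime: "prime_elem G" using G(2) by (rule irreducible_imp_prime_elem)
  have nd: "\<not> G dvd F" by (rule monic_irreducible_not_dvd[OF F(1,2) G ne])
  have F0: "F ^ k \<noteq> 0" for k using F(1) by auto
  have "\<not> G dvd F ^ length bs" using nd prime prime_elem_dvd_power by blast
  then have "multiplicity G (F ^ length bs) = 0" by (rule not_dvd_imp_multiplicity_0)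
  then show ?thesis
    unfolding char_poly_chainT[OF T F(1,3)]
    using prime_elem_multiplicity_mult_distrib[OF prime char_poly_monic(3)[OF T] F0] by simp
qed

text \<open>Induction over \<open>J\<close> for all \<open>T\<close> at once: sieving by a new
  \<open>F\<close> calls for the restricted limit at every chain extension of \<open>T\<close>, and
  these have the same multiplicities as \<open>T\<close> at the old polynomials. All |K|^(d i)
  chains of length i share one limit, which cancels the normalisation.\<close>

theorem sieve_limit:
  fixes P :: "nat \<Rightarrow> nat \<Rightarrow> nat \<Rightarrow> 'a::{field_gcd,finite} \<Rightarrow> real"
  assumes P: "\<forall>\<^sub>F n in sequentially. \<forall>i<n. \<forall>j<n. \<forall>a. 0 \<le> P n i j a"
    and mom: "\<And>d T. T \<in> carrier_mat d d \<Longrightarrow> (\<lambda>n. mat_expect n (P n) (\<lambda>A. real (card (emb n d T A)))) \<longlonglongrightarrow> 1"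
    and J: "finite J" "\<And>F. F \<in> J \<Longrightarrow> monic F \<and> irreducible F \<and> 0 < degree F"
    and T: "T \<in> carrier_mat d d"
  shows "(\<lambda>n. mat_expect n (P n) (\<lambda>A. real (card (emb n d T A))
      * of_bool (\<forall>F\<in>J. multiplicity F (char_poly A) = multiplicity F (char_poly T))))
    \<longlonglongrightarrow> (\<Prod>F\<in>J. euler (real CARD('a) ^ degree F))"
  using J T
proof (induction J arbitrary: d T rule: finite_induct)
  case empty
  then show ?case using mom by simp
next
  case (insert F J)
  let ?f = "degree F" and ?p = "real CARD('a)"
  define q where "q = ?p ^ ?f"
  define C where "C = (\<Prod>F\<in>J. euler (?p ^ degree F))"
  define ind where "ind = (\<lambda>A. of_bool (\<forall>F\<in>J. multiplicity F (char_poly A) = multiplicity F (char_poly T)) :: real)"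
  have F: "monic F" "irreducible F" "0 < degree F" using insert.prems(1)[of F] by auto
  note T = insert.prems(2)
  define BL where "BL = (\<lambda>i. {bs. set bs \<subseteq> (carrier_vec d :: 'a vec set) \<and> length bs = i})"
  have finBL: "finite (BL i)" for i unfolding BL_def by (rule finite_lists_length_eq) simp
  have cardBL: "real (card (BL i)) = ?p ^ (d * i)" for i
    unfolding BL_def by (simp add: card_lists_length_eq card_carrier_vec power_mult)
  define N where "N = (\<lambda>n i A. \<Sum>bs\<in>BL i. real (card (emb n (d + i * ?f) (chainT F T bs) A)))"
  define R where "R = (\<lambda>I n. mat_expect n (P n) (\<lambda>A. (\<Sum>i\<le>I. (-1) ^ i / qfact q i * (N n i A / ?p ^ (d * i))) * ind A))"
  have q2: "2 \<le> q" unfolding q_def by (rule q_ge_2[OF F(3)])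
  have p0: "?p > 0" using CARD_gt_1[where 'a='a] by simp
  have lim_bs: "(\<lambda>n. mat_expect n (P n) (\<lambda>A. real (card (emb n (d + i * ?f) (chainT F T bs) A)) * ind A)) \<longlonglongrightarrow> C"
    if bs: "bs \<in> BL i" for i bs
  proof -
    have len: "length bs = i" using bs by (simp add: BL_def)
    have T': "chainT F T bs \<in> carrier_mat (d + i * ?f) (d + i * ?f)" using chainT_carrier[OF T, of F bs] len by simp
    have "multiplicity G (char_poly (chainT F T bs)) = multiplicity G (char_poly T)" if "G \<in> J" for G
      using insert.prems(1)[of G] that insert.hyps(2) by (intro multiplicity_chainT_other[OF T F]) auto
    then have "ind A = of_bool (\<forall>G\<in>J. multiplicity G (char_poly A) = multiplicity G (char_poly (chainT F T bs)))" for A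
      unfolding ind_def by simp
    then show ?thesis using insert.IH[OF _ T'] insert.prems(1) unfolding C_def by simp
  qed
  have R_eq: "R I n = (\<Sum>i\<le>I. ((-1) ^ i / qfact q i / ?p ^ (d * i)) *
      (\<Sum>bs\<in>BL i. 1 * mat_expect n (P n) (\<lambda>A. real (card (emb n (d + i * ?f) (chainT F T bs) A)) * ind A)))" for I n
  proof -
    have "R I n = mat_expect n (P n) (\<lambda>A. \<Sum>i\<le>I. ((-1) ^ i / qfact q i / ?p ^ (d * i)) *
        (\<Sum>bs\<in>BL i. 1 * (real (card (emb n (d + i * ?f) (chainT F T bs) A)) * ind A)))"
      unfolding R_def N_def by (rule arg_cong[where f = "mat_expect n (P n)"]) (simp add: sum_distrib_right sum_distrib_left sum_divide_distrib mult_ac)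
    then show ?thesis by (simp only: mat_expect_sum)
  qed
  have R_lim: "R I \<longlonglongrightarrow> (\<Sum>i\<le>I. (-1) ^ i / qfact q i) * C" for I
  proof -
    have "(\<lambda>n. R I n) \<longlonglongrightarrow> (\<Sum>i\<le>I. ((-1) ^ i / qfact q i / ?p ^ (d * i)) * (\<Sum>bs\<in>BL i. 1 * C))"
      unfolding R_eq by (intro tendsto_sum tendsto_mult tendsto_const lim_bs)
    also have "(\<Sum>i\<le>I. ((-1) ^ i / qfact q i / ?p ^ (d * i)) * (\<Sum>bs\<in>BL i. 1 * C)) = (\<Sum>i\<le>I. (-1) ^ i / qfact q i) * C"
      using p0 by (simp add: cardBL sum_distrib_right)
    finally show ?thesis .
  qed
  define a where "a = (\<lambda>n. mat_expect n (P n) (\<lambda>A. real (card (emb n d T A))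
      * of_bool (\<forall>G\<in>insert F J. multiplicity G (char_poly A) = multiplicity G (char_poly T))))"
  have a_eq: "a n = mat_expect n (P n) (\<lambda>A. (real (card (emb n d T A)) * of_bool (multiplicity F (char_poly A) = multiplicity F (char_poly T))) * ind A)" for n
    unfolding a_def ind_def by (rule arg_cong[where f = "mat_expect n (P n)"]) auto
  have ind0: "0 \<le> ind A" for A by (simp add: ind_def)
  have upper: "\<forall>\<^sub>F n in sequentially. a n \<le> R (2 * k) n" for k
    using P
  proof eventually_elim
    case (elim n)
    show ?case unfolding a_eq R_def N_def BL_def q_def
      using elim by (intro mat_expect_mono mult_right_mono[OF _ ind0] sieve_bounds(1)[OF _ T F]) auto
  qed
  have lower: "\<forall>\<^sub>F n in sequentially. R (Suc (2 * k)) n \<le> a n" for k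
    using P
  proof eventually_elim
    case (elim n)
    show ?case unfolding a_eq R_def N_def BL_def q_def
      using elim by (intro mat_expect_mono mult_right_mono[OF _ ind0] sieve_bounds(2)[OF _ T F]) auto
  qed
  have eul: "(\<lambda>I. (\<Sum>i\<le>I. (-1) ^ i / qfact q i) * C) \<longlonglongrightarrow> euler q * C"
    by (intro tendsto_mult tendsto_const euler_partial_sums[OF q2])
  have "a \<longlonglongrightarrow> euler q * C"
  proof (rule tendsto_squeeze_family[OF lower R_lim _ upper R_lim])
    show "(\<lambda>k. (\<Sum>i\<le>Suc (2 * k). (-1) ^ i / qfact q i) * C) \<longlonglongrightarrow> euler q * C"
      by (rule LIMSEQ_subseq_LIMSEQ[OF eul, of "\<lambda>k. Suc (2 * k)", unfolded o_def]) (simp add: strict_mono_def)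
    show "(\<lambda>k. (\<Sum>i\<le>2 * k. (-1) ^ i / qfact q i) * C) \<longlonglongrightarrow> euler q * C"
      by (rule LIMSEQ_subseq_LIMSEQ[OF eul, of "\<lambda>k. 2 * k", unfolded o_def]) (simp add: strict_mono_def)
  qed
  then show ?case
    using insert.hyps by (simp add: a_def C_def q_def)
qed

section \<open>Matrices with a given characteristic polynomial\<close>

lemma card_carrier_mat: "card (carrier_mat n m :: 'a::finite mat set) = CARD('a) ^ (n * m)"
proof -
  have "bij_betw (mat n m) (PiE ({..<n} \<times> {..<m}) (\<lambda>_. UNIV :: 'a set)) (carrier_mat n m)"
  proof (rule bij_betw_byWitness[where f' = "\<lambda>M. \<lambda>ij\<in>{..<n} \<times> {..<m}. M $$ ij"])
    show "\<forall>f\<in>PiE ({..<n} \<times> {..<m}) (\<lambda>_. UNIV :: 'a set). (\<lambda>ij\<in>{..<n} \<times> {..<m}. mat n m f $$ ij) = f"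
    proof
      fix f :: "nat \<times> nat \<Rightarrow> 'a" assume f: "f \<in> PiE ({..<n} \<times> {..<m}) (\<lambda>_. UNIV)"
      show "(\<lambda>ij\<in>{..<n} \<times> {..<m}. mat n m f $$ ij) = f"
      proof
        fix ij
        show "(\<lambda>ij\<in>{..<n} \<times> {..<m}. mat n m f $$ ij) ij = f ij"
        proof (cases "ij \<in> {..<n} \<times> {..<m}")
          case True
          then show ?thesis by (cases ij) simp
        next
          case False
          then show ?thesis unfolding restrict_apply if_not_P[OF False] by (rule PiE_arb[OF f, symmetric])
        qed
      qed
    qed
    show "(\<lambda>M. \<lambda>ij\<in>{..<n} \<times> {..<m}. M $$ ij) ` carrier_mat n m \<subseteq> PiE ({..<n} \<times> {..<m}) (\<lambda>_. UNIV :: 'a set)"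
      unfolding restrict_PiE_iff image_subset_iff by simp
  qed auto
  then have "card (carrier_mat n m :: 'a mat set) = card (PiE ({..<n} \<times> {..<m}) (\<lambda>_. UNIV :: 'a set))"
    by (simp add: bij_betw_same_card)
  then show ?thesis by (simp add: card_PiE)
qed

lemma ext_zero:
  "ext [:0, 1:] (0\<^sub>m d d) (b :: 'a::field vec) = (0\<^sub>m (Suc d) (Suc d))" if "b \<in> carrier_vec 0"
  using that by (intro eq_matI) (auto simp: ext_def last_col_def companion_def)

lemma chainT_zero:
  assumes "set bs \<subseteq> (carrier_vec 0 :: 'a::field vec set)"
  shows "chainT [:0, 1:] (0\<^sub>m 0 0) bs = 0\<^sub>m (length bs) (length bs)"
  using assms by (induction bs) (auto simp: ext_zero)

lemma emb_0:
  assumes "A \<in> carrier_mat n n"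
  shows "emb n 0 (0\<^sub>m 0 0) A = {0\<^sub>m n 0 :: 'a::field mat}"
proof -
  have "X = 0\<^sub>m n 0" if "X \<in> carrier_mat n 0" for X :: "'a mat" using that by (intro eq_matI) auto
  then show ?thesis using empty_in_emb[OF assms] emb_carrier by blast
qed

lemma lists_carrier_vec_0:
  "{bs. set bs \<subseteq> carrier_vec 0 \<and> length bs = i} = {replicate i (0\<^sub>v 0 :: 'a::zero vec)}"
proof -
  have "v = 0\<^sub>v 0" if "v \<in> carrier_vec 0" for v :: "'a vec" using that by (intro eq_vecI) auto
  then show ?thesis by (auto intro: replicate_eqI)
qed

lemma emb_zero_zero: "emb n k (0\<^sub>m k k) (0\<^sub>m n n) = {X. injm n k (X :: 'a::field mat)}"
  unfolding emb_altdef by (auto dest: injm_carrier)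

text \<open>The number of injective n by k matrices over a field with p elements; for k = n the
  order of GL_n.\<close>

definition injc :: "real \<Rightarrow> nat \<Rightarrow> nat \<Rightarrow> real" where
  "injc p n k = (\<Prod>l<k. p ^ n - p ^ l)"

lemma irreducible_X: "irreducible [:0, 1 :: 'a::field_gcd:]"
  by (rule irreducible_linear_field_poly) simp

text \<open>The chain formula at A = 0 with empty \<open>T\<close> and F = t: every vector outside
  the span of the previous columns is admissible, and chains of length k are the injective n by k
  matrices.\<close>

lemma card_injm:
  "real (card {X. injm n k (X :: 'a::{field_gcd,finite} mat)}) = injc (real CARD('a)) n k"
proof -
  let ?F = "[:0, 1 :: 'a:]" and ?A = "0\<^sub>m n n :: 'a mat"
  have A: "?A \<in> carrier_mat n n" and T: "0\<^sub>m 0 0 \<in> carrier_mat 0 0" by auto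
  have KX: "KX ?A ?F (0\<^sub>m n 0) = carrier_vec n"
  proof -
    have "pact ?A ?F y = 0\<^sub>v n" if y: "y \<in> carrier_vec n" for y
      using y by (simp add: pact_pCons[OF A y] pact_zero_vec[OF A] one_pCons[symmetric]) (intro eq_vecI, auto)
    then show ?thesis unfolding KX_def colsp_empty by auto
  qed
  have "(\<Sum>bs\<in>{bs. set bs \<subseteq> carrier_vec 0 \<and> length bs = k}. \<Sum>Z\<in>emb n (0 + k * degree ?F) (chainT ?F (0\<^sub>m 0 0) bs) ?A. (1::real))
    = (\<Sum>X\<in>emb n 0 (0\<^sub>m 0 0) ?A. 1 * (\<Prod>l<k. real (card (KX ?A ?F X)) - real CARD('a) ^ (0 + l * degree ?F)))"
    by (rule chain_sum[OF A T _ irreducible_X]) auto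
  moreover have "chainT ?F (0\<^sub>m 0 0) (replicate k (0\<^sub>v 0)) = 0\<^sub>m k k"
    by (subst chainT_zero) (auto intro: zero_carrier_vec)
  ultimately show ?thesis
    unfolding lists_carrier_vec_0 emb_0[OF A]
    by (simp add: KX emb_zero_zero card_carrier_vec injc_def del: zero_vec_zero)
qed

text \<open>An injective n by k block has p^(k (n - k)) |GL_(n-k)| completions to an invertible
  matrix.\<close>

lemma injc_split:
  assumes "k \<le> n"
  shows "injc p n n = injc p n k * p ^ (k * (n - k)) * injc p (n - k) (n - k)"
proof -
  have "injc p n n = injc p n k * (\<Prod>l<n - k. p ^ n - p ^ (k + l))"
  proof -
    have "{..<n} = {..<k} \<union> (\<lambda>l. k + l) ` {..<n - k}"
    proof (intro equalityI subsetI)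
      fix x assume "x \<in> {..<n}"
      then show "x \<in> {..<k} \<union> (\<lambda>l. k + l) ` {..<n - k}"
        by (cases "x < k") (auto intro!: image_eqI[of _ _ "x - k"])
    qed (use assms in auto)
    then show ?thesis unfolding injc_def
      by (simp only:) (subst prod.union_disjoint, auto simp: prod.reindex inj_on_def)
  qed
  also have "(\<Prod>l<n - k. p ^ n - p ^ (k + l)) = (\<Prod>l<n - k. p ^ k * (p ^ (n - k) - p ^ l))"
    using assms by (intro prod.cong refl) (simp add: right_diff_distrib power_add flip: power_add)
  also have "\<dots> = p ^ (k * (n - k)) * injc p (n - k) (n - k)"
    by (simp add: prod.distrib injc_def power_mult)
  finally show ?thesis by simp
qed

lemma injc_pos: "1 < p \<Longrightarrow> k \<le> n \<Longrightarrow> 0 < injc p n k"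
  unfolding injc_def by (intro prod_pos) (auto intro: power_strict_increasing)

definition acnt :: "nat \<Rightarrow> 'a::{field,finite} poly \<Rightarrow> nat" where
  "acnt n g = card {A\<in>carrier_mat n n. char_poly A = g}"

text \<open>In a basis adapted to \<open>X\<close> such a matrix is block triangular: its corner
  block is arbitrary and its quotient block has characteristic polynomial \<open>g\<close>.\<close>

lemma card_invariant_char_poly:
  fixes X :: "'a::{field,finite} mat"
  assumes X: "injm n k X" and T: "T \<in> carrier_mat k k"
  shows "card {A\<in>carrier_mat n n. A * X = X * T \<and> char_poly A = char_poly T * g}
    = CARD('a) ^ (k * (n - k)) * acnt (n - k) g"
proof -
  let ?f = "n - k"
  have kn: "k \<le> n" by (rule injm_le[OF X])
  obtain Z where Z: "Z \<in> carrier_mat n ?f" "injm n n (hc X Z)" using injm_extend[OF X] by blast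
  let ?P = "hc X Z"
  obtain P' where P': "P' \<in> carrier_mat n n" "?P * P' = 1\<^sub>m n" "P' * ?P = 1\<^sub>m n"
    by (rule injm_square_inverse[OF Z(2)])
  have P: "?P \<in> carrier_mat n n" by (rule injm_carrier[OF Z(2)])
  define b where "b = (\<lambda>(B, S). four_block_mat T B (0\<^sub>m ?f k) S)"
  define \<phi> where "\<phi> = (\<lambda>BS. ?P * b BS * P')"
  have bc: "b (B, S) \<in> carrier_mat n n" if "B \<in> carrier_mat k ?f" "S \<in> carrier_mat ?f ?f" for B S
    using that T kn by (auto simp: b_def)
  have \<phi>c: "\<phi> (B, S) \<in> carrier_mat n n" if "B \<in> carrier_mat k ?f" "S \<in> carrier_mat ?f ?f" for B S
    using bc[OF that] P P'(1) by (simp add: \<phi>_def)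
  have cp: "char_poly (\<phi> (B, S)) = char_poly T * char_poly S"
    if "B \<in> carrier_mat k ?f" "S \<in> carrier_mat ?f ?f" for B S
  proof -
    have "similar_mat (\<phi> (B, S)) (b (B, S))"
      unfolding similar_mat_def similar_mat_wit_def
      using P P' \<phi>c[OF that] bc[OF that] carrier_matD(1)[OF \<phi>c[OF that]]
      by (intro exI[of _ ?P] exI[of _ P']) (simp only: Let_def insert_subset empty_subsetI simp_thms \<phi>_def)
    then have "char_poly (\<phi> (B, S)) = char_poly (b (B, S))" by (rule char_poly_similar)
    then show ?thesis unfolding b_def using char_poly_four_block_lower_zero[OF T that] by simp
  qed
  have T0: "char_poly T \<noteq> 0" by (rule char_poly_monic(3)[OF T])
  have set_eq: "{A\<in>carrier_mat n n. A * X = X * T \<and> char_poly A = char_poly T * g}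
      = \<phi> ` (carrier_mat k ?f \<times> {S\<in>carrier_mat ?f ?f. char_poly S = g})"
  proof (intro equalityI subsetI)
    fix A assume "A \<in> {A\<in>carrier_mat n n. A * X = X * T \<and> char_poly A = char_poly T * g}"
    then have A: "A \<in> carrier_mat n n" "A * X = X * T" "char_poly A = char_poly T * g" by auto
    obtain B S where BS: "B \<in> carrier_mat k ?f" "S \<in> carrier_mat ?f ?f" "A = \<phi> (B, S)"
      using A(2) unfolding invariant_block_form[OF injm_carrier[OF X] Z(1) kn P' T A(1)] \<phi>_def b_def by auto
    then have "char_poly S = g" using cp[OF BS(1,2)] A(3) T0 by simp
    then show "A \<in> \<phi> ` (carrier_mat k ?f \<times> {S\<in>carrier_mat ?f ?f. char_poly S = g})" using BS by blast
  next
    fix A assume "A \<in> \<phi> ` (carrier_mat k ?f \<times> {S\<in>carrier_mat ?f ?f. char_poly S = g})"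
    then obtain B S where BS: "B \<in> carrier_mat k ?f" "S \<in> carrier_mat ?f ?f" "A = \<phi> (B, S)" "char_poly S = g" by blast
    have "A * X = X * T"
      unfolding invariant_block_form[OF injm_carrier[OF X] Z(1) kn P' T \<phi>c[OF BS(1,2), folded BS(3)]]
      using BS by (auto simp: \<phi>_def b_def)
    then show "A \<in> {A\<in>carrier_mat n n. A * X = X * T \<and> char_poly A = char_poly T * g}"
      using cp[OF BS(1,2)] \<phi>c[OF BS(1,2)] BS by simp
  qed
  have "inj_on \<phi> (carrier_mat k ?f \<times> {S\<in>carrier_mat ?f ?f. char_poly S = g})"
  proof (rule inj_on_inverseI)
    fix BS :: "'a mat \<times> 'a mat" assume "BS \<in> carrier_mat k ?f \<times> {S\<in>carrier_mat ?f ?f. char_poly S = g}"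
    then obtain B S where BS: "BS = (B, S)" "B \<in> carrier_mat k ?f" "S \<in> carrier_mat ?f ?f" by auto
    note c = bc[OF BS(2,3)]
    have Pc: "?P * b (B, S) \<in> carrier_mat n n" by (rule mult_carrier_mat[OF P c])
    have "P' * \<phi> BS * ?P = P' * (\<phi> (B, S) * ?P)"
      unfolding BS(1) by (rule assoc_mult_mat[OF P'(1) \<phi>c[OF BS(2,3)] P])
    also have "\<phi> (B, S) * ?P = ?P * b (B, S)"
      unfolding \<phi>_def assoc_mult_mat[OF Pc P'(1) P] P'(3) by (rule right_mult_one_mat[OF Pc])
    also have "P' * (?P * b (B, S)) = b (B, S)" by (rule mult_inverse_cancel[OF P'(1) P P'(3) c])
    finally have e: "P' * \<phi> BS * ?P = b (B, S)" .
    show "(mat k ?f (\<lambda>(i, j). (P' * \<phi> BS * ?P) $$ (i, j + k)), mat ?f ?f (\<lambda>(i, j). (P' * \<phi> BS * ?P) $$ (i + k, j + k))) = BS"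
      unfolding e unfolding BS(1) b_def using BS(2,3) T by (auto intro!: eq_matI)
  qed
  then show ?thesis
    unfolding set_eq by (simp add: card_image card_cartesian_product card_carrier_mat acnt_def)
qed

text \<open>Pairs (A, X) are counted by X; all injective X contribute equally.\<close>

lemma sum_card_emb_char_poly:
  fixes T :: "'a::{field_gcd,finite} mat"
  assumes T: "T \<in> carrier_mat k k" and k: "k \<le> n"
  shows "(\<Sum>A\<in>{A\<in>carrier_mat n n. char_poly A = char_poly T * g}. real (card (emb n k T A)))
    = injc (real CARD('a)) n n / injc (real CARD('a)) (n - k) (n - k) * real (acnt (n - k) g)"
proof -
  let ?p = "real CARD('a)" and ?C = "{A\<in>carrier_mat n n. char_poly A = char_poly T * g}"
  have "(\<Sum>A\<in>?C. card (emb n k T A)) = card (SIGMA A:?C. emb n k T A)"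
    by (rule card_SigmaI[symmetric]) auto
  also have "\<dots> = card (SIGMA X:{X. injm n k X}. {A\<in>carrier_mat n n. A * X = X * T \<and> char_poly A = char_poly T * g})"
    by (rule bij_betw_same_card[OF bij_betw_byWitness[where f = "\<lambda>(A, X). (X, A)" and f' = "\<lambda>(X, A). (A, X)"]])
       (auto simp: emb_altdef)
  also have "\<dots> = (\<Sum>X\<in>{X. injm n k (X :: 'a mat)}. card {A\<in>carrier_mat n n. A * X = X * T \<and> char_poly A = char_poly T * g})"
    by (rule card_SigmaI) (auto intro: finite_subset[OF _ finite_carrier_mat[of n k]] dest: injm_carrier)
  also have "\<dots> = (\<Sum>X\<in>{X. injm n k (X :: 'a mat)}. CARD('a) ^ (k * (n - k)) * acnt (n - k) g)"
    by (rule sum.cong[OF refl]) (simp add: card_invariant_char_poly[OF _ T])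
  finally have "real (\<Sum>A\<in>?C. card (emb n k T A)) = real (card {X. injm n k (X :: 'a mat)}) * (?p ^ (k * (n - k)) * real (acnt (n - k) g))"
    by simp
  moreover have "injc ?p (n - k) (n - k) > 0" using CARD_gt_1[where 'a='a] by (intro injc_pos) auto
  ultimately show ?thesis unfolding card_injm injc_split[OF k] by simp
qed

section \<open>Two q-series\<close>

text \<open>For a prime power q this is the number of nilpotent m by m matrices over the field with
  q elements, divided by |GL_m|. It turns out to be the weight of F^m in
  \<open>cdens\<close>.\<close>

definition ap :: "real \<Rightarrow> nat \<Rightarrow> real" where
  "ap q m = (\<Prod>l<m. q ^ l) / qfact q m"

lemma ap_0 [simp]: "ap q 0 = 1" by (simp add: ap_def qfact_def)

lemma qfact_Suc: "qfact q (Suc m) = (q ^ Suc m - 1) * qfact q m"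
  unfolding qfact_def by (rule prod.nat_ivl_Suc') simp

lemma qfact_split:
  assumes "i \<le> m"
  shows "qfact q m = qfact q (m - i) * (\<Prod>l<i. q ^ (m - l) - 1)"
  using assms
proof (induction i)
  case (Suc i)
  then have "m - i = Suc (m - Suc i)" by simp
  then have "qfact q (m - i) = (q ^ (m - i) - 1) * qfact q (m - Suc i)" by (metis qfact_Suc)
  then show ?case using Suc by simp
qed simp

text \<open>Newton's identity at x = q^m after reversing the sum: for m > 0 the factor l = m of the
  closed form vanishes. The series of \<open>ap\<close> is thus inverse to that of
  \<open>euler\<close>.\<close>

lemma sum_ap_inverse:
  assumes q: "1 < q"
  shows "(\<Sum>i\<le>m. (-1) ^ i / qfact q i * ap q (m - i)) = of_bool (m = 0)"
proof (cases "m = 0")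
  case False
  have pos: "qfact q i > 0" for i by (rule qfact_pos[OF q])
  have qn: "q ^ l \<noteq> 1" if "0 < l" for l using one_less_power[OF q that] by simp
  have "(\<Sum>i\<le>m. (-1) ^ i / qfact q i * ap q (m - i)) = (\<Sum>i\<le>m. (-1) ^ (m - i) / qfact q (m - i) * ap q i)"
    by (rule sum.reindex_bij_witness[of _ "\<lambda>i. m - i" "\<lambda>i. m - i"]) auto
  also have "\<dots> = (\<Sum>i\<le>m. (-1) ^ m / qfact q m * ((-1) ^ i / qfact q i * (\<Prod>l<i. q ^ m - q ^ l)))"
  proof (rule sum.cong[OF refl])
    fix i assume "i \<in> {..m}"
    then have i: "i \<le> m" by simp
    have "(\<Prod>l<i. q ^ m - q ^ l) = (\<Prod>l<i. q ^ l * (q ^ (m - l) - 1))"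
      using i by (intro prod.cong refl) (simp add: right_diff_distrib flip: power_add)
    also have "\<dots> = (\<Prod>l<i. q ^ l) * (qfact q m / qfact q (m - i))"
      unfolding prod.distrib qfact_split[OF i] using pos[of "m - i"] by simp
    finally have e: "(\<Prod>l<i. q ^ m - q ^ l) = (\<Prod>l<i. q ^ l) * (qfact q m / qfact q (m - i))" .
    have "(-1) ^ (m - i) = (-1) ^ m * (-1 :: real) ^ i"
      using i by (auto simp: le_iff_add power_add mult_ac)
    then show "(-1) ^ (m - i) / qfact q (m - i) * ap q i = (-1) ^ m / qfact q m * ((-1) ^ i / qfact q i * (\<Prod>l<i. q ^ m - q ^ l))"
      unfolding e ap_def using pos[of m] by (simp add: mult_ac)
  qed
  also have "\<dots> = (-1) ^ m / qfact q m * ((-1) ^ m / qfact q m * (\<Prod>l\<in>{1..m}. q ^ m - q ^ l))"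
    unfolding sum_distrib_left[symmetric] by (subst newton_partial_sum[OF qn]) auto
  also have "(\<Prod>l\<in>{1..m}. q ^ m - q ^ l) = 0" using False by (intro prod_zero) auto
  finally show ?thesis using False by simp
qed (simp add: qfact_def)

lemma ap_nonneg: "1 < q \<Longrightarrow> 0 \<le> ap q m"
  unfolding ap_def using qfact_pos[of q m] by (auto intro!: divide_nonneg_pos prod_nonneg)

lemma ap_Suc: "ap q (Suc m) = ap q m * (q ^ m / (q ^ Suc m - 1))"
  by (simp add: ap_def qfact_Suc del: power_Suc)

lemma summable_norm_ap:
  assumes q: "2 \<le> q"
  shows "summable (\<lambda>m. norm (ap q m))"
proof (rule summable_ratio_test[of "2 / 3" 1])
  fix m :: nat assume m: "1 \<le> m"
  have qm: "2 \<le> q ^ m" using power_increasing[of 1 m q] q m by simp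
  have "2 * 1 \<le> q ^ m * (2 * q - 3)" using qm q by (intro mult_mono) auto
  then have "3 * q ^ m \<le> 2 * (q ^ Suc m - 1)" by (simp add: algebra_simps)
  moreover have "0 < q ^ Suc m - 1" using one_less_power[of q "Suc m"] q by simp
  ultimately have "q ^ m / (q ^ Suc m - 1) \<le> 2 / 3" by (simp add: divide_simps del: power_Suc)
  then have "ap q (Suc m) \<le> ap q m * (2 / 3)"
    unfolding ap_Suc using q by (intro mult_left_mono ap_nonneg) auto
  then show "norm (norm (ap q (Suc m))) \<le> 2 / 3 * norm (norm (ap q m))"
    using ap_nonneg[of q] q by (simp add: mult.commute)
qed simp

lemma euler_times_suminf_ap:
  assumes q: "2 \<le> q"
  shows "euler q * (\<Sum>m. ap q m) = 1"
proof -
  have q1: "1 < q" using q by simp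
  have "(\<lambda>m. \<Sum>i\<le>m. (-1) ^ i / qfact q i * ap q (m - i)) sums (euler q * (\<Sum>m. ap q m))"
    unfolding euler_def by (rule Cauchy_product_sums[OF summable_norm_euler[OF q] summable_norm_ap[OF q]])
  then have "(\<lambda>m. of_bool (m = 0)) sums (euler q * (\<Sum>m. ap q m))" unfolding sum_ap_inverse[OF q1] .
  moreover have "(\<lambda>m::nat. of_bool (m = 0) :: real) sums 1" using sums_single[of 0 "\<lambda>_. 1::real"] by (simp add: of_bool_def)
  ultimately show ?thesis by (rule sums_unique2)
qed

lemma ap_eq:
  assumes q: "1 < q"
  shows "ap q m = (\<Prod>l<m. 1 / (1 - 1 / q ^ Suc l)) / q ^ m"
proof (induction m)
  case (Suc m)
  have "q ^ Suc m > 1" by (rule one_less_power[OF q]) simp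
  then show ?case unfolding ap_Suc Suc using q by (simp add: field_simps)
qed simp

text \<open>The partial sums telescope into partial products, which identifies the sum of the series
  with an infinite product.\<close>

lemma sum_ap:
  assumes q: "1 < q"
  shows "(\<Sum>m\<le>M. ap q m) = (\<Prod>l<M. 1 / (1 - 1 / q ^ Suc l))"
proof (induction M)
  case (Suc M)
  have "q ^ Suc M > 1" by (rule one_less_power[OF q]) simp
  then have "w + w * (1 / (1 - 1 / q ^ Suc M)) / q ^ Suc M = w * (1 / (1 - 1 / q ^ Suc M))" for w
    by (simp add: field_simps del: power_Suc)
  then show ?case unfolding sum.atMost_Suc Suc ap_eq[OF q, of "Suc M"] prod.lessThan_Suc .
qed simp

text \<open>The product starting at m + 1 is a limit of quotients of the partial products
  \<open>w\<close>, whose own limit is the sum of \<open>ap\<close>, the reciprocal of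
  \<open>euler\<close>.\<close>

lemma prodinf_eq_euler:
  assumes q: "2 \<le> q" and conv: "convergent_prod (\<lambda>i. 1 - 1 / q ^ (m + 1 + i))"
  shows "1 / q ^ m * (\<Prod>i. 1 - 1 / q ^ (m + 1 + i)) = ap q m * euler q"
proof -
  have q1: "1 < q" using q by simp
  define w where "w = (\<lambda>M. \<Prod>l<M. 1 / (1 - 1 / q ^ Suc l))"
  have wf: "(\<Prod>i\<le>k. 1 - 1 / q ^ (m + 1 + i)) = w m / w (m + Suc k)" for k
  proof -
    have f0: "0 < 1 - 1 / q ^ Suc l" for l using one_less_power[OF q1, of "Suc l"] by simp
    have "w m > 0" unfolding w_def using f0 by (intro prod_pos) simp
    moreover have "w (m + j) * (\<Prod>i<j. 1 - 1 / q ^ (m + 1 + i)) = w m" for j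
    proof (induction j)
      case (Suc j)
      have "w (m + Suc j) * (1 - 1 / q ^ (m + 1 + j)) = w (m + j)"
        using less_imp_neq[OF f0[of "m + j"]] by (simp add: w_def del: power_Suc prod_zero_iff)
      moreover have "w (m + Suc j) * (\<Prod>i<Suc j. 1 - 1 / q ^ (m + 1 + i))
        = (w (m + Suc j) * (1 - 1 / q ^ (m + 1 + j))) * (\<Prod>i<j. 1 - 1 / q ^ (m + 1 + i))"
        unfolding prod.lessThan_Suc by (simp only: mult_ac)
      ultimately show ?case by (simp only: Suc)
    qed simp
    ultimately show ?thesis unfolding lessThan_Suc_atMost[symmetric] by (metis less_irrefl mult_eq_0_iff nonzero_mult_div_cancel_left)
  qed
  have lim1: "(\<lambda>k. w m / w (m + Suc k)) \<longlonglongrightarrow> (\<Prod>i. 1 - 1 / q ^ (m + 1 + i))"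
    using convergent_prod_LIMSEQ[OF conv] unfolding wf .
  have "w \<longlonglongrightarrow> (\<Sum>m. ap q m)"
    using summable_LIMSEQ'[OF summable_norm_cancel[OF summable_norm_ap[OF q]]] unfolding sum_ap[OF q1] w_def .
  then have "(\<lambda>k. w (k + Suc m)) \<longlonglongrightarrow> (\<Sum>m. ap q m)" by (rule LIMSEQ_ignore_initial_segment)
  then have "(\<lambda>k. w m / w (k + Suc m)) \<longlonglongrightarrow> w m / (\<Sum>m. ap q m)"
    using euler_times_suminf_ap[OF q] by (intro tendsto_divide tendsto_const) auto
  then have "(\<lambda>k. w m / w (m + Suc k)) \<longlonglongrightarrow> w m / (\<Sum>m. ap q m)" by (simp add: add.commute)
  with lim1 have "(\<Prod>i. 1 - 1 / q ^ (m + 1 + i)) = w m / (\<Sum>m. ap q m)" by (rule LIMSEQ_unique)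
  moreover have "euler q = 1 / (\<Sum>m. ap q m)"
    using euler_times_suminf_ap[OF q] by (metis mult_zero_right nonzero_eq_divide_eq zero_neq_one)
  ultimately show ?thesis unfolding ap_eq[OF q1] w_def by simp
qed

lemma nu_eq:
  fixes F :: "'p::prime_card mod_ring poly"
  assumes F: "degree F > 0"
  shows "nu F m = ap (real CARD('p) ^ degree F) m * euler (real CARD('p) ^ degree F)"
proof -
  let ?q = "real CARD('p) ^ degree F"
  have e: "real CARD('p) ^ (k * degree F) = ?q ^ k" for k by (subst mult.commute) (rule power_mult)
  have "2 \<le> ?q" using q_ge_2[OF F, where 'a = "'p mod_ring"] by simp
  then show ?thesis unfolding nu_def e
    by (rule prodinf_eq_euler) (use convergent_prod_nu[OF F, of m] in \<open>simp only: e\<close>)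
qed

text \<open>
  By orbit counting this is the sum of $1 / |\mathrm{Aut}|$ over the isomorphism classes of modules
  with characteristic polynomial \<open>g\<close>.
\<close>
definition cdens :: "'a::{field,finite} poly \<Rightarrow> real" where
  "cdens g = real (acnt (degree g) g) / injc (real CARD('a)) (degree g) (degree g)"

lemma cdens_1: "cdens (1 :: 'a::{field,finite} poly) = 1"
proof -
  have "{A \<in> carrier_mat 0 0. char_poly A = 1} = {0\<^sub>m 0 0 :: 'a mat}"
    by (auto simp: char_poly_0)
  then show ?thesis by (simp add: cdens_def acnt_def injc_def)
qed

text \<open>With empty \<open>T\<close> there is a single embedding and a single chain of each
  length, and s \<le> n. The Newton sum up to \<open>n\<close> has then reached its final value, so
  the inequality becomes an identity.\<close>

lemma sieve_exact:
  fixes A :: "'a::{field_gcd,finite} mat"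
  assumes A: "A \<in> carrier_mat n n" and F: "monic F" "irreducible F" "0 < degree F"
  defines "q \<equiv> real CARD('a) ^ degree F"
  shows "(\<Sum>i\<le>n. (-1) ^ i / qfact q i * real (card (emb n (i * degree F) (chainT F (0\<^sub>m 0 0) (replicate i (0\<^sub>v 0))) A)))
    = of_bool (multiplicity F (char_poly A) = 0)"
proof -
  have T: "0\<^sub>m 0 0 \<in> (carrier_mat 0 0 :: 'a mat set)" by simp
  have q1: "1 < q" unfolding q_def by (rule q_gt_1[OF F(3)])
  have qn: "q ^ l \<noteq> 1" if "0 < l" for l using one_less_power[OF q1 that] by simp
  obtain s where s: "s (0\<^sub>m n 0) = 0 \<longleftrightarrow> multiplicity F (char_poly A) = multiplicity F (char_poly (0\<^sub>m 0 0 :: 'a mat))"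
    "s (0\<^sub>m n 0) * degree F \<le> n"
    and e: "(\<Sum>i\<le>n. (-1) ^ i / qfact q i * real (card (emb n (i * degree F) (chainT F (0\<^sub>m 0 0) (replicate i (0\<^sub>v 0))) A)))
      = (\<Sum>i\<le>n. (-1) ^ i / qfact q i * (\<Prod>l<i. q ^ s (0\<^sub>m n 0) - q ^ l))"
    using sieve_expansion[OF A T F] unfolding emb_0[OF A] lists_carrier_vec_0 q_def by auto
  define k where "k = s (0\<^sub>m n 0)"
  have "(\<Sum>i\<le>n. (-1) ^ i / qfact q i * (\<Prod>l<i. q ^ k - q ^ l)) = of_bool (k = 0)"
  proof (cases "k = 0")
    case True
    then show ?thesis by (simp add: sum.atMost_shift prod.lessThan_Suc_shift qfact_def del: prod.lessThan_Suc)
  next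
    case False
    have "k \<le> k * degree F" using F(3) by simp
    then have "k \<le> n" using s(2) unfolding k_def by (rule le_trans)
    then have "(\<Prod>l\<in>{1..n}. q ^ k - q ^ l) = 0" using False by (intro prod_zero) auto
    then show ?thesis using False newton_partial_sum[OF qn] by simp
  qed
  moreover have "multiplicity F (char_poly (0\<^sub>m 0 0 :: 'a mat)) = 0" using char_poly_0[OF T] by simp
  ultimately show ?thesis unfolding e using s(1) by (simp add: k_def)
qed

text \<open>The exact sieve is summed over all matrices of characteristic polynomial F^m h.
  Embeddings of a chain of length i contribute |GL_n| times the density of the cofactor F^(m-i) h,
  and none exist for i > m; on the other side only m = 0 leaves matrices of multiplicity 0.\<close>

lemma cdens_recursion:
  fixes F h :: "'a::{field_gcd,finite} poly"
  assumes F: "monic F" "irreducible F" "0 < degree F" and h: "\<not> F dvd h"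
  defines "q \<equiv> real CARD('a) ^ degree F"
  shows "(\<Sum>i\<le>m. (-1) ^ i / qfact q i * cdens (F ^ (m - i) * h)) = of_bool (m = 0) * cdens h"
proof -
  let ?p = "real CARD('a)"
  define g where "g = F ^ m * h"
  define n where "n = degree g"
  define C where "C = {A \<in> carrier_mat n n. char_poly A = g}"
  define T where "T = (\<lambda>i. chainT F (0\<^sub>m 0 0) (replicate i (0\<^sub>v 0)))"
  have F0: "F \<noteq> 0" using F(1) by auto
  have h0: "h \<noteq> 0" using h by auto
  have n: "n = m * degree F + degree h"
    unfolding n_def g_def using F0 h0 by (simp add: degree_mult_eq degree_power_eq)
  have "m \<le> m * degree F" using F(3) by simp
  then have mn: "m \<le> n" unfolding n by (rule trans_le_add1)
  have T: "T i \<in> carrier_mat (i * degree F) (i * degree F)" for i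
    unfolding T_def using chainT_carrier[of "0\<^sub>m 0 0" 0 F "replicate i (0\<^sub>v 0)"] by simp
  have cT: "char_poly (T i) = F ^ i" for i
    unfolding T_def using char_poly_chainT[of "0\<^sub>m 0 0" 0 F "replicate i (0\<^sub>v 0)"] F by (simp add: char_poly_0)
  have "p > 1" if "p = ?p" for p using CARD_gt_1[where 'a = 'a] that by simp
  then have pos: "injc ?p k k > 0" for k by (intro injc_pos) auto
  have prime: "prime_elem F" using F(2) by (rule irreducible_imp_prime_elem)
  have dvd: "F ^ i dvd g \<longleftrightarrow> i \<le> m" for i
  proof
    assume d: "F ^ i dvd g"
    show "i \<le> m"
    proof (rule ccontr)
      assume "\<not> i \<le> m"
      then have "F ^ Suc m dvd F ^ m * h" using d le_imp_power_dvd[of "Suc m" i F] unfolding g_def by (meson dvd_trans not_less_eq_eq)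
      then have "F ^ m * F dvd F ^ m * h" by (simp add: mult.commute)
      then show False using h F0 by simp
    qed
  qed (auto simp: g_def intro: dvd_mult2 le_imp_power_dvd)
  have mult: "multiplicity F g = 0 \<longleftrightarrow> m = 0"
    using dvd[of 1] F h0 by (subst multiplicity_eq_zero_iff) (auto simp: g_def F0)
  have term_eq: "(\<Sum>A\<in>C. real (card (emb n (i * degree F) (T i) A)))
      = (if i \<le> m then injc ?p n n * cdens (F ^ (m - i) * h) else 0)" for i
  proof (cases "i \<le> m")
    case True
    have d: "degree (F ^ (m - i) * h) = n - i * degree F"
    proof -
      obtain j where "m = i + j" using True by (auto simp: le_iff_add)
      then show ?thesis unfolding n using F0 h0 by (simp add: degree_mult_eq degree_power_eq add_mult_distrib)
    qed
    have "g = char_poly (T i) * (F ^ (m - i) * h)"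
      unfolding cT g_def using True by (simp flip: mult.assoc power_add)
    moreover have "i * degree F \<le> n" unfolding n using True by (simp add: mult_le_mono1 trans_le_add1)
    ultimately have "(\<Sum>A\<in>C. real (card (emb n (i * degree F) (T i) A)))
      = injc ?p n n / injc ?p (n - i * degree F) (n - i * degree F) * real (acnt (n - i * degree F) (F ^ (m - i) * h))"
      unfolding C_def using sum_card_emb_char_poly[OF T] by simp
    then show ?thesis using True by (simp add: cdens_def d)
  next
    case False
    have "emb n (i * degree F) (T i) A = {}" if "A \<in> C" for A
    proof (rule ccontr)
      assume "emb n (i * degree F) (T i) A \<noteq> {}"
      then obtain X where X: "X \<in> emb n (i * degree F) (T i) A" by blast
      have A: "A \<in> carrier_mat n n" "char_poly A = g" using that by (auto simp: C_def)
      obtain S R where "quotient_of n (i * degree F) X (T i) A S R"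
        using quotient_of_ex[OF emb_injm[OF X] T A(1) emb_eq[OF X]] by blast
      then have "g = F ^ i * char_poly S" using quotient_ofD(6) A(2) cT by metis
      then show False using dvd[of i] False by simp
    qed
    then show ?thesis using False by simp
  qed
  have "real (card C) * of_bool (m = 0) = (\<Sum>A\<in>C. of_bool (multiplicity F (char_poly A) = 0))"
    using mult by (simp add: C_def)
  also have "\<dots> = (\<Sum>A\<in>C. \<Sum>i\<le>n. (-1) ^ i / qfact q i * real (card (emb n (i * degree F) (T i) A)))"
    unfolding q_def T_def by (rule sum.cong[OF refl], subst sieve_exact[OF _ F]) (auto simp: C_def)
  also have "\<dots> = (\<Sum>i\<le>n. (-1) ^ i / qfact q i * (if i \<le> m then injc ?p n n * cdens (F ^ (m - i) * h) else 0))"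
    by (subst sum.swap) (simp only: sum_distrib_left[symmetric] term_eq)
  also have "\<dots> = (\<Sum>i\<le>m. (-1) ^ i / qfact q i * (injc ?p n n * cdens (F ^ (m - i) * h)))"
    using mn by (intro sum.mono_neutral_cong_right) auto
  also have "\<dots> = injc ?p n n * (\<Sum>i\<le>m. (-1) ^ i / qfact q i * cdens (F ^ (m - i) * h))"
    by (simp add: sum_distrib_left mult_ac)
  finally have "(\<Sum>i\<le>m. (-1) ^ i / qfact q i * cdens (F ^ (m - i) * h)) = real (card C) * of_bool (m = 0) / injc ?p n n"
    using pos[of n] by simp
  also have "\<dots> = of_bool (m = 0) * cdens g" unfolding cdens_def acnt_def C_def n_def by simp
  finally show ?thesis by (cases "m = 0") (auto simp: g_def)
qed

text \<open>Both sides satisfy the same triangular recursion with leading coefficient 1, so their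
  difference \<open>Y\<close> vanishes by induction.\<close>

lemma cdens_power_mult:
  fixes F h :: "'a::{field_gcd,finite} poly"
  assumes F: "monic F" "irreducible F" "0 < degree F" and h: "\<not> F dvd h"
  shows "cdens (F ^ m * h) = ap (real CARD('a) ^ degree F) m * cdens h"
proof -
  let ?q = "real CARD('a) ^ degree F"
  define Y where "Y = (\<lambda>j. cdens (F ^ j * h) - ap ?q j * cdens h)"
  have Y: "(\<Sum>i\<le>m. (-1) ^ i / qfact ?q i * Y (m - i)) = 0" for m
  proof -
    have "(\<Sum>i\<le>m. (-1) ^ i / qfact ?q i * Y (m - i))
      = (\<Sum>i\<le>m. (-1) ^ i / qfact ?q i * cdens (F ^ (m - i) * h)) - (\<Sum>i\<le>m. (-1) ^ i / qfact ?q i * ap ?q (m - i)) * cdens h"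
      unfolding Y_def sum_distrib_right sum_subtractf[symmetric] by (rule sum.cong[OF refl]) (simp add: algebra_simps)
    then show ?thesis unfolding cdens_recursion[OF F h] sum_ap_inverse[OF q_gt_1[OF F(3)]] by simp
  qed
  have "Y m = 0"
  proof (induction m rule: less_induct)
    case (less m)
    have "(\<Sum>i\<le>m. (-1) ^ i / qfact ?q i * Y (m - i)) = (\<Sum>i\<in>{0}. (-1) ^ i / qfact ?q i * Y (m - i))"
      by (rule sum.mono_neutral_right) (auto simp: less)
    then show ?case unfolding Y by (simp add: qfact_def)
  qed
  then show ?thesis by (simp add: Y_def)
qed

lemma not_dvd_prod_powers:
  fixes F :: "'a::field_gcd poly"
  assumes F: "monic F" "irreducible F" and J: "finite J" "\<And>G. G \<in> J \<Longrightarrow> monic G \<and> irreducible G" "F \<notin> J"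
  shows "\<not> F dvd (\<Prod>G\<in>J. G ^ mm G)"
proof
  have prime: "prime_elem F" using F(2) by (rule irreducible_imp_prime_elem)
  have nu: "degree F \<noteq> 0"
    using irreducible_not_unit[OF F(2)] F(1) by (metis is_unit_iff_degree leading_coeff_0_iff zero_neq_one)
  assume "F dvd (\<Prod>G\<in>J. G ^ mm G)"
  then have "\<exists>G\<in>J. F dvd G ^ mm G"
    by (rule rev_mp) (rule finite_induct[OF J(1)], auto simp: prime_elem_dvd_mult_iff[OF prime] nu)
  then obtain G where G: "G \<in> J" "F dvd G ^ mm G" by blast
  then have "F dvd G" using prime_elem_dvd_power[OF prime] by blast
  moreover have "F \<noteq> G" using G(1) J(3) by blast
  ultimately show False using monic_irreducible_not_dvd F J(2)[OF G(1)] by blast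
qed

lemma cdens_prod:
  fixes J :: "'a::{field_gcd,finite} poly set"
  assumes "finite J" "\<And>F. F \<in> J \<Longrightarrow> monic F \<and> irreducible F \<and> 0 < degree F"
  shows "cdens (\<Prod>F\<in>J. F ^ mm F) = (\<Prod>F\<in>J. ap (real CARD('a) ^ degree F) (mm F))"
  using assms
proof (induction J rule: finite_induct)
  case (insert F J)
  have "\<not> F dvd (\<Prod>G\<in>J. G ^ mm G)" using insert by (intro not_dvd_prod_powers) auto
  then show ?case using insert cdens_power_mult[of F "\<Prod>G\<in>J. G ^ mm G" "mm F"] by simp
qed (simp add: cdens_1)

lemma multiplicity_prod_powers:
  fixes J :: "'a::field_gcd poly set"
  assumes J: "finite J" "\<And>F. F \<in> J \<Longrightarrow> monic F \<and> irreducible F" and F: "F \<in> J"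
  shows "multiplicity F (\<Prod>F\<in>J. F ^ mm F) = mm F"
proof -
  have nd: "\<not> F dvd (\<Prod>G\<in>J - {F}. G ^ mm G)" using J F by (intro not_dvd_prod_powers) auto
  have e: "(\<Prod>G\<in>J. G ^ mm G) = F ^ mm F * (\<Prod>G\<in>J - {F}. G ^ mm G)" using J(1) F by (rule prod.remove)
  show ?thesis
  proof (rule multiplicity_eqI)
    show "F ^ mm F dvd (\<Prod>G\<in>J. G ^ mm G)" unfolding e by simp
    have "F \<noteq> 0" using J(2)[OF F] by auto
    then show "\<not> F ^ Suc (mm F) dvd (\<Prod>G\<in>J. G ^ mm G)" unfolding e power_Suc2 using nd by simp
  qed
qed

section \<open>The primary part\<close>

lemma pact_prod_powers_inj:
  fixes S :: "'a::field_gcd mat"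
  assumes S: "S \<in> carrier_mat k k" and w: "w \<in> carrier_vec k"
    and J: "finite J" "\<And>F. F \<in> J \<Longrightarrow> irreducible F \<and> \<not> F dvd char_poly S"
    and 0: "pact S (\<Prod>F\<in>J. F ^ mm F) w = 0\<^sub>v k"
  shows "w = 0\<^sub>v k"
  using J 0
proof (induction J rule: finite_induct)
  case empty
  then show ?case using S w by simp
next
  case (insert F J)
  have F: "irreducible F" "\<not> F dvd char_poly S" using insert.prems(1)[of F] by auto
  have pw: "v = 0\<^sub>v k" if "v \<in> carrier_vec k" "pact S (F ^ i) v = 0\<^sub>v k" for i v
    using that
  proof (induction i)
    case 0
    then show ?case using S by simp
  next
    case (Suc i)
    have "pact S F (pact S (F ^ i) v) = 0\<^sub>v k" using Suc.prems(2) pact_mult[OF S Suc.prems(1)] by simp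
    then have "pact S (F ^ i) v = 0\<^sub>v k"
      by (rule pact_inj_if_not_dvd[OF S F pact_carrier[OF S Suc.prems(1)]])
    then show ?case by (rule Suc.IH[OF Suc.prems(1)])
  qed
  have c: "pact S (\<Prod>F\<in>J. F ^ mm F) w \<in> carrier_vec k" by (rule pact_carrier[OF S w])
  have "pact S (F ^ mm F) (pact S (\<Prod>F\<in>J. F ^ mm F) w) = 0\<^sub>v k"
    using insert.prems(2) insert.hyps pact_mult[OF S w] by simp
  then have "pact S (\<Prod>F\<in>J. F ^ mm F) w = 0\<^sub>v k" by (rule pw[OF c])
  then show ?case using insert.IH insert.prems(1) by simp
qed

text \<open>While \<open>F\<close> still has a kernel on the quotient, s > 0 and a chain of length s
  gives a strictly larger embedding; the codimension decreases.\<close>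

lemma extend_to_full_multiplicity:
  fixes A :: "'a::{field_gcd,finite} mat"
  assumes A: "A \<in> carrier_mat n n" and F: "monic F" "irreducible F" "0 < degree F"
    and T: "T \<in> carrier_mat d d" and X: "X \<in> emb n d T A"
  shows "\<exists>d' T' X' k. T' \<in> carrier_mat d' d' \<and> X' \<in> emb n d' T' A \<and>
    char_poly T' = char_poly T * F ^ k \<and> multiplicity F (char_poly T') = multiplicity F (char_poly A)"
  using T X
proof (induction "n - d" arbitrary: d T X rule: less_induct)
  case less
  note T = less.prems(1) and X = less.prems(2)
  obtain s where s: "s = 0 \<longleftrightarrow> KX A F X = colsp X"
    and ex: "\<exists>bs Z. length bs = s \<and> set bs \<subseteq> carrier_vec d \<and> Z \<in> emb n (d + s * degree F) (chainT F T bs) A"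
    by (rule card_KX[OF A T F X])
  show ?case
  proof (cases "s = 0")
    case True
    then have "multiplicity F (char_poly T) = multiplicity F (char_poly A)"
      using s KX_eq_colsp_iff[OF A T F(2) X] by simp
    then show ?thesis using T X by (intro exI[of _ d] exI[of _ T] exI[of _ X] exI[of _ 0]) simp
  next
    case False
    obtain bs Z where Z: "length bs = s" "Z \<in> emb n (d + s * degree F) (chainT F T bs) A" using ex by blast
    let ?d = "d + s * degree F"
    have T': "chainT F T bs \<in> carrier_mat ?d ?d" using chainT_carrier[OF T, of F bs] Z(1) by simp
    have "?d \<le> n" using injm_le emb_injm[OF Z(2)] by blast
    moreover have "d < ?d" using False F(3) by simp
    ultimately have "n - ?d < n - d" by linarith
    from less.hyps[OF this T' Z(2)] obtain d' T'' X' k where *: "T'' \<in> carrier_mat d' d'" "X' \<in> emb n d' T'' A"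
      "char_poly T'' = char_poly (chainT F T bs) * F ^ k" "multiplicity F (char_poly T'') = multiplicity F (char_poly A)"
      by (elim exE conjE)
    have "char_poly T'' = char_poly T * F ^ (s + k)"
      unfolding *(3) char_poly_chainT[OF T F(1,3)] Z(1) by (simp add: power_add mult.assoc)
    then show ?thesis using * by (intro exI[of _ d'] exI[of _ T''] exI[of _ X'] exI[of _ "s + k"]) simp
  qed
qed

text \<open>The polynomials are completed one at a time: adding blocks of \<open>F\<close> keeps the
  powers already reached, and the exponent of \<open>F\<close> is pinned down by its
  multiplicity.\<close>

lemma ex_primary_part:
  fixes A :: "'a::{field_gcd,finite} mat"
  assumes A: "A \<in> carrier_mat n n" and J: "finite J" "\<And>F. F \<in> J \<Longrightarrow> monic F \<and> irreducible F \<and> 0 < degree F"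
  shows "\<exists>d T X. T \<in> carrier_mat d d \<and> X \<in> emb n d T A \<and> char_poly T = (\<Prod>F\<in>J. F ^ multiplicity F (char_poly A))"
  using J
proof (induction J rule: finite_induct)
  case empty
  then show ?case
    using empty_in_emb[OF A] by (intro exI[of _ 0] exI[of _ "0\<^sub>m 0 0"] exI[of _ "0\<^sub>m n 0"]) (simp add: char_poly_0)
next
  case (insert F J)
  let ?m = "\<lambda>F. multiplicity F (char_poly A)"
  have F: "monic F" "irreducible F" "0 < degree F" using insert.prems[of F] by auto
  have "\<exists>d T X. T \<in> carrier_mat d d \<and> X \<in> emb n d T A \<and> char_poly T = (\<Prod>F\<in>J. F ^ ?m F)"
    by (rule insert.IH) (use insert.prems in auto)
  then obtain d T X where T: "T \<in> carrier_mat d d" "X \<in> emb n d T A" "char_poly T = (\<Prod>F\<in>J. F ^ ?m F)"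
    by (elim exE conjE)
  from extend_to_full_multiplicity[OF A F T(1,2)] obtain d' T' X' k where
    T': "T' \<in> carrier_mat d' d'" "X' \<in> emb n d' T' A" "char_poly T' = char_poly T * F ^ k" "multiplicity F (char_poly T') = ?m F"
    by (elim exE conjE)
  have nd: "\<not> F dvd (\<Prod>G\<in>J. G ^ ?m G)" using insert by (intro not_dvd_prod_powers) auto
  have "F \<noteq> 0" using F(1) by auto
  then have "multiplicity F ((\<Prod>G\<in>J. G ^ ?m G) * F ^ k) = k"
    using nd by (intro multiplicity_eqI) (auto simp: mult.commute[of _ "F ^ k"] simp del: power_Suc simp: power_Suc2)
  then have "k = ?m F" using T'(4) unfolding T'(3) T(3) by simp
  then have "char_poly T' = (\<Prod>F\<in>insert F J. F ^ ?m F)" unfolding T'(3) T(3) using insert.hyps by (simp add: mult.commute)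
  then show ?case using T'(1,2) by blast
qed

lemma injm_mult_cancel:
  assumes X: "injm n d X" and U: "U \<in> carrier_mat d m" and V: "V \<in> carrier_mat d m" and eq: "X * U = X * V"
  shows "U = V"
proof (rule mat_col_eqI)
  fix j assume "j < dim_col V"
  then have j: "j < m" using V by simp
  have "X *\<^sub>v col U j = X *\<^sub>v col V j"
    using col_mult2[OF injm_carrier[OF X] U j] col_mult2[OF injm_carrier[OF X] V j] eq by simp
  then show "col U j = col V j" by (rule injm_inj[OF X, rotated 2]) (use U V in auto)
qed (use U V in auto)

lemma factor_through:
  assumes X0: "X0 \<in> carrier_mat n d" and X: "X \<in> carrier_mat n m" and sub: "colsp X \<subseteq> colsp X0"
  shows "\<exists>G\<in>carrier_mat d m. X = X0 * G"
proof -
  have "\<exists>w\<in>carrier_vec d. col X j = X0 *\<^sub>v w" if j: "j < m" for j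
  proof -
    have "X *\<^sub>v unit_vec m j = col X j" using X j by (intro eq_vecI) auto
    moreover have "X *\<^sub>v unit_vec m j \<in> colsp X" by (rule colspI[OF X]) simp
    ultimately have "col X j \<in> colsp X0" using sub by auto
    then show ?thesis using colspE[OF _ X0] by metis
  qed
  then obtain w where w: "\<And>j. j < m \<Longrightarrow> w j \<in> carrier_vec d \<and> col X j = X0 *\<^sub>v w j" by metis
  let ?G = "mat d m (\<lambda>(i, j). w j $ i)"
  have "X = X0 * ?G"
  proof (rule mat_col_eqI)
    fix j assume "j < dim_col (X0 * ?G)"
    then have j: "j < m" by simp
    have "col ?G j = w j" using w[OF j] j by (intro eq_vecI) auto
    then show "col X j = col (X0 * ?G) j" using w[OF j] col_mult2[OF X0 _ j, of ?G] by simp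
  qed (use X X0 in auto)
  then show ?thesis by auto
qed

text \<open>With g the common characteristic polynomial, g(A) kills the image of every such X by
  Cayley-Hamilton, and by hypothesis g is injective on the quotient by the image of
  \<open>X0\<close>; so the first image lies in the second. Hence X = X0 G with G invertible, and T
  is the conjugate of \<open>T0\<close> by G, determined by G.\<close>

lemma primary_part_count:
  fixes A :: "'a::{field_gcd,finite} mat"
  assumes A: "A \<in> carrier_mat n n" and T0: "T0 \<in> carrier_mat d d" and X0: "X0 \<in> emb n d T0 A"
    and inj: "\<And>S w. S \<in> carrier_mat (n - d) (n - d) \<Longrightarrow> char_poly A = char_poly T0 * char_poly S \<Longrightarrow>
      w \<in> carrier_vec (n - d) \<Longrightarrow> pact S (char_poly T0) w = 0\<^sub>v (n - d) \<Longrightarrow> w = 0\<^sub>v (n - d)"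
  shows "(\<Sum>T\<in>{T\<in>carrier_mat d d. char_poly T = char_poly T0}. real (card (emb n d T A))) = injc (real CARD('a)) d d"
proof -
  let ?g = "char_poly T0" and ?C = "{T\<in>carrier_mat d d. char_poly T = char_poly T0}"
  have X0i: "injm n d X0" and X0c: "X0 \<in> carrier_mat n d" and AX0: "A * X0 = X0 * T0"
    using X0 emb_injm emb_carrier emb_eq by blast+
  obtain S R where Q: "quotient_of n d X0 T0 A S R" using quotient_of_ex[OF X0i T0 A AX0] by blast
  note Q = quotient_ofD[OF Q]
  have fwd: "(\<lambda>(T, X). X) \<in> (SIGMA T:?C. emb n d T A) \<rightarrow> (\<lambda>G. X0 * G) ` {G. injm d d G}"
  proof (intro funcsetI, clarify)
    fix T X assume T: "T \<in> carrier_mat d d" "char_poly T = ?g" and X: "X \<in> emb n d T A"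
    have Xi: "injm n d X" and Xc: "X \<in> carrier_mat n d" and AX: "A * X = X * T"
      using X emb_injm emb_carrier emb_eq by blast+
    have "colsp X \<subseteq> colsp X0"
    proof
      fix y assume "y \<in> colsp X"
      then obtain v where v: "v \<in> carrier_vec d" "y = X *\<^sub>v v" using Xc by (rule colspE)
      have y: "y \<in> carrier_vec n" unfolding v(2) using Xc v(1) by simp
      have "pact A ?g y = X *\<^sub>v pact T ?g v" unfolding v(2) by (rule pact_intertwine[OF A T(1) Xc AX v(1)])
      also have "\<dots> = 0\<^sub>v n" using cayley_hamilton[OF T(1) v(1)] Xc unfolding T(2) by simp
      finally have "R *\<^sub>v pact A ?g y = 0\<^sub>v (n - d)" using Q(2) by simp
      then have 0: "pact S ?g (R *\<^sub>v y) = 0\<^sub>v (n - d)" unfolding quotient_pact[OF Q(1,2) A Q(3) y] .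
      have "R *\<^sub>v y \<in> carrier_vec (n - d)" using Q(2) y by (rule mult_mat_vec_carrier)
      then have "R *\<^sub>v y = 0\<^sub>v (n - d)" using 0 by (rule inj[OF Q(1,6)])
      then show "y \<in> colsp X0" using Q(4)[OF y] by simp
    qed
    then obtain G where G: "G \<in> carrier_mat d d" "X = X0 * G" using factor_through[OF X0c Xc] by blast
    have "injm d d G" unfolding injm_def
    proof (intro conjI ballI impI G(1))
      fix v assume v: "v \<in> carrier_vec d" "G *\<^sub>v v = 0\<^sub>v d"
      then have "X *\<^sub>v v = 0\<^sub>v n" unfolding G(2) using X0c G(1) by simp
      then show "v = 0\<^sub>v d" by (rule injmD[OF Xi v(1)])
    qed
    then show "X \<in> (\<lambda>G. X0 * G) ` {G. injm d d G}" using G(2) by blast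
  qed
  have bwd: "\<exists>T\<in>?C. X0 * G \<in> emb n d T A" if G: "injm d d G" for G
  proof -
    have Gc: "G \<in> carrier_mat d d" by (rule injm_carrier[OF G])
    obtain G' where G': "G' \<in> carrier_mat d d" "G * G' = 1\<^sub>m d" "G' * G = 1\<^sub>m d" by (rule injm_square_inverse[OF G])
    define T where "T = G' * (T0 * G)"
    have TGc: "T0 * G \<in> carrier_mat d d" using T0 Gc by simp
    have Tc: "T \<in> carrier_mat d d" unfolding T_def using TGc G' by simp
    have GT: "G * T = T0 * G" unfolding T_def by (rule mult_inverse_cancel[OF Gc G'(1,2) TGc])
    have "similar_mat T T0"
      unfolding similar_mat_def similar_mat_wit_def
      by (rule exI[of _ G'], rule exI[of _ G])
        (use Tc T0 Gc G' assoc_mult_mat[OF G'(1) T0 Gc] in \<open>simp add: T_def Let_def\<close>)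
    then have "char_poly T = ?g" by (rule char_poly_similar)
    moreover have "A * (X0 * G) = (X0 * G) * T"
      using assoc_mult_mat[OF A X0c Gc] assoc_mult_mat[OF X0c T0 Gc] assoc_mult_mat[OF X0c Gc Tc] AX0 GT by simp
    moreover have "injm n d (X0 * G)" unfolding injm_def
    proof (intro conjI ballI impI)
      show "X0 * G \<in> carrier_mat n d" using X0c Gc by simp
      fix v assume v: "v \<in> carrier_vec d" "X0 * G *\<^sub>v v = 0\<^sub>v n"
      then have "X0 *\<^sub>v (G *\<^sub>v v) = 0\<^sub>v n" using X0c Gc by simp
      then have "G *\<^sub>v v = 0\<^sub>v d" by (intro injmD[OF X0i]) (use Gc v in auto)
      then show "v = 0\<^sub>v d" by (rule injmD[OF G v(1)])
    qed
    ultimately show ?thesis using Tc by (auto simp: emb_altdef)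
  qed
  have image_eq: "(\<lambda>(T, X). X) ` (SIGMA T:?C. emb n d T A) = (\<lambda>G. X0 * G) ` {G. injm d d G}"
  proof (intro equalityI subsetI)
    fix X assume "X \<in> (\<lambda>G. X0 * G) ` {G. injm d d G}"
    then obtain G where "X = X0 * G" "injm d d G" by blast
    then obtain T where "T \<in> ?C" "X \<in> emb n d T A" using bwd by blast
    then show "X \<in> (\<lambda>(T, X). X) ` (SIGMA T:?C. emb n d T A)" by (intro image_eqI[of _ _ "(T, X)"]) auto
  qed (use fwd in blast)
  have inj1: "inj_on (\<lambda>(T, X). X) (SIGMA T:?C. emb n d T A)"
  proof (rule inj_onI)
    fix p p' assume p: "p \<in> (SIGMA T:?C. emb n d T A)" "p' \<in> (SIGMA T:?C. emb n d T A)"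
      "(\<lambda>(T, X). X) p = (\<lambda>(T, X). X) p'"
    obtain T X T' where pp: "p = (T, X)" "p' = (T', X)" using p(3) by (cases p; cases p') auto
    have T: "T \<in> carrier_mat d d" "T' \<in> carrier_mat d d" and X: "X \<in> emb n d T A" "X \<in> emb n d T' A"
      using p(1,2) by (auto simp: pp)
    have "X * T = X * T'" using emb_eq[OF X(1)] emb_eq[OF X(2)] by simp
    then show "p = p'" using injm_mult_cancel[OF emb_injm[OF X(1)] T] by (simp add: pp)
  qed
  have inj2: "inj_on (\<lambda>G. X0 * G) {G. injm d d G}"
    by (rule inj_onI) (use injm_mult_cancel[OF X0i] injm_carrier in blast)
  have "(\<Sum>T\<in>?C. card (emb n d T A)) = card (SIGMA T:?C. emb n d T A)"
    by (rule card_SigmaI[symmetric]) auto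
  also have "\<dots> = card {G. injm d d (G :: 'a mat)}"
    using card_image[OF inj1] card_image[OF inj2] unfolding image_eq by simp
  finally have "real (\<Sum>T\<in>?C. card (emb n d T A)) = injc (real CARD('a)) d d" unfolding card_injm[symmetric] by simp
  then show ?thesis by simp
qed

text \<open>If the multiplicities of \<open>A\<close> agree with \<open>mm\<close>, no F in
  \<open>J\<close> divides the characteristic polynomial of the quotient by the primary part, and
  the count of embeddings applies. Otherwise every summand vanishes, as each \<open>T\<close> has
  multiplicities \<open>mm\<close>.\<close>

lemma indicator_eq_sum_emb:
  fixes A :: "'a::{field_gcd,finite} mat" and mm :: "'a poly \<Rightarrow> nat"
  assumes A: "A \<in> carrier_mat n n" and J: "finite J" "\<And>F. F \<in> J \<Longrightarrow> monic F \<and> irreducible F \<and> 0 < degree F"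
  defines "g \<equiv> \<Prod>F\<in>J. F ^ mm F"
  shows "(\<Sum>T\<in>{T\<in>carrier_mat (degree g) (degree g). char_poly T = g}. real (card (emb n (degree g) T A))
      * of_bool (\<forall>F\<in>J. multiplicity F (char_poly A) = multiplicity F (char_poly T)))
    = injc (real CARD('a)) (degree g) (degree g) * of_bool (\<forall>F\<in>J. multiplicity F (char_poly A) = mm F)"
proof -
  let ?D = "degree g"
  have mg: "multiplicity F g = mm F" if "F \<in> J" for F
    unfolding g_def using J that by (intro multiplicity_prod_powers) auto
  show ?thesis
  proof (cases "\<forall>F\<in>J. multiplicity F (char_poly A) = mm F")
    case True
    have "\<exists>d T X. T \<in> carrier_mat d d \<and> X \<in> emb n d T A \<and> char_poly T = (\<Prod>F\<in>J. F ^ multiplicity F (char_poly A))"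
      by (rule ex_primary_part[OF A J])
    also have "(\<Prod>F\<in>J. F ^ multiplicity F (char_poly A)) = g"
      unfolding g_def using True by (intro prod.cong) auto
    finally obtain d T0 X0 where T0: "T0 \<in> carrier_mat d d" "X0 \<in> emb n d T0 A" "char_poly T0 = g" by blast
    have d: "d = ?D" using char_poly_monic(1)[OF T0(1)] T0(3) by simp
    have "(\<Sum>T\<in>{T\<in>carrier_mat d d. char_poly T = char_poly T0}. real (card (emb n d T A))) = injc (real CARD('a)) d d"
    proof (rule primary_part_count[OF A T0(1,2)])
      fix S w assume S: "S \<in> carrier_mat (n - d) (n - d)" "char_poly A = char_poly T0 * char_poly S"
        and w: "w \<in> carrier_vec (n - d)" "pact S (char_poly T0) w = 0\<^sub>v (n - d)"
      have "\<not> F dvd char_poly S" if F: "F \<in> J" for F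
      proof
        assume dv: "F dvd char_poly S"
        have "F ^ mm F dvd char_poly T0" unfolding T0(3) using mg[OF F] by (metis multiplicity_dvd)
        then have "F ^ mm F * F dvd char_poly A" unfolding S(2) using dv by (rule mult_dvd_mono)
        then have "F ^ Suc (mm F) dvd char_poly A" by (simp add: mult.commute)
        then have "Suc (mm F) \<le> multiplicity F (char_poly A)"
          using J(2)[OF F] irreducible_not_unit[of F] by (intro multiplicity_geI[OF char_poly_monic(3)[OF A]]) auto
        then show False using True F by simp
      qed
      then show "w = 0\<^sub>v (n - d)"
        using J w unfolding T0(3) g_def by (intro pact_prod_powers_inj[OF S(1) w(1) J(1)]) auto
    qed
    then show ?thesis using True mg by (simp add: T0(3) d)
  next
    case False
    then show ?thesis using mg by (intro trans[OF sum.neutral]) auto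
  qed
qed

text \<open>All matrices T of characteristic polynomial g share one limit, so their number divided
  by |GL_D|, which is \<open>cdens g\<close>, is the remaining factor.\<close>

theorem multiplicity_limit:
  fixes P :: "nat \<Rightarrow> nat \<Rightarrow> nat \<Rightarrow> 'a::{field_gcd,finite} \<Rightarrow> real"
  assumes P: "\<forall>\<^sub>F n in sequentially. \<forall>i<n. \<forall>j<n. \<forall>a. 0 \<le> P n i j a"
    and mom: "\<And>d T. T \<in> carrier_mat d d \<Longrightarrow> (\<lambda>n. mat_expect n (P n) (\<lambda>A. real (card (emb n d T A)))) \<longlonglongrightarrow> 1"
    and J: "finite J" "\<And>F. F \<in> J \<Longrightarrow> monic F \<and> irreducible F \<and> 0 < degree F"
  shows "(\<lambda>n. mat_expect n (P n) (\<lambda>A. of_bool (\<forall>F\<in>J. multiplicity F (char_poly A) = mm F)))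
    \<longlonglongrightarrow> (\<Prod>F\<in>J. ap (real CARD('a) ^ degree F) (mm F) * euler (real CARD('a) ^ degree F))"
proof -
  define g where "g = (\<Prod>F\<in>J. F ^ mm F)"
  define C where "C = {T\<in>carrier_mat (degree g) (degree g). char_poly T = g}"
  let ?i = "injc (real CARD('a)) (degree g) (degree g)" and ?E = "\<Prod>F\<in>J. euler (real CARD('a) ^ degree F)"
  have pos: "?i > 0" using CARD_gt_1[where 'a = 'a] by (intro injc_pos) auto
  have "mat_expect n (P n) (\<lambda>A. of_bool (\<forall>F\<in>J. multiplicity F (char_poly A) = mm F))
    = (\<Sum>T\<in>C. 1 / ?i * mat_expect n (P n) (\<lambda>A. real (card (emb n (degree g) T A))
      * of_bool (\<forall>F\<in>J. multiplicity F (char_poly A) = multiplicity F (char_poly T))))" for n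
    unfolding mat_expect_sum[symmetric]
  proof (rule mat_expect_cong)
    fix A :: "'a mat" assume A: "A \<in> carrier_mat n n"
    show "of_bool (\<forall>F\<in>J. multiplicity F (char_poly A) = mm F)
      = (\<Sum>T\<in>C. 1 / ?i * (real (card (emb n (degree g) T A))
      * of_bool (\<forall>F\<in>J. multiplicity F (char_poly A) = multiplicity F (char_poly T))))"
      unfolding sum_distrib_left[symmetric] C_def
      by (subst indicator_eq_sum_emb[OF A J, where mm = mm, folded g_def]) (use pos in auto)
  qed
  moreover have "(\<lambda>n. \<Sum>T\<in>C. 1 / ?i * mat_expect n (P n) (\<lambda>A. real (card (emb n (degree g) T A))
      * of_bool (\<forall>F\<in>J. multiplicity F (char_poly A) = multiplicity F (char_poly T)))) \<longlonglongrightarrow> (\<Sum>T\<in>C. 1 / ?i * ?E)"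
    by (intro tendsto_sum tendsto_mult tendsto_const sieve_limit[OF P mom J]) (auto simp: C_def)
  moreover have "(\<Sum>T\<in>C. 1 / ?i * ?E) = cdens g * ?E" by (simp add: cdens_def acnt_def C_def)
  moreover have "cdens g = (\<Prod>F\<in>J. ap (real CARD('a) ^ degree F) (mm F))" unfolding g_def by (rule cdens_prod[OF J])
  ultimately show ?thesis by (simp add: prod.distrib)
qed

section \<open>Random matrices\<close>

context prob_space
begin

lemma sum_prob_count_space:
  fixes \<xi> :: "'a \<Rightarrow> 'b::finite"
  assumes "random_variable (count_space UNIV) \<xi>"
  shows "(\<Sum>a\<in>UNIV. prob {\<omega> \<in> space M. \<xi> \<omega> = a}) = 1"
proof -
  have "{\<omega> \<in> space M. \<xi> \<omega> = a} \<in> events" for a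
    using measurable_sets[OF assms, of "{a}"] by (simp add: vimage_def Int_def conj_commute)
  then have "prob (\<Union>a. {\<omega> \<in> space M. \<xi> \<omega> = a}) = (\<Sum>a\<in>UNIV. prob {\<omega> \<in> space M. \<xi> \<omega> = a})"
    by (intro finite_measure_finite_Union) (auto simp: disjoint_family_on_def)
  also have "(\<Union>a. {\<omega> \<in> space M. \<xi> \<omega> = a}) = space M" by auto
  finally show ?thesis by (simp add: prob_space)
qed

lemma pdist_entry:
  assumes "alpha_balanced_mat \<alpha> n A" "i < n" "j < n"
  shows "pdist (\<lambda>a. prob {\<omega> \<in> space M. A \<omega> $$ (i, j) = a})"
    "prob {\<omega> \<in> space M. A \<omega> $$ (i, j) = a} \<le> 1 - \<alpha>"
proof -
  have "alpha_balanced \<alpha> (\<lambda>\<omega>. A \<omega> $$ (i, j))" using assms by (simp add: alpha_balanced_mat_def)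
  then have *: "random_variable (count_space UNIV) (\<lambda>\<omega>. A \<omega> $$ (i, j))"
    "\<And>a. prob {\<omega> \<in> space M. A \<omega> $$ (i, j) = a} \<le> 1 - \<alpha>" unfolding alpha_balanced_def by blast+
  show "pdist (\<lambda>a. prob {\<omega> \<in> space M. A \<omega> $$ (i, j) = a})"
    unfolding pdist_def using sum_prob_count_space[OF *(1)] by simp
  show "prob {\<omega> \<in> space M. A \<omega> $$ (i, j) = a} \<le> 1 - \<alpha>" by (rule *(2))
qed

text \<open>The bridge from the probability space to the finite sum: the event is a disjoint union,
  over the matrices satisfying \<open>Q\<close>, of intersections of entry events, to which
  independence applies.\<close>

lemma prob_matrix_event:
  assumes A: "alpha_balanced_mat \<alpha> n A" and n: "0 < n"
  shows "prob {\<omega> \<in> space M. Q (A \<omega>)} = mat_expect n (\<lambda>i j a. prob {\<omega> \<in> space M. A \<omega> $$ (i, j) = a}) (\<lambda>B. of_bool (Q B))"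
proof -
  let ?I = "{..<n} \<times> {..<n}"
  define X where "X = (\<lambda>(i, j) \<omega>. A \<omega> $$ (i, j))"
  have carr: "\<And>\<omega>. \<omega> \<in> space M \<Longrightarrow> A \<omega> \<in> carrier_mat n n"
    and indep: "indep_vars (\<lambda>_. count_space UNIV) X ?I"
    using A by (auto simp: alpha_balanced_mat_def X_def)
  \<comment> \<open>n > 0 keeps the index set nonempty; an empty intersection would be
    \<open>UNIV\<close> rather than the sample space.\<close>
  define E where "E = (\<lambda>B. \<Inter>ij\<in>?I. X ij -` {B $$ ij} \<inter> space M)"
  have E: "E B = {\<omega> \<in> space M. A \<omega> = B}" if B: "B \<in> carrier_mat n n" for B
  proof (intro equalityI subsetI)
    fix \<omega> assume "\<omega> \<in> E B"
    then have *: "\<omega> \<in> X (i, j) -` {B $$ (i, j)} \<inter> space M" if "i < n" "j < n" for i j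
      using that unfolding E_def INT_iff by blast
    have \<omega>: "\<omega> \<in> space M" "\<And>i j. i < n \<Longrightarrow> j < n \<Longrightarrow> A \<omega> $$ (i, j) = B $$ (i, j)"
      using *[OF n n] * by (auto simp: X_def)
    then have "A \<omega> = B" using carr[OF \<omega>(1)] B by (intro eq_matI) auto
    then show "\<omega> \<in> {\<omega> \<in> space M. A \<omega> = B}" using \<omega>(1) by simp
  qed (auto simp: E_def X_def)
  have prob_E: "prob (E B) = (\<Prod>i<n. \<Prod>j<n. prob {\<omega> \<in> space M. A \<omega> $$ (i, j) = B $$ (i, j)})" for B
  proof -
    have "prob (E B) = (\<Prod>ij\<in>?I. prob (X ij -` {B $$ ij} \<inter> space M))"
      unfolding E_def using n by (intro indep_varsD_finite[OF indep]) auto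
    also have "\<dots> = (\<Prod>(i, j)\<in>?I. prob {\<omega> \<in> space M. A \<omega> $$ (i, j) = B $$ (i, j)})"
      by (intro prod.cong refl) (auto simp: X_def vimage_def Int_def conj_commute)
    finally show ?thesis by (simp add: prod.cartesian_product)
  qed
  have ev: "E B \<in> events" for B
  proof -
    have "random_variable (count_space UNIV) (X ij)" if "ij \<in> ?I" for ij
      using indep that unfolding indep_vars_def by blast
    then have "X ij -` {B $$ ij} \<inter> space M \<in> events" if "ij \<in> ?I" for ij
      using that by (intro measurable_sets) auto
    then show ?thesis unfolding E_def using n by (intro sets.finite_INT) auto
  qed
  have "disjoint_family_on E {B\<in>carrier_mat n n. Q B}" by (auto simp: disjoint_family_on_def E)
  then have "prob (\<Union>B\<in>{B\<in>carrier_mat n n. Q B}. E B) = (\<Sum>B\<in>{B\<in>carrier_mat n n. Q B}. prob (E B))"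
    by (intro finite_measure_finite_Union) (use ev in auto)
  also have "(\<Union>B\<in>{B\<in>carrier_mat n n. Q B}. E B) = {\<omega> \<in> space M. Q (A \<omega>)}"
    using carr by (auto simp: E)
  also have "(\<Sum>B\<in>{B\<in>carrier_mat n n. Q B}. prob (E B)) = (\<Sum>B\<in>carrier_mat n n. prob (E B) * of_bool (Q B))"
    by (rule sum.mono_neutral_cong_left) auto
  finally show ?thesis by (simp add: mat_expect_def prob_E)
qed

end

text \<open>The strict inequality leaves room for a constant c > 1. Weakening \<alpha> n to c ln n /
  n is harmless, as balancedness is monotone, and provides a parameter that tends to 0, in
  particular one eventually below 1/2.\<close>

lemma eventually_gt_log_over_n:
  assumes "liminf (\<lambda>n. ereal (real n * \<alpha> n / ln (real n))) > 1"
  shows "\<exists>c>1. \<forall>\<^sub>F n in sequentially. c * ln (real n) / real n \<le> \<alpha> n"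
proof -
  obtain c where c: "1 < ereal c" "ereal c < liminf (\<lambda>n. ereal (real n * \<alpha> n / ln (real n)))"
    using ereal_dense2[OF assms] by blast
  have "\<forall>\<^sub>F n in sequentially. ereal c < ereal (real n * \<alpha> n / ln (real n))" by (rule less_LiminfD[OF c(2)])
  then have "\<forall>\<^sub>F n in sequentially. c * ln (real n) / real n \<le> \<alpha> n"
    using eventually_ge_at_top[of 2]
  proof eventually_elim
    case (elim n)
    then have "ln (real n) > 0" by simp
    then show ?case using elim by (simp add: field_simps)
  qed
  then show ?thesis using c(1) by auto
qed

theorem corollary1p3:
  fixes \<alpha> :: "nat \<Rightarrow> real"
    and M :: "nat \<Rightarrow> 'w measure"
    and A :: "nat \<Rightarrow> 'w \<Rightarrow> 'p::prime_card mod_ring mat"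
    and F :: "nat \<Rightarrow> 'p mod_ring poly"
    and r :: nat
  assumes \<alpha>_pos: "\<And>n. n \<ge> 1 \<Longrightarrow> \<alpha> n > 0"
    and \<alpha>_liminf: "liminf (\<lambda>n. ereal (real n * \<alpha> n / ln (real n))) > 1"
    and M: "\<And>n. n \<ge> 1 \<Longrightarrow> prob_space (M n)"
    and A: "\<And>n. n \<ge> 1 \<Longrightarrow> prob_space.alpha_balanced_mat (M n) (\<alpha> n) n (A n)"
    and F_irred: "\<And>j. j \<in> {1..r} \<Longrightarrow> monic (F j) \<and> irreducible (F j) \<and> degree (F j) > 0"
    and F_distinct: "inj_on F {1..r}"
  shows "\<forall>m :: nat \<Rightarrow> nat.
    (\<lambda>n. \<P>(\<omega> in M n. \<forall>j\<in>{1..r}. factor_mult (F j) (A n \<omega>) = m j))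
      \<longlonglongrightarrow> (\<Prod>j\<in>{1..r}. nu (F j) (m j))"
proof
  fix m :: "nat \<Rightarrow> nat"
  define P where "P = (\<lambda>n i j a. measure (M n) {\<omega> \<in> space (M n). A n \<omega> $$ (i, j) = a})"
  define J where "J = F ` {1..r}"
  \<comment> \<open>The sieve indexes exponents by polynomials; injectivity of \<open>F\<close> on
    the indices makes the translation consistent.\<close>
  define mm where "mm = (\<lambda>G. m (inv_into {1..r} F G))"
  have mm: "mm (F j) = m j" if "j \<in> {1..r}" for j
    using F_distinct that by (simp add: mm_def)
  have J: "finite J" "\<And>G. G \<in> J \<Longrightarrow> monic G \<and> irreducible G \<and> 0 < degree G"
    using F_irred by (auto simp: J_def)
  obtain c where c: "1 < c" "\<forall>\<^sub>F n in sequentially. c * ln (real n) / real n \<le> \<alpha> n"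
    using eventually_gt_log_over_n[OF \<alpha>_liminf] by blast
  have P: "\<forall>\<^sub>F n in sequentially. \<forall>i<n. \<forall>j<n. pdist (P n i j) \<and> (\<forall>a. P n i j a \<le> 1 - c * ln (real n) / real n)"
    using c(2) eventually_ge_at_top[of 1]
  proof eventually_elim
    case (elim n)
    interpret prob_space "M n" by (rule M[OF elim(2)])
    show ?case
    proof (intro allI impI conjI)
      fix i j a assume ij: "i < n" "j < n"
      show "pdist (P n i j)" unfolding P_def by (rule pdist_entry(1)[OF A[OF elim(2)] ij])
      have "P n i j a \<le> 1 - \<alpha> n" unfolding P_def by (rule pdist_entry(2)[OF A[OF elim(2)] ij])
      then show "P n i j a \<le> 1 - c * ln (real n) / real n" using elim(1) by linarith
    qed
  qed
  have P_nonneg: "\<forall>\<^sub>F n in sequentially. \<forall>i<n. \<forall>j<n. \<forall>a. 0 \<le> P n i j a"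
    by (simp add: P_def)
  have "(\<lambda>n. mat_expect n (P n) (\<lambda>B. of_bool (\<forall>G\<in>J. multiplicity G (char_poly B) = mm G)))
    \<longlonglongrightarrow> (\<Prod>G\<in>J. ap (real CARD('p mod_ring) ^ degree G) (mm G) * euler (real CARD('p mod_ring) ^ degree G))"
    by (rule multiplicity_limit[OF P_nonneg moments_tendsto_1[OF c(1) P] J])
  also have "(\<Prod>G\<in>J. ap (real CARD('p mod_ring) ^ degree G) (mm G) * euler (real CARD('p mod_ring) ^ degree G))
    = (\<Prod>G\<in>J. nu G (mm G))"
    by (rule prod.cong[OF refl]) (simp add: nu_eq J(2))
  also have "\<dots> = (\<Prod>j\<in>{1..r}. nu (F j) (m j))"
    unfolding J_def prod.reindex[OF F_distinct] o_def by (rule prod.cong[OF refl]) (simp add: mm)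
  also have "(\<lambda>n. mat_expect n (P n) (\<lambda>B. of_bool (\<forall>G\<in>J. multiplicity G (char_poly B) = mm G)))
    = (\<lambda>n. mat_expect n (P n) (\<lambda>B. of_bool (\<forall>j\<in>{1..r}. factor_mult (F j) B = m j)))"
  proof -
    have "(\<forall>G\<in>J. multiplicity G (char_poly B) = mm G) \<longleftrightarrow> (\<forall>j\<in>{1..r}. factor_mult (F j) B = m j)" for B
    proof -
      have "(\<forall>G\<in>J. multiplicity G (char_poly B) = mm G) \<longleftrightarrow> (\<forall>j\<in>{1..r}. multiplicity (F j) (char_poly B) = mm (F j))"
        unfolding J_def by blast
      also have "\<dots> \<longleftrightarrow> (\<forall>j\<in>{1..r}. factor_mult (F j) B = m j)"
        by (rule ball_cong[OF refl]) (simp only: mm factor_mult_def)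
      finally show ?thesis .
    qed
    then show ?thesis by simp
  qed
  finally have lim: "(\<lambda>n. mat_expect n (P n) (\<lambda>B. of_bool (\<forall>j\<in>{1..r}. factor_mult (F j) B = m j)))
    \<longlonglongrightarrow> (\<Prod>j\<in>{1..r}. nu (F j) (m j))" .
  have "\<forall>\<^sub>F n in sequentially. mat_expect n (P n) (\<lambda>B. of_bool (\<forall>j\<in>{1..r}. factor_mult (F j) B = m j))
    = \<P>(\<omega> in M n. \<forall>j\<in>{1..r}. factor_mult (F j) (A n \<omega>) = m j)"
    using eventually_ge_at_top[of 1]
  proof eventually_elim
    case (elim n)
    interpret prob_space "M n" by (rule M[OF elim])
    have "0 < n" using elim by simp
    then show ?case unfolding P_def by (rule prob_matrix_event[OF A[OF elim], symmetric])
  qed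
  then show "(\<lambda>n. \<P>(\<omega> in M n. \<forall>j\<in>{1..r}. factor_mult (F j) (A n \<omega>) = m j))
      \<longlonglongrightarrow> (\<Prod>j\<in>{1..r}. nu (F j) (m j))"
    by (rule Lim_transform_eventually[OF lim])
qed

end
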